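(* Let $R$ be a proper rational $m_2\times m_1$ matrix function. Then $R$ is the left reflection coefficient of a Dirac type system $$\frac{d}{dx}u(x,\lambda)=i(\lambda j+jV(x))u(x,\lambda)\quad(x\ge0)$$ with $v\in\mathrm{PE}$ (determined by an admissible set with $\det S_0\neq0$) if and only if $R$ vanishes at infinity and is contractive on $\mathbb{R}$. If $R$ satisfies these conditions, then such a $v$ is uniquely determined by $R$ and can be recovered from $R$ in two steps. First, let $R(\lambda)=C(\lambda I_n-A)^{-1}B$ be a minimal realization, let $X=X^*$ be the $n\times n$ Hermitian solution of the Riccati equation $$i(XA-A^*X)=C^*C+XBB^*X$$ such that $\sigma(A+iBB^*X)\subset\overline{\mathbb{C}}_-$, and put $$\alpha=A+iBB^*X,\quad S_0=X^{-1},\quad \gamma_1=B,\quad \gamma=-iS_0C^* .$$ Next, construct $v$ by the formulas $$v(x)=-2i\gamma_1^*e^{ix\alpha^*}S(x)^{-1}e^{ix\alpha}\gamma,\qquad S(x)=S_0+\int_0^x\Lambda(t)\Lambda(t)^*\,dt,\qquad \Lambda(x)=[\,e^{-ix\alpha}\gamma_1\ \ \ e^{ix\alpha}\gamma\,].$$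
   Context: Here $m=m_1+m_2$, $j=\begin{bmatrix} I_{m_1} & 0 \\ 0 & -I_{m_2} \end{bmatrix}$, $V=\begin{bmatrix} 0 & v \\ v^* & 0 \end{bmatrix}$, $v$ is an $m_1\times m_2$ matrix function, $\sigma$ denotes spectrum, and $\overline{\mathbb{C}}_-$ is the closed lower half-plane. A set of parameter matrices $\alpha$ ($n\times n$), $S_0=S_0^*$ ($n\times n$), $\gamma_1$ ($n\times m_1$), $\gamma$ ($n\times m_2$) is admissible if $$\alpha S_0-S_0\alpha^*=i(\gamma_1\gamma_1^*-\gamma\gamma^* ),\quad \sigma(\alpha)\subset\overline{\mathbb{C}}_-,\quad \mathrm{span}\bigcup_{l=0}^{n-1}\mathrm{Im}\,\alpha^l\gamma_1=\mathbb{C}^n,\quad \mathrm{span}\bigcup_{l=0}^{n-1}\mathrm{Im}\,\alpha^l\gamma=\mathbb{C}^n,$$ where $\mathrm{Im}$ denotes image. The potential determined by the admissible set is $$v(x)=-2i\gamma_1^*e^{ix\alpha^*}S(x)^{-1}e^{ix\alpha}\gamma ,\quad S(x)=S_0+\int_0^x\Lambda(t)\Lambda(t)^*\,dt,\quad \Lambda(x)=[\,e^{-ix\alpha}\gamma_1\ \ \ e^{ix\alpha}\gamma\,],$$ and $\mathrm{PE}$ is the class of all such potentials (the degenerate case $n=0$ corresponds to $v=0$ and $R=0$). $S_0$ is not assumed positive, so $v$ may have singularities on the semi-axis (zeros of $\det S(x)$); solutions of the system are understood as solutions meromorphic in $x$. For $\lambda\in\mathbb{R}$, let $Y(x,\lambda)$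 be the $m\times m_1$ solution determined by $Y(x,\lambda)=e^{ix\lambda}\begin{bmatrix} I_{m_1} \\ 0 \end{bmatrix}+o(1)$ as $x\to\infty$, with upper block $Y_1$ ($m_1\times m_1$) and lower block $Y_2$ ($m_2\times m_1$). The left reflection coefficient is $R_L(\lambda)=Y_2(0,\lambda)Y_1(0,\lambda)^{-1}$, regarded as a rational function of $\lambda$ (equality of rational functions, i.e. for all real $\lambda$ with possibly finitely many exceptions). A rational matrix function is proper if it is analytic at infinity. $R$ is contractive on $\mathbb{R}$ if it has no poles there and $R(\lambda)^*R(\lambda)\le I$ for $\lambda\in\mathbb{R}$. A realization $R(\lambda)=C(\lambda I_n-A)^{-1}B$ is minimal if the order $n$ of $A$ is minimal among all such realizations. For $R$ contractive on $\mathbb{R}$ and vanishing at infinity, the Hermitian solution $X$ with the stated spectral property exists, is unique, and is invertible. *)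

theory Defs
  imports
    "HOL-Complex_Analysis.Complex_Analysis"
    "Jordan_Normal_Form.Spectral_Radius"
    "Jordan_Normal_Form.Schur_Decomposition"
    "Jordan_Normal_Form.Gauss_Jordan_Elimination"
    "Jordan_Normal_Form.VS_Connect"
begin

section \<open>Matrices\<close>

text \<open>Matrices are those of \<open>Jordan_Normal_Form.Matrix\<close>, since the order \<open>n\<close> of the parameter
  matrices varies; the value \<open>n = 0\<close> is allowed. The spectral parameter is written
  \<open>\<xi>\<close>. Several names are qualified because
  \<open>HOL-Analysis\<close> has its own \<open>mat\<close> and \<open>det\<close>.\<close>

text \<open>Only meaningful for invertible \<open>A\<close>; every use below is guarded accordingly.\<close>

definition mat_inv :: "complex mat \<Rightarrow> complex mat" where
  "mat_inv A = the (mat_inverse A)"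

definition hermitian_mat :: "complex mat \<Rightarrow> bool" where
  "hermitian_mat A \<longleftrightarrow> mat_adjoint A = A"

text \<open>The order on \<open>complex\<close> is that of \<open>Complex_Order\<close>: \<open>0 \<le> z\<close> says that \<open>z\<close> is real and
  non-negative.\<close>

definition pos_semidef :: "complex mat \<Rightarrow> bool" where
  "pos_semidef A \<longleftrightarrow> (\<forall>w \<in> carrier_vec (dim_row A). 0 \<le> (A *\<^sub>v w) \<bullet>c w)"

definition mat_exp :: "complex mat \<Rightarrow> complex mat" where
  "mat_exp A = Matrix.mat (dim_row A) (dim_row A) (\<lambda>(i, j). \<Sum>k. (A ^\<^sub>m k) $$ (i, j) / fact k)"

definition spectrum_in_closed_lower_half_plane :: "complex mat \<Rightarrow> bool" where
  "spectrum_in_closed_lower_half_plane A \<longleftrightarrow> (\<forall>z \<in> spectrum A. Im z \<le> 0)"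

definition mat_image :: "complex mat \<Rightarrow> complex vec set" where
  "mat_image A = {A *\<^sub>v w | w. w \<in> carrier_vec (dim_col A)}"

text \<open>The span of the images of \<open>\<alpha>\<^sup>l \<beta>\<close>, \<open>l = 0, \<dots>, n - 1\<close>, is the whole of \<open>\<complex>\<^sup>n\<close>.\<close>

definition controllable :: "nat \<Rightarrow> complex mat \<Rightarrow> complex mat \<Rightarrow> bool" where
  "controllable n \<alpha> \<beta> \<longleftrightarrow>
     LinearCombinations.module.span class_ring (module_vec TYPE(complex) n)
       (\<Union>l\<in>{..<n}. mat_image ((\<alpha> ^\<^sub>m l) * \<beta>)) = carrier_vec n"


section \<open>Pseudo-exponential potentials\<close>

definition admissible ::
  "nat \<Rightarrow> nat \<Rightarrow> nat \<Rightarrow> complex mat \<Rightarrow> complex mat \<Rightarrow> complex mat \<Rightarrow> complex mat \<Rightarrow> bool" where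
  "admissible m1 m2 n \<alpha> S0 \<gamma>1 \<gamma> \<longleftrightarrow>
     \<alpha> \<in> carrier_mat n n \<and> S0 \<in> carrier_mat n n \<and>
     \<gamma>1 \<in> carrier_mat n m1 \<and> \<gamma> \<in> carrier_mat n m2 \<and>
     hermitian_mat S0 \<and>
     \<alpha> * S0 - S0 * mat_adjoint \<alpha> = \<i> \<cdot>\<^sub>m (\<gamma>1 * mat_adjoint \<gamma>1 - \<gamma> * mat_adjoint \<gamma>) \<and>
     spectrum_in_closed_lower_half_plane \<alpha> \<and>
     controllable n \<alpha> \<gamma>1 \<and> controllable n \<alpha> \<gamma>"

definition Lambda_fun :: "complex mat \<Rightarrow> complex mat \<Rightarrow> complex mat \<Rightarrow> real \<Rightarrow> complex mat" where
  "Lambda_fun \<alpha> \<gamma>1 \<gamma> x =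
     four_block_mat
       (mat_exp ((- \<i> * of_real x) \<cdot>\<^sub>m \<alpha>) * \<gamma>1) (mat_exp ((\<i> * of_real x) \<cdot>\<^sub>m \<alpha>) * \<gamma>)
       (0\<^sub>m 0 (dim_col \<gamma>1)) (0\<^sub>m 0 (dim_col \<gamma>))"

definition S_fun ::
  "complex mat \<Rightarrow> complex mat \<Rightarrow> complex mat \<Rightarrow> complex mat \<Rightarrow> real \<Rightarrow> complex mat" where
  "S_fun \<alpha> S0 \<gamma>1 \<gamma> x =
     S0 + Matrix.mat (dim_row S0) (dim_row S0) (\<lambda>(i, j).
       integral {0..x} (\<lambda>t. (Lambda_fun \<alpha> \<gamma>1 \<gamma> t * mat_adjoint (Lambda_fun \<alpha> \<gamma>1 \<gamma> t)) $$ (i, j)))"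

text \<open>A potential is a partial function on the semi-axis: it is undefined exactly at the
  singular points, the zeros of \<open>det S(x)\<close>.\<close>

definition pe_potential ::
  "complex mat \<Rightarrow> complex mat \<Rightarrow> complex mat \<Rightarrow> complex mat \<Rightarrow> real \<Rightarrow> complex mat option" where
  "pe_potential \<alpha> S0 \<gamma>1 \<gamma> x =
     (if 0 \<le> x \<and> Determinant.det (S_fun \<alpha> S0 \<gamma>1 \<gamma> x) \<noteq> 0
      then Some ((- 2 * \<i>) \<cdot>\<^sub>m
        (mat_adjoint \<gamma>1 * mat_exp ((\<i> * of_real x) \<cdot>\<^sub>m mat_adjoint \<alpha>)
          * mat_inv (S_fun \<alpha> S0 \<gamma>1 \<gamma> x) * mat_exp ((\<i> * of_real x) \<cdot>\<^sub>m \<alpha>) * \<gamma>))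
      else None)"

text \<open>The potentials of the class \<open>PE\<close> that are determined by an admissible set with
  \<open>det S\<^sub>0 \<noteq> 0\<close>. The degenerate case \<open>v = 0\<close> is the one with \<open>n = 0\<close>.\<close>

definition PE_nonsing :: "nat \<Rightarrow> nat \<Rightarrow> (real \<Rightarrow> complex mat option) set" where
  "PE_nonsing m1 m2 = {pe_potential \<alpha> S0 \<gamma>1 \<gamma> | n \<alpha> S0 \<gamma>1 \<gamma>.
     admissible m1 m2 n \<alpha> S0 \<gamma>1 \<gamma> \<and> Determinant.det S0 \<noteq> 0}"


section \<open>Dirac systems and the left reflection coefficient\<close>

definition j_mat :: "nat \<Rightarrow> nat \<Rightarrow> complex mat" where
  "j_mat m1 m2 = four_block_mat (1\<^sub>m m1) (0\<^sub>m m1 m2) (0\<^sub>m m2 m1) (- 1\<^sub>m m2)"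

definition V_mat :: "nat \<Rightarrow> nat \<Rightarrow> complex mat \<Rightarrow> complex mat" where
  "V_mat m1 m2 w = four_block_mat (0\<^sub>m m1 m1) w (mat_adjoint w) (0\<^sub>m m2 m2)"

text \<open>A matrix solution with \<open>k\<close> columns, meromorphic in \<open>x\<close> at every point of the semi-axis.
  Since a solution is meromorphic near the semi-axis, its argument is complex and the derivative
  is the complex one. At the points where the potential is regular (in particular at \<open>0\<close> for
  the potentials in \<open>PE_nonsing\<close>) the equation forces the solution to be analytic, and
  continuation through the singular points is by meromorphy.\<close>

definition dirac_solution ::
  "nat \<Rightarrow> nat \<Rightarrow> (real \<Rightarrow> complex mat option) \<Rightarrow> real \<Rightarrow> nat \<Rightarrow> (complex \<Rightarrow> complex mat) \<Rightarrow> bool" where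
  "dirac_solution m1 m2 v \<xi> k u \<longleftrightarrow>
     (\<forall>z. u z \<in> carrier_mat (m1 + m2) k) \<and>
     (\<forall>i < m1 + m2. \<forall>l < k. (\<lambda>z. u z $$ (i, l)) meromorphic_on (of_real ` {0..})) \<and>
     (\<forall>x \<ge> 0. \<forall>w. v x = Some w \<longrightarrow>
       (\<forall>i < m1 + m2. \<forall>l < k.
         ((\<lambda>z. u z $$ (i, l)) has_field_derivative
           ((\<i> \<cdot>\<^sub>m (of_real \<xi> \<cdot>\<^sub>m j_mat m1 m2 + j_mat m1 m2 * V_mat m1 m2 w))
              * u (of_real x)) $$ (i, l)) (at (of_real x))))"

definition normalized_solution ::
  "nat \<Rightarrow> nat \<Rightarrow> (real \<Rightarrow> complex mat option) \<Rightarrow> real \<Rightarrow> (complex \<Rightarrow> complex mat) \<Rightarrow> bool" where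
  "normalized_solution m1 m2 v \<xi> Y \<longleftrightarrow>
     dirac_solution m1 m2 v \<xi> m1 Y \<and>
     (\<forall>i < m1 + m2. \<forall>l < m1.
       ((\<lambda>x. (Y (of_real x) - exp (\<i> * of_real (x * \<xi>)) \<cdot>\<^sub>m (1\<^sub>m m1 @\<^sub>r 0\<^sub>m m2 m1)) $$ (i, l))
          \<longlongrightarrow> 0) (at_top :: real filter))"

definition upper_block :: "nat \<Rightarrow> complex mat \<Rightarrow> complex mat" where
  "upper_block m1 U = Matrix.mat m1 (dim_col U) (\<lambda>(i, l). U $$ (i, l))"

definition lower_block :: "nat \<Rightarrow> nat \<Rightarrow> complex mat \<Rightarrow> complex mat" where
  "lower_block m1 m2 U = Matrix.mat m2 (dim_col U) (\<lambda>(i, l). U $$ (m1 + i, l))"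

text \<open>\<open>R\<close> is the left reflection coefficient of the system with potential \<open>v\<close>, as a rational
  function: \<open>R(\<xi>) = Y\<^sub>2(0, \<xi>) Y\<^sub>1(0, \<xi>)\<^sup>-\<^sup>1\<close> for all but finitely many real \<open>\<xi>\<close>. The pair of
  quantifiers over \<open>Y\<close> avoids any choice of a solution off the semi-axis or at singular points.\<close>

definition left_reflection_coefficient ::
  "nat \<Rightarrow> nat \<Rightarrow> (real \<Rightarrow> complex mat option) \<Rightarrow> (complex \<Rightarrow> complex mat) \<Rightarrow> bool" where
  "left_reflection_coefficient m1 m2 v R \<longleftrightarrow>
     (\<exists>F. finite F \<and> (\<forall>\<xi>. \<xi> \<notin> F \<longrightarrow>
       (\<exists>Y. normalized_solution m1 m2 v \<xi> Y) \<and>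
       (\<forall>Y. normalized_solution m1 m2 v \<xi> Y \<longrightarrow>
          Determinant.det (upper_block m1 (Y 0)) \<noteq> 0 \<and>
          R (of_real \<xi>) = lower_block m1 m2 (Y 0) * mat_inv (upper_block m1 (Y 0)))))"


section \<open>Rational matrix functions\<close>

text \<open>Entries are quotients \<open>p/q\<close> in lowest terms, so the zeros of \<open>q\<close> are precisely the poles;
  the values at the poles are irrelevant and left unspecified.\<close>

definition rational_mat_fun :: "nat \<Rightarrow> nat \<Rightarrow> (complex \<Rightarrow> complex mat) \<Rightarrow> bool" where
  "rational_mat_fun nr nc R \<longleftrightarrow>
     (\<forall>z. R z \<in> carrier_mat nr nc) \<and>
     (\<forall>i < nr. \<forall>l < nc. \<exists>p q :: complex poly. q \<noteq> 0 \<and> coprime p q \<and>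
        (\<forall>z. poly q z \<noteq> 0 \<longrightarrow> R z $$ (i, l) = poly p z / poly q z))"

definition proper_mat_fun :: "nat \<Rightarrow> nat \<Rightarrow> (complex \<Rightarrow> complex mat) \<Rightarrow> bool" where
  "proper_mat_fun nr nc R \<longleftrightarrow>
     (\<forall>i < nr. \<forall>l < nc. \<exists>g. g analytic_on {0} \<and>
        (\<forall>\<^sub>F z in at_infinity. R z $$ (i, l) = g (inverse z)))"

definition vanishes_at_infinity :: "nat \<Rightarrow> nat \<Rightarrow> (complex \<Rightarrow> complex mat) \<Rightarrow> bool" where
  "vanishes_at_infinity nr nc R \<longleftrightarrow>
     (\<forall>i < nr. \<forall>l < nc. ((\<lambda>z. R z $$ (i, l)) \<longlongrightarrow> 0) at_infinity)"

definition contractive_on_reals :: "nat \<Rightarrow> nat \<Rightarrow> (complex \<Rightarrow> complex mat) \<Rightarrow> bool" where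
  "contractive_on_reals nr nc R \<longleftrightarrow>
     (\<forall>\<xi> :: real.
        (\<forall>i < nr. \<forall>l < nc. \<not> is_pole (\<lambda>z. R z $$ (i, l)) (of_real \<xi>)) \<and>
        pos_semidef (1\<^sub>m nc - mat_adjoint (R (of_real \<xi>)) * R (of_real \<xi>)))"

definition realization ::
  "nat \<Rightarrow> nat \<Rightarrow> nat \<Rightarrow> complex mat \<Rightarrow> complex mat \<Rightarrow> complex mat \<Rightarrow> (complex \<Rightarrow> complex mat) \<Rightarrow> bool" where
  "realization m1 m2 n A B C R \<longleftrightarrow>
     A \<in> carrier_mat n n \<and> B \<in> carrier_mat n m1 \<and> C \<in> carrier_mat m2 n \<and>
     (\<forall>z. z \<notin> spectrum A \<longrightarrow> R z = C * mat_inv (z \<cdot>\<^sub>m 1\<^sub>m n - A) * B)"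

definition minimal_realization ::
  "nat \<Rightarrow> nat \<Rightarrow> nat \<Rightarrow> complex mat \<Rightarrow> complex mat \<Rightarrow> complex mat \<Rightarrow> (complex \<Rightarrow> complex mat) \<Rightarrow> bool" where
  "minimal_realization m1 m2 n A B C R \<longleftrightarrow>
     realization m1 m2 n A B C R \<and>
     (\<forall>n' A' B' C'. realization m1 m2 n' A' B' C' R \<longrightarrow> n \<le> n')"

definition riccati_solution ::
  "nat \<Rightarrow> complex mat \<Rightarrow> complex mat \<Rightarrow> complex mat \<Rightarrow> complex mat \<Rightarrow> bool" where
  "riccati_solution n A B C X \<longleftrightarrow>
     X \<in> carrier_mat n n \<and> hermitian_mat X \<and>
     \<i> \<cdot>\<^sub>m (X * A - mat_adjoint A * X) = mat_adjoint C * C + X * B * mat_adjoint B * X \<and>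
     spectrum_in_closed_lower_half_plane (A + \<i> \<cdot>\<^sub>m (B * mat_adjoint B * X))"

end

theory Submission
  imports Defs
begin

text \<open>Given an admissible set, put \<open>P(x) = exp(ix\<alpha>) S(x) exp(-ix\<alpha>\<^sup>*)\<close> and let \<open>(\<alpha> - \<xi>) K = \<gamma>\<^sub>1\<close>. The Dirac
  system then has the explicit solution with blocks \<open>exp(ix\<xi>) (I - i \<gamma>\<^sub>1\<^sup>* P\<^sup>-\<^sup>1 K)\<close> and
  \<open>i exp(ix\<xi>) \<gamma>\<^sup>* exp(-2ix\<alpha>\<^sup>*) P\<^sup>-\<^sup>1 K\<close>, which is normalized because controllability and the spectral condition
  force \<open>P(x)\<close> to grow beyond all bounds. Its \<open>j\<close>-form is constant, also across the singularities, and
  equals \<open>I\<close>; this gives contractivity and shows that every normalized solution has the same value at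
  \<open>0\<close>. Evaluating there yields the realization \<open>A = \<alpha> - i \<gamma>\<^sub>1 \<gamma>\<^sub>1\<^sup>* X\<close>, \<open>B = \<gamma>\<^sub>1\<close>, \<open>C = -i \<gamma>\<^sup>* X\<close> with
  \<open>X = S\<^sub>0\<^sup>-\<^sup>1\<close>, and the identity of the admissible set becomes the Riccati equation for \<open>X\<close>.

  Conversely, the Riccati equation of a controllable and observable realization of a contractive
  function is solved by stable subspaces of the Hamiltonian matrix: for \<open>r R\<close> with \<open>r < 1\<close> the matrix
  has no real eigenvalues, and the solutions increase to a limit as \<open>r \<rightarrow> 1\<close>. The solution with spectral
  condition is unique, so it transforms covariantly under similarity of realizations, and the
  potential does not change.\<close>

section \<open>Matrix algebra\<close>

text \<open>The obstacle is that S0 may be indefinite: the potential may be singular on the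
  semi-axis, so nothing can be integrated from 0 to infinity. Everything is therefore continued
  holomorphically, with the adjoint taken at \<open>cnj z\<close>; a function with an isolated
  singularity at a real point whose derivative vanishes on one side of it is constant on both sides.
  Normalized solutions agree at 0 because their difference is j-null and j-orthogonal to the
  explicit solution, whose columns span a maximal j-positive subspace. Growth of P: if one of its
  forms stayed bounded, its increments over unit intervals would tend to 0, and some eigenvector of
  \<open>adj \<alpha>\<close> would decay under a flow that the spectral condition makes
  non-decaying. The detour through r < 1 is forced because the closed loop for R itself may have
  real eigenvalues. The stable solutions are bounded above by the anti-stable solution for the
  smallest r. The spectral condition survives the limit because for Im z > 0 the characteristic
  polynomials have modulus at least \<open>(Im z) ^ n\<close> at z, uniformly along the
  sequence.\<close>

abbreviation adj :: "complex mat \<Rightarrow> complex mat" where "adj \<equiv> mat_adjoint"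

lemma carrier_iff: "X \<in> carrier_mat n m \<longleftrightarrow> dim_row X = n \<and> dim_col X = m"
  by blast

lemma dim_adj [simp]: "dim_row (adj A) = dim_col A" "dim_col (adj A) = dim_row A"
  by (auto simp: mat_adjoint_def)

lemma index_adj [simp]:
  "i < dim_col A \<Longrightarrow> j < dim_row A \<Longrightarrow> adj A $$ (i, j) = cnj (A $$ (j, i))"
  by (simp add: mat_adjoint_def mat_of_rows_index)

lemma adj_carrier [simp]: "A \<in> carrier_mat n m \<Longrightarrow> adj A \<in> carrier_mat m n"
  by (rule carrier_matI) auto

lemma index_mult_sum:
  "i < dim_row A \<Longrightarrow> j < dim_col B \<Longrightarrow> dim_col A = dim_row B \<Longrightarrow>
    (A * B) $$ (i, j) = (\<Sum>k<dim_row B. A $$ (i, k) * B $$ (k, j))"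
  by (simp add: scalar_prod_def atLeast0LessThan)

context
  fixes A B C :: "complex mat"
begin

lemma mult_assoc_dim:
  "dim_col A = dim_row B \<Longrightarrow> dim_col B = dim_row C \<Longrightarrow> A * B * C = A * (B * C)"
  by (rule assoc_mult_mat[of _ "dim_row A" "dim_col A" _ "dim_col B" _ "dim_col C"]) auto

lemma mult_add_dim:
  "dim_col A = dim_row B \<Longrightarrow> dim_row B = dim_row C \<Longrightarrow> dim_col B = dim_col C \<Longrightarrow>
    A * (B + C) = A * B + A * C"
  by (rule mult_add_distrib_mat[of _ "dim_row A" "dim_col A" _ "dim_col B"]) auto

lemma add_mult_dim:
  "dim_col A = dim_row C \<Longrightarrow> dim_row A = dim_row B \<Longrightarrow> dim_col A = dim_col B \<Longrightarrow>
    (A + B) * C = A * C + B * C"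
  by (rule add_mult_distrib_mat[of _ "dim_row A" "dim_col A" _ _ "dim_col C"]) auto

lemma mult_minus_dim:
  "dim_col A = dim_row B \<Longrightarrow> dim_row B = dim_row C \<Longrightarrow> dim_col B = dim_col C \<Longrightarrow>
    A * (B - C) = A * B - A * C"
  by (rule mult_minus_distrib_mat[of _ "dim_row A" "dim_col A" _ "dim_col B"]) auto

lemma minus_mult_dim:
  "dim_col A = dim_row C \<Longrightarrow> dim_row A = dim_row B \<Longrightarrow> dim_col A = dim_col B \<Longrightarrow>
    (A - B) * C = A * C - B * C"
  by (rule minus_mult_distrib_mat[of _ "dim_row A" "dim_col A" _ _ "dim_col C"]) auto

lemma smult_mult_dim: "dim_col A = dim_row B \<Longrightarrow> (k \<cdot>\<^sub>m A) * B = k \<cdot>\<^sub>m (A * B)"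
  by (rule mult_smult_assoc_mat[of _ "dim_row A" "dim_col A" _ "dim_col B"]) auto

lemma mult_smult_dim: "dim_col A = dim_row B \<Longrightarrow> A * (k \<cdot>\<^sub>m B) = k \<cdot>\<^sub>m (A * B)"
  by (rule mult_smult_distrib[of _ "dim_row A" "dim_col A" _ "dim_col B"]) auto

lemma uminus_mult_dim: "dim_col A = dim_row B \<Longrightarrow> (- A) * B = - (A * B)"
  by (rule eq_matI) auto

lemma mult_uminus_dim: "dim_col A = dim_row B \<Longrightarrow> A * (- B) = - (A * B)"
  by (rule eq_matI) auto

lemma one_mult_dim: "dim_row A = n \<Longrightarrow> 1\<^sub>m n * A = A"
  by (metis carrier_matI left_mult_one_mat)

lemma mult_one_dim: "dim_col A = n \<Longrightarrow> A * 1\<^sub>m n = A"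
  by (metis carrier_matI right_mult_one_mat)

lemma zero_mult_dim: "dim_row A = n \<Longrightarrow> 0\<^sub>m m n * A = 0\<^sub>m m (dim_col A)"
  by (rule eq_matI) (auto simp: index_mult_sum simp del: index_mult_mat(1))

lemma mult_zero_dim: "dim_col A = n \<Longrightarrow> A * 0\<^sub>m n m = 0\<^sub>m (dim_row A) m"
  by (rule eq_matI) (auto simp: index_mult_sum simp del: index_mult_mat(1))

lemma smult_add_dim:
  "dim_row A = dim_row B \<Longrightarrow> dim_col A = dim_col B \<Longrightarrow> k \<cdot>\<^sub>m (A + B) = k \<cdot>\<^sub>m A + k \<cdot>\<^sub>m B"
  by (rule eq_matI) (auto simp: algebra_simps)

lemma smult_minus_dim:
  "dim_row A = dim_row B \<Longrightarrow> dim_col A = dim_col B \<Longrightarrow> k \<cdot>\<^sub>m (A - B) = k \<cdot>\<^sub>m A - k \<cdot>\<^sub>m B"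
  by (rule eq_matI) (auto simp: algebra_simps)

lemma smult_uminus: "k \<cdot>\<^sub>m (- A) = - (k \<cdot>\<^sub>m A)"
  by (rule eq_matI) auto

lemma smult_smult: "k \<cdot>\<^sub>m (l \<cdot>\<^sub>m A) = (k * l) \<cdot>\<^sub>m A"
  by (rule eq_matI) auto

lemma smult_one_mat: "1 \<cdot>\<^sub>m A = A"
  by (rule eq_matI) auto

lemma adj_mult: "dim_col A = dim_row B \<Longrightarrow> adj (A * B) = adj B * adj A"
  by (rule eq_matI) (auto simp: index_mult_sum mult.commute simp del: index_mult_mat(1))

lemma adj_add:
  "dim_row A = dim_row B \<Longrightarrow> dim_col A = dim_col B \<Longrightarrow> adj (A + B) = adj A + adj B"
  by (rule eq_matI) auto

lemma adj_minus:
  "dim_row A = dim_row B \<Longrightarrow> dim_col A = dim_col B \<Longrightarrow> adj (A - B) = adj A - adj B"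
  by (rule eq_matI) auto

lemma adj_smult: "adj (k \<cdot>\<^sub>m A) = cnj k \<cdot>\<^sub>m adj A"
  by (rule eq_matI) auto

lemma adj_uminus: "adj (- A) = - adj A"
  by (rule eq_matI) auto

lemma adj_adj: "adj (adj A) = A"
  by (rule eq_matI) auto

end

lemma adj_one: "adj (1\<^sub>m n) = 1\<^sub>m n"
  by (rule eq_matI) auto

lemma adj_zero: "adj (0\<^sub>m n m) = 0\<^sub>m m n"
  by (rule eq_matI) auto

text \<open>These rules multiply out products into right-nested monomials; the side conditions mention
  dimensions only, so that the simplifier can discharge them without guessing carriers. Identities
  are then compared entrywise with the monomials as atoms, which is why the entrywise product rule
  is removed.\<close>

lemmas mat_simps = mult_assoc_dim mult_add_dim add_mult_dim mult_minus_dim minus_mult_dim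
  smult_mult_dim mult_smult_dim uminus_mult_dim mult_uminus_dim one_mult_dim mult_one_dim
  zero_mult_dim mult_zero_dim smult_add_dim smult_minus_dim smult_uminus smult_smult smult_one_mat
  adj_mult adj_add adj_minus adj_smult adj_uminus adj_adj adj_one adj_zero

declare index_mult_mat(1) [simp del]

lemma dim_pow_mat [simp]:
  "dim_row A = dim_col A \<Longrightarrow> dim_row (A ^\<^sub>m l) = dim_row A"
  "dim_row A = dim_col A \<Longrightarrow> dim_col (A ^\<^sub>m l) = dim_col A"
  by (induction l) auto

lemma pow_mat_Suc_left:
  fixes A :: "complex mat"
  assumes A: "dim_row A = dim_col A"
  shows "A ^\<^sub>m Suc l = A * A ^\<^sub>m l"
proof (induction l)
  case (Suc l)
  have "A ^\<^sub>m Suc (Suc l) = A * A ^\<^sub>m l * A" using Suc by simp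
  then show ?case using A by (simp add: mult_assoc_dim)
qed (use A in \<open>simp add: mat_simps\<close>)

lemma adj_pow: "dim_row A = dim_col A \<Longrightarrow> adj (A ^\<^sub>m l) = adj A ^\<^sub>m l"
proof (induction l)
  case (Suc l)
  then have "adj (A ^\<^sub>m Suc l) = adj A * adj A ^\<^sub>m l" by (simp add: adj_mult)
  then show ?case using Suc.prems pow_mat_Suc_left[of "adj A" l] by simp
qed (simp add: adj_one)

subsection \<open>Norms and quadratic forms\<close>

definition nrm2 :: "complex mat \<Rightarrow> real" where
  "nrm2 w = (\<Sum>i<dim_row w. (cmod (w $$ (i, 0)))\<^sup>2)"

definition qf :: "complex mat \<Rightarrow> complex mat \<Rightarrow> complex" where
  "qf A w = (adj w * (A * w)) $$ (0, 0)"

lemma adj_self_diag: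
  assumes "l < dim_col Z"
  shows "(adj Z * Z) $$ (l, l) = of_real (\<Sum>i<dim_row Z. (cmod (Z $$ (i, l)))\<^sup>2)"
  using assms by (simp add: index_mult_sum complex_norm_square[symmetric] mult.commute)

lemma adj_self_nrm2: "dim_col w = 1 \<Longrightarrow> (adj w * w) $$ (0, 0) = of_real (nrm2 w)"
  using adj_self_diag[of 0 w] by (simp add: nrm2_def)

lemma nrm2_nonneg [simp]: "0 \<le> nrm2 w"
  by (simp add: nrm2_def sum_nonneg)

lemma nrm2_zero_iff: "w \<in> carrier_mat n 1 \<Longrightarrow> nrm2 w = 0 \<longleftrightarrow> w = 0\<^sub>m n 1"
  by (auto simp: nrm2_def sum_nonneg_eq_0_iff intro!: eq_matI)

lemma nrm2_pos: "w \<in> carrier_mat n 1 \<Longrightarrow> w \<noteq> 0\<^sub>m n 1 \<Longrightarrow> 0 < nrm2 w"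
  using nrm2_zero_iff[of w n] nrm2_nonneg[of w] by linarith

lemma adj_self_zero:
  assumes "\<And>l. l < dim_col Z \<Longrightarrow> (adj Z * Z) $$ (l, l) = 0"
  shows "Z = 0\<^sub>m (dim_row Z) (dim_col Z)"
proof (rule eq_matI)
  fix i l assume il: "i < dim_row (0\<^sub>m (dim_row Z) (dim_col Z) :: complex mat)"
    "l < dim_col (0\<^sub>m (dim_row Z) (dim_col Z) :: complex mat)"
  then have "complex_of_real (\<Sum>i<dim_row Z. (cmod (Z $$ (i, l)))\<^sup>2) = 0"
    using assms[of l] adj_self_diag[of l Z] by simp
  then have "(\<Sum>i<dim_row Z. (cmod (Z $$ (i, l)))\<^sup>2) = 0"
    using of_real_eq_0_iff by blast
  then have "\<forall>i\<in>{..<dim_row Z}. (cmod (Z $$ (i, l)))\<^sup>2 = 0"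
    by (subst (asm) sum_nonneg_eq_0_iff) auto
  with il show "Z $$ (i, l) = 0\<^sub>m (dim_row Z) (dim_col Z) $$ (i, l)"
    by auto
qed auto

subsection \<open>Inverses and eigenvectors\<close>

text \<open>Vectors are handled as one-column matrices throughout, so that a single set of product
  rules covers matrices and vectors. The lemmas that follow translate determinants and spectra into
  this language.\<close>

lemma col_mult_vec:
  assumes "A \<in> carrier_mat n m" "v \<in> carrier_vec m"
  shows "A * Matrix.mat m 1 (\<lambda>(i, j). v $ i) = Matrix.mat n 1 (\<lambda>(i, j). (A *\<^sub>v v) $ i)"
  using assms by (intro eq_matI) (auto simp: index_mult_sum scalar_prod_def atLeast0LessThan)

lemma mult_vec_col:
  assumes "A \<in> carrier_mat n m" "w \<in> carrier_mat m 1"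
  shows "A *\<^sub>v col w 0 = col (A * w) 0"
  using assms by (intro eq_vecI) (auto simp: index_mult_mat(1))

lemma mat_of_vec_zero_iff:
  "v \<in> carrier_vec n \<Longrightarrow> Matrix.mat n 1 (\<lambda>(i, j). v $ i) = 0\<^sub>m n 1 \<longleftrightarrow> v = 0\<^sub>v n"
  by (auto simp: mat_eq_iff vec_eq_iff)

lemma col_zero_iff: "w \<in> carrier_mat n 1 \<Longrightarrow> col w 0 = 0\<^sub>v n \<longleftrightarrow> w = 0\<^sub>m n 1"
  by (auto simp: mat_eq_iff vec_eq_iff)

lemma det_nonzero_iff:
  fixes A :: "complex mat"
  assumes A: "A \<in> carrier_mat n n"
  shows "Determinant.det A \<noteq> 0 \<longleftrightarrow> (\<forall>w\<in>carrier_mat n 1. A * w = 0\<^sub>m n 1 \<longrightarrow> w = 0\<^sub>m n (1::nat))"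
    (is "_ \<longleftrightarrow> ?R")
proof -
  have "?R \<longleftrightarrow> \<not> (\<exists>v. v \<in> carrier_vec n \<and> v \<noteq> 0\<^sub>v n \<and> A *\<^sub>v v = 0\<^sub>v n)"
  proof (intro iffI notI ballI impI; (elim exE conjE)?)
    fix v assume R: ?R and v: "v \<in> carrier_vec n" "v \<noteq> 0\<^sub>v n" "A *\<^sub>v v = 0\<^sub>v n"
    let ?w = "Matrix.mat n 1 (\<lambda>(i, j). v $ i)"
    have "A * ?w = 0\<^sub>m n 1" unfolding col_mult_vec[OF A v(1)] v(3) by (rule eq_matI) auto
    then have "?w = 0\<^sub>m n 1" using R by auto
    then show False using v mat_of_vec_zero_iff by auto
  next
    fix w assume H: "\<nexists>v. v \<in> carrier_vec n \<and> v \<noteq> 0\<^sub>v n \<and> A *\<^sub>v v = 0\<^sub>v n"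
      and w: "w \<in> carrier_mat n 1" "A * w = 0\<^sub>m n 1"
    have "A *\<^sub>v col w 0 = 0\<^sub>v n" unfolding mult_vec_col[OF A w(1)] w(2) by auto
    moreover have "col w 0 \<in> carrier_vec n" using w by auto
    ultimately have "col w 0 = 0\<^sub>v n" using H by blast
    then show "w = 0\<^sub>m n 1" using col_zero_iff w by blast
  qed
  then show ?thesis using det_0_iff_vec_prod_zero[OF A] by blast
qed

lemma mat_inv_props:
  assumes A: "A \<in> carrier_mat n n" and d: "Determinant.det A \<noteq> 0"
  shows mat_inv_carrier: "mat_inv A \<in> carrier_mat n n"
    and mult_mat_inv: "A * mat_inv A = 1\<^sub>m n" and mat_inv_mult: "mat_inv A * A = 1\<^sub>m n"
proof -
  have "A \<in> Units (ring_mat TYPE(complex) n ())" using det_non_zero_imp_unit[OF A d] .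
  then obtain B where "mat_inverse A = Some B"
    using mat_inverse(1)[OF A, of "()"] by (cases "mat_inverse A") auto
  then show "mat_inv A \<in> carrier_mat n n" "A * mat_inv A = 1\<^sub>m n" "mat_inv A * A = 1\<^sub>m n"
    using mat_inverse(2)[OF A] by (auto simp: mat_inv_def)
qed

lemma det_nonzero_of_inverse:
  fixes A :: "complex mat"
  assumes "A \<in> carrier_mat n n" "B \<in> carrier_mat n n" "A * B = 1\<^sub>m n"
  shows "Determinant.det A \<noteq> 0" "Determinant.det B \<noteq> 0"
  using det_mult[OF assms(1,2)] assms(3) by auto

lemma mat_inv_unique:
  assumes A: "A \<in> carrier_mat n n" and B: "B \<in> carrier_mat n n" and AB: "A * B = 1\<^sub>m n"
  shows "mat_inv A = B"
proof -
  have d: "Determinant.det A \<noteq> 0" using det_nonzero_of_inverse[OF A B AB] by simp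
  note I = mat_inv_props[OF A d]
  note [simp] = carrier_matD[OF A] carrier_matD[OF B] carrier_matD[OF I(1)]
  have "mat_inv A = mat_inv A * (A * B)" using AB I by (simp add: mat_simps)
  also have "\<dots> = (mat_inv A * A) * B" by (simp add: mat_simps)
  also have "\<dots> = B" using I B by (simp add: mat_simps)
  finally show ?thesis .
qed

lemma minus_zero_iff:
  fixes X Y :: "complex mat"
  assumes "X \<in> carrier_mat n m" "Y \<in> carrier_mat n m"
  shows "X - Y = 0\<^sub>m n m \<longleftrightarrow> X = Y"
  unfolding mat_eq_iff using assms by auto

lemma spectrum_iff:
  fixes A :: "complex mat"
  assumes A: "A \<in> carrier_mat n n"
  shows "z \<in> spectrum A \<longleftrightarrow> (\<exists>w\<in>carrier_mat n 1. w \<noteq> 0\<^sub>m n 1 \<and> A * w = z \<cdot>\<^sub>m w)"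
proof
  assume "z \<in> spectrum A"
  then obtain v where v: "v \<in> carrier_vec n" "v \<noteq> 0\<^sub>v n" "A *\<^sub>v v = z \<cdot>\<^sub>v v"
    using A by (auto simp: spectrum_def eigenvalue_def eigenvector_def)
  let ?w = "Matrix.mat n 1 (\<lambda>(i, j). v $ i)"
  have "A * ?w = z \<cdot>\<^sub>m ?w" unfolding col_mult_vec[OF A v(1)] v(3) using v by (intro eq_matI) auto
  then show "\<exists>w\<in>carrier_mat n 1. w \<noteq> 0\<^sub>m n 1 \<and> A * w = z \<cdot>\<^sub>m w"
    using v mat_of_vec_zero_iff by (intro bexI[of _ ?w]) auto
next
  assume "\<exists>w\<in>carrier_mat n 1. w \<noteq> 0\<^sub>m n 1 \<and> A * w = z \<cdot>\<^sub>m w"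
  then obtain w where w: "w \<in> carrier_mat n 1" "w \<noteq> 0\<^sub>m n 1" "A * w = z \<cdot>\<^sub>m w" by auto
  have "A *\<^sub>v col w 0 = z \<cdot>\<^sub>v col w 0" unfolding mult_vec_col[OF A w(1)] w(3) using w by auto
  moreover have "col w 0 \<in> carrier_vec n" using w by auto
  moreover have "col w 0 \<noteq> 0\<^sub>v n" using col_zero_iff w by blast
  ultimately show "z \<in> spectrum A"
    using A by (auto simp: spectrum_def eigenvalue_def eigenvector_def)
qed

lemma spectrum_det:
  fixes A :: "complex mat"
  assumes A: "A \<in> carrier_mat n n"
  shows "z \<in> spectrum A \<longleftrightarrow> Determinant.det (z \<cdot>\<^sub>m 1\<^sub>m n - A) = 0"
proof -
  note [simp] = carrier_matD[OF A]
  have C: "z \<cdot>\<^sub>m 1\<^sub>m n - A \<in> carrier_mat n n" by (simp add: carrier_iff)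
  have "(z \<cdot>\<^sub>m 1\<^sub>m n - A) * w = 0\<^sub>m n 1 \<longleftrightarrow> A * w = z \<cdot>\<^sub>m w" if w: "w \<in> carrier_mat n 1" for w
  proof -
    note [simp] = carrier_matD[OF w]
    have "(z \<cdot>\<^sub>m 1\<^sub>m n - A) * w = z \<cdot>\<^sub>m w - A * w" by (simp add: mat_simps)
    moreover have "z \<cdot>\<^sub>m w - A * w = 0\<^sub>m n 1 \<longleftrightarrow> z \<cdot>\<^sub>m w = A * w"
      by (rule minus_zero_iff) (auto simp: carrier_iff)
    ultimately show ?thesis by metis
  qed
  then have "Determinant.det (z \<cdot>\<^sub>m 1\<^sub>m n - A) \<noteq> 0 \<longleftrightarrow> z \<notin> spectrum A"
    unfolding det_nonzero_iff[OF C] spectrum_iff[OF A] by auto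
  then show ?thesis by simp
qed

lemma finite_spectrum: "A \<in> carrier_mat n n \<Longrightarrow> finite (spectrum (A :: complex mat))"
  using card_finite_spectrum(1) .

lemma spectrum_adj:
  assumes A: "A \<in> carrier_mat n n"
  shows "z \<in> spectrum (adj A) \<longleftrightarrow> cnj z \<in> spectrum A"
proof -
  note [simp] = carrier_matD[OF A]
  have *: "Determinant.det (adj M) \<noteq> 0" if M: "M \<in> carrier_mat n n" "Determinant.det M \<noteq> 0" for M
  proof -
    note I = mat_inv_props[OF M] note [simp] = carrier_matD[OF I(1)] carrier_matD[OF M(1)]
    have "adj M * adj (mat_inv M) = adj (mat_inv M * M)" by (simp add: adj_mult)
    also have "\<dots> = 1\<^sub>m n" using I by (simp add: adj_one)
    finally show ?thesis using det_nonzero_of_inverse[of "adj M" n "adj (mat_inv M)"] M I by auto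
  qed
  have C: "cnj z \<cdot>\<^sub>m 1\<^sub>m n - A \<in> carrier_mat n n" by (simp add: carrier_iff)
  have e: "adj (cnj z \<cdot>\<^sub>m 1\<^sub>m n - A) = z \<cdot>\<^sub>m 1\<^sub>m n - adj A" by (simp add: mat_simps)
  have "Determinant.det (cnj z \<cdot>\<^sub>m 1\<^sub>m n - A) = 0 \<longleftrightarrow> Determinant.det (z \<cdot>\<^sub>m 1\<^sub>m n - adj A) = 0"
    using *[OF C] *[of "adj (cnj z \<cdot>\<^sub>m 1\<^sub>m n - A)"] C by (auto simp: adj_adj e[symmetric])
  then show ?thesis using spectrum_det[OF A] spectrum_det[of "adj A" n] A by simp
qed

text \<open>As a simplification rule, \<open>carrier_matD\<close> would loop with \<open>carrier_iff\<close>.\<close>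

declare carrier_matD [simp del]

section \<open>Triangularization and invariant subspaces\<close>

text \<open>The order of the eigenvalues on the diagonal is free; listing one half-plane first later
  singles out the stable or the anti-stable subspace of the Hamiltonian matrix.\<close>

lemma schur_ordered:
  fixes A :: "complex mat"
  assumes A: "A \<in> carrier_mat n n" and es: "char_poly A = (\<Prod>a\<leftarrow>es. [:- a, 1:])"
  obtains P Q T where "P \<in> carrier_mat n n" "Q \<in> carrier_mat n n" "T \<in> carrier_mat n n"
    "P * Q = 1\<^sub>m n" "Q * P = 1\<^sub>m n" "A * P = P * T" "Q * A = T * Q" "upper_triangular T"
    "length es = n" "\<And>i. i < n \<Longrightarrow> T $$ (i, i) = es ! i"
    "\<And>i. i < n \<Longrightarrow> es ! i \<in> spectrum A"
proof -
  obtain T P Q where s: "schur_decomposition A es = (T, P, Q)"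
    by (cases "schur_decomposition A es") auto
  from schur_decomposition[OF A es s]
  have w: "similar_mat_wit A T P Q" and ut: "upper_triangular T" and d: "diag_mat T = es" by auto
  from similar_mat_witD2[OF A w]
  have PQ: "P * Q = 1\<^sub>m n" and QP: "Q * P = 1\<^sub>m n" and AP: "A = P * T * Q"
    and c: "T \<in> carrier_mat n n" "P \<in> carrier_mat n n" "Q \<in> carrier_mat n n" by auto
  note [simp] = c[THEN carrier_matD(1)] c[THEN carrier_matD(2)]
  have "A * P = P * (T * (Q * P))" unfolding AP by (simp add: mat_simps)
  then have 1: "A * P = P * T" by (simp add: QP mat_simps)
  have "Q * A = (Q * P) * (T * Q)" unfolding AP by (simp add: mat_simps)
  then have 2: "Q * A = T * Q" by (simp add: QP mat_simps)
  have len: "length es = n" unfolding d[symmetric] by (simp add: diag_mat_def)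
  have di: "T $$ (i, i) = es ! i" if "i < n" for i
    using that unfolding d[symmetric] by (simp add: diag_mat_def)
  have "es ! i \<in> spectrum A" if "i < n" for i
  proof -
    have "es ! i \<in> set es" using that len by auto
    then have "poly (char_poly A) (es ! i) = 0"
      unfolding es poly_prod_list by (auto simp: prod_list_zero_iff image_iff intro!: bexI[of _ "es ! i"])
    then show ?thesis using spectrum_root_char_poly[OF A] by auto
  qed
  then show thesis using that c PQ QP 1 2 ut len di by blast
qed

lemma schur_exists:
  fixes A :: "complex mat"
  assumes A: "A \<in> carrier_mat n n"
  obtains P Q T where "P \<in> carrier_mat n n" "Q \<in> carrier_mat n n" "T \<in> carrier_mat n n"
    "P * Q = 1\<^sub>m n" "Q * P = 1\<^sub>m n" "A * P = P * T" "Q * A = T * Q" "upper_triangular T"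
    "\<And>i. i < n \<Longrightarrow> T $$ (i, i) \<in> spectrum A"
proof -
  obtain es where es: "char_poly A = (\<Prod>a\<leftarrow>es. [:- a, 1:])" using char_poly_factorized[OF A] by blast
  show thesis by (rule schur_ordered[OF A es]) (use that in metis)
qed

text \<open>With a triangular form \<open>T\<close> of \<open>F\<close>, the matrix
  \<open>M = D * P\<close> satisfies \<open>E * M = M * T\<close>. Its first nonzero column is an
  eigenvector of \<open>E\<close>: the columns to its left vanish, so only the diagonal entry of
  \<open>T\<close> contributes.\<close>

lemma intertwining_eigenvector:
  fixes D E F :: "complex mat"
  assumes F: "F \<in> carrier_mat n n" and E: "E \<in> carrier_mat k k" and D: "D \<in> carrier_mat k n"
    and DF: "D * F = E * D" and nz: "D \<noteq> 0\<^sub>m k n"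
  obtains z \<mu> where "z \<in> carrier_mat n 1" "\<mu> \<in> spectrum F" "D * z \<noteq> 0\<^sub>m k 1"
    "E * (D * z) = \<mu> \<cdot>\<^sub>m (D * z)"
proof -
  obtain P Q T where P: "P \<in> carrier_mat n n" and Q: "Q \<in> carrier_mat n n" and T: "T \<in> carrier_mat n n"
    and PQ: "P * Q = 1\<^sub>m n" and FP: "F * P = P * T" and ut: "upper_triangular T"
    and sp: "\<And>i. i < n \<Longrightarrow> T $$ (i, i) \<in> spectrum F"
    by (rule schur_exists[OF F]) metis
  note [simp] = carrier_matD[OF P] carrier_matD[OF Q] carrier_matD[OF T] carrier_matD[OF F]
    carrier_matD[OF E] carrier_matD[OF D]
  define M where "M = D * P"
  have M [simp]: "dim_row M = k" "dim_col M = n" by (auto simp: M_def)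
  have "E * M = D * F * P" unfolding M_def DF by (simp add: mat_simps)
  also have "\<dots> = M * T" by (simp add: M_def mat_simps FP)
  finally have EM: "E * M = M * T" .
  have "M * Q = D" by (simp add: M_def mat_simps PQ)
  then have "M \<noteq> 0\<^sub>m k n" using nz by (auto simp: mat_simps)
  then have ex: "\<exists>c. c < n \<and> (\<exists>i<k. M $$ (i, c) \<noteq> 0)" by (auto simp: mat_eq_iff)
  define c where "c = (LEAST c. c < n \<and> (\<exists>i<k. M $$ (i, c) \<noteq> 0))"
  have c: "c < n" "\<exists>i<k. M $$ (i, c) \<noteq> 0" using LeastI_ex[OF ex] unfolding c_def by auto
  have c0: "M $$ (i, l) = 0" if "l < c" "i < k" for i l
  proof -
    have "\<not> (l < n \<and> (\<exists>i<k. M $$ (i, l) \<noteq> 0))"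
      using not_less_Least[of l "\<lambda>c. c < n \<and> (\<exists>i<k. M $$ (i, c) \<noteq> 0)"] that(1) unfolding c_def by blast
    then show ?thesis using that c by auto
  qed
  let ?z = "Matrix.mat n 1 (\<lambda>(i, j). P $$ (i, c))"
  have z: "(D * ?z) $$ (i, 0) = M $$ (i, c)" if "i < k" for i
    using that c by (simp add: M_def index_mult_sum)
  have "E * (D * ?z) = T $$ (c, c) \<cdot>\<^sub>m (D * ?z)"
  proof (rule eq_matI)
    fix i j assume "i < dim_row (T $$ (c, c) \<cdot>\<^sub>m (D * ?z))" "j < dim_col (T $$ (c, c) \<cdot>\<^sub>m (D * ?z))"
    then have ij: "i < k" "j = 0" by auto
    have "(E * (D * ?z)) $$ (i, 0) = (\<Sum>l<k. E $$ (i, l) * M $$ (l, c))"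
      using ij z by (simp add: index_mult_sum[of _ _ _ "D * _"])
    also have "\<dots> = (E * M) $$ (i, c)" using ij c by (simp add: index_mult_sum)
    also have "\<dots> = (\<Sum>l<n. M $$ (i, l) * T $$ (l, c))" unfolding EM using ij c by (simp add: index_mult_sum)
    also have "\<dots> = (\<Sum>l<n. if l = c then M $$ (i, c) * T $$ (c, c) else 0)"
    proof (rule sum.cong[OF refl])
      fix l assume "l \<in> {..<n}"
      then show "M $$ (i, l) * T $$ (l, c) = (if l = c then M $$ (i, c) * T $$ (c, c) else 0)"
        using c0[of l i] ij upper_triangularD[OF ut, of c l] by (cases "l < c"; cases "l = c") auto
    qed
    also have "\<dots> = T $$ (c, c) * M $$ (i, c)" using c by simp
    finally show "(E * (D * ?z)) $$ (i, j) = (T $$ (c, c) \<cdot>\<^sub>m (D * ?z)) $$ (i, j)"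
      using ij z by simp
  qed auto
  moreover have "D * ?z \<noteq> 0\<^sub>m k 1"
  proof
    assume "D * ?z = 0\<^sub>m k 1"
    then have "\<forall>i<k. M $$ (i, c) = 0" using z by (metis index_zero_mat(1) less_numeral_extra(1))
    then show False using c by auto
  qed
  ultimately show thesis using that[of ?z "T $$ (c, c)"] sp c by auto
qed

text \<open>A nonzero solution would carry an eigenvalue of \<open>F\<close> over to
  \<open>E\<close>.\<close>

lemma sylvester_zero:
  fixes D E F :: "complex mat"
  assumes "F \<in> carrier_mat n n" "E \<in> carrier_mat k k" "D \<in> carrier_mat k n"
    and "D * F = E * D" and "spectrum E \<inter> spectrum F = {}"
  shows "D = 0\<^sub>m k n"
proof (rule ccontr)
  assume "D \<noteq> 0\<^sub>m k n"
  from intertwining_eigenvector[OF assms(1-4) this] obtain z \<mu>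
    where "z \<in> carrier_mat n 1" "\<mu> \<in> spectrum F" "D * z \<noteq> 0\<^sub>m k 1" "E * (D * z) = \<mu> \<cdot>\<^sub>m (D * z)" .
  moreover then have "D * z \<in> carrier_mat k 1" using assms(3) by auto
  ultimately have "\<mu> \<in> spectrum E" using spectrum_iff[OF assms(2)] by blast
  then show False using \<open>\<mu> \<in> spectrum F\<close> assms(5) by auto
qed

definition subspace_mat :: "nat \<Rightarrow> complex mat set \<Rightarrow> bool" where
  "subspace_mat n K \<longleftrightarrow> K \<subseteq> carrier_mat n 1 \<and> 0\<^sub>m n 1 \<in> K \<and>
    (\<forall>x\<in>K. \<forall>y\<in>K. x + y \<in> K) \<and> (\<forall>x\<in>K. \<forall>c. c \<cdot>\<^sub>m x \<in> K)"

lemma subspace_matI: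
  assumes "K \<subseteq> carrier_mat n 1" "0\<^sub>m n 1 \<in> K" "\<And>x y. x \<in> K \<Longrightarrow> y \<in> K \<Longrightarrow> x + y \<in> K"
    "\<And>x c. x \<in> K \<Longrightarrow> c \<cdot>\<^sub>m x \<in> K"
  shows "subspace_mat n K"
  using assms unfolding subspace_mat_def by blast

text \<open>Induction on the number \<open>m\<close> of leading Schur coordinates that may be
  nonzero: applying \<open>A - T $$ (m, m)\<close> to a vector of \<open>K\<close> either gives 0,
  so that the vector is an eigenvector, or gives a nonzero vector of \<open>K\<close> with one
  coordinate fewer.\<close>

lemma invariant_subspace_eigenvector:
  fixes A :: "complex mat"
  assumes A: "A \<in> carrier_mat n n" and K: "subspace_mat n K"
    and inv: "\<And>x. x \<in> K \<Longrightarrow> A * x \<in> K" and x: "x \<in> K" "x \<noteq> 0\<^sub>m n 1"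
  obtains w \<mu> where "w \<in> K" "w \<noteq> 0\<^sub>m n 1" "A * w = \<mu> \<cdot>\<^sub>m w"
proof -
  obtain P Q T where P: "P \<in> carrier_mat n n" and Q: "Q \<in> carrier_mat n n" and T: "T \<in> carrier_mat n n"
    and PQ: "P * Q = 1\<^sub>m n" and QA: "Q * A = T * Q" and ut: "upper_triangular T"
    by (rule schur_exists[OF A]) metis
  note [simp] = carrier_matD[OF P] carrier_matD[OF Q] carrier_matD[OF T] carrier_matD[OF A]
  have Kc: "w \<in> carrier_mat n 1" if "w \<in> K" for w using K that unfolding subspace_mat_def by auto
  have "\<exists>w\<in>K. w \<noteq> 0\<^sub>m n 1 \<and> (\<exists>\<mu>. A * w = \<mu> \<cdot>\<^sub>m w)"
    if "m \<le> n" "w \<in> K" "w \<noteq> 0\<^sub>m n 1" "\<And>i. m \<le> i \<Longrightarrow> i < n \<Longrightarrow> (Q * w) $$ (i, 0) = 0" for m w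
    using that
  proof (induction m arbitrary: w)
    case 0
    note w [simp] = carrier_matD[OF Kc[OF 0(2)]]
    have "Q * w = 0\<^sub>m n 1" by (rule eq_matI) (use 0 in auto)
    then have "P * (Q * w) = 0\<^sub>m n 1" by (simp add: mat_simps)
    moreover have "P * (Q * w) = (P * Q) * w" by (simp add: mat_simps)
    then have "P * (Q * w) = w" by (simp add: PQ mat_simps)
    ultimately show ?case using 0 by simp
  next
    case (Suc m)
    note w [simp] = carrier_matD[OF Kc[OF Suc.prems(2)]]
    let ?v = "Q * w"
    define u where "u = A * w + (- T $$ (m, m)) \<cdot>\<^sub>m w"
    have uK: "u \<in> K" using Suc.prems(2) inv K unfolding u_def subspace_mat_def by auto
    show ?case
    proof (cases "u = 0\<^sub>m n 1")
      case True
      have "A * w = T $$ (m, m) \<cdot>\<^sub>m w"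
      proof (rule eq_matI)
        fix i j assume "i < dim_row (T $$ (m, m) \<cdot>\<^sub>m w)" "j < dim_col (T $$ (m, m) \<cdot>\<^sub>m w)"
        then show "(A * w) $$ (i, j) = (T $$ (m, m) \<cdot>\<^sub>m w) $$ (i, j)"
          using arg_cong[OF True, of "\<lambda>M. M $$ (i, j)"] by (simp add: u_def)
      qed auto
      then show ?thesis using Suc.prems by blast
    next
      case False
      have "Q * u = Q * A * w + (- T $$ (m, m)) \<cdot>\<^sub>m ?v" by (simp add: u_def mat_simps)
      then have Qu: "Q * u = T * ?v + (- T $$ (m, m)) \<cdot>\<^sub>m ?v" by (simp add: QA mat_simps)
      have "(Q * u) $$ (i, 0) = 0" if i: "m \<le> i" "i < n" for i
      proof -
        have "(T * ?v) $$ (i, 0) = (\<Sum>l<n. T $$ (i, l) * ?v $$ (l, 0))"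
          using i by (simp add: index_mult_sum[of _ T])
        also have "\<dots> = (\<Sum>l<n. if l = m then (if i = m then T $$ (m, m) * ?v $$ (m, 0) else 0) else 0)"
        proof (rule sum.cong[OF refl])
          fix l assume "l \<in> {..<n}"
          then show "T $$ (i, l) * ?v $$ (l, 0) =
              (if l = m then (if i = m then T $$ (m, m) * ?v $$ (m, 0) else 0) else 0)"
            using i Suc.prems(4)[of l] upper_triangularD[OF ut, of l i]
            by (cases "l < m"; cases "l = m") auto
        qed
        also have "\<dots> = (if i = m then T $$ (m, m) * ?v $$ (m, 0) else 0)"
          using i by simp
        finally show ?thesis using i Suc.prems(4)[of i] by (cases "i = m") (auto simp: Qu)
      qed
      then show ?thesis using Suc.IH[OF _ uK False] Suc.prems(1) by auto
    qed
  qed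
  from this[OF _ x, of n] show thesis using that by auto
qed

text \<open>Cayley--Hamilton in the form that is needed: the product of the factors \<open>F - e\<^sub>i\<close> over all
  eigenvalues annihilates everything, since each factor shortens the Schur flag by one.\<close>

lemma krylov_step:
  fixes F C :: "complex mat"
  assumes F: "F \<in> carrier_mat n n" and C: "C \<in> carrier_mat p n" and w: "w \<in> carrier_mat n 1"
    and 0: "\<And>l. l < n \<Longrightarrow> C * (F ^\<^sub>m l * w) = 0\<^sub>m p 1"
  shows "C * (F ^\<^sub>m n * w) = 0\<^sub>m p 1"
proof -
  obtain P Q T where P: "P \<in> carrier_mat n n" and Q: "Q \<in> carrier_mat n n" and T: "T \<in> carrier_mat n n"
    and PQ: "P * Q = 1\<^sub>m n" and QF: "Q * F = T * Q" and ut: "upper_triangular T"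
    by (rule schur_exists[OF F]) metis
  note [simp] = carrier_matD[OF P] carrier_matD[OF Q] carrier_matD[OF T] carrier_matD[OF F]
    carrier_matD[OF C] carrier_matD[OF w]
  define N where "N = rec_nat (1\<^sub>m n) (\<lambda>k M. M * (F - T $$ (k, k) \<cdot>\<^sub>m 1\<^sub>m n))"
  have N0: "N 0 = 1\<^sub>m n" and NS: "N (Suc k) = N k * (F - T $$ (k, k) \<cdot>\<^sub>m 1\<^sub>m n)" for k
    by (auto simp: N_def)
  have Nd [simp]: "dim_row (N k) = n" "dim_col (N k) = n" for k
    by (induction k) (auto simp: N0 NS)
  have pd [simp]: "dim_row (F ^\<^sub>m l) = n" "dim_col (F ^\<^sub>m l) = n" for l
    using pow_carrier_mat[OF F, of l] by auto
  have FF: "F * (F ^\<^sub>m l * y) = F ^\<^sub>m (Suc l) * y" if "y \<in> carrier_mat n 1" for l y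
    using that by (subst pow_mat_Suc_left) (auto simp: mult_assoc_dim)
  have kill: "N k * y = 0\<^sub>m n 1"
    if "k \<le> n" "y \<in> carrier_mat n 1" "\<And>i. k \<le> i \<Longrightarrow> i < n \<Longrightarrow> (Q * y) $$ (i, 0) = 0" for k y
    using that
  proof (induction k arbitrary: y)
    case 0
    note [simp] = carrier_matD[OF 0(2)]
    have "Q * y = 0\<^sub>m n 1" by (rule eq_matI) (use 0 in auto)
    then have "P * (Q * y) = 0\<^sub>m n 1" by (simp add: mat_simps)
    moreover have "P * (Q * y) = (P * Q) * y" by (simp add: mat_simps)
    then have "P * (Q * y) = y" by (simp add: PQ mat_simps)
    ultimately show ?case by (simp add: N0 mat_simps)
  next
    case (Suc k)
    note [simp] = carrier_matD[OF Suc.prems(2)]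
    let ?u = "(F - T $$ (k, k) \<cdot>\<^sub>m 1\<^sub>m n) * y" and ?v = "Q * y"
    have "Q * ?u = Q * F * y - T $$ (k, k) \<cdot>\<^sub>m ?v" by (simp add: mat_simps)
    then have Qu: "Q * ?u = T * ?v - T $$ (k, k) \<cdot>\<^sub>m ?v" by (simp add: QF mat_simps)
    have "(Q * ?u) $$ (i, 0) = 0" if i: "k \<le> i" "i < n" for i
    proof -
      have "(T * ?v) $$ (i, 0) = (\<Sum>l<n. T $$ (i, l) * ?v $$ (l, 0))"
        using i by (simp add: index_mult_sum[of _ T])
      also have "\<dots> = (\<Sum>l<n. if l = k then (if i = k then T $$ (k, k) * ?v $$ (k, 0) else 0) else 0)"
      proof (rule sum.cong[OF refl])
        fix l assume "l \<in> {..<n}"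
        then show "T $$ (i, l) * ?v $$ (l, 0) =
            (if l = k then (if i = k then T $$ (k, k) * ?v $$ (k, 0) else 0) else 0)"
          using i Suc.prems(3)[of l] upper_triangularD[OF ut, of l i]
          by (cases "l < k"; cases "l = k") auto
      qed
      also have "\<dots> = (if i = k then T $$ (k, k) * ?v $$ (k, 0) else 0)"
        using i by simp
      finally show ?thesis using i Suc.prems(3)[of i] unfolding Qu by (cases "i = k") auto
    qed
    moreover have "?u \<in> carrier_mat n 1" by (simp add: carrier_iff)
    ultimately have "N k * ?u = 0\<^sub>m n 1" using Suc.IH Suc.prems(1) by auto
    then show ?case unfolding NS by (simp add: mult_assoc_dim)
  qed
  \<comment> \<open>On the Krylov sequence each factor \<open>F - T $$ (k, k)\<close> contributes
    its leading term only: the subtracted multiples involve powers below \<open>n\<close>, which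
    \<open>C\<close> annihilates by assumption.\<close>
  have "C * (N k * (F ^\<^sub>m j * w)) = C * (F ^\<^sub>m (k + j) * w)" if "k + j \<le> n" for k j
    using that
  proof (induction k arbitrary: j)
    case 0 then show ?case by (simp add: N0 mat_simps)
  next
    case (Suc k)
    have "N (Suc k) * (F ^\<^sub>m j * w) = N k * (F * (F ^\<^sub>m j * w)) - T $$ (k, k) \<cdot>\<^sub>m (N k * (F ^\<^sub>m j * w))"
      unfolding NS by (simp add: mat_simps)
    also have "\<dots> = N k * (F ^\<^sub>m (Suc j) * w) - T $$ (k, k) \<cdot>\<^sub>m (N k * (F ^\<^sub>m j * w))"
      by (subst FF[OF w]) (rule refl)
    finally have "C * (N (Suc k) * (F ^\<^sub>m j * w)) =
        C * (N k * (F ^\<^sub>m (Suc j) * w)) - T $$ (k, k) \<cdot>\<^sub>m (C * (N k * (F ^\<^sub>m j * w)))"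
      by (simp add: mult_minus_dim mult_smult_dim)
    also have "\<dots> = C * (F ^\<^sub>m (Suc k + j) * w)"
    proof -
      have "C * (N k * (F ^\<^sub>m (Suc j) * w)) = C * (F ^\<^sub>m (Suc k + j) * w)"
        using Suc.IH[of "Suc j"] Suc.prems by simp
      moreover have "C * (N k * (F ^\<^sub>m j * w)) = 0\<^sub>m p 1"
        using Suc.IH[of j] 0[of "k + j"] Suc.prems by simp
      ultimately show ?thesis by (intro eq_matI) auto
    qed
    finally show ?case .
  qed
  from this[of n 0] have "C * (F ^\<^sub>m n * w) = C * (N n * w)" by (simp add: one_mult_dim)
  also have "N n * w = 0\<^sub>m n 1" by (rule kill) (use w in auto)
  finally show ?thesis by (simp add: mat_simps)
qed

section \<open>Controllability\<close>

text \<open>The Popov--Belevitch--Hautus form of controllability; observability of \<open>(C, A)\<close> is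
  \<open>pbh n (adj A) (adj C)\<close>.\<close>

definition pbh :: "nat \<Rightarrow> complex mat \<Rightarrow> complex mat \<Rightarrow> bool" where
  "pbh n A B \<longleftrightarrow> (\<forall>w\<in>carrier_mat n 1. \<forall>\<mu>.
     adj A * w = \<mu> \<cdot>\<^sub>m w \<and> adj B * w = 0\<^sub>m (dim_col B) 1 \<longrightarrow> w = 0\<^sub>m n 1)"

lemma pbhD:
  "pbh n A B \<Longrightarrow> w \<in> carrier_mat n 1 \<Longrightarrow> adj A * w = \<mu> \<cdot>\<^sub>m w \<Longrightarrow> B \<in> carrier_mat n m \<Longrightarrow>
    adj B * w = 0\<^sub>m m 1 \<Longrightarrow> w = 0\<^sub>m n 1"
  unfolding pbh_def by auto

lemma obsD:
  "pbh n (adj A) (adj C) \<Longrightarrow> w \<in> carrier_mat n 1 \<Longrightarrow> A * w = \<mu> \<cdot>\<^sub>m w \<Longrightarrow> C \<in> carrier_mat m n \<Longrightarrow>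
    C * w = 0\<^sub>m m 1 \<Longrightarrow> w = 0\<^sub>m n 1"
  unfolding pbh_def by (auto simp: adj_adj)

text \<open>The vectors that \<open>C\<close> does not see under the first \<open>n\<close> powers
  form a space that is invariant by \<open>krylov_step\<close>; if nonzero, it would contain an
  eigenvector of \<open>F\<close> in the kernel of \<open>C\<close>.\<close>

lemma krylov_vanish:
  fixes F C :: "complex mat"
  assumes F: "F \<in> carrier_mat n n" and C: "C \<in> carrier_mat m n"
    and pbh: "\<And>w \<mu>. w \<in> carrier_mat n 1 \<Longrightarrow> F * w = \<mu> \<cdot>\<^sub>m w \<Longrightarrow> C * w = 0\<^sub>m m 1 \<Longrightarrow> w = 0\<^sub>m n 1"
    and w: "w \<in> carrier_mat n 1" and 0: "\<And>l. l < n \<Longrightarrow> C * (F ^\<^sub>m l * w) = 0\<^sub>m m 1"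
  shows "w = 0\<^sub>m n 1"
proof (rule ccontr)
  assume nz: "w \<noteq> 0\<^sub>m n 1"
  note [simp] = carrier_matD[OF F] carrier_matD[OF C]
  define K where "K = {x \<in> carrier_mat n 1. \<forall>l<n. C * (F ^\<^sub>m l * x) = 0\<^sub>m m 1}"
  have n: "0 < n" using nz w by (cases n) (auto simp: mat_eq_iff)
  have "subspace_mat n K"
    by (rule subspace_matI) (auto simp: K_def mat_simps carrier_iff intro!: eq_matI)
  moreover have "F * x \<in> K" if x: "x \<in> K" for x
  proof -
    have xc: "x \<in> carrier_mat n 1" using x by (auto simp: K_def)
    note [simp] = carrier_matD[OF xc]
    have *: "C * (F ^\<^sub>m l * x) = 0\<^sub>m m 1" if "l \<le> n" for l
      using that krylov_step[OF F C xc] x by (cases "l = n") (auto simp: K_def)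
    have "C * (F ^\<^sub>m l * (F * x)) = 0\<^sub>m m 1" if "l < n" for l
      using *[of "Suc l"] that by (simp add: mult_assoc_dim)
    then show ?thesis by (simp add: K_def carrier_iff)
  qed
  moreover have "w \<in> K" using w 0 by (auto simp: K_def)
  ultimately obtain y \<mu> where y: "y \<in> K" "y \<noteq> 0\<^sub>m n 1" "F * y = \<mu> \<cdot>\<^sub>m y"
    using nz by (rule invariant_subspace_eigenvector[OF F])
  then have yc: "y \<in> carrier_mat n 1" and "C * (F ^\<^sub>m 0 * y) = 0\<^sub>m m 1" using n by (auto simp: K_def)
  then have "C * y = 0\<^sub>m m 1" using carrier_matD[OF yc] by (simp add: one_mult_dim)
  then show False using pbh[OF yc y(3)] y(2) by simp
qed

lemma pbh_krylov_mat:
  assumes A: "A \<in> carrier_mat n n" and B: "B \<in> carrier_mat n m" and AB: "pbh n A B"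
    and M: "M \<in> carrier_mat n p" and 0: "\<And>l. l < n \<Longrightarrow> adj B * (adj A ^\<^sub>m l * M) = 0\<^sub>m m p"
  shows "M = 0\<^sub>m n p"
proof (rule eq_matI)
  note [simp] = carrier_matD[OF A] carrier_matD[OF B] carrier_matD[OF M]
  fix i j assume "i < dim_row (0\<^sub>m n p :: complex mat)" "j < dim_col (0\<^sub>m n p :: complex mat)"
  then have ij: "i < n" "j < p" by auto
  \<comment> \<open>Right multiplication by \<open>E\<close> picks column \<open>j\<close>, which
    reduces the claim to a single column.\<close>
  define E :: "complex mat" where "E = Matrix.mat p 1 (\<lambda>(a, b). if a = j then 1 else 0)"
  have E [simp]: "dim_row E = p" "dim_col E = 1" by (auto simp: E_def)
  have "M * E = 0\<^sub>m n 1"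
  proof (rule krylov_vanish[of "adj A" n "adj B" m])
    show "M * E \<in> carrier_mat n 1" by (auto simp: carrier_iff)
    show "adj B * (adj A ^\<^sub>m l * (M * E)) = 0\<^sub>m m 1" if "l < n" for l
    proof -
      have "adj B * (adj A ^\<^sub>m l * (M * E)) = (adj B * (adj A ^\<^sub>m l * M)) * E" by (simp add: mult_assoc_dim)
      then show ?thesis using 0[OF that] by (simp add: mat_simps)
    qed
  qed (use AB A B pbhD[OF AB _ _ B] in \<open>auto\<close>)
  then have "(M * E) $$ (i, 0) = 0" using ij by auto
  then show "M $$ (i, j) = 0\<^sub>m n p $$ (i, j)"
    using ij by (simp add: index_mult_sum E_def if_distrib cong: if_cong)
qed (use carrier_matD[OF M] in auto)

lemma obs_krylov_mat:
  assumes A: "A \<in> carrier_mat n n" and C: "C \<in> carrier_mat m n" and AC: "pbh n (adj A) (adj C)"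
    and M: "M \<in> carrier_mat n p" and 0: "\<And>l. l < n \<Longrightarrow> C * (A ^\<^sub>m l * M) = 0\<^sub>m m p"
  shows "M = 0\<^sub>m n p"
  by (rule pbh_krylov_mat[of "adj A" n "adj C" m]) (use assms in \<open>auto simp: adj_adj\<close>)

text \<open>For equal pairs this is the discrete controllability Gramian, the sum of
  \<open>A^l B (A^l B)^*\<close> over \<open>l < k\<close>. The version with two pairs yields the
  state space isomorphism.\<close>

primrec cross_gram ::
  "complex mat \<Rightarrow> complex mat \<Rightarrow> complex mat \<Rightarrow> complex mat \<Rightarrow> nat \<Rightarrow> complex mat" where
  "cross_gram A' B' A B 0 = 0\<^sub>m (dim_row A') (dim_row A)"
| "cross_gram A' B' A B (Suc k) = cross_gram A' B' A B k + A' ^\<^sub>m k * B' * adj (A ^\<^sub>m k * B)"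

abbreviation gram :: "complex mat \<Rightarrow> complex mat \<Rightarrow> nat \<Rightarrow> complex mat" where
  "gram A B \<equiv> cross_gram A B A B"

lemma dim_cross_gram [simp]:
  assumes "A' \<in> carrier_mat n' n'" "A \<in> carrier_mat n n" "B \<in> carrier_mat n m" "B' \<in> carrier_mat n' m"
  shows "dim_row (cross_gram A' B' A B k) = n'" "dim_col (cross_gram A' B' A B k) = n"
  using assms by (induction k) auto

lemma gram_quadratic:
  assumes A: "A \<in> carrier_mat n n" and B: "B \<in> carrier_mat n m" and w: "w \<in> carrier_mat n 1"
  shows "(adj w * (gram A B k * w)) $$ (0, 0) = of_real (\<Sum>l<k. nrm2 (adj (A ^\<^sub>m l * B) * w))"
proof (induction k)
  case 0
  note [simp] = carrier_matD[OF A] carrier_matD[OF B] carrier_matD[OF w]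
  show ?case by (simp add: mat_simps)
next
  case (Suc k)
  note [simp] = carrier_matD[OF A] carrier_matD[OF B] carrier_matD[OF w] dim_cross_gram[OF A A B B]
  define N where "N = A ^\<^sub>m k * B"
  have N [simp]: "dim_row N = n" "dim_col N = m" by (auto simp: N_def)
  have "adj w * ((gram A B k + N * adj N) * w) = adj w * (gram A B k * w) + adj (adj N * w) * (adj N * w)"
    by (simp add: mat_simps)
  then show ?case using Suc by (simp add: N_def[symmetric] adj_self_nrm2)
qed

text \<open>The quadratic form of the Gramian is a sum of squared norms, so a kernel vector is
  annihilated by every \<open>adj B * adj A ^ l\<close> with \<open>l < n\<close>, and the Hautus
  condition makes it 0.\<close>

lemma gram_det:
  assumes A: "A \<in> carrier_mat n n" and B: "B \<in> carrier_mat n m" and AB: "pbh n A B"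
  shows "Determinant.det (gram A B n) \<noteq> 0"
proof -
  note [simp] = carrier_matD[OF A] carrier_matD[OF B] dim_cross_gram[OF A A B B]
  have G: "gram A B n \<in> carrier_mat n n" by (simp add: carrier_iff)
  show ?thesis unfolding det_nonzero_iff[OF G]
  proof (intro ballI impI)
    fix w assume w: "w \<in> carrier_mat n (1::nat)" and 0: "gram A B n * w = 0\<^sub>m n 1"
    note [simp] = carrier_matD[OF w]
    have "(\<Sum>l<n. nrm2 (adj (A ^\<^sub>m l * B) * w)) = 0"
      using gram_quadratic[OF A B w, of n] unfolding 0 by (simp add: mat_simps del: of_real_sum)
    then have z: "nrm2 (adj (A ^\<^sub>m l * B) * w) = 0" if "l < n" for l
      using that by (subst (asm) sum_nonneg_eq_0_iff) auto
    have "adj B * (adj A ^\<^sub>m l * w) = 0\<^sub>m m 1" if "l < n" for l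
    proof -
      have "adj (A ^\<^sub>m l * B) * w = adj B * (adj A ^\<^sub>m l * w)"
        by (simp add: adj_mult adj_pow mult_assoc_dim)
      moreover have "adj B * (adj A ^\<^sub>m l * w) \<in> carrier_mat m 1" by (simp add: carrier_iff)
      ultimately show ?thesis using z[OF that] nrm2_zero_iff by metis
    qed
    then show "w = 0\<^sub>m n 1" using pbh_krylov_mat[OF A B AB w] by auto
  qed
qed

text \<open>Writing \<open>x\<close> as the Gramian times \<open>y\<close> exhibits it as a sum of
  vectors \<open>A^l B u\<close> with \<open>u = adj (A^l B) y\<close>.\<close>

lemma reachable_krylov:
  assumes A: "A \<in> carrier_mat n n" and B: "B \<in> carrier_mat n m" and AB: "pbh n A B"
    and V: "subspace_mat n V"
    and AlB: "\<And>l u. l < n \<Longrightarrow> u \<in> carrier_mat m 1 \<Longrightarrow> A ^\<^sub>m l * B * u \<in> V"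
    and x: "x \<in> carrier_mat n 1"
  shows "x \<in> V"
proof -
  note [simp] = carrier_matD[OF A] carrier_matD[OF B] carrier_matD[OF x] dim_cross_gram[OF A A B B]
  have G: "gram A B n \<in> carrier_mat n n" by (simp add: carrier_iff)
  note I = mat_inv_props[OF G gram_det[OF A B AB]] note [simp] = carrier_matD[OF I(1)]
  define y where "y = mat_inv (gram A B n) * x"
  have y [simp]: "dim_row y = n" "dim_col y = 1" by (auto simp: y_def)
  have "gram A B k * y \<in> V" if "k \<le> n" for k
    using that
  proof (induction k)
    case 0
    then show ?case using V by (simp add: subspace_mat_def mat_simps)
  next
    case (Suc k)
    define N where "N = A ^\<^sub>m k * B"
    have N [simp]: "dim_row N = n" "dim_col N = m" by (auto simp: N_def)
    have "gram A B (Suc k) * y = gram A B k * y + A ^\<^sub>m k * B * (adj N * y)"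
      by (simp add: N_def[symmetric] mat_simps)
    moreover have "A ^\<^sub>m k * B * (adj N * y) \<in> V"
      using Suc.prems by (intro AlB) (auto simp: carrier_iff)
    ultimately show ?case using Suc V by (simp add: subspace_mat_def)
  qed
  from this[of n] have "gram A B n * (mat_inv (gram A B n) * x) \<in> V" by (simp add: y_def)
  moreover have "gram A B n * (mat_inv (gram A B n) * x) = x"
    by (simp add: mult_assoc_dim[symmetric] I(2) one_mult_dim)
  ultimately show ?thesis by simp
qed

lemma reachable:
  assumes A: "A \<in> carrier_mat n n" and B: "B \<in> carrier_mat n m" and AB: "pbh n A B"
    and V: "subspace_mat n V"
    and BV: "\<And>u. u \<in> carrier_mat m 1 \<Longrightarrow> B * u \<in> V" and AV: "\<And>x. x \<in> V \<Longrightarrow> A * x \<in> V"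
    and x: "x \<in> carrier_mat n 1"
  shows "x \<in> V"
proof (rule reachable_krylov[OF A B AB V _ x])
  note [simp] = carrier_matD[OF A] carrier_matD[OF B]
  fix l and u :: "complex mat" assume u: "u \<in> carrier_mat m 1"
  note [simp] = carrier_matD[OF u]
  show "A ^\<^sub>m l * B * u \<in> V"
  proof (induction l)
    case 0 show ?case using BV[OF u] by (simp add: one_mult_dim)
  next
    case (Suc l)
    then show ?case using AV[OF Suc] by (subst pow_mat_Suc_left) (auto simp: mult_assoc_dim)
  qed
qed

lemma pbh_imp_controllable:
  assumes A: "A \<in> carrier_mat n n" and B: "B \<in> carrier_mat n m" and AB: "pbh n A B"
  shows "controllable n A B"
proof -
  interpret V: vec_space "TYPE(complex)" n .
  note [simp] = carrier_matD[OF A] carrier_matD[OF B]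
  let ?S = "\<Union>l\<in>{..<n}. mat_image (A ^\<^sub>m l * B)"
  have S: "?S \<subseteq> carrier_vec n" by (auto simp: mat_image_def intro!: mult_mat_vec_carrier[of _ n m] carrier_matI)
  define K where "K = {x \<in> carrier_mat n 1. col x 0 \<in> V.span ?S}"
  have K: "subspace_mat n K"
  proof (rule subspace_matI)
    show "0\<^sub>m n 1 \<in> K" using V.span_zero[of ?S] by (simp add: K_def)
    show "x + y \<in> K" if "x \<in> K" "y \<in> K" for x y
    proof -
      have "col (x + y) 0 = col x 0 + col y 0" using that by (intro eq_vecI) (auto simp: K_def)
      then show ?thesis using that V.span_add1[of ?S "col x 0" "col y 0"] S by (auto simp: K_def)
    qed
    show "c \<cdot>\<^sub>m x \<in> K" if "x \<in> K" for x c
    proof -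
      have "col (c \<cdot>\<^sub>m x) 0 = c \<cdot>\<^sub>v col x 0" using that by (intro eq_vecI) (auto simp: K_def)
      then show ?thesis using that V.smult_in_span[OF S, of "col x 0" c] by (auto simp: K_def)
    qed
  qed (auto simp: K_def)
  have "A ^\<^sub>m l * B * u \<in> K" if "l < n" and u: "u \<in> carrier_mat m 1" for l u
  proof -
    note [simp] = carrier_matD[OF u]
    have c: "A ^\<^sub>m l * B \<in> carrier_mat n m" by (simp add: carrier_iff)
    have "col (A ^\<^sub>m l * B * u) 0 = (A ^\<^sub>m l * B) *\<^sub>v col u 0" using mult_vec_col[OF c u] by simp
    moreover have "(A ^\<^sub>m l * B) *\<^sub>v col u 0 \<in> mat_image (A ^\<^sub>m l * B)"
      unfolding mat_image_def using carrier_vecI[of "col u 0" m] by fastforce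
    ultimately have "col (A ^\<^sub>m l * B * u) 0 \<in> ?S" using that by auto
    then show ?thesis using V.in_own_span[of ?S] S by (auto simp: K_def carrier_iff)
  qed
  note r = reachable_krylov[OF A B AB K this]
  have "V.span ?S = carrier_vec n"
  proof
    show "V.span ?S \<subseteq> carrier_vec n" using V.span_is_subset2[of ?S] S by auto
    show "carrier_vec n \<subseteq> V.span ?S"
    proof
      fix v :: "complex Matrix.vec" assume v: "v \<in> carrier_vec n"
      have "Matrix.mat n 1 (\<lambda>(i, j). vec_index v i) \<in> K" by (rule r) auto
      moreover have "col (Matrix.mat n 1 (\<lambda>(i, j). vec_index v i)) 0 = v" using v by (intro eq_vecI) auto
      ultimately show "v \<in> V.span ?S" by (simp add: K_def)
    qed
  qed
  then show ?thesis by (simp add: controllable_def)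
qed

text \<open>An eigenvector \<open>w\<close> of \<open>adj A\<close> in the kernel of
  \<open>adj B\<close> is orthogonal to all \<open>A^l B u\<close>; if these span the whole space,
  \<open>w\<close> is orthogonal to itself.\<close>

lemma controllable_imp_pbh:
  assumes A: "A \<in> carrier_mat n n" and B: "B \<in> carrier_mat n m" and AB: "controllable n A B"
  shows "pbh n A B"
  unfolding pbh_def
proof (intro ballI allI impI; elim conjE)
  fix w \<mu> assume w: "w \<in> carrier_mat n 1" and Aw: "adj A * w = \<mu> \<cdot>\<^sub>m w"
    and Bw: "adj B * w = 0\<^sub>m (dim_col B) 1"
  interpret V: vec_space "TYPE(complex)" n .
  note [simp] = carrier_matD[OF A] carrier_matD[OF B] carrier_matD[OF w]
  let ?S = "\<Union>l\<in>{..<n}. mat_image (A ^\<^sub>m l * B)"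
  define N where "N = {x \<in> carrier_vec n. x \<bullet>c col w 0 = 0}"
  have wc: "conjugate (col w 0) \<in> carrier_vec n" by (intro carrier_vec_conjugate carrier_vecI) simp
  have "submodule class_ring N (module_vec TYPE(complex) n)"
    by (rule submodule.intro)
       (use wc V.module_axioms in \<open>auto simp: N_def add_scalar_prod_distrib[of _ n] smult_scalar_prod_distrib[of _ n]
          intro: V.module_axioms\<close>)
  moreover have "?S \<subseteq> N"
  proof
    fix v assume "v \<in> ?S"
    then obtain l u where u: "u \<in> carrier_vec m" and v: "v = (A ^\<^sub>m l * B) *\<^sub>v u"
      by (auto simp: mat_image_def)
    let ?u = "Matrix.mat m 1 (\<lambda>(i, j). vec_index u i)"
    have c: "A ^\<^sub>m l * B \<in> carrier_mat n m" by (simp add: carrier_iff)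
    have vn: "v \<in> carrier_vec n" using u v c by auto
    have pw: "adj A ^\<^sub>m l * w = \<mu> ^ l \<cdot>\<^sub>m w"
    proof (induction l)
      case (Suc l)
      then show ?case by (simp add: mat_simps Aw mult.commute)
    qed (auto simp: one_mult_dim)
    have "adj w * (A ^\<^sub>m l * B) = adj (adj B * (adj A ^\<^sub>m l * w))"
      by (simp add: mat_simps adj_pow)
    also have "\<dots> = 0\<^sub>m 1 m" by (simp add: pw mat_simps Bw)
    finally have "adj w * (A ^\<^sub>m l * B) * ?u = 0\<^sub>m 1 1" by (simp add: zero_mult_dim)
    then have "adj w * Matrix.mat n 1 (\<lambda>(i, j). vec_index v i) = 0\<^sub>m 1 1"
      using col_mult_vec[OF c u] v by (simp add: mult_assoc_dim)
    then have "(adj w * Matrix.mat n 1 (\<lambda>(i, j). vec_index v i)) $$ (0, 0) = 0" by simp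
    then have "v \<bullet>c col w 0 = 0"
      by (simp add: index_mult_sum scalar_prod_def conjugate_complex_def atLeast0LessThan mult.commute)
    then show "v \<in> N" using vn by (simp add: N_def)
  qed
  ultimately have "V.span ?S \<subseteq> N" by (rule V.span_is_subset[rotated])
  moreover have "col w 0 \<in> carrier_vec n" by (intro carrier_vecI) simp
  ultimately have "col w 0 \<in> N" using AB unfolding controllable_def by blast
  then have "(adj w * w) $$ (0, 0) = 0"
    by (simp add: N_def index_mult_sum scalar_prod_def conjugate_complex_def atLeast0LessThan mult.commute)
  then show "w = 0\<^sub>m n 1" using nrm2_zero_iff[OF w] adj_self_nrm2[of w] by simp
qed

lemma controllable_iff_pbh:
  "A \<in> carrier_mat n n \<Longrightarrow> B \<in> carrier_mat n m \<Longrightarrow> controllable n A B \<longleftrightarrow> pbh n A B"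
  by (rule iffI) (rule controllable_imp_pbh pbh_imp_controllable; assumption)+

subsection \<open>State space isomorphism\<close>

text \<open>Padded with zero rows to a square matrix, \<open>T\<close> would still be injective,
  hence invertible, although its row \<open>k\<close> is 0.\<close>

lemma injective_dim_le:
  fixes T :: "complex mat"
  assumes T: "T \<in> carrier_mat k n"
    and inj: "\<And>w. w \<in> carrier_mat n 1 \<Longrightarrow> T * w = 0\<^sub>m k 1 \<Longrightarrow> w = 0\<^sub>m n 1"
  shows "n \<le> k"
proof (rule ccontr)
  assume "\<not> n \<le> k"
  then have kn: "k < n" by simp
  note [simp] = carrier_matD[OF T]
  define S where "S = Matrix.mat n n (\<lambda>(i, j). if i < k then T $$ (i, j) else 0)"
  have S: "S \<in> carrier_mat n n" and [simp]: "dim_row S = n" "dim_col S = n" by (auto simp: S_def)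
  have "Determinant.det S \<noteq> 0" unfolding det_nonzero_iff[OF S]
  proof (intro ballI impI inj)
    fix w assume w: "w \<in> carrier_mat n (1::nat)" and 0: "S * w = 0\<^sub>m n 1"
    note [simp] = carrier_matD[OF w]
    show "T * w = 0\<^sub>m k 1"
    proof (rule eq_matI)
      fix i j assume "i < dim_row (0\<^sub>m k 1 :: complex mat)" "j < dim_col (0\<^sub>m k 1 :: complex mat)"
      then have ij: "i < k" "j = 0" by auto
      have "(T * w) $$ (i, 0) = (S * w) $$ (i, 0)" using ij kn by (simp add: index_mult_sum S_def)
      then show "(T * w) $$ (i, j) = 0\<^sub>m k 1 $$ (i, j)" using 0 ij kn by simp
    qed auto
  qed
  note I = mat_inv_props[OF S this] note [simp] = carrier_matD[OF I(1)]
  have "S $$ (k, l) = 0" if "l < n" for l using that kn by (simp add: S_def)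
  then have "(S * mat_inv S) $$ (k, k) = 0" using kn by (simp add: index_mult_sum)
  then show False using I kn by simp
qed

lemma pow_mat_add:
  fixes A :: "complex mat"
  assumes "dim_row A = dim_col A"
  shows "A ^\<^sub>m (k + l) = A ^\<^sub>m k * A ^\<^sub>m l"
  using assms by (induction l) (auto simp: mult_assoc_dim mult_one_dim)

text \<open>\<open>T\<close> has to send \<open>A^l B\<close> to \<open>A'^l B'\<close>, which
  determines it as the mixed Gramian times the inverse Gramian. Equality of the Markov parameters
  gives \<open>C' A'^k T = C A^k\<close>. Observability of the second system and controllability of
  the first turn this into the intertwining relations, and observability of the first makes
  \<open>T\<close> injective.\<close>

lemma realization_morphism:
  assumes A: "A \<in> carrier_mat n n" and B: "B \<in> carrier_mat n m" and C: "C \<in> carrier_mat p n"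
    and A': "A' \<in> carrier_mat n' n'" and B': "B' \<in> carrier_mat n' m" and C': "C' \<in> carrier_mat p n'"
    and AB: "pbh n A B" and CA: "pbh n (adj A) (adj C)"
    and CA': "pbh n' (adj A') (adj C')"
    and markov: "\<And>k. C * (A ^\<^sub>m k * B) = C' * (A' ^\<^sub>m k * B')"
  obtains T where "T \<in> carrier_mat n' n" "T * A = A' * T" "T * B = B'" "C' * T = C"
    "\<And>w. w \<in> carrier_mat n 1 \<Longrightarrow> T * w = 0\<^sub>m n' 1 \<Longrightarrow> w = 0\<^sub>m n 1"
proof -
  note [simp] = carrier_matD[OF A] carrier_matD[OF B] carrier_matD[OF C]
    carrier_matD[OF A'] carrier_matD[OF B'] carrier_matD[OF C']
    dim_cross_gram[OF A A B B] dim_cross_gram[OF A' A B B']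
  let ?G = "gram A B n" and ?H = "cross_gram A' B' A B n"
  have G: "?G \<in> carrier_mat n n" by (simp add: carrier_iff)
  note I = mat_inv_props[OF G gram_det[OF A B AB]] note [simp] = carrier_matD[OF I(1)]
  define T where "T = ?H * mat_inv ?G"
  have T [simp]: "dim_row T = n'" "dim_col T = n" by (auto simp: T_def)
  have 1: "C' * (A' ^\<^sub>m k * cross_gram A' B' A B l) = C * (A ^\<^sub>m k * gram A B l)" for k l
  proof (induction l)
    case 0 show ?case by (simp add: mult_zero_dim)
  next
    case (Suc l)
    define N where "N = A ^\<^sub>m l * B"
    have N [simp]: "dim_row N = n" "dim_col N = m" by (auto simp: N_def)
    have "C' * (A' ^\<^sub>m k * cross_gram A' B' A B (Suc l)) =
        C' * (A' ^\<^sub>m k * cross_gram A' B' A B l) + C' * (A' ^\<^sub>m (k + l) * B') * adj N"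
      by (simp add: N_def[symmetric] mat_simps pow_mat_add)
    also have "\<dots> = C * (A ^\<^sub>m k * gram A B l) + C * (A ^\<^sub>m (k + l) * B) * adj N"
      using Suc markov by simp
    also have "\<dots> = C * (A ^\<^sub>m k * gram A B (Suc l))"
      by (simp add: N_def[symmetric]) (simp add: N_def mat_simps pow_mat_add)
    finally show ?case .
  qed
  have 2: "C' * (A' ^\<^sub>m k * T) = C * A ^\<^sub>m k" for k
  proof -
    have "C' * (A' ^\<^sub>m k * T) = C' * (A' ^\<^sub>m k * ?H) * mat_inv ?G" by (simp add: T_def mult_assoc_dim)
    also have "\<dots> = C * A ^\<^sub>m k * (?G * mat_inv ?G)" unfolding 1 by (simp add: mult_assoc_dim)
    also have "\<dots> = C * A ^\<^sub>m k" unfolding I(2) by (simp add: mult_one_dim)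
    finally show ?thesis .
  qed
  have 3: "T * (A ^\<^sub>m l * B) = A' ^\<^sub>m l * B'" for l
  proof -
    have "T * (A ^\<^sub>m l * B) - A' ^\<^sub>m l * B' = 0\<^sub>m n' m"
    proof (rule obs_krylov_mat[OF A' C' CA'])
      show "T * (A ^\<^sub>m l * B) - A' ^\<^sub>m l * B' \<in> carrier_mat n' m" by (simp add: carrier_iff)
      fix k
      have "C' * (A' ^\<^sub>m k * (T * (A ^\<^sub>m l * B) - A' ^\<^sub>m l * B')) =
          C' * (A' ^\<^sub>m k * T) * (A ^\<^sub>m l * B) - C' * (A' ^\<^sub>m (k + l) * B')"
        by (simp add: mat_simps pow_mat_add)
      also have "\<dots> = C * (A ^\<^sub>m (k + l) * B) - C' * (A' ^\<^sub>m (k + l) * B')"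
        unfolding 2 by (simp add: mat_simps pow_mat_add)
      also have "\<dots> = 0\<^sub>m p m" unfolding markov by (rule eq_matI) auto
      finally show "C' * (A' ^\<^sub>m k * (T * (A ^\<^sub>m l * B) - A' ^\<^sub>m l * B')) = 0\<^sub>m p m" .
    qed
    then show ?thesis by (subst (asm) minus_zero_iff) (auto simp: carrier_iff)
  qed
  have "adj (T * A - A' * T) = 0\<^sub>m n n'"
  proof (rule pbh_krylov_mat[OF A B AB])
    fix l
    have "(T * A - A' * T) * (A ^\<^sub>m l * B) = T * (A ^\<^sub>m Suc l * B) - A' * (T * (A ^\<^sub>m l * B))"
      by (subst pow_mat_Suc_left) (auto simp: mat_simps)
    also have "\<dots> = A' ^\<^sub>m Suc l * B' - A' * (A' ^\<^sub>m l * B')" unfolding 3 ..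
    also have "A' ^\<^sub>m Suc l * B' = A' * (A' ^\<^sub>m l * B')" by (subst pow_mat_Suc_left) (auto simp: mat_simps)
    finally have "adj ((T * A - A' * T) * (A ^\<^sub>m l * B)) = 0\<^sub>m m n'" by (auto intro!: eq_matI)
    then show "adj B * (adj A ^\<^sub>m l * adj (T * A - A' * T)) = 0\<^sub>m m n'"
      by (simp add: adj_mult adj_pow mult_assoc_dim)
  qed (simp add: carrier_iff)
  then have "adj (adj (T * A - A' * T)) = 0\<^sub>m n' n" by (simp add: adj_zero)
  then have "T * A - A' * T = 0\<^sub>m n' n" by (simp add: adj_adj)
  then have 4: "T * A = A' * T" by (subst (asm) minus_zero_iff) (auto simp: carrier_iff)
  show thesis
  proof (rule that)
    show "T * B = B'" using 3[of 0] by (simp add: one_mult_dim)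
    show "C' * T = C" using 2[of 0] by (simp add: one_mult_dim mult_one_dim)
    fix w assume w: "w \<in> carrier_mat n 1" and 0: "T * w = 0\<^sub>m n' 1"
    note [simp] = carrier_matD[OF w]
    show "w = 0\<^sub>m n 1"
    proof (rule obs_krylov_mat[OF A C CA w])
      fix k
      have "C * (A ^\<^sub>m k * w) = C * A ^\<^sub>m k * w" by (simp add: mult_assoc_dim)
      also have "\<dots> = C' * (A' ^\<^sub>m k * (T * w))" unfolding 2[symmetric] by (simp add: mult_assoc_dim)
      finally show "C * (A ^\<^sub>m k * w) = 0\<^sub>m p 1" by (simp add: 0 mult_zero_dim)
    qed
  qed (use 4 in \<open>auto simp: carrier_iff\<close>)
qed

text \<open>There are injective morphisms in both directions, so the orders agree and an injective
  square matrix is invertible.\<close>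

lemma realization_isomorphism:
  assumes A: "A \<in> carrier_mat n n" and B: "B \<in> carrier_mat n m" and C: "C \<in> carrier_mat p n"
    and A': "A' \<in> carrier_mat n' n'" and B': "B' \<in> carrier_mat n' m" and C': "C' \<in> carrier_mat p n'"
    and AB: "pbh n A B" and CA: "pbh n (adj A) (adj C)"
    and AB': "pbh n' A' B'" and CA': "pbh n' (adj A') (adj C')"
    and markov: "\<And>k. C * (A ^\<^sub>m k * B) = C' * (A' ^\<^sub>m k * B')"
  shows "n' = n" and "\<exists>T\<in>carrier_mat n n. Determinant.det T \<noteq> 0 \<and> T * A = A' * T \<and> T * B = B' \<and> C' * T = C"
proof -
  obtain T where T: "T \<in> carrier_mat n' n" "T * A = A' * T" "T * B = B'" "C' * T = C"
    "\<And>w. w \<in> carrier_mat n 1 \<Longrightarrow> T * w = 0\<^sub>m n' 1 \<Longrightarrow> w = 0\<^sub>m n 1"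
    by (rule realization_morphism[OF A B C A' B' C' AB CA CA' markov], rule that)
  obtain U where U: "U \<in> carrier_mat n n'" "U * A' = A * U" "U * B' = B" "C * U = C'"
    "\<And>w. w \<in> carrier_mat n' 1 \<Longrightarrow> U * w = 0\<^sub>m n 1 \<Longrightarrow> w = 0\<^sub>m n' 1"
    by (rule realization_morphism[OF A' B' C' A B C AB' CA' CA markov[symmetric]], rule that)
  show eq: "n' = n" using injective_dim_le[OF T(1,5)] injective_dim_le[OF U(1,5)] by auto
  have Tn: "T \<in> carrier_mat n n" using T(1) eq by simp
  have "Determinant.det T \<noteq> 0" unfolding det_nonzero_iff[OF Tn] using T(5) eq by simp
  then show "\<exists>T\<in>carrier_mat n n. Determinant.det T \<noteq> 0 \<and> T * A = A' * T \<and> T * B = B' \<and> C' * T = C"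
    using T(2-4) Tn by (intro bexI[of _ T] conjI)
qed

section \<open>Lyapunov and Riccati equations\<close>

lemma smult_pow_mat:
  fixes A :: "complex mat"
  assumes "dim_row A = dim_col A"
  shows "(c \<cdot>\<^sub>m A) ^\<^sub>m k = c ^ k \<cdot>\<^sub>m A ^\<^sub>m k"
  using assms by (induction k) (auto simp: mat_simps mult.commute intro!: eq_matI)

text \<open>Each factor of the characteristic polynomial has modulus at least \<open>Im z\<close>.
  The bound depends on the spectral condition only and not on the size of \<open>A\<close>, so it
  passes to limits of matrices.\<close>

lemma det_resolvent_lower_bound:
  fixes A :: "complex mat"
  assumes A: "A \<in> carrier_mat n n" and sp: "\<And>\<mu>. \<mu> \<in> spectrum A \<Longrightarrow> Im \<mu> \<le> 0" and z: "0 < Im z"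
  shows "(Im z) ^ n \<le> cmod (Determinant.det (z \<cdot>\<^sub>m 1\<^sub>m n - A))"
proof -
  note [simp] = carrier_matD[OF A]
  obtain es where es: "char_poly A = (\<Prod>a\<leftarrow>es. [:- a, 1:])" and len: "length es = n"
    using char_poly_factorized[OF A] by blast
  have sp': "Im e \<le> 0" if "e \<in> set es" for e
  proof -
    have "poly (char_poly A) e = 0"
      unfolding es poly_prod_list using that by (auto simp: prod_list_zero_iff image_iff intro!: bexI[of _ e])
    then show ?thesis using sp spectrum_root_char_poly[OF A] by auto
  qed
  have "- char_matrix A z = z \<cdot>\<^sub>m 1\<^sub>m n - A"
    by (rule eq_matI) (auto simp: char_matrix_def)
  then have "Determinant.det (z \<cdot>\<^sub>m 1\<^sub>m n - A) = (\<Prod>a\<leftarrow>es. z - a)"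
    using char_poly_matrix[OF A, of z] by (simp add: es poly_prod_list o_def)
  moreover have "(Im z) ^ length es \<le> cmod (\<Prod>a\<leftarrow>es. z - a)" using sp'
  proof (induction es)
    case (Cons a es)
    have "Im z \<le> cmod (z - a)" using Cons.prems[of a] abs_Im_le_cmod[of "z - a"] by simp
    then show ?case using Cons z by (auto simp: norm_mult intro!: mult_mono)
  qed simp
  ultimately show ?thesis using len by simp
qed

text \<open>Scaling by \<open>1 / r\<close>, with \<open>r\<close> between the spectral radius and
  1, keeps the spectral radius below 1. The powers of the scaled matrix stay bounded, so those of
  \<open>U\<close> decay like \<open>r ^ k\<close>.\<close>

lemma pow_mat_tendsto_zero:
  fixes U :: "complex mat"
  assumes U: "U \<in> carrier_mat n n" and sp: "\<And>\<mu>. \<mu> \<in> spectrum U \<Longrightarrow> cmod \<mu> < 1"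
    and ij: "i < n" "j < n"
  shows "(\<lambda>k. (U ^\<^sub>m k) $$ (i, j)) \<longlonglongrightarrow> 0"
proof -
  note [simp] = carrier_matD[OF U]
  have n: "0 < n" using ij by auto
  define \<rho> where "\<rho> = spectral_radius U"
  have \<rho>: "\<rho> < 1"
  proof -
    have "\<rho> \<in> norm ` spectrum U" using spectral_radius_mem_max(1)[OF U n] by (simp add: \<rho>_def)
    then show ?thesis using sp by auto
  qed
  have \<rho>0: "0 \<le> \<rho>"
    using spectral_radius_mem_max(1)[OF U n] by (auto simp: \<rho>_def)
  obtain r where r: "\<rho> < r" "r < 1" using dense[OF \<rho>] by blast
  define W where "W = complex_of_real (1 / r) \<cdot>\<^sub>m U"
  have W: "W \<in> carrier_mat n n" using U by (simp add: W_def)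
  have "cmod \<mu> < 1" if mu: "\<mu> \<in> spectrum W" for \<mu>
  proof -
    obtain w where w: "w \<in> carrier_mat n 1" "w \<noteq> 0\<^sub>m n 1" "W * w = \<mu> \<cdot>\<^sub>m w"
      using mu unfolding spectrum_iff[OF W] by auto
    note [simp] = carrier_matD[OF w(1)]
    have "U * w = complex_of_real r \<cdot>\<^sub>m (W * w)"
      using r \<rho>0 by (simp add: W_def mat_simps)
    then have "U * w = (r * \<mu>) \<cdot>\<^sub>m w" by (simp add: w(3) smult_smult)
    then have "r * \<mu> \<in> spectrum U" unfolding spectrum_iff[OF U] using w by auto
    then have "cmod (r * \<mu>) \<le> \<rho>" using spectral_radius_mem_max(2)[OF U n] by (auto simp: \<rho>_def)
    then have "cmod \<mu> \<le> \<rho> / r" using r \<rho>0 by (simp add: norm_mult field_simps)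
    also have "\<dots> < 1" using r \<rho>0 by simp
    finally show ?thesis .
  qed
  then have "spectral_radius W < 1"
    using spectral_radius_mem_max(1)[OF W n] by auto
  from spectral_radius_jnf_norm_bound_less_1_upper_triangular[OF W this]
  obtain c where c: "\<And>k. norm_bound (W ^\<^sub>m k) c" by auto
  have bd: "cmod ((U ^\<^sub>m k) $$ (i, j)) \<le> c * r ^ k" for k
  proof -
    have "U = complex_of_real r \<cdot>\<^sub>m W" unfolding W_def using r \<rho>0 by (intro eq_matI) auto
    then have "U ^\<^sub>m k = complex_of_real r ^ k \<cdot>\<^sub>m W ^\<^sub>m k"
      using carrier_matD[OF W] by (simp add: smult_pow_mat)
    then have "(U ^\<^sub>m k) $$ (i, j) = complex_of_real r ^ k * (W ^\<^sub>m k) $$ (i, j)"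
      using ij carrier_matD[OF W] by simp
    moreover have "cmod ((W ^\<^sub>m k) $$ (i, j)) \<le> c"
      using c[of k] ij carrier_matD[OF W] by (auto simp: norm_bound_def)
    ultimately show ?thesis using r \<rho>0 by (simp add: norm_mult norm_power mult.commute mult_right_mono)
  qed
  have "(\<lambda>k. c * r ^ k) \<longlonglongrightarrow> 0"
    using r \<rho>0 by (intro tendsto_mult_right_zero LIMSEQ_power_zero) auto
  then show ?thesis by (rule Lim_null_comparison[rotated]) (use bd in auto)
qed

lemma qf_alt: "A \<in> carrier_mat n n \<Longrightarrow> w \<in> carrier_mat n 1 \<Longrightarrow>
  qf A w = (\<Sum>i<n. \<Sum>j<n. cnj (w $$ (i, 0)) * A $$ (i, j) * w $$ (j, 0))"
  by (simp add: qf_def index_mult_sum carrier_iff sum_distrib_left mult.assoc)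

text \<open>The Cayley transform \<open>U = (\<alpha> + \<i>)(\<alpha> - \<i>)\<^sup>-\<^sup>1\<close> turns the Lyapunov inequality into
  \<open>U\<^sup>* D U \<le> D\<close>, which is iterated.\<close>

lemma lyapunov_nonneg:
  fixes \<alpha> D :: "complex mat"
  assumes a: "\<alpha> \<in> carrier_mat n n" and sp: "\<And>\<mu>. \<mu> \<in> spectrum \<alpha> \<Longrightarrow> Im \<mu> < 0"
    and D: "D \<in> carrier_mat n n"
    and M: "\<And>w. w \<in> carrier_mat n 1 \<Longrightarrow> 0 \<le> Re (qf (\<i> \<cdot>\<^sub>m (D * \<alpha> - adj \<alpha> * D)) w)"
    and w: "w \<in> carrier_mat n 1"
  shows "0 \<le> Re (qf D w)"
proof -
  note [simp] = carrier_matD[OF a] carrier_matD[OF D]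
  define S where "S = \<alpha> - \<i> \<cdot>\<^sub>m 1\<^sub>m n"
  have S: "S \<in> carrier_mat n n" by (simp add: S_def carrier_iff)
  have "Determinant.det S \<noteq> 0" unfolding det_nonzero_iff[OF S]
  proof (intro ballI impI, rule ccontr)
    fix x assume x: "x \<in> carrier_mat n (1::nat)" and 0: "S * x = 0\<^sub>m n 1" and nz: "x \<noteq> 0\<^sub>m n 1"
    note [simp] = carrier_matD[OF x]
    have "\<alpha> * x - \<i> \<cdot>\<^sub>m x = 0\<^sub>m n 1" using 0 by (simp add: S_def mat_simps)
    then have "\<alpha> * x = \<i> \<cdot>\<^sub>m x" by (subst (asm) minus_zero_iff) (auto simp: carrier_iff)
    then have "\<i> \<in> spectrum \<alpha>" unfolding spectrum_iff[OF a] using x nz by auto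
    then show False using sp by fastforce
  qed
  note I = mat_inv_props[OF S this]
  define N where "N = mat_inv S"
  have SN: "S * N = 1\<^sub>m n" and NS: "N * S = 1\<^sub>m n" and N [simp]: "dim_row N = n" "dim_col N = n"
    using I carrier_matD[OF I(1)] by (auto simp: N_def)
  have Sd [simp]: "dim_row S = n" "dim_col S = n" by (auto simp: S_def)
  define T where "T = \<alpha> + \<i> \<cdot>\<^sub>m 1\<^sub>m n"
  have Td [simp]: "dim_row T = n" "dim_col T = n" by (auto simp: T_def)
  define U where "U = T * N"
  have U: "U \<in> carrier_mat n n" and Ud [simp]: "dim_row U = n" "dim_col U = n"
    by (auto simp: U_def carrier_iff)
  \<comment> \<open>The terms \<open>D\<close> and \<open>adj \<alpha> * D * \<alpha>\<close> are
    the same in both products; only the mixed terms differ, by their sign.\<close>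
  have key: "adj S * D * S = adj T * D * T + 2 \<cdot>\<^sub>m (\<i> \<cdot>\<^sub>m (D * \<alpha> - adj \<alpha> * D))"
    by (simp add: S_def T_def mat_simps) (rule eq_matI, auto simp: algebra_simps)
  have step: "Re (qf D (U * x)) \<le> Re (qf D x)" if x: "x \<in> carrier_mat n 1" for x
  proof -
    note [simp] = carrier_matD[OF x]
    define y where "y = N * x"
    have yd [simp]: "dim_row y = n" "dim_col y = 1" by (auto simp: y_def)
    have xy: "x = S * y" and uy: "U * x = T * y"
      by (simp_all add: y_def U_def mult_assoc_dim[symmetric] SN one_mult_dim)
    have "adj x * (D * x) = adj y * ((adj S * D * S) * y)"
      by (simp add: xy mat_simps)
    also have "\<dots> = adj (U * x) * (D * (U * x)) + 2 \<cdot>\<^sub>m (adj y * ((\<i> \<cdot>\<^sub>m (D * \<alpha> - adj \<alpha> * D)) * y))"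
      unfolding key uy by (simp add: add_mult_dim mult_add_dim adj_mult smult_mult_dim mult_smult_dim mult_assoc_dim)
    finally have "qf D x = qf D (U * x) + 2 * qf (\<i> \<cdot>\<^sub>m (D * \<alpha> - adj \<alpha> * D)) y"
      by (simp add: qf_def)
    then show ?thesis using M[of y] by (simp add: carrier_iff)
  qed
  have lim: "(\<lambda>k. qf D (U ^\<^sub>m k * w)) \<longlonglongrightarrow> 0"
  proof -
    note [simp] = carrier_matD[OF w]
    have spU: "cmod \<mu> < 1" if mu: "\<mu> \<in> spectrum U" for \<mu>
    proof -
      obtain x where x: "x \<in> carrier_mat n 1" "x \<noteq> 0\<^sub>m n 1" "U * x = \<mu> \<cdot>\<^sub>m x"
        using mu unfolding spectrum_iff[OF U] by auto
      note [simp] = carrier_matD[OF x(1)]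
      define y where "y = N * x"
      have yd [simp]: "dim_row y = n" "dim_col y = 1" and yc: "y \<in> carrier_mat n 1"
        by (auto simp: y_def carrier_iff)
      have xy: "x = S * y" by (simp add: y_def mult_assoc_dim[symmetric] SN one_mult_dim)
      have y0: "y \<noteq> 0\<^sub>m n 1" using x(2) xy by (auto simp: mult_zero_dim)
      have "T * y = U * x" by (simp add: U_def y_def mult_assoc_dim)
      then have "T * y = \<mu> \<cdot>\<^sub>m (S * y)" using x(3) xy by metis
      then have eq: "\<alpha> * y + \<i> \<cdot>\<^sub>m y = \<mu> \<cdot>\<^sub>m (\<alpha> * y) - (\<mu> * \<i>) \<cdot>\<^sub>m y"
        by (simp add: S_def T_def mat_simps)
      have eq': "(1 - \<mu>) * (\<alpha> * y) $$ (i, 0) = - \<i> * (1 + \<mu>) * y $$ (i, 0)" if "i < n" for i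
        using arg_cong[OF eq, of "\<lambda>M. M $$ (i, 0)"] that by (simp add: algebra_simps)
      have m1: "\<mu> \<noteq> 1"
      proof
        assume "\<mu> = 1"
        then have "y = 0\<^sub>m n 1" using eq' by (intro eq_matI) auto
        then show False using y0 by simp
      qed
      \<comment> \<open>The inverse Cayley transform, which carries eigenvalues of \<open>U\<close>
        back to eigenvalues of \<alpha>.\<close>
      define \<nu> where "\<nu> = - \<i> * (1 + \<mu>) / (1 - \<mu>)"
      have "\<alpha> * y = \<nu> \<cdot>\<^sub>m y"
        using eq' m1 by (intro eq_matI) (auto simp: \<nu>_def field_simps)
      then have "\<nu> \<in> spectrum \<alpha>" unfolding spectrum_iff[OF a] using yc y0 by auto
      then have "Im \<nu> < 0" using sp by blast
      have mu: "\<mu> = (\<nu> + \<i>) / (\<nu> - \<i>)"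
      proof -
        have "\<nu> * (1 - \<mu>) = - \<i> * (1 + \<mu>)" using m1 by (simp add: \<nu>_def)
        then have "\<mu> * (\<nu> - \<i>) = \<nu> + \<i>" by (simp add: algebra_simps)
        moreover have "\<nu> - \<i> \<noteq> 0" using \<open>Im \<nu> < 0\<close> by (auto simp: complex_eq_iff)
        ultimately show ?thesis by (simp add: field_simps)
      qed
      \<comment> \<open>A point of the lower half-plane is closer to \<open>-\<i>\<close> than to
        \<open>\<i>\<close>.\<close>
      have "cmod (\<nu> + \<i>) < cmod (\<nu> - \<i>)"
        using \<open>Im \<nu> < 0\<close> by (simp add: cmod_def power2_eq_square algebra_simps)
      then show ?thesis unfolding mu by (simp add: norm_divide divide_less_eq_1)
    qed
    have pd [simp]: "dim_row (U ^\<^sub>m k) = n" "dim_col (U ^\<^sub>m k) = n" for k by simp_all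
    have e: "(\<lambda>k. (U ^\<^sub>m k * w) $$ (i, 0)) \<longlonglongrightarrow> 0" if "i < n" for i
    proof -
      have "(\<lambda>k. \<Sum>j<n. (U ^\<^sub>m k) $$ (i, j) * w $$ (j, 0)) \<longlonglongrightarrow> (\<Sum>j<n. 0 * w $$ (j, 0))"
        by (intro tendsto_sum tendsto_mult tendsto_const pow_mat_tendsto_zero[OF U spU]) (use that in auto)
      then show ?thesis using that by (simp add: index_mult_sum)
    qed
    have q: "qf D (U ^\<^sub>m k * w) = (\<Sum>i<n. \<Sum>j<n. cnj ((U ^\<^sub>m k * w) $$ (i, 0)) * D $$ (i, j) * (U ^\<^sub>m k * w) $$ (j, 0))" for k
      by (rule qf_alt[OF D]) (simp add: carrier_iff)
    have "(\<lambda>k. \<Sum>i<n. \<Sum>j<n. cnj ((U ^\<^sub>m k * w) $$ (i, 0)) * D $$ (i, j) * (U ^\<^sub>m k * w) $$ (j, 0))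
        \<longlonglongrightarrow> (\<Sum>i<n. \<Sum>j<n. cnj 0 * D $$ (i, j) * 0)"
      by (intro tendsto_sum tendsto_mult tendsto_const tendsto_cnj e) auto
    then show ?thesis unfolding q by simp
  qed
  have mono: "Re (qf D (U ^\<^sub>m k * w)) \<le> Re (qf D w)" for k
  proof (induction k)
    case 0 then show ?case using carrier_matD[OF w] by (simp add: one_mult_dim)
  next
    case (Suc k)
    have c: "U ^\<^sub>m k * w \<in> carrier_mat n 1" using carrier_matD[OF w] by (simp add: carrier_iff)
    have "U ^\<^sub>m Suc k * w = U * (U ^\<^sub>m k * w)"
      using carrier_matD[OF w] by (subst pow_mat_Suc_left) (auto simp: mult_assoc_dim)
    then show ?case using step[OF c] Suc by simp
  qed
  have "(\<lambda>k. Re (qf D (U ^\<^sub>m k * w))) \<longlonglongrightarrow> Re 0" by (rule tendsto_Re[OF lim])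
  then show ?thesis using mono by (auto intro: LIMSEQ_le_const2)
qed

text \<open>The constant term \<open>Q\<close> is a parameter so that the equations for
  \<open>r R\<close> with different \<open>r\<close> can be compared. Products are nested to the
  right to match \<open>mat_simps\<close>.\<close>

definition ric :: "nat \<Rightarrow> complex mat \<Rightarrow> complex mat \<Rightarrow> complex mat \<Rightarrow> complex mat \<Rightarrow> bool" where
  "ric n A B Q X \<longleftrightarrow> X \<in> carrier_mat n n \<and> adj X = X \<and>
     \<i> \<cdot>\<^sub>m (X * A - adj A * X) = Q + X * (B * (adj B * X))"

definition closed_loop :: "complex mat \<Rightarrow> complex mat \<Rightarrow> complex mat \<Rightarrow> complex mat" where
  "closed_loop A B X = A + \<i> \<cdot>\<^sub>m (B * (adj B * X))"

lemma dim_closed_loop [simp]: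
  assumes "A \<in> carrier_mat n n" "B \<in> carrier_mat n m" "X \<in> carrier_mat n n"
  shows "dim_row (closed_loop A B X) = n" "dim_col (closed_loop A B X) = n"
  using assms by (auto simp: closed_loop_def)

text \<open>The quadratic term is expanded around \<open>X1\<close>: its linear part is absorbed
  into the closed loop matrix, its quadratic part is a square, and what remains is a Lyapunov
  equation for the difference.\<close>

lemma riccati_difference:
  assumes A: "A \<in> carrier_mat n n" and B: "B \<in> carrier_mat n m"
    and Q1: "Q1 \<in> carrier_mat n n" and Q2: "Q2 \<in> carrier_mat n n"
    and 1: "ric n A B Q1 X1" and 2: "ric n A B Q2 X2"
  defines "D \<equiv> X2 - X1" and "\<alpha> \<equiv> closed_loop A B X1"
  shows "\<i> \<cdot>\<^sub>m (D * \<alpha> - adj \<alpha> * D) = (Q2 - Q1) + adj (adj B * D) * (adj B * D)"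
proof -
  have X1: "X1 \<in> carrier_mat n n" and X2: "X2 \<in> carrier_mat n n"
    and h: "adj X1 = X1" "adj X2 = X2"
    and r1: "\<i> \<cdot>\<^sub>m (X1 * A - adj A * X1) = Q1 + X1 * (B * (adj B * X1))"
    and r2: "\<i> \<cdot>\<^sub>m (X2 * A - adj A * X2) = Q2 + X2 * (B * (adj B * X2))"
    using 1 2 by (auto simp: ric_def)
  note [simp] = carrier_matD[OF A] carrier_matD[OF B] carrier_matD[OF X1] carrier_matD[OF X2]
    carrier_matD[OF Q1] carrier_matD[OF Q2]
  show ?thesis
  proof (rule eq_matI)
    fix i j assume "i < dim_row ((Q2 - Q1) + adj (adj B * D) * (adj B * D))"
      "j < dim_col ((Q2 - Q1) + adj (adj B * D) * (adj B * D))"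
    then have ij: "i < n" "j < n" by (auto simp: D_def)
    have e1: "\<i> * ((X1 * A) $$ (i, j) - (adj A * X1) $$ (i, j)) = Q1 $$ (i, j) + (X1 * (B * (adj B * X1))) $$ (i, j)"
      using arg_cong[OF r1, of "\<lambda>M. M $$ (i, j)"] ij by simp
    have e2: "\<i> * ((X2 * A) $$ (i, j) - (adj A * X2) $$ (i, j)) = Q2 $$ (i, j) + (X2 * (B * (adj B * X2))) $$ (i, j)"
      using arg_cong[OF r2, of "\<lambda>M. M $$ (i, j)"] ij by simp
    \<comment> \<open>Entrywise the claim agrees with the difference of the two Riccati equations up
      to terms that cancel, so it is enough to match the two differences.\<close>
    have c: "a - b = (l2 - p2) - (l1 - p1) \<Longrightarrow> l1 = p1 \<Longrightarrow> l2 = p2 \<Longrightarrow> a = b"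
      for a b l1 l2 p1 p2 :: complex by simp
    show "(\<i> \<cdot>\<^sub>m (D * \<alpha> - adj \<alpha> * D)) $$ (i, j) = ((Q2 - Q1) + adj (adj B * D) * (adj B * D)) $$ (i, j)"
      by (rule c[OF _ e1 e2]) (use ij in \<open>simp add: D_def \<alpha>_def closed_loop_def mat_simps h algebra_simps\<close>)
  qed (auto simp: D_def \<alpha>_def closed_loop_def)
qed

text \<open>The Lyapunov expression of \<open>X2 - X1\<close> along the closed loop of
  \<open>X1\<close> is nonnegative. For an anti-stable closed loop, changing the sign of both the
  difference and the matrix leaves that expression unchanged and reverses the conclusion.\<close>

lemma riccati_comparison:
  assumes A: "A \<in> carrier_mat n n" and B: "B \<in> carrier_mat n m"
    and Q1: "Q1 \<in> carrier_mat n n" and Q2: "Q2 \<in> carrier_mat n n"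
    and r1: "ric n A B Q1 X1" and r2: "ric n A B Q2 X2"
    and Q: "\<And>w. w \<in> carrier_mat n 1 \<Longrightarrow> 0 \<le> Re (qf (Q2 - Q1) w)"
    and w: "w \<in> carrier_mat n 1"
  shows "(\<And>\<mu>. \<mu> \<in> spectrum (closed_loop A B X1) \<Longrightarrow> Im \<mu> < 0) \<Longrightarrow> Re (qf X1 w) \<le> Re (qf X2 w)"
    and "(\<And>\<mu>. \<mu> \<in> spectrum (closed_loop A B X1) \<Longrightarrow> Im \<mu> > 0) \<Longrightarrow> Re (qf X2 w) \<le> Re (qf X1 w)"
proof -
  have X1: "X1 \<in> carrier_mat n n" and X2: "X2 \<in> carrier_mat n n" using r1 r2 by (auto simp: ric_def)
  note [simp] = carrier_matD[OF A] carrier_matD[OF B] carrier_matD[OF X1] carrier_matD[OF X2]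
    carrier_matD[OF Q1] carrier_matD[OF Q2] dim_closed_loop[OF A B X1]
  let ?a = "closed_loop A B X1" and ?D = "X2 - X1"
  have a: "?a \<in> carrier_mat n n" by (simp add: carrier_iff)
  have M: "0 \<le> Re (qf (\<i> \<cdot>\<^sub>m (?D * ?a - adj ?a * ?D)) x)" if x: "x \<in> carrier_mat n 1" for x
  proof -
    note [simp] = carrier_matD[OF x]
    define E where "E = adj B * ?D"
    have Ed [simp]: "dim_row E = m" "dim_col E = n" by (auto simp: E_def)
    have "qf ((Q2 - Q1) + adj E * E) x = qf (Q2 - Q1) x + (adj (E * x) * (E * x)) $$ (0, 0)"
      by (simp add: qf_def mat_simps)
    then show ?thesis
      unfolding riccati_difference[OF A B Q1 Q2 r1 r2] E_def[symmetric]
      using Q[OF x] by (simp add: adj_self_nrm2)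
  qed
  have q: "qf ?D w = qf X2 w - qf X1 w"
    using carrier_matD[OF w] by (simp add: qf_def mat_simps)
  show "Re (qf X1 w) \<le> Re (qf X2 w)" if "\<And>\<mu>. \<mu> \<in> spectrum ?a \<Longrightarrow> Im \<mu> < 0"
    using lyapunov_nonneg[OF a that _ M w] q by (simp add: carrier_iff)
  show "Re (qf X2 w) \<le> Re (qf X1 w)" if sp: "\<And>\<mu>. \<mu> \<in> spectrum ?a \<Longrightarrow> Im \<mu> > 0"
  proof -
    have na: "- ?a \<in> carrier_mat n n" by (simp add: carrier_iff)
    have sp': "Im \<mu> < 0" if mu: "\<mu> \<in> spectrum (- ?a)" for \<mu>
    proof -
      obtain x where x: "x \<in> carrier_mat n 1" "x \<noteq> 0\<^sub>m n 1" "(- ?a) * x = \<mu> \<cdot>\<^sub>m x"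
        using mu unfolding spectrum_iff[OF na] by auto
      note [simp] = carrier_matD[OF x(1)]
      have "?a * x = (- \<mu>) \<cdot>\<^sub>m x"
      proof (rule eq_matI)
        fix i j assume "i < dim_row ((- \<mu>) \<cdot>\<^sub>m x)" "j < dim_col ((- \<mu>) \<cdot>\<^sub>m x)"
        then show "(?a * x) $$ (i, j) = ((- \<mu>) \<cdot>\<^sub>m x) $$ (i, j)"
          using arg_cong[OF x(3), of "\<lambda>M. - M $$ (i, j)"] by (simp add: uminus_mult_dim)
      qed auto
      then have "- \<mu> \<in> spectrum ?a" unfolding spectrum_iff[OF a] using x(1,2) by (intro bexI[of _ x] conjI)
      then show ?thesis using sp by fastforce
    qed
    have e: "\<i> \<cdot>\<^sub>m ((- ?D) * (- ?a) - adj (- ?a) * (- ?D)) = \<i> \<cdot>\<^sub>m (?D * ?a - adj ?a * ?D)"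
      by (simp add: mat_simps) (rule eq_matI, auto)
    have M': "0 \<le> Re (qf (\<i> \<cdot>\<^sub>m ((- ?D) * (- ?a) - adj (- ?a) * (- ?D))) x)"
      if "x \<in> carrier_mat n 1" for x unfolding e using M[OF that] .
    have "0 \<le> Re (qf (- ?D) w)"
      by (rule lyapunov_nonneg[OF na sp' _ M' w]) (auto simp: carrier_iff)
    moreover have "qf (- ?D) w = - qf ?D w" using carrier_matD[OF w] by (simp add: qf_def mat_simps)
    ultimately show ?thesis using q by simp
  qed
qed

text \<open>The closed loop spectra may meet the real axis, so the two spectra need not be disjoint.
  The difference \<open>D\<close> intertwines the second closed loop with the adjoint of the first.
  If \<open>D\<close> is nonzero, there is a common eigenvalue, which the two spectral conditions
  force to be real; the Lyapunov form then vanishes at \<open>z\<close>, so \<open>adj B\<close>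
  kills \<open>D * z\<close>. This makes \<open>D * z\<close> an eigenvector of \<open>adj A\<close>
  that controllability excludes.\<close>

lemma riccati_unique:
  assumes A: "A \<in> carrier_mat n n" and B: "B \<in> carrier_mat n m" and Q: "Q \<in> carrier_mat n n"
    and AB: "pbh n A B" and r1: "ric n A B Q X1" and r2: "ric n A B Q X2"
    and s1: "\<And>\<mu>. \<mu> \<in> spectrum (closed_loop A B X1) \<Longrightarrow> Im \<mu> \<le> 0"
    and s2: "\<And>\<mu>. \<mu> \<in> spectrum (closed_loop A B X2) \<Longrightarrow> Im \<mu> \<le> 0"
  shows "X1 = X2"
proof (rule ccontr)
  assume ne: "X1 \<noteq> X2"
  have X1: "X1 \<in> carrier_mat n n" and X2: "X2 \<in> carrier_mat n n"
    and h: "adj X1 = X1" "adj X2 = X2" using r1 r2 by (auto simp: ric_def)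
  note [simp] = carrier_matD[OF A] carrier_matD[OF B] carrier_matD[OF X1] carrier_matD[OF X2]
    carrier_matD[OF Q] dim_closed_loop[OF A B X1] dim_closed_loop[OF A B X2]
  define D where "D = X2 - X1"
  let ?a1 = "closed_loop A B X1" and ?a2 = "closed_loop A B X2"
  have Dd [simp]: "dim_row D = n" "dim_col D = n" and hD: "adj D = D" by (auto simp: D_def mat_simps h)
  have D: "D \<in> carrier_mat n n" and a1: "adj ?a1 \<in> carrier_mat n n" and a1': "?a1 \<in> carrier_mat n n"
    and a2: "?a2 \<in> carrier_mat n n" by (auto simp: carrier_iff)
  have D0: "D \<noteq> 0\<^sub>m n n"
    unfolding D_def minus_zero_iff[OF X2 X1] using ne by simp
  have key: "\<i> \<cdot>\<^sub>m (D * ?a1 - adj ?a1 * D) = adj (adj B * D) * (adj B * D)"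
    unfolding D_def riccati_difference[OF A B Q Q r1 r2] by (rule eq_matI) auto
  have inter: "D * ?a2 = adj ?a1 * D"
  proof (rule eq_matI)
    fix i j assume "i < dim_row (adj ?a1 * D)" "j < dim_col (adj ?a1 * D)"
    then have ij: "i < n" "j < n" by auto
    have k: "\<i> * ((D * ?a1) $$ (i, j) - (adj ?a1 * D) $$ (i, j)) = (D * (B * (adj B * D))) $$ (i, j)"
      using arg_cong[OF key, of "\<lambda>M. M $$ (i, j)"] ij by (simp add: mat_simps hD algebra_simps)
    have "?a2 = ?a1 + \<i> \<cdot>\<^sub>m (B * (adj B * D))"
      by (simp add: closed_loop_def D_def mat_simps) (rule eq_matI, auto)
    then have "(D * ?a2) $$ (i, j) = (D * ?a1) $$ (i, j) + \<i> * (D * (B * (adj B * D))) $$ (i, j)"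
      using ij by (simp add: mult_add_dim mult_smult_dim)
    then show "(D * ?a2) $$ (i, j) = (adj ?a1 * D) $$ (i, j)"
      unfolding k[symmetric] by (simp add: mult.assoc[symmetric] algebra_simps)
  qed auto
  obtain z \<mu> where z: "z \<in> carrier_mat n 1" and mu: "\<mu> \<in> spectrum ?a2"
    and Dz: "D * z \<noteq> 0\<^sub>m n 1" and ev: "adj ?a1 * (D * z) = \<mu> \<cdot>\<^sub>m (D * z)"
    by (rule intertwining_eigenvector[OF a2 a1 D inter D0])
  note [simp] = carrier_matD[OF z]
  define w where "w = D * z"
  have wd [simp]: "dim_row w = n" "dim_col w = 1" and w: "w \<in> carrier_mat n 1" by (auto simp: w_def carrier_iff)
  have "\<mu> \<in> spectrum (adj ?a1)" unfolding spectrum_iff[OF a1] using w Dz ev by (auto simp: w_def)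
  then have real: "Im \<mu> = 0" using s1[of "cnj \<mu>"] s2[OF mu] spectrum_adj[OF a1'] by fastforce
  then have cnjmu: "cnj \<mu> = \<mu>" by (simp add: complex_eq_iff)
  define s where "s = (adj z * w) $$ (0, 0)"
  have awz: "adj w * z = adj z * w" by (simp add: w_def mat_simps hD)
  have 1: "adj z * (adj ?a1 * w) = \<mu> \<cdot>\<^sub>m (adj z * w)" using ev by (simp add: w_def[symmetric] mult_smult_dim)
  \<comment> \<open>As \<mu> is real and \<open>D\<close> is Hermitian, the two terms of the
    Lyapunov form at \<open>z\<close> are equal and cancel.\<close>
  have "adj z * (D * (?a1 * z)) = adj (adj ?a1 * w) * z" by (simp add: w_def mat_simps hD)
  also have "\<dots> = \<mu> \<cdot>\<^sub>m (adj z * w)"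
    using ev by (simp add: w_def[symmetric] adj_smult cnjmu smult_mult_dim awz)
  finally have 2: "adj z * (D * (?a1 * z)) = \<mu> \<cdot>\<^sub>m (adj z * w)" .
  have "adj z * (\<i> \<cdot>\<^sub>m (D * ?a1 - adj ?a1 * D) * z) = adj (adj B * w) * (adj B * w)"
    unfolding key by (simp add: w_def mat_simps)
  moreover have "adj z * (\<i> \<cdot>\<^sub>m (D * ?a1 - adj ?a1 * D) * z) =
      \<i> \<cdot>\<^sub>m (adj z * (D * (?a1 * z)) - adj z * (adj ?a1 * w))"
    by (simp add: w_def mult_smult_dim smult_mult_dim minus_mult_dim mult_minus_dim mult_assoc_dim)
  ultimately have e: "adj (adj B * w) * (adj B * w) = \<i> \<cdot>\<^sub>m (\<mu> \<cdot>\<^sub>m (adj z * w) - \<mu> \<cdot>\<^sub>m (adj z * w))"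
    unfolding 1 2 by (rule trans[OF sym])
  have "(adj (adj B * w) * (adj B * w)) $$ (0, 0) = 0" unfolding e by simp
  then have "nrm2 (adj B * w) = 0" by (subst (asm) adj_self_nrm2) auto
  then have Bw: "adj B * w = 0\<^sub>m m 1" by (subst (asm) nrm2_zero_iff[of _ m]) (auto simp: carrier_iff)
  have "adj ?a1 * w = adj A * w - \<i> \<cdot>\<^sub>m (X1 * (B * (adj B * w)))"
    by (simp add: closed_loop_def mat_simps h) (rule eq_matI, auto)
  then have "adj ?a1 * w = adj A * w" unfolding Bw by (auto simp: mat_simps intro!: eq_matI)
  then have "adj A * w = \<mu> \<cdot>\<^sub>m w" using ev by (simp add: w_def)
  then have "w = 0\<^sub>m n 1" by (rule pbhD[OF AB w _ B Bw])
  then show False using Dz by (simp add: w_def)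
qed

text \<open>Tested on a kernel vector \<open>x\<close> of \<open>X\<close>, the Riccati equation
  reads \<open>0 = |C x|^2\<close>; applied to \<open>x\<close> it then gives
  \<open>X (A x) = 0\<close>. So the kernel is \<open>A\<close>-invariant and lies in the kernel of
  \<open>C\<close>, which observability allows for 0 only.\<close>

lemma riccati_solution_nonsingular:
  assumes A: "A \<in> carrier_mat n n" and B: "B \<in> carrier_mat n m" and C: "C \<in> carrier_mat p n"
    and CA: "pbh n (adj A) (adj C)" and r: "ric n A B (adj C * C) X"
  shows "Determinant.det X \<noteq> 0"
proof -
  have X: "X \<in> carrier_mat n n" and h: "adj X = X"
    and eq: "\<i> \<cdot>\<^sub>m (X * A - adj A * X) = adj C * C + X * (B * (adj B * X))" using r by (auto simp: ric_def)
  note [simp] = carrier_matD[OF A] carrier_matD[OF B] carrier_matD[OF X] carrier_matD[OF C]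
  define K where "K = {x \<in> carrier_mat n 1. X * x = 0\<^sub>m n 1}"
  have K: "subspace_mat n K"
    by (rule subspace_matI) (auto simp: K_def mat_simps carrier_iff intro!: eq_matI)
  have CK: "C * x = 0\<^sub>m p 1 \<and> A * x \<in> K" if x: "x \<in> K" for x
  proof -
    have xc: "x \<in> carrier_mat n 1" and Xx: "X * x = 0\<^sub>m n 1" using x by (auto simp: K_def)
    note [simp] = carrier_matD[OF xc]
    have "\<i> \<cdot>\<^sub>m (X * A - adj A * X) * x = \<i> \<cdot>\<^sub>m (X * (A * x))"
      by (simp add: mat_simps Xx) (rule eq_matI, auto)
    moreover have "(adj C * C + X * (B * (adj B * X))) * x = adj C * (C * x)"
      by (simp add: mat_simps Xx) (rule eq_matI, auto)
    ultimately have e: "\<i> \<cdot>\<^sub>m (X * (A * x)) = adj C * (C * x)" unfolding eq by (rule trans[OF sym])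
    have "adj (C * x) * (C * x) = adj x * (\<i> \<cdot>\<^sub>m (X * (A * x)))" unfolding e by (simp add: mat_simps)
    also have "\<dots> = \<i> \<cdot>\<^sub>m (adj (X * x) * (A * x))" by (simp add: mat_simps h)
    finally have "(adj (C * x) * (C * x)) $$ (0, 0) = 0" by (simp add: Xx mat_simps)
    then have "nrm2 (C * x) = 0" by (subst (asm) adj_self_nrm2) auto
    then have Cx: "C * x = 0\<^sub>m p 1" by (subst (asm) nrm2_zero_iff[of _ p]) (auto simp: carrier_iff)
    have "(- \<i>) \<cdot>\<^sub>m (\<i> \<cdot>\<^sub>m (X * (A * x))) = 0\<^sub>m n 1" unfolding e Cx by (simp add: mat_simps)
    then have "X * (A * x) = 0\<^sub>m n 1" by (simp add: smult_smult smult_one_mat)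
    then show ?thesis using Cx by (auto simp: K_def carrier_iff)
  qed
  show ?thesis unfolding det_nonzero_iff[OF X]
  proof (intro ballI impI, rule ccontr)
    fix x assume x: "x \<in> carrier_mat n (1::nat)" "X * x = 0\<^sub>m n 1" "x \<noteq> 0\<^sub>m n 1"
    have xK: "x \<in> K" unfolding K_def using x(1,2) by simp
    have AK: "A * y \<in> K" if "y \<in> K" for y using CK[OF that] by simp
    obtain w \<mu> where w: "w \<in> K" "w \<noteq> 0\<^sub>m n 1" "A * w = \<mu> \<cdot>\<^sub>m w"
      by (rule invariant_subspace_eigenvector[OF A K AK xK x(3)])
    have wc: "w \<in> carrier_mat n 1" and Cw: "C * w = 0\<^sub>m p 1" using w(1) CK[OF w(1)] by (auto simp: K_def)
    have "w = 0\<^sub>m n 1" by (rule obsD[OF CA wc w(3) C Cw])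
    then show False using w by simp
  qed
qed

subsection \<open>Stable subspaces of the Hamiltonian matrix\<close>

lemma spectrum_upper_triangular:
  fixes T :: "complex mat"
  assumes T: "T \<in> carrier_mat k k" and ut: "upper_triangular T" and mu: "\<mu> \<in> spectrum T"
  obtains i where "i < k" "T $$ (i, i) = \<mu>"
proof -
  have "poly (char_poly T) \<mu> = 0" using mu spectrum_root_char_poly[OF T] by auto
  then have "\<mu> \<in> set (diag_mat T)"
    unfolding char_poly_upper_triangular[OF T ut] poly_prod_list
    by (auto simp: prod_list_zero_iff)
  then show thesis using that carrier_matD[OF T] by (auto simp: diag_mat_def)
qed

lemma schur_invariant_block:
  fixes H :: "complex mat"
  assumes H: "H \<in> carrier_mat N N" and es: "char_poly H = (\<Prod>a\<leftarrow>es. [:- a, 1:])" and k: "k \<le> N"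
  obtains U T where "U \<in> carrier_mat N k" "T \<in> carrier_mat k k" "H * U = U * T"
    "\<And>x. x \<in> carrier_mat k 1 \<Longrightarrow> U * x = 0\<^sub>m N 1 \<Longrightarrow> x = 0\<^sub>m k 1"
    "spectrum T \<subseteq> set (take k es)"
proof -
  obtain P Q S where P: "P \<in> carrier_mat N N" and Q: "Q \<in> carrier_mat N N" and S: "S \<in> carrier_mat N N"
    and QP: "Q * P = 1\<^sub>m N" and HP: "H * P = P * S" and ut: "upper_triangular S"
    and len: "length es = N" and di: "\<And>i. i < N \<Longrightarrow> S $$ (i, i) = es ! i"
    by (rule schur_ordered[OF H es]) metis
  note [simp] = carrier_matD[OF P] carrier_matD[OF Q] carrier_matD[OF S] carrier_matD[OF H]
  define U where "U = Matrix.mat N k (\<lambda>(i, j). P $$ (i, j))"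
  define T where "T = Matrix.mat k k (\<lambda>(i, j). S $$ (i, j))"
  have d [simp]: "dim_row U = N" "dim_col U = k" "dim_row T = k" "dim_col T = k"
    by (auto simp: U_def T_def)
  have T: "T \<in> carrier_mat k k" and U: "U \<in> carrier_mat N k" by (auto simp: carrier_iff)
  have "H * U = U * T"
  proof (rule eq_matI)
    fix i j assume "i < dim_row (U * T)" "j < dim_col (U * T)"
    then have ij: "i < N" "j < k" by auto
    have "(H * U) $$ (i, j) = (H * P) $$ (i, j)" using ij k by (simp add: index_mult_sum U_def)
    also have "\<dots> = (\<Sum>l<N. P $$ (i, l) * S $$ (l, j))" unfolding HP using ij k by (simp add: index_mult_sum)
    also have "\<dots> = (\<Sum>l<k. P $$ (i, l) * S $$ (l, j))"
      by (rule sum.mono_neutral_right) (use ij k upper_triangularD[OF ut] in auto)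
    also have "\<dots> = (U * T) $$ (i, j)" using ij by (simp add: index_mult_sum U_def T_def)
    finally show "(H * U) $$ (i, j) = (U * T) $$ (i, j)" .
  qed auto
  moreover have "x = 0\<^sub>m k 1" if x: "x \<in> carrier_mat k 1" and 0: "U * x = 0\<^sub>m N 1" for x
  proof -
    note [simp] = carrier_matD[OF x]
    define y where "y = Matrix.mat N 1 (\<lambda>(i, j). if i < k then x $$ (i, 0) else 0)"
    have yd [simp]: "dim_row y = N" "dim_col y = 1" by (auto simp: y_def)
    have "P * y = U * x"
    proof (rule eq_matI)
      fix i j assume "i < dim_row (U * x)" "j < dim_col (U * x)"
      then have ij: "i < N" "j = 0" by auto
      have "(P * y) $$ (i, 0) = (\<Sum>l<N. P $$ (i, l) * y $$ (l, 0))" using ij by (simp add: index_mult_sum)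
      also have "\<dots> = (\<Sum>l<k. P $$ (i, l) * y $$ (l, 0))"
        by (rule sum.mono_neutral_right) (use k in \<open>auto simp: y_def\<close>)
      also have "\<dots> = (U * x) $$ (i, 0)" using ij k by (simp add: index_mult_sum U_def y_def)
      finally show "(P * y) $$ (i, j) = (U * x) $$ (i, j)" using ij by simp
    qed auto
    then have "Q * P * y = 0\<^sub>m N 1" by (simp add: mult_assoc_dim 0 mult_zero_dim)
    then have y0: "y = 0\<^sub>m N 1" by (simp add: QP one_mult_dim)
    show ?thesis
    proof (rule eq_matI)
      fix i j assume "i < dim_row (0\<^sub>m k 1 :: complex mat)" "j < dim_col (0\<^sub>m k 1 :: complex mat)"
      then show "x $$ (i, j) = 0\<^sub>m k 1 $$ (i, j)"
        using k arg_cong[OF y0, of "\<lambda>M. M $$ (i, 0)"] by (simp add: y_def)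
    qed auto
  qed
  moreover have "spectrum T \<subseteq> set (take k es)"
  proof
    fix \<mu> assume mu: "\<mu> \<in> spectrum T"
    have "upper_triangular T" using ut k by (auto simp: upper_triangular_def T_def)
    then obtain i where "i < k" "T $$ (i, i) = \<mu>" using spectrum_upper_triangular[OF T _ mu] by blast
    then have "i < k" "\<mu> = take k es ! i" using di k by (auto simp: T_def)
    then show "\<mu> \<in> set (take k es)" using len k nth_mem[of i "take k es"] by simp
  qed
  ultimately show thesis by (intro that[OF U T])
qed

text \<open>The Hamiltonian matrix with block rows \<open>A, \<i> B B^*\<close> and
  \<open>-\<i> C^* C, A^*\<close>. The graph of \<open>X\<close> is invariant under it exactly if
  \<open>X\<close> satisfies the Riccati identity, and it acts on the graph as the closed loop
  matrix.\<close>

definition ham :: "nat \<Rightarrow> complex mat \<Rightarrow> complex mat \<Rightarrow> complex mat \<Rightarrow> complex mat" where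
  "ham n A B C = Matrix.mat (n + n) (n + n) (\<lambda>(i, j).
     if i < n then (if j < n then A $$ (i, j) else (\<i> \<cdot>\<^sub>m (B * adj B)) $$ (i, j - n))
     else (if j < n then ((- \<i>) \<cdot>\<^sub>m (adj C * C)) $$ (i - n, j) else (adj A) $$ (i - n, j - n)))"

lemma ham_carrier [simp]: "ham n A B C \<in> carrier_mat (n + n) (n + n)"
  by (simp add: ham_def)

lemma sum_lessThan_add: "(\<Sum>l<n + m. f l) = (\<Sum>l<n. f l) + (\<Sum>l<m. f (n + l))"
  for f :: "nat \<Rightarrow> 'a::comm_monoid_add"
  by (induction m) (auto simp: add.assoc)

lemma ham_blocks:
  assumes A: "A \<in> carrier_mat n n" and B: "B \<in> carrier_mat n m" and C: "C \<in> carrier_mat p n"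
    and U: "U \<in> carrier_mat (n + n) k" and T: "T \<in> carrier_mat k k" and HU: "ham n A B C * U = U * T"
  defines "U1 \<equiv> Matrix.mat n k (\<lambda>(i, j). U $$ (i, j))"
    and "U2 \<equiv> Matrix.mat n k (\<lambda>(i, j). U $$ (n + i, j))"
  shows "A * U1 + \<i> \<cdot>\<^sub>m (B * (adj B * U2)) = U1 * T"
    and "(- \<i>) \<cdot>\<^sub>m (adj C * (C * U1)) + adj A * U2 = U2 * T"
proof -
  note [simp] = carrier_matD[OF A] carrier_matD[OF B] carrier_matD[OF C] carrier_matD[OF U]
    carrier_matD[OF T] carrier_matD[OF ham_carrier]
  have d [simp]: "dim_row U1 = n" "dim_col U1 = k" "dim_row U2 = n" "dim_col U2 = k"
    by (auto simp: U1_def U2_def)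
  define G where "G = \<i> \<cdot>\<^sub>m (B * adj B)"
  define Q where "Q = (- \<i>) \<cdot>\<^sub>m (adj C * C)"
  have Gd [simp]: "dim_row G = n" "dim_col G = n" "dim_row Q = n" "dim_col Q = n"
    by (auto simp: G_def Q_def)
  have s: "(Z * U1) $$ (i, j) = (\<Sum>l<n. Z $$ (i, l) * U $$ (l, j))"
    "(Z * U2) $$ (i, j) = (\<Sum>l<n. Z $$ (i, l) * U $$ (n + l, j))"
    if "i < n" "j < k" "dim_row Z = n" "dim_col Z = n" for Z i j
    using that by (auto simp: index_mult_sum U1_def U2_def)
  have h: "(ham n A B C * U) $$ (i, j) = (\<Sum>l<n. ham n A B C $$ (i, l) * U $$ (l, j)) +
      (\<Sum>l<n. ham n A B C $$ (i, n + l) * U $$ (n + l, j))" if "i < n + n" "j < k" for i j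
    using that by (simp add: index_mult_sum sum_lessThan_add)
  have "A * U1 + G * U2 = U1 * T"
  proof (rule eq_matI)
    fix i j assume "i < dim_row (U1 * T)" "j < dim_col (U1 * T)"
    then have ij: "i < n" "j < k" by auto
    have "(A * U1 + G * U2) $$ (i, j) = (ham n A B C * U) $$ (i, j)"
      using ij by (simp add: s h) (simp add: ham_def G_def)
    also have "\<dots> = (U1 * T) $$ (i, j)" unfolding HU using ij by (simp add: index_mult_sum U1_def)
    finally show "(A * U1 + G * U2) $$ (i, j) = (U1 * T) $$ (i, j)" .
  qed auto
  then show "A * U1 + \<i> \<cdot>\<^sub>m (B * (adj B * U2)) = U1 * T" by (simp add: G_def mat_simps)
  have "Q * U1 + adj A * U2 = U2 * T"
  proof (rule eq_matI)
    fix i j assume "i < dim_row (U2 * T)" "j < dim_col (U2 * T)"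
    then have ij: "i < n" "j < k" by auto
    have "(Q * U1 + adj A * U2) $$ (i, j) = (ham n A B C * U) $$ (n + i, j)"
      using ij by (simp add: s h) (simp add: ham_def Q_def)
    also have "\<dots> = (U2 * T) $$ (i, j)" unfolding HU using ij by (simp add: index_mult_sum U2_def)
    finally show "(Q * U1 + adj A * U2) $$ (i, j) = (U2 * T) $$ (i, j)" .
  qed auto
  then show "(- \<i>) \<cdot>\<^sub>m (adj C * (C * U1)) + adj A * U2 = U2 * T" by (simp add: Q_def mat_simps)
qed

lemma stack_zero:
  fixes x :: "complex mat"
  assumes U: "U \<in> carrier_mat (n + n) k" and x: "x \<in> carrier_mat k 1"
    and 1: "Matrix.mat n k (\<lambda>(i, j). U $$ (i, j)) * x = 0\<^sub>m n 1"
    and 2: "Matrix.mat n k (\<lambda>(i, j). U $$ (n + i, j)) * x = 0\<^sub>m n 1"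
  shows "U * x = 0\<^sub>m (n + n) 1"
proof (rule eq_matI)
  note [simp] = carrier_matD[OF U] carrier_matD[OF x]
  fix i j assume "i < dim_row (0\<^sub>m (n + n) 1 :: complex mat)" "j < dim_col (0\<^sub>m (n + n) 1 :: complex mat)"
  then have ij: "i < n + n" "j = 0" by auto
  show "(U * x) $$ (i, j) = 0\<^sub>m (n + n) 1 $$ (i, j)"
  proof (cases "i < n")
    case True
    then show ?thesis using arg_cong[OF 1, of "\<lambda>M. M $$ (i, 0)"] ij by (simp add: index_mult_sum)
  next
    case False
    then show ?thesis using arg_cong[OF 2, of "\<lambda>M. M $$ (i - n, 0)"] ij by (simp add: index_mult_sum)
  qed
qed (use carrier_matD[OF U] carrier_matD[OF x] in auto)

text \<open>For an eigenvector \<open>(x, y)\<close> at a real point,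
  \<open>u = \<i> adj B y\<close> is an input with state \<open>x\<close>, and pairing the second
  block with \<open>x\<close> gives \<open>|C x| = |u|\<close>. Strict contractivity forces
  \<open>u = 0\<close>; then \<open>x\<close> and \<open>y\<close>, unless 0, would be eigenvectors
  of \<open>A\<close> and \<open>adj A\<close> at a real point.\<close>

lemma ham_no_real_eigenvalue:
  assumes A: "A \<in> carrier_mat n n" and B: "B \<in> carrier_mat n m" and C: "C \<in> carrier_mat p n"
    and nr: "\<And>l. complex_of_real l \<notin> spectrum A"
    and contr: "\<And>l x u. x \<in> carrier_mat n 1 \<Longrightarrow> u \<in> carrier_mat m 1 \<Longrightarrow>
      complex_of_real l \<cdot>\<^sub>m x - A * x = B * u \<Longrightarrow> u \<noteq> 0\<^sub>m m 1 \<Longrightarrow> nrm2 (C * x) < nrm2 u"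
    and mu: "\<mu> \<in> spectrum (ham n A B C)"
  shows "Im \<mu> \<noteq> 0"
proof
  assume "Im \<mu> = 0"
  then obtain l where l: "\<mu> = complex_of_real l" by (metis complex_is_Real_iff Reals_cases)
  note [simp] = carrier_matD[OF A] carrier_matD[OF B] carrier_matD[OF C]
  obtain w where w: "w \<in> carrier_mat (n + n) 1" and w0: "w \<noteq> 0\<^sub>m (n + n) 1" and Hw: "ham n A B C * w = \<mu> \<cdot>\<^sub>m w"
    using mu unfolding spectrum_iff[OF ham_carrier] by auto
  note [simp] = carrier_matD[OF w]
  have T: "\<mu> \<cdot>\<^sub>m 1\<^sub>m 1 \<in> carrier_mat 1 1" by simp
  have HU: "ham n A B C * w = w * (\<mu> \<cdot>\<^sub>m 1\<^sub>m 1)" by (simp add: Hw mat_simps)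
  define x where "x = Matrix.mat n 1 (\<lambda>(i, j). w $$ (i, j))"
  define y where "y = Matrix.mat n 1 (\<lambda>(i, j). w $$ (n + i, j))"
  have d [simp]: "dim_row x = n" "dim_col x = 1" "dim_row y = n" "dim_col y = 1" by (auto simp: x_def y_def)
  have xc: "x \<in> carrier_mat n 1" and yc: "y \<in> carrier_mat n 1" by (auto simp: carrier_iff)
  note hb = ham_blocks[OF A B C w T HU, folded x_def y_def]
  have 1: "A * x + \<i> \<cdot>\<^sub>m (B * (adj B * y)) = \<mu> \<cdot>\<^sub>m x" using hb(1) by (simp add: mat_simps)
  have 2: "(- \<i>) \<cdot>\<^sub>m (adj C * (C * x)) + adj A * y = \<mu> \<cdot>\<^sub>m y" using hb(2) by (simp add: mat_simps)
  define u where "u = \<i> \<cdot>\<^sub>m (adj B * y)"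
  have ud [simp]: "dim_row u = m" "dim_col u = 1" and uc: "u \<in> carrier_mat m 1" by (auto simp: u_def carrier_iff)
  have xu: "\<mu> \<cdot>\<^sub>m x - A * x = B * u"
    unfolding 1[symmetric] by (rule eq_matI) (auto simp: u_def mult_smult_dim)
  have yu: "adj y * (\<mu> \<cdot>\<^sub>m x - A * x) = \<i> \<cdot>\<^sub>m (adj u * u)"
    unfolding xu by (simp add: u_def mat_simps)
  have "\<mu> \<cdot>\<^sub>m y - adj A * y = (- \<i>) \<cdot>\<^sub>m (adj C * (C * x))"
    unfolding 2[symmetric] by (rule eq_matI) auto
  then have "adj (\<mu> \<cdot>\<^sub>m y - adj A * y) * x = \<i> \<cdot>\<^sub>m (adj (C * x) * (C * x))"
    by (simp add: mat_simps)
  moreover have "adj (\<mu> \<cdot>\<^sub>m y - adj A * y) * x = adj y * (\<mu> \<cdot>\<^sub>m x - A * x)"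
    by (simp add: mat_simps l)
  ultimately have "\<i> \<cdot>\<^sub>m (adj (C * x) * (C * x)) = \<i> \<cdot>\<^sub>m (adj u * u)" using yu by simp
  from arg_cong[OF this, of "\<lambda>M. M $$ (0, 0)"] have "nrm2 (C * x) = nrm2 u"
    by (simp add: adj_self_nrm2)
  then have u0: "u = 0\<^sub>m m 1" using contr[OF xc uc xu[unfolded l]] by (metis less_irrefl)
  have "x = 0\<^sub>m n 1"
  proof (rule ccontr)
    assume x0: "x \<noteq> 0\<^sub>m n 1"
    have "\<mu> \<cdot>\<^sub>m x - A * x = 0\<^sub>m n 1" unfolding xu u0 by (simp add: mult_zero_dim)
    then have "A * x = \<mu> \<cdot>\<^sub>m x" by (subst (asm) minus_zero_iff) (auto simp: carrier_iff)
    then have "\<mu> \<in> spectrum A" unfolding spectrum_iff[OF A] using xc x0 by (intro bexI[of _ x] conjI)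
    then show False using nr l by simp
  qed
  have "y = 0\<^sub>m n 1"
  proof (rule ccontr)
    assume y0: "y \<noteq> 0\<^sub>m n 1"
    have "(- \<i>) \<cdot>\<^sub>m (adj C * (C * x)) + adj A * y = adj A * y"
      unfolding \<open>x = 0\<^sub>m n 1\<close> by (simp add: mult_zero_dim) (rule eq_matI, auto)
    then have "adj A * y = \<mu> \<cdot>\<^sub>m y" using 2 by simp
    then have "\<mu> \<in> spectrum (adj A)"
      unfolding spectrum_iff[OF adj_carrier[OF A]] using yc y0 by (intro bexI[of _ y] conjI)
    then show False using nr[of l] spectrum_adj[OF A, of \<mu>] l by simp
  qed
  have "w = 0\<^sub>m (n + n) 1"
  proof (rule eq_matI)
    fix i j assume "i < dim_row (0\<^sub>m (n + n) 1 :: complex mat)" "j < dim_col (0\<^sub>m (n + n) 1 :: complex mat)"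
    then have ij: "i < n + n" "j = 0" by auto
    show "w $$ (i, j) = 0\<^sub>m (n + n) 1 $$ (i, j)"
      using arg_cong[OF \<open>x = 0\<^sub>m n 1\<close>, of "\<lambda>M. M $$ (i, 0)"] arg_cong[OF \<open>y = 0\<^sub>m n 1\<close>, of "\<lambda>M. M $$ (i - n, 0)"] ij
      by (cases "i < n") (auto simp: x_def y_def)
  qed auto
  then show False using w0 by simp
qed

text \<open>The spectrum of \<open>T\<close> is disjoint from its complex conjugate, so a Sylvester
  equation makes \<open>adj U1 * U2\<close> Hermitian. This gives \<open>adj B * U2 = 0\<close> on
  the kernel of \<open>U1\<close> and makes that kernel \<open>T\<close>-invariant, so
  controllability reduces it to 0. For \<open>k = n\<close> the subspace is therefore a graph, with
  \<open>X = U2 U1^-1\<close>.\<close>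

lemma ham_lagrangian:
  assumes A: "A \<in> carrier_mat n n" and B: "B \<in> carrier_mat n m" and C: "C \<in> carrier_mat p n"
    and AB: "pbh n A B"
    and U1: "U1 \<in> carrier_mat n k" and U2: "U2 \<in> carrier_mat n k" and T: "T \<in> carrier_mat k k"
    and e1: "A * U1 + \<i> \<cdot>\<^sub>m (B * (adj B * U2)) = U1 * T"
    and e2: "(- \<i>) \<cdot>\<^sub>m (adj C * (C * U1)) + adj A * U2 = U2 * T"
    and inj: "\<And>x. x \<in> carrier_mat k 1 \<Longrightarrow> U1 * x = 0\<^sub>m n 1 \<Longrightarrow> U2 * x = 0\<^sub>m n 1 \<Longrightarrow> x = 0\<^sub>m k 1"
    and sp: "\<And>\<mu> \<nu>. \<mu> \<in> spectrum T \<Longrightarrow> \<nu> \<in> spectrum T \<Longrightarrow> \<mu> \<noteq> cnj \<nu>"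
  shows "k \<le> n"
    and "k = n \<Longrightarrow> \<exists>X. ric n A B (adj C * C) X \<and> spectrum (closed_loop A B X) \<subseteq> spectrum T"
proof -
  note [simp] = carrier_matD[OF A] carrier_matD[OF B] carrier_matD[OF C] carrier_matD[OF U1]
    carrier_matD[OF U2] carrier_matD[OF T]
  define W where "W = adj U1 * U2 - adj U2 * U1"
  have Wd [simp]: "dim_row W = k" "dim_col W = k" and W: "W \<in> carrier_mat k k" by (auto simp: W_def carrier_iff)
  have "W * T = adj U1 * (U2 * T) - adj U2 * (U1 * T)" by (simp add: W_def mat_simps)
  also have "\<dots> = adj (U1 * T) * U2 - adj (U2 * T) * U1"
    unfolding e1[symmetric] e2[symmetric]
    by (simp add: mat_simps) (rule eq_matI, auto simp: algebra_simps)
  also have "\<dots> = adj T * W" by (simp add: W_def mat_simps)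
  finally have WT: "W * T = adj T * W" .
  have "spectrum (adj T) \<inter> spectrum T = {}"
    using sp spectrum_adj[OF T] complex_cnj_cnj by (metis disjoint_iff)
  then have "W = 0\<^sub>m k k" using sylvester_zero[OF T adj_carrier[OF T] W WT] by simp
  then have comm: "adj U1 * U2 = adj U2 * U1"
    unfolding W_def by (subst (asm) minus_zero_iff) (auto simp: carrier_iff)
  define K where "K = {x \<in> carrier_mat k 1. U1 * x = 0\<^sub>m n 1}"
  have K: "subspace_mat k K"
    by (rule subspace_matI) (auto simp: K_def mat_simps carrier_iff intro!: eq_matI)
  have BK: "adj B * (U2 * x) = 0\<^sub>m m 1" and TK: "T * x \<in> K" if x: "x \<in> K" for x
  proof -
    have xc: "x \<in> carrier_mat k 1" and Ux: "U1 * x = 0\<^sub>m n 1" using x by (auto simp: K_def)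
    note [simp] = carrier_matD[OF xc]
    have f: "\<i> \<cdot>\<^sub>m (B * (adj B * (U2 * x))) = U1 * (T * x)"
    proof -
      have "U1 * (T * x) = (U1 * T) * x" by (simp add: mat_simps)
      also have "\<dots> = A * (U1 * x) + \<i> \<cdot>\<^sub>m (B * (adj B * (U2 * x)))" unfolding e1[symmetric] by (simp add: mat_simps)
      also have "\<dots> = \<i> \<cdot>\<^sub>m (B * (adj B * (U2 * x)))" unfolding Ux by (simp add: mat_simps) (rule eq_matI, auto)
      finally show ?thesis by (rule sym)
    qed
    have "\<i> \<cdot>\<^sub>m (adj (adj B * (U2 * x)) * (adj B * (U2 * x))) = adj x * (adj U2 * (\<i> \<cdot>\<^sub>m (B * (adj B * (U2 * x)))))"
      by (simp add: mat_simps)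
    also have "\<dots> = adj x * ((adj U2 * U1) * (T * x))" unfolding f by (simp add: mat_simps)
    also have "\<dots> = adj (U1 * x) * (U2 * (T * x))" unfolding comm[symmetric] by (simp add: mat_simps)
    also have "\<dots> = 0\<^sub>m 1 1" unfolding Ux by (simp add: mat_simps)
    finally have z: "\<i> \<cdot>\<^sub>m (adj (adj B * (U2 * x)) * (adj B * (U2 * x))) = 0\<^sub>m 1 1" .
    from arg_cong[OF z, of "\<lambda>M. M $$ (0, 0)"] have "nrm2 (adj B * (U2 * x)) = 0"
      by (simp add: adj_self_nrm2)
    then show b: "adj B * (U2 * x) = 0\<^sub>m m 1" by (subst (asm) nrm2_zero_iff[of _ m]) (auto simp: carrier_iff)
    have "U1 * (T * x) = 0\<^sub>m n 1" unfolding f[symmetric] b by (simp add: mat_simps)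
    then show "T * x \<in> K" by (simp add: K_def carrier_iff)
  qed
  have inj1: "x = 0\<^sub>m k 1" if xc: "x \<in> carrier_mat k 1" and Ux: "U1 * x = 0\<^sub>m n 1" for x
  proof (rule ccontr)
    assume x0: "x \<noteq> 0\<^sub>m k 1"
    have xK: "x \<in> K" using xc Ux by (simp add: K_def)
    obtain y \<mu> where y: "y \<in> K" "y \<noteq> 0\<^sub>m k 1" "T * y = \<mu> \<cdot>\<^sub>m y"
      by (rule invariant_subspace_eigenvector[OF T K TK xK x0])
    have yc: "y \<in> carrier_mat k 1" and Uy: "U1 * y = 0\<^sub>m n 1" using y(1) by (auto simp: K_def)
    note [simp] = carrier_matD[OF yc]
    have "(U2 * T) * y = adj A * (U2 * y)"
      unfolding e2[symmetric] by (simp add: mat_simps Uy) (rule eq_matI, auto)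
    then have "adj A * (U2 * y) = \<mu> \<cdot>\<^sub>m (U2 * y)" by (simp add: mat_simps y(3))
    then have "U2 * y = 0\<^sub>m n 1" by (intro pbhD[OF AB _ _ B BK[OF y(1)]]) (auto simp: carrier_iff)
    then show False using inj[OF yc Uy] y(2) by simp
  qed
  show "k \<le> n" by (rule injective_dim_le[OF U1 inj1])
  assume kn: "k = n"
  have U1n: "U1 \<in> carrier_mat n n" using U1 kn by simp
  have "Determinant.det U1 \<noteq> 0" unfolding det_nonzero_iff[OF U1n] using inj1 kn by simp
  note I = mat_inv_props[OF U1n this]
  define V where "V = mat_inv U1"
  have Vd [simp]: "dim_row V = n" "dim_col V = n" using carrier_matD[OF I(1)] by (auto simp: V_def)
  have UV: "U1 * V = 1\<^sub>m n" and VU: "V * U1 = 1\<^sub>m n" using I by (auto simp: V_def)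
  have UV': "U1 * (V * Z) = Z" if "dim_row Z = n" for Z
    using that kn by (simp add: mult_assoc_dim[symmetric] UV one_mult_dim)
  define X where "X = U2 * V"
  have Xd [simp]: "dim_row X = n" "dim_col X = n" by (auto simp: X_def)
  note [simp] = kn
  have "adj V * (adj U1 * U2) * V = adj V * (adj U2 * U1) * V" using comm by simp
  moreover have "adj V * (adj U1 * U2) * V = adj (U1 * V) * (U2 * V)" by (simp add: mat_simps)
  moreover have "adj V * (adj U2 * U1) * V = adj (U2 * V) * (U1 * V)" by (simp add: mat_simps)
  ultimately have hX: "adj X = X" by (simp add: X_def UV adj_one one_mult_dim mult_one_dim)
  have cl: "closed_loop A B X = U1 * (T * V)"
  proof -
    have "U1 * (T * V) = (U1 * T) * V" by (simp add: mat_simps)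
    also have "\<dots> = A * (U1 * V) + \<i> \<cdot>\<^sub>m (B * (adj B * X))" unfolding e1[symmetric] by (simp add: X_def mat_simps)
    finally show ?thesis by (simp add: UV mult_one_dim closed_loop_def)
  qed
  have XA: "X * closed_loop A B X = (- \<i>) \<cdot>\<^sub>m (adj C * C) + adj A * X"
  proof -
    have "X * closed_loop A B X = U2 * ((V * U1) * (T * V))" unfolding cl by (simp add: X_def mat_simps)
    also have "\<dots> = (U2 * T) * V" by (simp add: VU mat_simps)
    also have "\<dots> = (- \<i>) \<cdot>\<^sub>m (adj C * (C * (U1 * V))) + adj A * X"
      unfolding e2[symmetric] by (simp add: X_def mat_simps)
    finally show ?thesis by (simp add: UV mult_one_dim)
  qed
  have "\<i> \<cdot>\<^sub>m (X * A - adj A * X) = adj C * C + X * (B * (adj B * X))"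
  proof (rule eq_matI)
    fix i j assume "i < dim_row (adj C * C + X * (B * (adj B * X)))" "j < dim_col (adj C * C + X * (B * (adj B * X)))"
    then have ij: "i < n" "j < n" by auto
    have e: "(X * A) $$ (i, j) + \<i> * (X * (B * (adj B * X))) $$ (i, j) =
        - (\<i> * (adj C * C) $$ (i, j)) + (adj A * X) $$ (i, j)"
      using arg_cong[OF XA, of "\<lambda>M. M $$ (i, j)"] ij by (simp add: closed_loop_def mult_add_dim mult_smult_dim)
    have "(X * A) $$ (i, j) - (adj A * X) $$ (i, j) =
        - (\<i> * (adj C * C) $$ (i, j)) - \<i> * (X * (B * (adj B * X))) $$ (i, j)"
      using e by (simp add: algebra_simps)
    then have "\<i> * ((X * A) $$ (i, j) - (adj A * X) $$ (i, j)) =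
        (adj C * C) $$ (i, j) + (X * (B * (adj B * X))) $$ (i, j)"
      by (simp only:) (simp add: algebra_simps)
    then show "(\<i> \<cdot>\<^sub>m (X * A - adj A * X)) $$ (i, j) = (adj C * C + X * (B * (adj B * X))) $$ (i, j)"
      using ij by simp
  qed auto
  then have "ric n A B (adj C * C) X" by (simp add: ric_def hX carrier_iff)
  moreover have "spectrum (closed_loop A B X) \<subseteq> spectrum T"
  proof
    fix \<mu> assume "\<mu> \<in> spectrum (closed_loop A B X)"
    moreover have clc: "closed_loop A B X \<in> carrier_mat n n" by (simp add: closed_loop_def carrier_iff)
    ultimately obtain w where w: "w \<in> carrier_mat n 1" "w \<noteq> 0\<^sub>m n 1" "closed_loop A B X * w = \<mu> \<cdot>\<^sub>m w"
      unfolding spectrum_iff[OF clc] by auto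
    note [simp] = carrier_matD[OF w(1)]
    have "T * (V * w) = (V * U1) * (T * (V * w))" by (simp add: VU one_mult_dim)
    also have "\<dots> = V * (closed_loop A B X * w)" unfolding cl by (simp add: mult_assoc_dim)
    finally have "T * (V * w) = \<mu> \<cdot>\<^sub>m (V * w)" by (simp add: w(3) mult_smult_dim)
    moreover have "V * w \<noteq> 0\<^sub>m n 1"
    proof
      assume "V * w = 0\<^sub>m n 1"
      then have "U1 * (V * w) = 0\<^sub>m n 1" by (simp add: mult_zero_dim)
      then show False using w(2) UV'[of w] by simp
    qed
    moreover have "V * w \<in> carrier_mat n 1" "T \<in> carrier_mat n n" by (simp_all add: carrier_iff)
    ultimately show "\<mu> \<in> spectrum T" unfolding spectrum_iff[OF \<open>T \<in> carrier_mat n n\<close>] by (intro bexI[of _ "V * w"] conjI)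
  qed
  ultimately show "\<exists>X. ric n A B (adj C * C) X \<and> spectrum (closed_loop A B X) \<subseteq> spectrum T" by blast
qed

lemma ham_half_plane:
  assumes A: "A \<in> carrier_mat n n" and B: "B \<in> carrier_mat n m" and C: "C \<in> carrier_mat p n"
    and AB: "pbh n A B" and es: "char_poly (ham n A B C) = (\<Prod>a\<leftarrow>es @ fs. [:- a, 1:])"
    and sp: "\<And>\<mu> \<nu>. \<mu> \<in> set es \<Longrightarrow> \<nu> \<in> set es \<Longrightarrow> \<mu> \<noteq> cnj \<nu>" and len: "length (es @ fs) = n + n"
  shows "length es \<le> n"
    and "length es = n \<Longrightarrow> \<exists>X. ric n A B (adj C * C) X \<and> spectrum (closed_loop A B X) \<subseteq> set es"
proof -
  obtain U T where U: "U \<in> carrier_mat (n + n) (length es)" and T: "T \<in> carrier_mat (length es) (length es)"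
    and HU: "ham n A B C * U = U * T"
    and inj: "\<And>x. x \<in> carrier_mat (length es) 1 \<Longrightarrow> U * x = 0\<^sub>m (n + n) 1 \<Longrightarrow> x = 0\<^sub>m (length es) 1"
    and spT: "spectrum T \<subseteq> set (take (length es) (es @ fs))"
    by (rule schur_invariant_block[OF ham_carrier es, of "length es"]) (use len in auto)
  have spT': "spectrum T \<subseteq> set es" using spT by simp
  note hb = ham_blocks[OF A B C U T HU]
  have inj': "x = 0\<^sub>m (length es) 1" if x: "x \<in> carrier_mat (length es) 1"
    and z: "Matrix.mat n (length es) (\<lambda>(i, j). U $$ (i, j)) * x = 0\<^sub>m n 1"
      "Matrix.mat n (length es) (\<lambda>(i, j). U $$ (n + i, j)) * x = 0\<^sub>m n 1" for x
    by (rule inj[OF x stack_zero[OF U x z]])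
  have sp': "\<mu> \<noteq> cnj \<nu>" if "\<mu> \<in> spectrum T" "\<nu> \<in> spectrum T" for \<mu> \<nu>
    using sp[of \<mu> \<nu>] spT' that by auto
  note L = ham_lagrangian[OF A B C AB mat_carrier mat_carrier T hb]
  show "length es \<le> n" by (rule L(1), erule (2) inj', erule (1) sp')
  show "\<exists>X. ric n A B (adj C * C) X \<and> spectrum (closed_loop A B X) \<subseteq> set es" if "length es = n"
  proof -
    have "\<exists>X. ric n A B (adj C * C) X \<and> spectrum (closed_loop A B X) \<subseteq> spectrum T"
      by (rule L(2), erule (2) inj', erule (1) sp', rule that)
    then show ?thesis using spT' by (meson order_trans)
  qed
qed

lemma prod_list_filter_compl:
  fixes f :: "'a \<Rightarrow> 'b::comm_monoid_mult"
  shows "(\<Prod>a\<leftarrow>xs. f a) = (\<Prod>a\<leftarrow>filter P xs. f a) * (\<Prod>a\<leftarrow>filter (\<lambda>a. \<not> P a) xs. f a)"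
  by (induction xs) (auto simp: ac_simps)

text \<open>The eigenvalues off the real axis split into two half-planes. Each half supplies an
  invariant subspace of dimension at most \<open>n\<close> by \<open>ham_half_plane\<close>; as the
  total is \<open>2n\<close>, both dimensions are \<open>n\<close>. No appeal to the symmetry of the
  Hamiltonian spectrum is made.\<close>

lemma riccati_strict:
  assumes A: "A \<in> carrier_mat n n" and B: "B \<in> carrier_mat n m" and C: "C \<in> carrier_mat p n"
    and AB: "pbh n A B" and nr: "\<And>\<mu>. \<mu> \<in> spectrum (ham n A B C) \<Longrightarrow> Im \<mu> \<noteq> 0"
  shows "\<exists>X. ric n A B (adj C * C) X \<and> (\<forall>\<mu>\<in>spectrum (closed_loop A B X). Im \<mu> < 0)"
    and "\<exists>X. ric n A B (adj C * C) X \<and> (\<forall>\<mu>\<in>spectrum (closed_loop A B X). Im \<mu> > 0)"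
proof -
  obtain es where es: "char_poly (ham n A B C) = (\<Prod>a\<leftarrow>es. [:- a, 1:])" and len: "length es = n + n"
    using char_poly_factorized[OF ham_carrier] by blast
  have nr': "Im e \<noteq> 0" if "e \<in> set es" for e
  proof -
    have "poly (char_poly (ham n A B C)) e = 0"
      unfolding es poly_prod_list using that by (auto simp: prod_list_zero_iff image_iff intro!: bexI[of _ e])
    then show ?thesis using nr spectrum_root_char_poly[OF ham_carrier] by auto
  qed
  define L where "L = filter (\<lambda>e. Im e < 0) es"
  define R where "R = filter (\<lambda>e. \<not> Im e < 0) es"
  have split: "(\<Prod>a\<leftarrow>es. [:- a, 1:]) = (\<Prod>a\<leftarrow>L. [:- a, 1:]) * (\<Prod>a\<leftarrow>R. [:- a, 1:])"
    unfolding L_def R_def by (rule prod_list_filter_compl)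
  have lenLR: "length L + length R = n + n"
    unfolding L_def R_def len[symmetric] by (rule sum_length_filter_compl)
  have 1: "char_poly (ham n A B C) = (\<Prod>a\<leftarrow>L @ R. [:- a, 1:])" unfolding es split by simp
  have 2: "char_poly (ham n A B C) = (\<Prod>a\<leftarrow>R @ L. [:- a, 1:])" unfolding es split by (simp add: mult.commute)
  have spL: "\<mu> \<noteq> cnj \<nu>" if "\<mu> \<in> set L" "\<nu> \<in> set L" for \<mu> \<nu> using that by (auto simp: L_def)
  have spR: "\<mu> \<noteq> cnj \<nu>" if "\<mu> \<in> set R" "\<nu> \<in> set R" for \<mu> \<nu>
    using that nr'[of \<mu>] by (auto simp: R_def)
  note hL = ham_half_plane[OF A B C AB 1 spL] and hR = ham_half_plane[OF A B C AB 2 spR]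
  have "length L \<le> n" "length R \<le> n" using hL(1) hR(1) lenLR by auto
  then have "length L = n" "length R = n" using lenLR by auto
  then have "\<exists>X. ric n A B (adj C * C) X \<and> spectrum (closed_loop A B X) \<subseteq> set L"
    "\<exists>X. ric n A B (adj C * C) X \<and> spectrum (closed_loop A B X) \<subseteq> set R" using hL(2) hR(2) by auto
  moreover have "Im e < 0" if "e \<in> set L" for e using that by (auto simp: L_def)
  moreover have "Im e > 0" if "e \<in> set R" for e using that nr'[of e] by (auto simp: R_def)
  ultimately show "\<exists>X. ric n A B (adj C * C) X \<and> (\<forall>\<mu>\<in>spectrum (closed_loop A B X). Im \<mu> < 0)"
    "\<exists>X. ric n A B (adj C * C) X \<and> (\<forall>\<mu>\<in>spectrum (closed_loop A B X). Im \<mu> > 0)" by blast+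
qed

subsection \<open>The limit of vanishing strictness\<close>

text \<open>Dimensions are fixed for every argument and not just eventually, so that the limit rules
  for products and sums have no further side conditions.\<close>

definition mtendsto ::
  "nat \<Rightarrow> nat \<Rightarrow> ('a \<Rightarrow> complex mat) \<Rightarrow> complex mat \<Rightarrow> 'a filter \<Rightarrow> bool" where
  "mtendsto n m F L net \<longleftrightarrow> (\<forall>x. F x \<in> carrier_mat n m) \<and> L \<in> carrier_mat n m \<and>
     (\<forall>i<n. \<forall>j<m. ((\<lambda>x. F x $$ (i, j)) \<longlongrightarrow> L $$ (i, j)) net)"

lemma mtendstoD:
  assumes "mtendsto n m F L net"
  shows "F x \<in> carrier_mat n m" "L \<in> carrier_mat n m"
    "i < n \<Longrightarrow> j < m \<Longrightarrow> ((\<lambda>x. F x $$ (i, j)) \<longlongrightarrow> L $$ (i, j)) net"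
  using assms by (auto simp: mtendsto_def)

lemma mtendsto_const: "L \<in> carrier_mat n m \<Longrightarrow> mtendsto n m (\<lambda>x. L) L net"
  by (auto simp: mtendsto_def)

lemma mtendsto_mult:
  assumes F: "mtendsto n k F L net" and G: "mtendsto k m G M net"
  shows "mtendsto n m (\<lambda>x. F x * G x) (L * M) net"
  unfolding mtendsto_def
proof (intro conjI allI impI)
  note [simp] = carrier_matD[OF mtendstoD(1)[OF F]] carrier_matD[OF mtendstoD(2)[OF F]]
    carrier_matD[OF mtendstoD(1)[OF G]] carrier_matD[OF mtendstoD(2)[OF G]]
  show "F x * G x \<in> carrier_mat n m" for x by (simp add: carrier_iff)
  show "L * M \<in> carrier_mat n m" by (simp add: carrier_iff)
  fix i j assume ij: "i < n" "j < m"
  have "((\<lambda>x. \<Sum>l<k. F x $$ (i, l) * G x $$ (l, j)) \<longlongrightarrow> (\<Sum>l<k. L $$ (i, l) * M $$ (l, j))) net"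
    by (intro tendsto_sum tendsto_mult mtendstoD(3)[OF F] mtendstoD(3)[OF G]) (use ij in auto)
  then show "((\<lambda>x. (F x * G x) $$ (i, j)) \<longlongrightarrow> (L * M) $$ (i, j)) net"
    using ij by (simp add: index_mult_sum)
qed

lemma mtendsto_add:
  assumes F: "mtendsto n m F L net" and G: "mtendsto n m G M net"
  shows "mtendsto n m (\<lambda>x. F x + G x) (L + M) net"
  unfolding mtendsto_def
  using mtendstoD[OF F] mtendstoD[OF G]
  by (auto simp: carrier_iff intro!: tendsto_intros)

lemma mtendsto_minus:
  assumes F: "mtendsto n m F L net" and G: "mtendsto n m G M net"
  shows "mtendsto n m (\<lambda>x. F x - G x) (L - M) net"
  unfolding mtendsto_def
  using mtendstoD[OF F] mtendstoD[OF G]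
  by (auto simp: carrier_iff intro!: tendsto_intros)

lemma mtendsto_smult:
  assumes F: "mtendsto n m F L net" and c: "(c \<longlongrightarrow> d) net"
  shows "mtendsto n m (\<lambda>x. c x \<cdot>\<^sub>m F x) (d \<cdot>\<^sub>m L) net"
  unfolding mtendsto_def
  using mtendstoD[OF F] c
  by (auto simp: carrier_iff intro!: tendsto_intros)

lemma mtendsto_adj:
  assumes F: "mtendsto n m F L net"
  shows "mtendsto m n (\<lambda>x. adj (F x)) (adj L) net"
  unfolding mtendsto_def
  using mtendstoD[OF F]
  by (auto simp: carrier_iff intro!: tendsto_intros)

lemma mtendsto_unique:
  assumes F: "mtendsto n m F L net" and G: "mtendsto n m F M net" and net: "net \<noteq> bot"
  shows "L = M"
  by (rule eq_matI)
     (use tendsto_unique[OF net mtendstoD(3)[OF F] mtendstoD(3)[OF G]] mtendstoD(2)[OF F] mtendstoD(2)[OF G]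
      in \<open>auto simp: carrier_iff\<close>)

lemma tendsto_det:
  assumes F: "mtendsto n n F L net"
  shows "((\<lambda>x. Determinant.det (F x)) \<longlongrightarrow> Determinant.det L) net"
proof -
  have "((\<lambda>x. \<Sum>p | p permutes {0..<n}. signof p * (\<Prod>i = 0..<n. F x $$ (i, p i))) \<longlongrightarrow>
      (\<Sum>p | p permutes {0..<n}. signof p * (\<Prod>i = 0..<n. L $$ (i, p i)))) net"
    by (intro tendsto_sum tendsto_mult tendsto_const tendsto_prod mtendstoD(3)[OF F])
       (auto simp: permutes_in_image)
  then show ?thesis
    unfolding det_def'[OF mtendstoD(1)[OF F]] det_def'[OF mtendstoD(2)[OF F]] .
qed

definition unit_col :: "nat \<Rightarrow> nat \<Rightarrow> complex mat" where
  "unit_col n i = Matrix.mat n 1 (\<lambda>(a, b). if a = i then 1 else 0)"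

lemma unit_col_carrier [simp]: "unit_col n i \<in> carrier_mat n 1"
  by (simp add: unit_col_def)

lemma dim_unit_col [simp]: "dim_row (unit_col n i) = n" "dim_col (unit_col n i) = 1"
  by (simp_all add: unit_col_def)

lemma unit_col_form:
  assumes X: "X \<in> carrier_mat n n" and ij: "i < n" "j < n"
  shows "(adj (unit_col n i) * (X * unit_col n j)) $$ (0, 0) = X $$ (i, j)"
proof -
  note [simp] = carrier_matD[OF X]
  have "(X * unit_col n j) $$ (k, 0) = X $$ (k, j)" if "k < n" for k
    using that ij by (simp add: index_mult_sum unit_col_def if_distrib cong: if_cong)
  then show ?thesis
    using ij by (simp add: index_mult_sum[of _ "adj _"] unit_col_def if_distrib if_distribR cong: if_cong)
qed

text \<open>Monotone convergence is available for quadratic forms only; this recovers the entries,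
  and thereby a limit matrix, from four values of the form.\<close>

lemma polarization:
  assumes X: "X \<in> carrier_mat n n" and ij: "i < n" "j < n"
  shows "2 * X $$ (i, j) = qf X (unit_col n i + unit_col n j) - \<i> * qf X (unit_col n i + \<i> \<cdot>\<^sub>m unit_col n j)
    - (1 - \<i>) * (qf X (unit_col n i) + qf X (unit_col n j))"
proof -
  note [simp] = carrier_matD[OF X]
  show ?thesis
    by (simp add: qf_def mat_simps unit_col_form[OF X] ij) (simp add: algebra_simps)
qed

lemma qf_hermitian_real:
  assumes X: "X \<in> carrier_mat n n" and h: "adj X = X" and w: "w \<in> carrier_mat n 1"
  shows "qf X w = of_real (Re (qf X w))"
proof -
  note [simp] = carrier_matD[OF X] carrier_matD[OF w]
  have "adj (adj w * (X * w)) = adj w * (X * w)" by (simp add: mat_simps h)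
  from arg_cong[OF this, of "\<lambda>M. M $$ (0, 0)"] have "cnj (qf X w) = qf X w" by (simp add: qf_def)
  then show ?thesis by (simp add: complex_eq_iff)
qed

lemma riccati_exists:
  assumes A: "A \<in> carrier_mat n n" and B: "B \<in> carrier_mat n m" and C: "C \<in> carrier_mat p n"
    and AB: "pbh n A B" and nr: "\<And>l. complex_of_real l \<notin> spectrum A"
    and contr: "\<And>l x u. x \<in> carrier_mat n 1 \<Longrightarrow> u \<in> carrier_mat m 1 \<Longrightarrow>
      complex_of_real l \<cdot>\<^sub>m x - A * x = B * u \<Longrightarrow> nrm2 (C * x) \<le> nrm2 u"
  shows "\<exists>X. ric n A B (adj C * C) X \<and> (\<forall>\<mu>\<in>spectrum (closed_loop A B X). Im \<mu> \<le> 0)"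
proof -
  note [simp] = carrier_matD[OF A] carrier_matD[OF B] carrier_matD[OF C]
  \<comment> \<open>The sequence starts at 1/2 and increases to 1 while staying below it.\<close>
  define r where "r = (\<lambda>k. 1 - 1 / real (k + 2))"
  have r0: "0 \<le> r k" and r1: "r k < 1" for k by (auto simp: r_def field_simps)
  have rmono: "r k \<le> r l" if "k \<le> l" for k l using that by (auto simp: r_def field_simps)
  have rlim: "r \<longlonglongrightarrow> 1"
  proof -
    have "(\<lambda>k. 1 / real (k + 2)) \<longlonglongrightarrow> 0"
      using LIMSEQ_ignore_initial_segment[OF lim_1_over_n, of 2] by simp
    from tendsto_diff[OF tendsto_const this, of 1] show ?thesis by (simp add: r_def)
  qed
  define Cr where "Cr = (\<lambda>k. complex_of_real (r k) \<cdot>\<^sub>m C)"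
  have Cr: "Cr k \<in> carrier_mat p n" for k using C by (simp add: Cr_def)
  note [simp] = carrier_matD[OF Cr]
  have Q: "adj (Cr k) * Cr k \<in> carrier_mat n n" for k by (simp add: carrier_iff)
  have Qeq: "adj (Cr k) * Cr k = complex_of_real ((r k)\<^sup>2) \<cdot>\<^sub>m (adj C * C)" for k
    by (simp add: Cr_def mat_simps power2_eq_square)
  have nrm: "nrm2 (Cr k * x) = (r k)\<^sup>2 * nrm2 (C * x)" if "x \<in> carrier_mat n 1" for k x
    using carrier_matD[OF that]
    by (simp add: Cr_def nrm2_def smult_mult_dim norm_mult power_mult_distrib sum_distrib_left r0 abs_of_nonneg)
  have strict: "Im \<mu> \<noteq> 0" if "\<mu> \<in> spectrum (ham n A B (Cr k))" for \<mu> k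
  proof (rule ham_no_real_eigenvalue[OF A B Cr nr _ that])
    fix l x and u :: "complex mat"
    assume x: "x \<in> carrier_mat n 1" and u: "u \<in> carrier_mat m 1" and u0: "u \<noteq> 0\<^sub>m m 1"
      and xu: "complex_of_real l \<cdot>\<^sub>m x - A * x = B * u"
    have "(r k)\<^sup>2 < 1" using r0 r1 by (simp add: power_less_one_iff abs_square_less_1)
    then have "(r k)\<^sup>2 * nrm2 u < 1 * nrm2 u" by (rule mult_strict_right_mono) (rule nrm2_pos[OF u u0])
    moreover have "(r k)\<^sup>2 * nrm2 (C * x) \<le> (r k)\<^sup>2 * nrm2 u" using contr[OF x u xu] by (intro mult_left_mono) auto
    ultimately show "nrm2 (Cr k * x) < nrm2 u" unfolding nrm[OF x] by simp
  qed
  have ex1: "\<exists>X. ric n A B (adj (Cr k) * Cr k) X \<and> (\<forall>\<mu>\<in>spectrum (closed_loop A B X). Im \<mu> < 0)" for k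
    by (rule riccati_strict(1)[OF A B Cr AB]) (rule strict)
  have ex2: "\<exists>X. ric n A B (adj (Cr k) * Cr k) X \<and> (\<forall>\<mu>\<in>spectrum (closed_loop A B X). Im \<mu> > 0)" for k
    by (rule riccati_strict(2)[OF A B Cr AB]) (rule strict)
  have "\<exists>X. \<forall>k. ric n A B (adj (Cr k) * Cr k) (X k) \<and> (\<forall>\<mu>\<in>spectrum (closed_loop A B (X k)). Im \<mu> < 0)"
    by (intro choice allI ex1)
  then obtain X where X: "\<And>k. ric n A B (adj (Cr k) * Cr k) (X k)"
    and spX: "\<And>k \<mu>. \<mu> \<in> spectrum (closed_loop A B (X k)) \<Longrightarrow> Im \<mu> < 0" by blast
  \<comment> \<open>The anti-stable solution for the smallest \<open>r\<close> is the upper bound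
    for all stable solutions that makes the monotone sequence converge.\<close>
  obtain Z where Z: "ric n A B (adj (Cr 0) * Cr 0) Z"
    and spZ: "\<And>\<mu>. \<mu> \<in> spectrum (closed_loop A B Z) \<Longrightarrow> Im \<mu> > 0" using ex2[of 0] by blast
  have Xc: "X k \<in> carrier_mat n n" and hX: "adj (X k) = X k" for k using X[of k] by (auto simp: ric_def)
  have dQ: "0 \<le> Re (qf (adj (Cr l) * Cr l - adj (Cr k) * Cr k) w)"
    if kl: "k \<le> l" and w: "w \<in> carrier_mat n 1" for k l w
  proof -
    note [simp] = carrier_matD[OF w]
    have q: "(adj w * (adj C * (C * w))) $$ (0, 0) = of_real (nrm2 (C * w))"
      using adj_self_nrm2[of "C * w"] by (simp add: mat_simps)
    have "qf (adj (Cr l) * Cr l - adj (Cr k) * Cr k) w = of_real (((r l)\<^sup>2 - (r k)\<^sup>2) * nrm2 (C * w))"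
      unfolding Qeq by (simp add: qf_def mat_simps q algebra_simps)
    moreover have "(r k)\<^sup>2 \<le> (r l)\<^sup>2" using rmono[OF kl] r0 by (intro power_mono)
    ultimately show ?thesis by simp
  qed
  have conv: "\<exists>L. (\<lambda>k. qf (X k) w) \<longlonglongrightarrow> L" if w: "w \<in> carrier_mat n 1" for w
  proof -
    have "incseq (\<lambda>k. Re (qf (X k) w))"
      by (intro incseq_SucI riccati_comparison(1)[OF A B Q Q X X dQ w spX]) auto
    moreover have "Re (qf (X k) w) \<le> Re (qf Z w)" for k
      by (rule riccati_comparison(2)[OF A B Q Q Z X dQ w spZ]) auto
    ultimately obtain L where "(\<lambda>k. Re (qf (X k) w)) \<longlonglongrightarrow> L"
      using incseq_convergent[of "\<lambda>k. Re (qf (X k) w)" "Re (qf Z w)"] by metis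
    then have "(\<lambda>k. complex_of_real (Re (qf (X k) w))) \<longlonglongrightarrow> of_real L" by (rule tendsto_of_real)
    then show ?thesis using qf_hermitian_real[OF Xc hX w, symmetric] by (simp only:) blast
  qed
  have conv': "\<exists>L. (\<lambda>k. X k $$ (i, j)) \<longlonglongrightarrow> L" if ij: "i < n" "j < n" for i j
  proof -
    obtain L1 where L1: "(\<lambda>k. qf (X k) (unit_col n i + unit_col n j)) \<longlonglongrightarrow> L1"
      using conv[of "unit_col n i + unit_col n j"] by (auto simp: carrier_iff)
    obtain L2 where L2: "(\<lambda>k. qf (X k) (unit_col n i + \<i> \<cdot>\<^sub>m unit_col n j)) \<longlonglongrightarrow> L2"
      using conv[of "unit_col n i + \<i> \<cdot>\<^sub>m unit_col n j"] by (auto simp: carrier_iff)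
    obtain L3 where L3: "(\<lambda>k. qf (X k) (unit_col n i)) \<longlonglongrightarrow> L3"
      using conv[OF unit_col_carrier] by blast
    obtain L4 where L4: "(\<lambda>k. qf (X k) (unit_col n j)) \<longlonglongrightarrow> L4"
      using conv[OF unit_col_carrier] by blast
    have "(\<lambda>k. (qf (X k) (unit_col n i + unit_col n j) - \<i> * qf (X k) (unit_col n i + \<i> \<cdot>\<^sub>m unit_col n j)
      - (1 - \<i>) * (qf (X k) (unit_col n i) + qf (X k) (unit_col n j))) / 2) \<longlonglongrightarrow> (L1 - \<i> * L2 - (1 - \<i>) * (L3 + L4)) / 2"
      by (intro tendsto_intros L1 L2 L3 L4) auto
    then have "(\<lambda>k. X k $$ (i, j)) \<longlonglongrightarrow> (L1 - \<i> * L2 - (1 - \<i>) * (L3 + L4)) / 2"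
      unfolding polarization[OF Xc ij, symmetric] by simp
    then show ?thesis by blast
  qed
  define Y where "Y = Matrix.mat n n (\<lambda>(i, j). lim (\<lambda>k. X k $$ (i, j)))"
  have XY: "mtendsto n n X Y sequentially"
    unfolding mtendsto_def
  proof (intro conjI allI impI)
    fix i j assume ij: "i < n" "j < n"
    then show "(\<lambda>k. X k $$ (i, j)) \<longlonglongrightarrow> Y $$ (i, j)"
      using conv'[OF ij] by (auto simp: Y_def limI)
  qed (auto simp: Xc Y_def)
  have Y: "Y \<in> carrier_mat n n" by (rule mtendstoD(2)[OF XY])
  note [simp] = carrier_matD[OF Y]
  have AY: "mtendsto n n (\<lambda>_. A) A sequentially" by (rule mtendsto_const[OF A])
  have aA: "mtendsto n n (\<lambda>_. adj A) (adj A) sequentially" by (rule mtendsto_const) (use A in simp)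
  have BB: "mtendsto n m (\<lambda>_. B) B sequentially" by (rule mtendsto_const[OF B])
  have aB: "mtendsto m n (\<lambda>_. adj B) (adj B) sequentially" by (rule mtendsto_const) (use B in simp)
  have hY: "adj Y = Y"
    by (rule mtendsto_unique[OF mtendsto_adj[OF XY]]) (use XY hX in auto)
  have CC: "mtendsto n n (\<lambda>k. adj (Cr k) * Cr k) (adj C * C) sequentially"
  proof -
    have "(\<lambda>k. complex_of_real ((r k)\<^sup>2)) \<longlonglongrightarrow> complex_of_real (1\<^sup>2)"
      by (intro tendsto_intros rlim)
    moreover have "mtendsto n n (\<lambda>_. adj C * C) (adj C * C) sequentially"
      by (rule mtendsto_const) (simp add: carrier_iff)
    ultimately have "mtendsto n n (\<lambda>k. complex_of_real ((r k)\<^sup>2) \<cdot>\<^sub>m (adj C * C)) (complex_of_real (1\<^sup>2) \<cdot>\<^sub>m (adj C * C)) sequentially"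
      by (intro mtendsto_smult)
    then show ?thesis unfolding Qeq by (simp add: smult_one_mat)
  qed
  have BX: "mtendsto n n (\<lambda>k. B * (adj B * X k)) (B * (adj B * Y)) sequentially"
    by (intro mtendsto_mult[OF BB] mtendsto_mult[OF aB] XY)
  have "\<i> \<cdot>\<^sub>m (Y * A - adj A * Y) = adj C * C + Y * (B * (adj B * Y))"
  proof (rule mtendsto_unique)
    show "mtendsto n n (\<lambda>k. \<i> \<cdot>\<^sub>m (X k * A - adj A * X k)) (\<i> \<cdot>\<^sub>m (Y * A - adj A * Y)) sequentially"
      by (intro mtendsto_smult tendsto_const mtendsto_minus mtendsto_mult[OF XY AY] mtendsto_mult[OF aA XY])
    have "mtendsto n n (\<lambda>k. adj (Cr k) * Cr k + X k * (B * (adj B * X k))) (adj C * C + Y * (B * (adj B * Y))) sequentially"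
      by (intro mtendsto_add CC mtendsto_mult[OF XY BX])
    then show "mtendsto n n (\<lambda>k. \<i> \<cdot>\<^sub>m (X k * A - adj A * X k)) (adj C * C + Y * (B * (adj B * Y))) sequentially"
      using X by (simp add: ric_def)
  qed simp
  then have "ric n A B (adj C * C) Y" using Y hY by (simp add: ric_def)
  moreover have "Im \<mu> \<le> 0" if mu: "\<mu> \<in> spectrum (closed_loop A B Y)" for \<mu>
  proof (rule ccontr)
    assume "\<not> Im \<mu> \<le> 0"
    then have pos: "0 < Im \<mu>" by simp
    \<comment> \<open>Eigenvalues are not followed through the limit: an eigenvalue \<mu> in the
      open upper half-plane would make the determinants at \<mu> tend to 0, against their uniform
      lower bound.\<close>
    have cl: "mtendsto n n (\<lambda>k. closed_loop A B (X k)) (closed_loop A B Y) sequentially"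
      unfolding closed_loop_def by (intro mtendsto_add AY mtendsto_smult BX tendsto_const)
    note clc = mtendstoD(1)[OF cl] and clY = mtendstoD(2)[OF cl]
    have "mtendsto n n (\<lambda>k. \<mu> \<cdot>\<^sub>m 1\<^sub>m n - closed_loop A B (X k)) (\<mu> \<cdot>\<^sub>m 1\<^sub>m n - closed_loop A B Y) sequentially"
      by (intro mtendsto_minus cl mtendsto_const) simp
    from tendsto_norm[OF tendsto_det[OF this]]
    have "(\<lambda>k. cmod (Determinant.det (\<mu> \<cdot>\<^sub>m 1\<^sub>m n - closed_loop A B (X k)))) \<longlonglongrightarrow> 0"
      using mu spectrum_det[OF clY] by simp
    moreover have "(Im \<mu>) ^ n \<le> cmod (Determinant.det (\<mu> \<cdot>\<^sub>m 1\<^sub>m n - closed_loop A B (X k)))" for k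
      by (rule det_resolvent_lower_bound[OF clc _ pos]) (use spX in \<open>auto intro: less_imp_le\<close>)
    ultimately have "(Im \<mu>) ^ n \<le> 0" by (intro LIMSEQ_le_const[of _ 0]) auto
    then show False using zero_less_power[OF pos, of n] by linarith
  qed
  ultimately show ?thesis by blast
qed

section \<open>Realizations of rational matrix functions\<close>

text \<open>Stated for any class of functions closed under constants, sums and products, because it
  is applied both to polynomials and to entire functions.\<close>

lemma det_closed:
  fixes \<P> :: "(complex \<Rightarrow> complex) \<Rightarrow> bool"
  assumes const: "\<And>c. \<P> (\<lambda>_. c)" and add: "\<And>f g. \<P> f \<Longrightarrow> \<P> g \<Longrightarrow> \<P> (\<lambda>z. f z + g z)"
    and mult: "\<And>f g. \<P> f \<Longrightarrow> \<P> g \<Longrightarrow> \<P> (\<lambda>z. f z * g z)"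
    and M: "\<And>z. M z \<in> carrier_mat n n" and e: "\<And>i j. i < n \<Longrightarrow> j < n \<Longrightarrow> \<P> (\<lambda>z. M z $$ (i, j))"
  shows "\<P> (\<lambda>z. Determinant.det (M z))"
proof -
  have sum: "\<P> (\<lambda>z. \<Sum>x\<in>S. f x z)" if "finite S" "\<And>x. x \<in> S \<Longrightarrow> \<P> (f x)" for S and f :: "(nat \<Rightarrow> nat) \<Rightarrow> complex \<Rightarrow> complex"
    using that by (induction S rule: finite_induct) (auto simp: const intro!: add)
  have prod: "\<P> (\<lambda>z. \<Prod>x\<in>S. f x z)" if "finite S" "\<And>x. x \<in> S \<Longrightarrow> \<P> (f x)" for S and f :: "nat \<Rightarrow> complex \<Rightarrow> complex"
    using that by (induction S rule: finite_induct) (auto simp: const intro!: mult)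
  have "\<P> (\<lambda>z. \<Sum>p | p permutes {0..<n}. signof p * (\<Prod>i = 0..<n. M z $$ (i, p i)))"
    by (rule sum) (auto intro!: mult const prod e simp: permutes_in_image finite_permutations)
  then show ?thesis unfolding det_def'[OF M] .
qed

lemma adj_mat_closed:
  fixes \<P> :: "(complex \<Rightarrow> complex) \<Rightarrow> bool"
  assumes const: "\<And>c. \<P> (\<lambda>_. c)" and add: "\<And>f g. \<P> f \<Longrightarrow> \<P> g \<Longrightarrow> \<P> (\<lambda>z. f z + g z)"
    and mult: "\<And>f g. \<P> f \<Longrightarrow> \<P> g \<Longrightarrow> \<P> (\<lambda>z. f z * g z)"
    and M: "\<And>z. M z \<in> carrier_mat n n" and e: "\<And>i j. i < n \<Longrightarrow> j < n \<Longrightarrow> \<P> (\<lambda>z. M z $$ (i, j))"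
    and ij: "i < n" "j < n"
  shows "\<P> (\<lambda>z. adj_mat (M z) $$ (i, j))"
proof -
  have "\<P> (\<lambda>z. Determinant.det (mat_delete (M z) j i))"
    by (rule det_closed[where \<P> = \<P> and n = "n - 1", OF const add mult])
       (use carrier_matD[OF M] ij in \<open>auto simp: mat_delete_def carrier_iff intro!: e\<close>)
  then have "\<P> (\<lambda>z. (-1) ^ (j + i) * Determinant.det (mat_delete (M z) j i))" by (intro mult const)
  moreover have "adj_mat (M z) $$ (i, j) = (-1) ^ (j + i) * Determinant.det (mat_delete (M z) j i)" for z
    using carrier_matD[OF M, of z] ij by (simp add: adj_mat_def cofactor_def)
  ultimately show ?thesis by simp
qed

definition poly_fun :: "(complex \<Rightarrow> complex) \<Rightarrow> bool" where
  "poly_fun f \<longleftrightarrow> (\<exists>p. \<forall>z. f z = poly p z)"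

lemma poly_fun_const: "poly_fun (\<lambda>_. c)"
  unfolding poly_fun_def by (rule exI[of _ "[:c:]"]) simp

lemma poly_fun_add: "poly_fun f \<Longrightarrow> poly_fun g \<Longrightarrow> poly_fun (\<lambda>z. f z + g z)"
  unfolding poly_fun_def by (metis poly_add)

lemma poly_fun_mult: "poly_fun f \<Longrightarrow> poly_fun g \<Longrightarrow> poly_fun (\<lambda>z. f z * g z)"
  unfolding poly_fun_def by (metis poly_mult)

lemma poly_fun_sum: "finite S \<Longrightarrow> (\<And>x. x \<in> S \<Longrightarrow> poly_fun (f x)) \<Longrightarrow> poly_fun (\<lambda>z. \<Sum>x\<in>S. f x z)"
  by (induction S rule: finite_induct) (auto simp: poly_fun_const intro!: poly_fun_add)

lemma poly_fun_affine: "poly_fun (\<lambda>z. z * a - b)"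
  unfolding poly_fun_def by (rule exI[of _ "[:-b, a:]"]) (simp add: algebra_simps)

lemma poly_fun_char_mat:
  assumes A: "A \<in> carrier_mat n n" and ij: "i < n" "j < n"
  shows "poly_fun (\<lambda>z. (z \<cdot>\<^sub>m 1\<^sub>m n - A) $$ (i, j))"
  using poly_fun_affine[of "1\<^sub>m n $$ (i, j)" "A $$ (i, j)"] carrier_matD[OF A] ij by simp

lemma mat_inv_adj_mat:
  assumes M: "M \<in> carrier_mat n n" and d: "Determinant.det M \<noteq> 0"
  shows "mat_inv M = (1 / Determinant.det M) \<cdot>\<^sub>m adj_mat M"
proof (rule mat_inv_unique[OF M])
  note a = adj_mat[OF M] note [simp] = carrier_matD[OF M] carrier_matD[OF a(1)]
  show "(1 / Determinant.det M) \<cdot>\<^sub>m adj_mat M \<in> carrier_mat n n" using a by simp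
  show "M * ((1 / Determinant.det M) \<cdot>\<^sub>m adj_mat M) = 1\<^sub>m n"
    using d by (simp add: mult_smult_dim a(2) smult_smult smult_one_mat)
qed

text \<open>Stands for \<open>Y = (z - A)^-1 B\<close> without an inverse, so that solutions can be
  moved between state spaces and checked by multiplication.\<close>

definition resolvent_sol :: "nat \<Rightarrow> nat \<Rightarrow> complex mat \<Rightarrow> complex mat \<Rightarrow> complex \<Rightarrow> complex mat \<Rightarrow> bool" where
  "resolvent_sol n m A B z Y \<longleftrightarrow> Y \<in> carrier_mat n m \<and> z \<cdot>\<^sub>m Y - A * Y = B"

lemma resolvent_sol_iff:
  assumes A: "A \<in> carrier_mat n n" and B: "B \<in> carrier_mat n m" and z: "z \<notin> spectrum A"
  shows "resolvent_sol n m A B z Y \<longleftrightarrow> Y = mat_inv (z \<cdot>\<^sub>m 1\<^sub>m n - A) * B"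
proof -
  note [simp] = carrier_matD[OF A] carrier_matD[OF B]
  have M: "z \<cdot>\<^sub>m 1\<^sub>m n - A \<in> carrier_mat n n" by (simp add: carrier_iff)
  have "Determinant.det (z \<cdot>\<^sub>m 1\<^sub>m n - A) \<noteq> 0" using spectrum_det[OF A] z by simp
  note I = mat_inv_props[OF M this] note [simp] = carrier_matD[OF I(1)]
  have *: "z \<cdot>\<^sub>m Y - A * Y = (z \<cdot>\<^sub>m 1\<^sub>m n - A) * Y" if "Y \<in> carrier_mat n m" for Y
    using carrier_matD[OF that] by (simp add: mat_simps)
  show ?thesis
  proof
    assume r: "resolvent_sol n m A B z Y"
    then have Y: "Y \<in> carrier_mat n m" and e: "z \<cdot>\<^sub>m Y - A * Y = B" by (auto simp: resolvent_sol_def)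
    note [simp] = carrier_matD[OF Y]
    have "mat_inv (z \<cdot>\<^sub>m 1\<^sub>m n - A) * B = mat_inv (z \<cdot>\<^sub>m 1\<^sub>m n - A) * (z \<cdot>\<^sub>m 1\<^sub>m n - A) * Y"
      unfolding e[symmetric] *[OF Y] by (subst mult_assoc_dim) auto
    then show "Y = mat_inv (z \<cdot>\<^sub>m 1\<^sub>m n - A) * B" unfolding I(3) by (simp add: one_mult_dim)
  next
    assume e: "Y = mat_inv (z \<cdot>\<^sub>m 1\<^sub>m n - A) * B"
    then have Y: "Y \<in> carrier_mat n m" by (simp add: carrier_iff)
    have "(z \<cdot>\<^sub>m 1\<^sub>m n - A) * Y = ((z \<cdot>\<^sub>m 1\<^sub>m n - A) * mat_inv (z \<cdot>\<^sub>m 1\<^sub>m n - A)) * B"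
      unfolding e by (subst mult_assoc_dim) auto
    then show "resolvent_sol n m A B z Y"
      unfolding resolvent_sol_def *[OF Y] using Y I(2) by (simp add: one_mult_dim)
  qed
qed

text \<open>Both sides are quotients of polynomials, so agreement at infinitely many points gives
  the polynomial identity \<open>p d = g q\<close>, with \<open>d\<close> the characteristic
  determinant. As \<open>p / q\<close> is in lowest terms, \<open>q\<close> cannot vanish where
  \<open>d\<close> does not; so outside the spectrum \<open>R\<close> has the value of its quotient,
  and equality holds there.\<close>

lemma realization_rational:
  assumes R: "rational_mat_fun m2 m1 R"
    and A: "A \<in> carrier_mat n n" and B: "B \<in> carrier_mat n m1" and C: "C \<in> carrier_mat m2 n"
    and S: "infinite S" and eq: "\<And>z. z \<in> S \<Longrightarrow> \<exists>Y. resolvent_sol n m1 A B z Y \<and> R z = C * Y"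
  shows "realization m1 m2 n A B C R"
  unfolding realization_def
proof (intro conjI A B C allI impI)
  note [simp] = carrier_matD[OF A] carrier_matD[OF B] carrier_matD[OF C]
  let ?M = "\<lambda>z. z \<cdot>\<^sub>m 1\<^sub>m n - A"
  have M: "?M z \<in> carrier_mat n n" for z by (simp add: carrier_iff)
  note adj_dims [simp] = carrier_matD[OF adj_mat(1)[OF M]]
  have Rc: "R z \<in> carrier_mat m2 m1" for z using R by (simp add: rational_mat_fun_def)
  have inv: "C * mat_inv (?M z) * B = (1 / Determinant.det (?M z)) \<cdot>\<^sub>m (C * (adj_mat (?M z) * B))"
    if "z \<notin> spectrum A" for z
    using mat_inv_adj_mat[OF M, of z] spectrum_det[OF A, of z] that by (simp add: mat_simps)
  have inv_dims: "dim_row (mat_inv (?M z)) = n" "dim_col (mat_inv (?M z)) = n" if "z \<notin> spectrum A" for z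
    using mat_inv_adj_mat[OF M, of z] spectrum_det[OF A, of z] that by simp_all
  obtain d where d: "\<And>z. Determinant.det (?M z) = poly d z"
    using det_closed[OF poly_fun_const poly_fun_add poly_fun_mult M poly_fun_char_mat[OF A]]
    by (auto simp: poly_fun_def)
  fix z0 assume z0: "z0 \<notin> spectrum A"
  show "R z0 = C * mat_inv (?M z0) * B"
  proof (rule eq_matI)
    fix i l assume "i < dim_row (C * mat_inv (?M z0) * B)" "l < dim_col (C * mat_inv (?M z0) * B)"
    then have il: "i < m2" "l < m1" by auto
    obtain p q where q0: "q \<noteq> 0" and cop: "coprime p q"
      and pq: "\<And>z. poly q z \<noteq> 0 \<Longrightarrow> R z $$ (i, l) = poly p z / poly q z"
      using R il unfolding rational_mat_fun_def by blast
    have "poly_fun (\<lambda>z. \<Sum>a<n. C $$ (i, a) * (\<Sum>b<n. adj_mat (?M z) $$ (a, b) * B $$ (b, l)))"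
      by (intro poly_fun_sum poly_fun_mult poly_fun_const
          adj_mat_closed[OF poly_fun_const poly_fun_add poly_fun_mult M poly_fun_char_mat[OF A]]) auto
    then obtain g where g: "\<And>z. (C * (adj_mat (?M z) * B)) $$ (i, l) = poly g z"
      using il by (auto simp: poly_fun_def index_mult_sum)
    have "infinite (S - spectrum A - {z. poly q z = 0})"
      using S finite_spectrum[OF A] poly_roots_finite[OF q0] by (simp add: Diff_infinite_finite)
    moreover have "S - spectrum A - {z. poly q z = 0} \<subseteq> {z. poly (p * d - g * q) z = 0}"
    proof
      fix z assume "z \<in> S - spectrum A - {z. poly q z = 0}"
      then have z: "z \<in> S" "z \<notin> spectrum A" "poly q z \<noteq> 0" by auto
      obtain Y where Y: "resolvent_sol n m1 A B z Y" "R z = C * Y" using eq[OF z(1)] by auto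
      have "R z = C * mat_inv (?M z) * B"
        unfolding Y(2) Y(1)[unfolded resolvent_sol_iff[OF A B z(2)]] using inv_dims[OF z(2)]
        by (simp add: mult_assoc_dim)
      then have "R z $$ (i, l) = poly g z / poly d z" using inv[OF z(2)] il by (simp add: g d)
      moreover have "poly d z \<noteq> 0" using d spectrum_det[OF A] z(2) by metis
      ultimately show "z \<in> {z. poly (p * d - g * q) z = 0}" using pq[OF z(3)] z(3) by (simp add: field_simps)
    qed
    ultimately have "infinite {z. poly (p * d - g * q) z = 0}" using finite_subset by blast
    then have "p * d - g * q = 0" using poly_roots_finite by blast
    then have id: "poly p z * poly d z = poly g z * poly q z" for z
      by (metis eq_iff_diff_eq_0 poly_mult)
    have dz: "poly d z0 \<noteq> 0" using d spectrum_det[OF A] z0 by metis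
    have "poly q z0 \<noteq> 0"
    proof
      assume q: "poly q z0 = 0"
      then have "poly p z0 = 0" using id[of z0] dz by simp
      then show False using coprime_poly_0[OF cop, of z0] q by simp
    qed
    then have "R z0 $$ (i, l) = poly g z0 / poly d z0" using pq[of z0] id[of z0] dz by (simp add: frac_eq_eq)
    then show "R z0 $$ (i, l) = (C * mat_inv (?M z0) * B) $$ (i, l)" using inv[OF z0] il by (simp add: g d)
  qed (use carrier_matD[OF Rc] in auto)
qed

lemma realization_sol:
  assumes r: "realization m1 m2 n A B C R" and z: "z \<notin> spectrum A"
  shows "\<exists>Y. resolvent_sol n m1 A B z Y \<and> R z = C * Y"
proof -
  have A: "A \<in> carrier_mat n n" and B: "B \<in> carrier_mat n m1" and C: "C \<in> carrier_mat m2 n"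
    and e: "R z = C * mat_inv (z \<cdot>\<^sub>m 1\<^sub>m n - A) * B" using r z by (auto simp: realization_def)
  note [simp] = carrier_matD[OF A] carrier_matD[OF B] carrier_matD[OF C]
  have M: "z \<cdot>\<^sub>m 1\<^sub>m n - A \<in> carrier_mat n n" by (simp add: carrier_iff)
  have "Determinant.det (z \<cdot>\<^sub>m 1\<^sub>m n - A) \<noteq> 0" using spectrum_det[OF A] z by simp
  note [simp] = carrier_matD[OF mat_inv_carrier[OF M this]]
  show ?thesis using resolvent_sol_iff[OF A B z] e by (auto simp: mult_assoc_dim)
qed

lemma resolvent_decay:
  assumes A: "A \<in> carrier_mat n n" and B: "B \<in> carrier_mat n m"
  obtains K r where "\<And>z Y i l. r < cmod z \<Longrightarrow> resolvent_sol n m A B z Y \<Longrightarrow> i < n \<Longrightarrow> l < m \<Longrightarrow>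
    cmod (Y $$ (i, l)) \<le> K / cmod z"
proof -
  note [simp] = carrier_matD[OF A] carrier_matD[OF B]
  define a where "a = (\<Sum>i<n. \<Sum>k<n. cmod (A $$ (i, k)))"
  define b where "b = (\<Sum>i<n. \<Sum>l<m. cmod (B $$ (i, l)))"
  have a0: "0 \<le> a" by (simp add: a_def sum_nonneg)
  show thesis
  \<comment> \<open>The sum \<open>s\<close> over a column satisfies
    \<open>|z| s \<le> b + a s\<close>; beyond \<open>|z| = 2 a\<close> the last term is absorbed by
    half of the left side.\<close>
  proof (rule that[of "2 * a" "2 * b"])
    fix z Y i l assume z: "2 * a < cmod z" and r: "resolvent_sol n m A B z Y" and il: "i < n" "l < m"
    have Y: "Y \<in> carrier_mat n m" and e: "z \<cdot>\<^sub>m Y - A * Y = B" using r by (auto simp: resolvent_sol_def)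
    note [simp] = carrier_matD[OF Y]
    define s where "s = (\<Sum>k<n. cmod (Y $$ (k, l)))"
    have s0: "0 \<le> s" by (simp add: s_def sum_nonneg)
    have Ys: "cmod (Y $$ (k, l)) \<le> s" if "k < n" for k
      unfolding s_def using that by (intro member_le_sum) auto
    have row: "cmod z * cmod (Y $$ (k, l)) \<le> cmod (B $$ (k, l)) + (\<Sum>j<n. cmod (A $$ (k, j))) * s" if k: "k < n" for k
    proof -
      have "z * Y $$ (k, l) = B $$ (k, l) + (\<Sum>j<n. A $$ (k, j) * Y $$ (j, l))"
        using arg_cong[OF e, of "\<lambda>M. M $$ (k, l)"] k il by (simp add: index_mult_sum algebra_simps)
      then have "cmod z * cmod (Y $$ (k, l)) = cmod (B $$ (k, l) + (\<Sum>j<n. A $$ (k, j) * Y $$ (j, l)))"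
        by (metis norm_mult)
      also have "\<dots> \<le> cmod (B $$ (k, l)) + (\<Sum>j<n. cmod (A $$ (k, j) * Y $$ (j, l)))"
        by (rule order_trans[OF norm_triangle_ineq]) (intro add_left_mono norm_sum)
      also have "(\<Sum>j<n. cmod (A $$ (k, j) * Y $$ (j, l))) \<le> (\<Sum>j<n. cmod (A $$ (k, j)) * s)"
        by (intro sum_mono) (auto simp: norm_mult intro!: mult_left_mono Ys)
      finally show ?thesis by (simp add: sum_distrib_right)
    qed
    have "cmod z * s = (\<Sum>k<n. cmod z * cmod (Y $$ (k, l)))" by (simp add: s_def sum_distrib_left)
    also have "\<dots> \<le> (\<Sum>k<n. cmod (B $$ (k, l)) + (\<Sum>j<n. cmod (A $$ (k, j))) * s)"
      by (intro sum_mono row) auto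
    also have "\<dots> = (\<Sum>k<n. cmod (B $$ (k, l))) + a * s"
      by (simp add: sum.distrib a_def sum_distrib_right)
    also have "(\<Sum>k<n. cmod (B $$ (k, l))) \<le> b"
      unfolding b_def using il by (intro sum_mono member_le_sum) auto
    finally have 1: "cmod z * s \<le> b + a * s" by simp
    have "2 * a * s \<le> cmod z * s" using z s0 by (intro mult_right_mono) auto
    then have "cmod z * s \<le> 2 * b" using 1 by simp
    moreover have "0 < cmod z" using z a0 by linarith
    ultimately have "s \<le> 2 * b / cmod z" by (simp add: field_simps)
    then show "cmod (Y $$ (i, l)) \<le> 2 * b / cmod z" using Ys[OF il(1)] by linarith
  qed
qed

lemma entry_bound:
  assumes C: "C \<in> carrier_mat p n" and Y: "Y \<in> carrier_mat n m" and il: "i < p" "l < m"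
    and K: "\<And>k. k < n \<Longrightarrow> cmod (Y $$ (k, l)) \<le> K"
  shows "cmod ((C * Y) $$ (i, l)) \<le> (\<Sum>k<n. cmod (C $$ (i, k))) * K"
proof -
  have "(C * Y) $$ (i, l) = (\<Sum>k<n. C $$ (i, k) * Y $$ (k, l))"
    using carrier_matD[OF C] carrier_matD[OF Y] il by (simp add: index_mult_sum)
  also have "cmod \<dots> \<le> (\<Sum>k<n. cmod (C $$ (i, k) * Y $$ (k, l)))" by (rule norm_sum)
  also have "\<dots> \<le> (\<Sum>k<n. cmod (C $$ (i, k)) * K)"
    by (intro sum_mono) (auto simp: norm_mult intro!: mult_left_mono K)
  finally show ?thesis by (simp add: sum_distrib_right)
qed

lemma realization_vanishes:
  assumes r: "realization m1 m2 n A B C R"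
  shows "vanishes_at_infinity m2 m1 R"
  unfolding vanishes_at_infinity_def
proof (intro allI impI)
  have A: "A \<in> carrier_mat n n" and B: "B \<in> carrier_mat n m1" and C: "C \<in> carrier_mat m2 n"
    using r by (auto simp: realization_def)
  obtain K r0 where K: "\<And>z Y i l. r0 < cmod z \<Longrightarrow> resolvent_sol n m1 A B z Y \<Longrightarrow> i < n \<Longrightarrow> l < m1 \<Longrightarrow>
    cmod (Y $$ (i, l)) \<le> K / cmod z" by (rule resolvent_decay[OF A B], rule that, blast)
  fix i l assume il: "i < m2" "l < m1"
  obtain b where b: "\<forall>z\<in>spectrum A. cmod z \<le> b"
    using finite_imp_bounded[OF finite_spectrum[OF A]] by (auto simp: bounded_iff)
  have bd: "cmod (R z $$ (i, l)) \<le> (\<Sum>k<n. cmod (C $$ (i, k))) * (K / cmod z)"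
    if z: "max r0 b + 1 \<le> cmod z" for z
  proof -
    have "z \<notin> spectrum A" using b z by force
    then obtain Y where Y: "resolvent_sol n m1 A B z Y" "R z = C * Y" using realization_sol[OF r] by blast
    have Yc: "Y \<in> carrier_mat n m1" using Y(1) by (simp add: resolvent_sol_def)
    show ?thesis unfolding Y(2) by (rule entry_bound[OF C Yc il]) (use K[OF _ Y(1)] il z in auto)
  qed
  have "((\<lambda>z::complex. (\<Sum>k<n. cmod (C $$ (i, k))) * (K / cmod z)) \<longlongrightarrow> (\<Sum>k<n. cmod (C $$ (i, k))) * 0) at_infinity"
    by (intro tendsto_mult tendsto_const tendsto_divide_0[OF tendsto_const] filterlim_at_top_imp_at_infinity filterlim_norm_at_top)
  then have lim: "((\<lambda>z::complex. (\<Sum>k<n. cmod (C $$ (i, k))) * (K / cmod z)) \<longlongrightarrow> 0) at_infinity" by simp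
  show "((\<lambda>z. R z $$ (i, l)) \<longlongrightarrow> 0) at_infinity"
    by (rule Lim_null_comparison[OF _ lim]) (use bd in \<open>auto simp: eventually_at_infinity\<close>)
qed

text \<open>With \<open>E\<^sub>k\<close> the difference of \<open>C A\<^sup>k (z - A)\<^sup>-\<^sup>1 B\<close> for the two systems and \<open>M\<^sub>k\<close> that of the Markov
  parameters, \<open>E\<^sub>k\<^sub>+\<^sub>1 = z E\<^sub>k - M\<^sub>k\<close>. If \<open>E\<^sub>k = 0\<close> for large \<open>z\<close>, then \<open>E\<^sub>k\<^sub>+\<^sub>1\<close> is a constant that
  vanishes at infinity.\<close>

lemma markov_parameters_eq:
  assumes r: "realization m1 m2 n A B C R" and r': "realization m1 m2 n' A' B' C' R"
  shows "C * (A ^\<^sub>m k * B) = C' * (A' ^\<^sub>m k * B')"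
proof -
  have A: "A \<in> carrier_mat n n" and B: "B \<in> carrier_mat n m1" and C: "C \<in> carrier_mat m2 n"
    and A': "A' \<in> carrier_mat n' n'" and B': "B' \<in> carrier_mat n' m1" and C': "C' \<in> carrier_mat m2 n'"
    using r r' by (auto simp: realization_def)
  note [simp] = carrier_matD[OF A] carrier_matD[OF B] carrier_matD[OF C]
    carrier_matD[OF A'] carrier_matD[OF B'] carrier_matD[OF C']
  obtain b where b: "\<forall>z\<in>spectrum A \<union> spectrum A'. cmod z \<le> b"
    using finite_imp_bounded[of "spectrum A \<union> spectrum A'"] finite_spectrum[OF A] finite_spectrum[OF A']
    by (auto simp: bounded_iff)
  have "\<exists>Y Y'. resolvent_sol n m1 A B z Y \<and> resolvent_sol n' m1 A' B' z Y' \<and> C * Y = C' * Y'"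
    if "b < cmod z" for z
  proof -
    have "z \<notin> spectrum A" "z \<notin> spectrum A'" using b that by force+
    then show ?thesis using realization_sol[OF r] realization_sol[OF r'] by metis
  qed
  then obtain Y Y' where Y: "\<And>z. b < cmod z \<Longrightarrow> resolvent_sol n m1 A B z (Y z)"
    and Y': "\<And>z. b < cmod z \<Longrightarrow> resolvent_sol n' m1 A' B' z (Y' z)"
    and CY: "\<And>z. b < cmod z \<Longrightarrow> C * Y z = C' * Y' z" by metis
  have dims: "dim_row (Y z) = n" "dim_col (Y z) = m1" "dim_row (Y' z) = n'" "dim_col (Y' z) = m1" if "b < cmod z" for z
    using Y[OF that] Y'[OF that] by (auto simp: resolvent_sol_def)
  have step: "C * (A ^\<^sub>m k * B) = C' * (A' ^\<^sub>m k * B')"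
    and next_eq: "\<And>z. b < cmod z \<Longrightarrow> C * (A ^\<^sub>m Suc k * Y z) = C' * (A' ^\<^sub>m Suc k * Y' z)"
    if E: "\<And>z. b < cmod z \<Longrightarrow> C * (A ^\<^sub>m k * Y z) = C' * (A' ^\<^sub>m k * Y' z)" for k
  proof -
    have rec: "C * (A ^\<^sub>m Suc k * Y z) = z \<cdot>\<^sub>m (C * (A ^\<^sub>m k * Y z)) - C * (A ^\<^sub>m k * B)"
      and rec': "C' * (A' ^\<^sub>m Suc k * Y' z) = z \<cdot>\<^sub>m (C' * (A' ^\<^sub>m k * Y' z)) - C' * (A' ^\<^sub>m k * B')"
      if z: "b < cmod z" for z
    proof -
      note [simp] = dims[OF z]
      have e: "A * Y z = z \<cdot>\<^sub>m Y z - B" and e': "A' * Y' z = z \<cdot>\<^sub>m Y' z - B'"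
        using Y[OF z] Y'[OF z] by (auto simp: resolvent_sol_def intro!: eq_matI)
      show "C * (A ^\<^sub>m Suc k * Y z) = z \<cdot>\<^sub>m (C * (A ^\<^sub>m k * Y z)) - C * (A ^\<^sub>m k * B)"
        by (simp add: mult_assoc_dim e) (simp add: mat_simps)
      show "C' * (A' ^\<^sub>m Suc k * Y' z) = z \<cdot>\<^sub>m (C' * (A' ^\<^sub>m k * Y' z)) - C' * (A' ^\<^sub>m k * B')"
        by (simp add: mult_assoc_dim e') (simp add: mat_simps)
    qed
    show eq: "C * (A ^\<^sub>m k * B) = C' * (A' ^\<^sub>m k * B')"
    proof (rule eq_matI)
      fix i l assume "i < dim_row (C' * (A' ^\<^sub>m k * B'))" "l < dim_col (C' * (A' ^\<^sub>m k * B'))"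
      then have il: "i < m2" "l < m1" by auto
      let ?D = "C' * A' ^\<^sub>m Suc k" and ?E = "C * A ^\<^sub>m Suc k"
      define c where "c = (C' * (A' ^\<^sub>m k * B')) $$ (i, l) - (C * (A ^\<^sub>m k * B)) $$ (i, l)"
      obtain K r0 where K: "\<And>z Y i l. r0 < cmod z \<Longrightarrow> resolvent_sol n m1 A B z Y \<Longrightarrow> i < n \<Longrightarrow> l < m1 \<Longrightarrow>
        cmod (Y $$ (i, l)) \<le> K / cmod z" by (rule resolvent_decay[OF A B], rule that, blast)
      obtain K' r0' where K': "\<And>z Y i l. r0' < cmod z \<Longrightarrow> resolvent_sol n' m1 A' B' z Y \<Longrightarrow> i < n' \<Longrightarrow> l < m1 \<Longrightarrow>
        cmod (Y $$ (i, l)) \<le> K' / cmod z" by (rule resolvent_decay[OF A' B'], rule that, blast)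
      define a where "a = (\<Sum>k<n. cmod (?E $$ (i, k)))"
      define a' where "a' = (\<Sum>k<n'. cmod (?D $$ (i, k)))"
      have bd: "cmod c \<le> a * (K / cmod z) + a' * (K' / cmod z)" if z: "max b (max r0 r0') + 1 \<le> cmod z" for z
      proof -
        have zb: "b < cmod z" using z by auto
        note [simp] = dims[OF zb]
        have "c = (C * (A ^\<^sub>m Suc k * Y z)) $$ (i, l) - (C' * (A' ^\<^sub>m Suc k * Y' z)) $$ (i, l)"
          unfolding rec[OF zb] rec'[OF zb] E[OF zb] using il by (simp add: c_def)
        also have "\<dots> = (?E * Y z) $$ (i, l) - (?D * Y' z) $$ (i, l)" by (simp add: mult_assoc_dim)
        finally have "cmod c \<le> cmod ((?E * Y z) $$ (i, l)) + cmod ((?D * Y' z) $$ (i, l))"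
          using norm_triangle_ineq4 by metis
        moreover have "cmod ((?E * Y z) $$ (i, l)) \<le> a * (K / cmod z)"
          unfolding a_def by (rule entry_bound[of _ m2 n _ m1])
            (use K[OF _ Y[OF zb]] il z in \<open>auto simp: carrier_iff\<close>)
        moreover have "cmod ((?D * Y' z) $$ (i, l)) \<le> a' * (K' / cmod z)"
          unfolding a'_def by (rule entry_bound[of _ m2 n' _ m1])
            (use K'[OF _ Y'[OF zb]] il z in \<open>auto simp: carrier_iff\<close>)
        ultimately show ?thesis by linarith
      qed
      have "(\<lambda>N. a * (K / cmod (of_nat N)) + a' * (K' / cmod (of_nat N))) \<longlonglongrightarrow> a * 0 + a' * 0"
        using lim_const_over_n[of K] lim_const_over_n[of K'] by (intro tendsto_intros) auto
      moreover have "eventually (\<lambda>N. cmod c \<le> a * (K / cmod (of_nat N)) + a' * (K' / cmod (of_nat N))) sequentially"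
      proof -
        obtain N0 where N0: "max b (max r0 r0') + 1 \<le> real N0" using real_arch_simple by blast
        show ?thesis unfolding eventually_sequentially
        proof (intro exI[of _ N0] allI impI)
          fix N assume "N0 \<le> N"
          then have "max b (max r0 r0') + 1 \<le> cmod (of_nat N)" using N0 by simp
          then show "cmod c \<le> a * (K / cmod (of_nat N)) + a' * (K' / cmod (of_nat N))" by (rule bd)
        qed
      qed
      ultimately have "cmod c \<le> a * 0 + a' * 0"
        by (intro tendsto_le[OF sequentially_bot _ tendsto_const])
      then have "c = 0" by simp
      then show "(C * (A ^\<^sub>m k * B)) $$ (i, l) = (C' * (A' ^\<^sub>m k * B')) $$ (i, l)" by (simp add: c_def)
    qed auto
    show "C * (A ^\<^sub>m Suc k * Y z) = C' * (A' ^\<^sub>m Suc k * Y' z)" if z: "b < cmod z" for z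
      unfolding rec[OF z] rec'[OF z] E[OF z] eq ..
  qed
  have "\<forall>z. b < cmod z \<longrightarrow> C * (A ^\<^sub>m k * Y z) = C' * (A' ^\<^sub>m k * Y' z)" for k
  proof (induction k)
    case 0
    show ?case using CY dims by (auto simp: one_mult_dim)
  next
    case (Suc k)
    then show ?case using next_eq[of k] by blast
  qed
  then show ?thesis using step[of k] by blast
qed

subsection \<open>Minimal realizations are controllable and observable\<close>

text \<open>\<open>J\<close> parametrizes the orthogonal complement of \<open>w\<close> by solving
  for a coordinate \<open>k\<close> with \<open>w $$ (k, 0) \<noteq> 0\<close>, and \<open>L\<close>
  deletes that coordinate. Hence \<open>J * L\<close> is the projection onto the complement along
  the unit vector \<open>k\<close>, of which \<open>u\<close> is a multiple.\<close>

lemma hyperplane_coordinates: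
  fixes w :: "complex mat"
  assumes w: "w \<in> carrier_mat n 1" and w0: "w \<noteq> 0\<^sub>m n 1"
  obtains J L u where "J \<in> carrier_mat n (n - 1)" "L \<in> carrier_mat (n - 1) n" "u \<in> carrier_mat n 1"
    "J * L = 1\<^sub>m n - u * adj w" "adj w * J = 0\<^sub>m 1 (n - 1)"
proof -
  note [simp] = carrier_matD[OF w]
  obtain k where k: "k < n" "w $$ (k, 0) \<noteq> 0" using w0 by (auto simp: mat_eq_iff)
  define c where "c = (\<lambda>i. cnj (w $$ (i, 0)))"
  have ck: "c k \<noteq> 0" using k by (simp add: c_def)
  define \<delta> where "\<delta> = (\<lambda>i. if i < k then i else Suc i)"
  have bij: "bij_betw \<delta> {..<n - 1} ({..<n} - {k})"
  proof (rule bij_betw_byWitness[where f' = "\<lambda>i. if i < k then i else i - 1"])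
  qed (use k in \<open>auto simp: \<delta>_def split: if_splits\<close>)
  have \<delta>n: "\<delta> j < n" "\<delta> j \<noteq> k" if "j < n - 1" for j using that k by (auto simp: \<delta>_def)
  define J where "J = Matrix.mat n (n - 1) (\<lambda>(i, j). if i = k then - c (\<delta> j) / c k else if i = \<delta> j then 1 else 0)"
  define L where "L = Matrix.mat (n - 1) n (\<lambda>(i, j). if j = \<delta> i then (1::complex) else 0)"
  define u where "u = Matrix.mat n 1 (\<lambda>(i, j). if i = k then 1 / c k else 0)"
  have d [simp]: "dim_row J = n" "dim_col J = n - 1" "dim_row L = n - 1" "dim_col L = n"
    "dim_row u = n" "dim_col u = 1" by (auto simp: J_def L_def u_def)
  have reidx: "(\<Sum>a<n - 1. g (\<delta> a)) = (\<Sum>a\<in>{..<n} - {k}. g a)" for g :: "nat \<Rightarrow> complex"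
    by (rule sum.reindex_bij_betw[OF bij])
  have "J * L = 1\<^sub>m n - u * adj w"
  proof (rule eq_matI)
    fix i j assume "i < dim_row (1\<^sub>m n - u * adj w)" "j < dim_col (1\<^sub>m n - u * adj w)"
    then have ij: "i < n" "j < n" by auto
    have "(J * L) $$ (i, j) = (\<Sum>a<n - 1. (if i = k then - c (\<delta> a) / c k else if i = \<delta> a then 1 else 0) * (if j = \<delta> a then 1 else 0))"
      using ij by (simp add: index_mult_sum J_def L_def)
    also have "\<dots> = (\<Sum>a\<in>{..<n} - {k}. (if i = k then - c a / c k else if i = a then 1 else 0) * (if j = a then 1 else 0))"
      by (rule reidx)
    also have "\<dots> = (\<Sum>a\<in>{..<n} - {k}. if j = a then (if i = k then - c j / c k else if i = j then 1 else 0) else 0)"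
      by (rule sum.cong) auto
    also have "\<dots> = (if j = k then 0 else if i = k then - c j / c k else if i = j then 1 else 0)"
      using ij by (simp add: sum.delta)
    also have "\<dots> = (1\<^sub>m n - u * adj w) $$ (i, j)"
      using ij ck by (auto simp: index_mult_sum u_def c_def)
    finally show "(J * L) $$ (i, j) = (1\<^sub>m n - u * adj w) $$ (i, j)" .
  qed auto
  moreover have "adj w * J = 0\<^sub>m 1 (n - 1)"
  proof (rule eq_matI)
    fix i j assume "i < dim_row (0\<^sub>m 1 (n - 1) :: complex mat)" "j < dim_col (0\<^sub>m 1 (n - 1) :: complex mat)"
    then have ij: "i = 0" "j < n - 1" by auto
    have "(adj w * J) $$ (0, j) = (\<Sum>a<n. c a * (if a = k then - c (\<delta> j) / c k else if a = \<delta> j then 1 else 0))"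
      using ij by (simp add: index_mult_sum J_def c_def)
    also have "\<dots> = (\<Sum>a<n. (if a = k then c k * (- c (\<delta> j) / c k) else 0) + (if a = \<delta> j then c (\<delta> j) else 0))"
      by (rule sum.cong) (use \<delta>n[OF ij(2)] in auto)
    also have "\<dots> = 0" using \<delta>n[OF ij(2)] k ck by (simp add: sum.distrib)
    finally show "(adj w * J) $$ (i, j) = 0\<^sub>m 1 (n - 1) $$ (i, j)" using ij by simp
  qed auto
  ultimately show thesis using that[of J L u] by (auto simp: carrier_iff)
qed

text \<open>A vector violating the Hautus condition allows a reduction by one dimension. In the
  uncontrollable case the states \<open>(z - A)^-1 B\<close> lie in the hyperplane orthogonal to it;
  in the unobservable case the vector is factored out.\<close>

lemma minimal_realization_pbh:
  assumes R: "rational_mat_fun m2 m1 R" and mr: "minimal_realization m1 m2 n A B C R"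
  shows "pbh n A B" and "pbh n (adj A) (adj C)"
proof -
  have r: "realization m1 m2 n A B C R" using mr by (simp add: minimal_realization_def)
  have A: "A \<in> carrier_mat n n" and B: "B \<in> carrier_mat n m1" and C: "C \<in> carrier_mat m2 n"
    using r by (auto simp: realization_def)
  note [simp] = carrier_matD[OF A] carrier_matD[OF B] carrier_matD[OF C]
  have no_smaller: False
    if n: "0 < n" and J: "J \<in> carrier_mat n (n - 1)" and L: "L \<in> carrier_mat (n - 1) n"
      and F: "finite F"
      and s: "\<And>z Y. z \<notin> F \<Longrightarrow> resolvent_sol n m1 A B z Y \<Longrightarrow>
        resolvent_sol (n - 1) m1 (L * A * J) (L * B) z (L * Y) \<and> C * Y = (C * J) * (L * Y)" for J L F
  proof -
    note [simp] = carrier_matD[OF J] carrier_matD[OF L]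
    have "realization m1 m2 (n - 1) (L * A * J) (L * B) (C * J) R"
    proof (rule realization_rational[OF R, of _ _ _ _ "- (F \<union> spectrum A)"])
      show "infinite (- (F \<union> spectrum A))"
        using F finite_spectrum[OF A] infinite_UNIV_char_0 by (metis finite_Un finite_compl)
      fix z assume "z \<in> - (F \<union> spectrum A)"
      then obtain Y where "resolvent_sol n m1 A B z Y" "R z = C * Y" "z \<notin> F"
        using realization_sol[OF r] by auto
      then show "\<exists>Y. resolvent_sol (n - 1) m1 (L * A * J) (L * B) z Y \<and> R z = C * J * Y"
        using s by metis
    qed (auto simp: carrier_iff)
    then have "n \<le> n - 1" using mr by (auto simp: minimal_realization_def)
    then show False using n by simp
  qed
  have npos: "0 < n" if "w \<in> carrier_mat n 1" "w \<noteq> 0\<^sub>m n 1" for w :: "complex mat"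
    using that by (cases n) (auto simp: mat_eq_iff)
  show "pbh n A B" unfolding pbh_def
  proof (intro ballI allI impI, elim conjE, rule ccontr)
    fix w \<mu> assume w: "w \<in> carrier_mat n 1" and Aw: "adj A * w = \<mu> \<cdot>\<^sub>m w"
      and Bw: "adj B * w = 0\<^sub>m (dim_col B) 1" and w0: "w \<noteq> 0\<^sub>m n 1"
    note [simp] = carrier_matD[OF w]
    obtain J L u where J: "J \<in> carrier_mat n (n - 1)" and L: "L \<in> carrier_mat (n - 1) n"
      and u: "u \<in> carrier_mat n 1" and JL: "J * L = 1\<^sub>m n - u * adj w"
      by (rule hyperplane_coordinates[OF w w0])
    note [simp] = carrier_matD[OF J] carrier_matD[OF L] carrier_matD[OF u]
    show False
    \<comment> \<open>Pairing the state equation with \<open>w\<close> gives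
      \<open>(z - cnj \<mu>) (adj w * Y) = 0\<close>, so the point \<open>cnj \<mu>\<close> is left
      out.\<close>
    proof (rule no_smaller[OF npos[OF w w0] J L, of "{cnj \<mu>}"])
      fix z Y assume z: "z \<notin> {cnj \<mu>}" and Y: "resolvent_sol n m1 A B z Y"
      have Yc: "Y \<in> carrier_mat n m1" and e: "z \<cdot>\<^sub>m Y - A * Y = B" using Y by (auto simp: resolvent_sol_def)
      note [simp] = carrier_matD[OF Yc]
      have "adj w * (z \<cdot>\<^sub>m Y - A * Y) = adj (adj B * w)" unfolding e by (simp add: mat_simps)
      then have 1: "adj w * (z \<cdot>\<^sub>m Y - A * Y) = 0\<^sub>m 1 m1" unfolding Bw by (simp add: adj_zero)
      have "adj w * (A * Y) = adj (adj A * w) * Y" by (simp add: mat_simps)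
      then have 2: "adj w * (A * Y) = cnj \<mu> \<cdot>\<^sub>m (adj w * Y)" unfolding Aw by (simp add: mat_simps)
      have "z \<cdot>\<^sub>m (adj w * Y) - cnj \<mu> \<cdot>\<^sub>m (adj w * Y) = 0\<^sub>m 1 m1"
        using 1 by (simp add: mult_minus_dim mult_smult_dim 2)
      then have wY: "adj w * Y = 0\<^sub>m 1 m1"
      proof (intro eq_matI)
        fix i j assume z0: "z \<cdot>\<^sub>m (adj w * Y) - cnj \<mu> \<cdot>\<^sub>m (adj w * Y) = 0\<^sub>m 1 m1"
          and "i < dim_row (0\<^sub>m 1 m1 :: complex mat)" "j < dim_col (0\<^sub>m 1 m1 :: complex mat)"
        then have ij: "i < 1" "j < m1" by auto
        have "(z - cnj \<mu>) * (adj w * Y) $$ (i, j) = 0"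
          using arg_cong[OF z0, of "\<lambda>M. M $$ (i, j)"] ij by (simp add: algebra_simps)
        then show "(adj w * Y) $$ (i, j) = 0\<^sub>m 1 m1 $$ (i, j)" using z ij by simp
      qed auto
      have JLY: "J * (L * Y) = Y"
      proof -
        have "J * (L * Y) = (J * L) * Y" by (simp add: mult_assoc_dim)
        also have "\<dots> = Y - u * (adj w * Y)" unfolding JL by (simp add: mat_simps)
        also have "\<dots> = Y" unfolding wY by (rule eq_matI) (auto simp: mult_zero_dim)
        finally show ?thesis .
      qed
      have "z \<cdot>\<^sub>m (L * Y) - (L * A * J) * (L * Y) = L * (z \<cdot>\<^sub>m Y - A * Y)"
        by (simp add: mat_simps JLY)
      then show "resolvent_sol (n - 1) m1 (L * A * J) (L * B) z (L * Y) \<and> C * Y = (C * J) * (L * Y)"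
        unfolding e by (simp add: resolvent_sol_def carrier_iff mult_assoc_dim JLY)
    qed simp
  qed
  show "pbh n (adj A) (adj C)" unfolding pbh_def adj_adj
  proof (intro ballI allI impI, elim conjE, rule ccontr)
    fix w \<mu> assume w: "w \<in> carrier_mat n 1" and Aw: "A * w = \<mu> \<cdot>\<^sub>m w"
      and Cw: "C * w = 0\<^sub>m (dim_col (adj C)) 1" and w0: "w \<noteq> 0\<^sub>m n 1"
    note [simp] = carrier_matD[OF w]
    obtain J' L' u where J': "J' \<in> carrier_mat n (n - 1)" and L': "L' \<in> carrier_mat (n - 1) n"
      and u: "u \<in> carrier_mat n 1" and JL': "J' * L' = 1\<^sub>m n - u * adj w" and wJ: "adj w * J' = 0\<^sub>m 1 (n - 1)"
      by (rule hyperplane_coordinates[OF w w0])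
    note [simp] = carrier_matD[OF J'] carrier_matD[OF L'] carrier_matD[OF u]
    \<comment> \<open>The adjoint coordinates describe the quotient by \<open>w\<close> in place of
      the hyperplane: now \<open>L * w = 0\<close>.\<close>
    define J where "J = adj L'"
    define L where "L = adj J'"
    have d [simp]: "dim_row J = n" "dim_col J = n - 1" "dim_row L = n - 1" "dim_col L = n"
      by (auto simp: J_def L_def)
    have JL: "J * L = 1\<^sub>m n - w * adj u"
      unfolding J_def L_def using arg_cong[OF JL', of adj] by (simp add: mat_simps)
    have Lw: "L * w = 0\<^sub>m (n - 1) 1"
      unfolding L_def using arg_cong[OF wJ, of adj] by (simp add: mat_simps)
    show False
    proof (rule no_smaller[OF npos[OF w w0], of J L "{}"])
      fix z Y assume Y: "resolvent_sol n m1 A B z Y"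
      have Yc: "Y \<in> carrier_mat n m1" and e: "z \<cdot>\<^sub>m Y - A * Y = B" using Y by (auto simp: resolvent_sol_def)
      note [simp] = carrier_matD[OF Yc]
      have JLY: "J * (L * Y) = Y - w * (adj u * Y)"
      proof -
        have "J * (L * Y) = (J * L) * Y" by (simp add: mult_assoc_dim)
        also have "\<dots> = Y - w * (adj u * Y)" unfolding JL by (simp add: mat_simps)
        finally show ?thesis .
      qed
      have "L * (A * (w * (adj u * Y))) = L * ((A * w) * (adj u * Y))" by (simp add: mult_assoc_dim)
      also have "\<dots> = \<mu> \<cdot>\<^sub>m ((L * w) * (adj u * Y))" unfolding Aw by (simp add: mat_simps)
      also have "\<dots> = 0\<^sub>m (n - 1) m1" unfolding Lw by (simp add: mat_simps)
      finally have LAw: "L * (A * (w * (adj u * Y))) = 0\<^sub>m (n - 1) m1" .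
      have "C * (w * (adj u * Y)) = (C * w) * (adj u * Y)" by (simp add: mult_assoc_dim)
      also have "\<dots> = 0\<^sub>m m2 m1" unfolding Cw by (simp add: mat_simps)
      finally have CJ: "C * (w * (adj u * Y)) = 0\<^sub>m m2 m1" .
      have "(L * A * J) * (L * Y) = L * (A * Y) - L * (A * (w * (adj u * Y)))"
        by (simp add: mult_assoc_dim JLY) (simp add: mult_minus_dim)
      then have 1: "(L * A * J) * (L * Y) = L * (A * Y)" unfolding LAw by (auto intro!: eq_matI)
      have "(C * J) * (L * Y) = C * Y - C * (w * (adj u * Y))"
        by (simp add: mult_assoc_dim JLY) (simp add: mult_minus_dim)
      then have 2: "(C * J) * (L * Y) = C * Y" unfolding CJ by (auto intro!: eq_matI)
      have "z \<cdot>\<^sub>m (L * Y) - (L * A * J) * (L * Y) = L * (z \<cdot>\<^sub>m Y - A * Y)"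
        unfolding 1 by (simp add: mat_simps)
      then show "resolvent_sol (n - 1) m1 (L * A * J) (L * B) z (L * Y) \<and> C * Y = (C * J) * (L * Y)"
        unfolding e 2 by (simp add: resolvent_sol_def carrier_iff)
    qed (auto simp: carrier_iff)
  qed
qed

subsection \<open>Existence of realizations\<close>

text \<open>A working version of \<open>realization\<close> with finitely many exceptional points,
  so that sums and single entries can be treated without tracking spectra;
  \<open>realization_rational\<close> restores the exact form.\<close>

definition realizable :: "nat \<Rightarrow> nat \<Rightarrow> (complex \<Rightarrow> complex mat) \<Rightarrow> bool" where
  "realizable m1 m2 R \<longleftrightarrow> (\<exists>n A B C F. A \<in> carrier_mat n n \<and> B \<in> carrier_mat n m1 \<and> C \<in> carrier_mat m2 n \<and>
     finite F \<and> (\<forall>z. z \<notin> F \<longrightarrow> (\<exists>Y. resolvent_sol n m1 A B z Y \<and> R z = C * Y)))"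

lemma realizable_zero: "realizable m1 m2 (\<lambda>z. 0\<^sub>m m2 m1)"
  unfolding realizable_def
proof (intro exI conjI allI impI)
  show "0\<^sub>m 0 0 \<in> carrier_mat 0 0" "0\<^sub>m 0 m1 \<in> carrier_mat 0 m1" "0\<^sub>m m2 0 \<in> carrier_mat m2 0" "finite {}"
    by auto
  fix z :: complex
  show "resolvent_sol 0 m1 (0\<^sub>m 0 0) (0\<^sub>m 0 m1) z (0\<^sub>m 0 m1)"
    by (auto simp: resolvent_sol_def intro!: eq_matI)
  show "0\<^sub>m m2 m1 = 0\<^sub>m m2 0 * (0\<^sub>m 0 m1 :: complex mat)" by (simp add: mult_zero_dim)
qed

text \<open>The direct sum of the state spaces: block diagonal \<open>A\<close>, stacked
  \<open>B\<close>, adjoined \<open>C\<close>.\<close>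

lemma realizable_add:
  assumes 1: "realizable m1 m2 R1" and 2: "realizable m1 m2 R2"
  shows "realizable m1 m2 (\<lambda>z. R1 z + R2 z)"
proof -
  obtain n A B C F where A: "A \<in> carrier_mat n n" and B: "B \<in> carrier_mat n m1" and C: "C \<in> carrier_mat m2 n"
    and F: "finite F" and r: "\<And>z. z \<notin> F \<Longrightarrow> \<exists>Y. resolvent_sol n m1 A B z Y \<and> R1 z = C * Y"
    using 1 unfolding realizable_def by metis
  obtain n' A' B' C' F' where A': "A' \<in> carrier_mat n' n'" and B': "B' \<in> carrier_mat n' m1" and C': "C' \<in> carrier_mat m2 n'"
    and F': "finite F'" and r': "\<And>z. z \<notin> F' \<Longrightarrow> \<exists>Y. resolvent_sol n' m1 A' B' z Y \<and> R2 z = C' * Y"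
    using 2 unfolding realizable_def by metis
  note [simp] = carrier_matD[OF A] carrier_matD[OF B] carrier_matD[OF C]
    carrier_matD[OF A'] carrier_matD[OF B'] carrier_matD[OF C']
  define A2 where "A2 = Matrix.mat (n + n') (n + n') (\<lambda>(i, j).
    if i < n then (if j < n then A $$ (i, j) else 0) else (if j < n then 0 else A' $$ (i - n, j - n)))"
  define B2 where "B2 = Matrix.mat (n + n') m1 (\<lambda>(i, j). if i < n then B $$ (i, j) else B' $$ (i - n, j))"
  define C2 where "C2 = Matrix.mat m2 (n + n') (\<lambda>(i, j). if j < n then C $$ (i, j) else C' $$ (i, j - n))"
  show ?thesis unfolding realizable_def
  proof (rule exI[of _ "n + n'"], rule exI[of _ A2], rule exI[of _ B2], rule exI[of _ C2],
      rule exI[of _ "F \<union> F'"], intro conjI allI impI)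
    fix z assume z: "z \<notin> F \<union> F'"
    obtain Y where Y: "resolvent_sol n m1 A B z Y" "R1 z = C * Y" using r z by auto
    obtain Y' where Y': "resolvent_sol n' m1 A' B' z Y'" "R2 z = C' * Y'" using r' z by auto
    have Yc: "Y \<in> carrier_mat n m1" and Yc': "Y' \<in> carrier_mat n' m1" and e: "z \<cdot>\<^sub>m Y - A * Y = B"
      and e': "z \<cdot>\<^sub>m Y' - A' * Y' = B'"
      using Y(1) Y'(1) by (auto simp: resolvent_sol_def)
    note [simp] = carrier_matD[OF Yc] carrier_matD[OF Yc']
    define Z where "Z = Matrix.mat (n + n') m1 (\<lambda>(i, j). if i < n then Y $$ (i, j) else Y' $$ (i - n, j))"
    have d [simp]: "dim_row Z = n + n'" "dim_col Z = m1" "dim_row A2 = n + n'" "dim_col A2 = n + n'"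
      "dim_row B2 = n + n'" "dim_col B2 = m1" "dim_row C2 = m2" "dim_col C2 = n + n'"
      by (auto simp: Z_def A2_def B2_def C2_def)
    have "z \<cdot>\<^sub>m Z - A2 * Z = B2"
    proof (rule eq_matI)
      fix i j assume "i < dim_row B2" "j < dim_col B2"
      then have ij: "i < n + n'" "j < m1" by auto
      have s: "(A2 * Z) $$ (i, j) = (\<Sum>l<n. A2 $$ (i, l) * Z $$ (l, j)) + (\<Sum>l<n'. A2 $$ (i, n + l) * Z $$ (n + l, j))"
        using ij by (simp add: index_mult_sum sum_lessThan_add)
      show "(z \<cdot>\<^sub>m Z - A2 * Z) $$ (i, j) = B2 $$ (i, j)"
      proof (cases "i < n")
        case True
        then have "(A2 * Z) $$ (i, j) = (A * Y) $$ (i, j)" using ij s by (simp add: A2_def Z_def index_mult_sum)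
        then show ?thesis
          using True ij arg_cong[OF e, of "\<lambda>M. M $$ (i, j)"] by (simp add: Z_def B2_def)
      next
        case False
        then have "(A2 * Z) $$ (i, j) = (A' * Y') $$ (i - n, j)" using ij s by (simp add: A2_def Z_def index_mult_sum)
        then show ?thesis
          using False ij arg_cong[OF e', of "\<lambda>M. M $$ (i - n, j)"] by (simp add: Z_def B2_def)
      qed
    qed auto
    moreover have "R1 z + R2 z = C2 * Z" unfolding Y(2) Y'(2)
      by (rule eq_matI) (auto simp: index_mult_sum sum_lessThan_add C2_def Z_def)
    ultimately show "\<exists>Y. resolvent_sol (n + n') m1 A2 B2 z Y \<and> R1 z + R2 z = C2 * Y"
      by (intro exI[of _ Z]) (simp add: resolvent_sol_def carrier_iff)
  qed (use F F' in \<open>auto simp: A2_def B2_def C2_def\<close>)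
qed

text \<open>The companion matrix of \<open>q\<close> satisfies \<open>(z - A) (1, z, \<dots>, z\<^sup>N\<^sup>-\<^sup>1)\<^sup>T = q(z) e\<^sub>N / lead q\<close>.\<close>

lemma realizable_entry:
  fixes p q :: "complex poly"
  assumes deg: "degree p < degree q" and il: "i < m2" "l < m1"
  shows "realizable m1 m2 (\<lambda>z. Matrix.mat m2 m1 (\<lambda>(a, b). if a = i \<and> b = l then poly p z / poly q z else 0))"
proof -
  define N where "N = degree q"
  have N: "0 < N" "degree p < N" using deg by (auto simp: N_def)
  have q0: "q \<noteq> 0" using deg by auto
  define c where "c = lead_coeff q"
  have c0: "c \<noteq> 0" using q0 by (simp add: c_def)
  define A where "A = Matrix.mat N N (\<lambda>(a, b). (if b = Suc a then 1 else 0) - (if a = N - 1 then coeff q b / c else 0))"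
  define B where "B = Matrix.mat N m1 (\<lambda>(a, b). if a = N - 1 \<and> b = l then 1 / c else 0)"
  define C where "C = Matrix.mat m2 N (\<lambda>(a, b). if a = i then coeff p b else 0)"
  have qs: "poly q z = (\<Sum>b<N. coeff q b * z ^ b) + c * z ^ N" for z
    by (simp add: poly_altdef N_def c_def lessThan_Suc_atMost[symmetric])
  have ps: "poly p z = (\<Sum>b<N. coeff p b * z ^ b)" for z
  proof -
    have "poly p z = (\<Sum>b\<le>degree p. coeff p b * z ^ b)" by (simp add: poly_altdef)
    also have "\<dots> = (\<Sum>b<N. coeff p b * z ^ b)"
      by (rule sum.mono_neutral_left) (use N in \<open>auto simp: coeff_eq_0\<close>)
    finally show ?thesis .
  qed
  show ?thesis unfolding realizable_def
  proof (rule exI[of _ N], rule exI[of _ A], rule exI[of _ B], rule exI[of _ C],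
      rule exI[of _ "{z. poly q z = 0}"], intro conjI allI impI)
    show "finite {z. poly q z = 0}" by (rule poly_roots_finite[OF q0])
    fix z assume "z \<notin> {z. poly q z = 0}"
    then have qz: "poly q z \<noteq> 0" by simp
    define Y where "Y = Matrix.mat N m1 (\<lambda>(a, b). if b = l then z ^ a / poly q z else 0)"
    have d [simp]: "dim_row A = N" "dim_col A = N" "dim_row B = N" "dim_col B = m1"
      "dim_row C = m2" "dim_col C = N" "dim_row Y = N" "dim_col Y = m1"
      by (auto simp: A_def B_def C_def Y_def)
    have "z \<cdot>\<^sub>m Y - A * Y = B"
    proof (rule eq_matI)
      fix a b assume "a < dim_row B" "b < dim_col B"
      then have ab: "a < N" "b < m1" by auto
      show "(z \<cdot>\<^sub>m Y - A * Y) $$ (a, b) = B $$ (a, b)"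
      proof (cases "b = l")
        case False
        then have "(A * Y) $$ (a, b) = 0" using ab by (simp add: index_mult_sum Y_def)
        then show ?thesis using ab False by (simp add: Y_def B_def)
      next
        case True
        have "(A * Y) $$ (a, b) = (\<Sum>k<N. ((if k = Suc a then 1 else 0) - (if a = N - 1 then coeff q k / c else 0)) * (z ^ k / poly q z))"
          using ab True by (simp add: index_mult_sum A_def Y_def)
        also have "\<dots> = (\<Sum>k<N. if k = Suc a then z ^ Suc a / poly q z else 0) -
            (\<Sum>k<N. (if a = N - 1 then coeff q k / c else 0) * (z ^ k / poly q z))"
          unfolding sum_subtractf[symmetric] by (rule sum.cong) (auto simp: algebra_simps)
        also have "\<dots> = (if Suc a < N then z ^ Suc a / poly q z else 0) -
            (if a = N - 1 then (\<Sum>k<N. coeff q k * z ^ k) / (c * poly q z) else 0)"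
          by (simp add: sum_divide_distrib)
        finally have AY: "(A * Y) $$ (a, b) = (if Suc a < N then z ^ Suc a / poly q z else 0) -
            (if a = N - 1 then (\<Sum>k<N. coeff q k * z ^ k) / (c * poly q z) else 0)" .
        have Yab: "Y $$ (a, b) = z ^ a / poly q z" using ab True by (simp add: Y_def)
        show ?thesis
        proof (cases "a = N - 1")
          case False
          then have "Suc a < N" using ab by auto
          then show ?thesis using False ab AY Yab by (simp add: B_def)
        next
          case a: True
          have S: "(\<Sum>k<N. coeff q k * z ^ k) = poly q z - c * z ^ N" using qs[of z] by simp
          have "z * z ^ a = z ^ N" using a N by (simp add: power_Suc[symmetric] del: power_Suc)
          then have "z * (z ^ a / poly q z) + (\<Sum>k<N. coeff q k * z ^ k) / (c * poly q z) = 1 / c"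
            unfolding S using qz c0 by (simp add: field_simps)
          then show ?thesis using a ab True N AY Yab by (simp add: B_def)
        qed
      qed
    qed auto
    moreover have "Matrix.mat m2 m1 (\<lambda>(a, b). if a = i \<and> b = l then poly p z / poly q z else 0) = C * Y"
      by (rule eq_matI) (auto simp: index_mult_sum C_def Y_def ps sum_divide_distrib)
    ultimately show "\<exists>Y. resolvent_sol N m1 A B z Y \<and>
        Matrix.mat m2 m1 (\<lambda>(a, b). if a = i \<and> b = l then poly p z / poly q z else 0) = C * Y"
      by (intro exI[of _ Y]) (simp add: resolvent_sol_def carrier_iff)
  qed (auto simp: A_def B_def C_def)
qed

text \<open>After division with remainder, the polynomial part tends to 0 at infinity along with the
  function and the proper part, so it is 0.\<close>

lemma strictly_proper_quotient:
  fixes p q :: "complex poly"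
  assumes q: "q \<noteq> 0" and f: "\<And>z. poly q z \<noteq> 0 \<Longrightarrow> f z = poly p z / poly q z"
    and lim: "(f \<longlongrightarrow> 0) at_infinity"
  shows "p = 0 \<or> degree p < degree q"
proof -
  define s where "s = p div q"
  define r where "r = p mod q"
  have pqr: "p = q * s + r" by (simp add: s_def r_def)
  have r: "r = 0 \<or> degree r < degree q" using degree_mod_less[OF q] by (simp add: r_def)
  have rl: "((\<lambda>z. poly r z / poly q z) \<longlongrightarrow> 0) at_infinity"
    using r poly_divide_tendsto_0_at_infinity[of r q] by auto
  have "eventually (\<lambda>z. poly q z \<noteq> 0) at_infinity"
  proof -
    obtain b where "\<forall>z\<in>{z. poly q z = 0}. cmod z \<le> b"
      using finite_imp_bounded[OF poly_roots_finite[OF q]] by (auto simp: bounded_iff)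
    then show ?thesis unfolding eventually_at_infinity by (intro exI[of _ "b + 1"]) force
  qed
  then have ev: "eventually (\<lambda>z. f z - poly r z / poly q z = poly s z) at_infinity"
    by eventually_elim (simp add: f pqr field_simps)
  have "((\<lambda>z. f z - poly r z / poly q z) \<longlongrightarrow> 0 - 0) at_infinity" by (intro tendsto_diff lim rl)
  then have sl: "(poly s \<longlongrightarrow> 0) at_infinity" using tendsto_cong[OF ev] by simp
  have "s = 0"
  proof (cases "degree s = 0")
    case True
    then obtain k where k: "s = [:k:]" by (rule degree_eq_zeroE)
    have "poly s = (\<lambda>z. k)" by (rule ext) (simp add: k)
    then have "((\<lambda>z::complex. k) \<longlongrightarrow> 0) at_infinity" using sl by simp
    then show ?thesis using k by (simp add: tendsto_const_iff[OF trivial_limit_at_infinity])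
  next
    case False
    then have "filterlim (poly s) at_infinity at_infinity" by (intro filterlim_poly_at_infinity) auto
    then show ?thesis using not_tendsto_and_filterlim_at_infinity[OF trivial_limit_at_infinity sl] by blast
  qed
  then show ?thesis using pqr r by auto
qed

lemma realizable_cong:
  assumes H: "realizable m1 m2 H" and F: "finite F" and HG: "\<And>z. z \<notin> F \<Longrightarrow> H z = G z"
  shows "realizable m1 m2 G"
proof -
  obtain n A B C F' where r: "A \<in> carrier_mat n n" "B \<in> carrier_mat n m1" "C \<in> carrier_mat m2 n"
    "finite F'" "\<And>z. z \<notin> F' \<Longrightarrow> \<exists>Y. resolvent_sol n m1 A B z Y \<and> H z = C * Y"
    using H unfolding realizable_def by metis
  have 1: "finite (F \<union> F')" using F r(4) by simp
  have 2: "\<exists>Y. resolvent_sol n m1 A B z Y \<and> G z = C * Y" if "z \<notin> F \<union> F'" for z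
    using r(5)[of z] HG[of z] that by simp
  show ?thesis using 1 2 r(1-3) unfolding realizable_def by metis
qed

lemma rational_realizable:
  assumes R: "rational_mat_fun m2 m1 R" and v: "vanishes_at_infinity m2 m1 R"
  shows "\<exists>n A B C. realization m1 m2 n A B C R"
proof -
  have Rc: "R z \<in> carrier_mat m2 m1" for z using R by (simp add: rational_mat_fun_def)
  have entry: "\<exists>p q :: complex poly. degree p < degree q \<and> (\<exists>F. finite F \<and> (\<forall>z. z \<notin> F \<longrightarrow> R z $$ (i, l) = poly p z / poly q z))"
    if il: "i < m2" "l < m1" for i l
  proof -
    obtain p q where q: "q \<noteq> 0" and pq: "\<And>z. poly q z \<noteq> 0 \<Longrightarrow> R z $$ (i, l) = poly p z / poly q z"
      using R il unfolding rational_mat_fun_def by blast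
    have "p = 0 \<or> degree p < degree q"
      by (rule strictly_proper_quotient[OF q pq]) (use v il in \<open>auto simp: vanishes_at_infinity_def\<close>)
    then show ?thesis
    proof
      assume "p = 0"
      \<comment> \<open>A zero entry is written as \<open>0 / z\<close>, which satisfies the strict
        degree inequality even if \<open>q\<close> is constant.\<close>
      then show ?thesis using pq poly_roots_finite[OF q]
        by (intro exI[of _ 0] exI[of _ "[:0, 1:]"] conjI exI[of _ "{z. poly q z = 0}"]) auto
    next
      assume "degree p < degree q"
      then show ?thesis using pq poly_roots_finite[OF q]
        by (intro exI[of _ p] exI[of _ q] conjI exI[of _ "{z. poly q z = 0}"]) auto
    qed
  qed
  define RS where "RS = (\<lambda>S z. Matrix.mat m2 m1 (\<lambda>(i, l). if (i, l) \<in> S then R z $$ (i, l) else 0))"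
  have RSr: "realizable m1 m2 (RS S)" if "finite S" "S \<subseteq> {..<m2} \<times> {..<m1}" for S
    using that
  proof (induction S rule: finite_induct)
    case empty
    have "RS {} = (\<lambda>z. 0\<^sub>m m2 m1)" by (auto simp: RS_def fun_eq_iff intro!: eq_matI)
    then show ?case using realizable_zero by simp
  next
    case (insert x S)
    obtain i l where x: "x = (i, l)" and il: "i < m2" "l < m1" using insert.prems by auto
    obtain p q :: "complex poly" and F where deg: "degree p < degree q" and F: "finite F"
      and pq: "\<And>z. z \<notin> F \<Longrightarrow> R z $$ (i, l) = poly p z / poly q z" using entry[OF il] by metis
    have "realizable m1 m2 (\<lambda>z. RS S z + Matrix.mat m2 m1 (\<lambda>(a, b). if a = i \<and> b = l then poly p z / poly q z else 0))"
      by (intro realizable_add insert.IH realizable_entry deg il) (use insert.prems in auto)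
    then show ?case
    proof (rule realizable_cong[OF _ F])
      fix z assume "z \<notin> F"
      then show "RS S z + Matrix.mat m2 m1 (\<lambda>(a, b). if a = i \<and> b = l then poly p z / poly q z else 0) = RS (insert x S) z"
        using insert.hyps(2) pq by (intro eq_matI) (auto simp: RS_def x)
    qed
  qed
  have "RS ({..<m2} \<times> {..<m1}) = R"
    by (rule ext, rule eq_matI) (simp_all add: RS_def carrier_matD[OF Rc])
  then have "realizable m1 m2 R" using RSr[of "{..<m2} \<times> {..<m1}"] by simp
  then obtain n A B C F where A: "A \<in> carrier_mat n n" and B: "B \<in> carrier_mat n m1" and C: "C \<in> carrier_mat m2 n"
    and F: "finite F" and r: "\<And>z. z \<notin> F \<Longrightarrow> \<exists>Y. resolvent_sol n m1 A B z Y \<and> R z = C * Y"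
    unfolding realizable_def by metis
  have "realization m1 m2 n A B C R"
  proof (rule realization_rational[OF R A B C, of "- F"])
    show "infinite (- F)" using F infinite_UNIV_char_0 by (metis finite_compl)
  qed (use r in simp)
  then show ?thesis by blast
qed

lemma minimal_realization_exists:
  assumes R: "rational_mat_fun m2 m1 R" and v: "vanishes_at_infinity m2 m1 R"
  shows "\<exists>n A B C. minimal_realization m1 m2 n A B C R"
proof -
  let ?P = "\<lambda>n. \<exists>A B C. realization m1 m2 n A B C R"
  have "\<exists>n. ?P n" using rational_realizable[OF R v] by blast
  then have "?P (LEAST n. ?P n)" by (rule LeastI_ex)
  then obtain A B C where "realization m1 m2 (LEAST n. ?P n) A B C R" by (elim exE)
  moreover have "(LEAST n. ?P n) \<le> n'" if "realization m1 m2 n' A' B' C' R" for n' A' B' C'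
    by (rule Least_le) (use that in blast)
  ultimately have "minimal_realization m1 m2 (LEAST n. ?P n) A B C R"
    unfolding minimal_realization_def by simp
  then show ?thesis by (intro exI)
qed

subsection \<open>Contractive functions and their Riccati equation\<close>

lemma qf_vec:
  assumes M: "M \<in> carrier_mat n n" and w: "w \<in> carrier_vec n"
  shows "(M *\<^sub>v w) \<bullet>c w = qf M (Matrix.mat n 1 (\<lambda>(i, j). vec_index w i))"
proof -
  have Mw: "M *\<^sub>v w \<in> carrier_vec n" using M w by (auto intro: mult_mat_vec_carrier)
  show ?thesis
    unfolding qf_def col_mult_vec[OF M w]
    using carrier_vecD[OF w] carrier_vecD[OF Mw]
    by (simp add: index_mult_sum scalar_prod_def conjugate_complex_def atLeast0LessThan mult.commute)
qed

lemma qf_defect: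
  assumes R: "R \<in> carrier_mat p m" and u: "u \<in> carrier_mat m 1"
  shows "qf (1\<^sub>m m - adj R * R) u = of_real (nrm2 u - nrm2 (R * u))"
proof -
  note [simp] = carrier_matD[OF R] carrier_matD[OF u]
  have "adj u * ((1\<^sub>m m - adj R * R) * u) = adj u * u - adj (R * u) * (R * u)" by (simp add: mat_simps)
  then show ?thesis by (simp add: qf_def adj_self_nrm2)
qed

lemma pos_semidef_defect_iff:
  assumes R: "R \<in> carrier_mat p m"
  shows "pos_semidef (1\<^sub>m m - adj R * R) \<longleftrightarrow> (\<forall>u\<in>carrier_mat m 1. nrm2 (R * u) \<le> nrm2 u)"
proof -
  note [simp] = carrier_matD[OF R]
  have M: "1\<^sub>m m - adj R * R \<in> carrier_mat m m" by (simp add: carrier_iff)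
  have dr: "dim_row (1\<^sub>m m - adj R * R) = m" by simp
  show ?thesis unfolding pos_semidef_def dr
  proof (intro iffI ballI)
    fix u :: "complex mat" assume H: "\<forall>w\<in>carrier_vec m. 0 \<le> ((1\<^sub>m m - adj R * R) *\<^sub>v w) \<bullet>c w" and u: "u \<in> carrier_mat m (1::nat)"
    have cu: "col u 0 \<in> carrier_vec m" using carrier_matD[OF u] by (intro carrier_vecI) simp
    have "Matrix.mat m 1 (\<lambda>(i, j). vec_index (col u 0) i) = u"
      using carrier_matD[OF u] by (intro eq_matI) auto
    then have "0 \<le> qf (1\<^sub>m m - adj R * R) u" using H[rule_format, OF cu] unfolding qf_vec[OF M cu] by simp
    then show "nrm2 (R * u) \<le> nrm2 u" unfolding qf_defect[OF R u] by (simp add: less_eq_complex_def)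
  next
    fix w :: "complex Matrix.vec"
    assume H: "\<forall>u\<in>carrier_mat m 1. nrm2 (R * u) \<le> nrm2 u" and w: "w \<in> carrier_vec m"
    show "0 \<le> ((1\<^sub>m m - adj R * R) *\<^sub>v w) \<bullet>c w"
      unfolding qf_vec[OF M w] qf_defect[OF R mat_carrier]
      using H by (simp add: less_eq_complex_def)
  qed
qed

lemma nrm2_unit_col: "j < n \<Longrightarrow> nrm2 (unit_col n j) = 1"
  by (simp add: nrm2_def unit_col_def if_distrib[of "\<lambda>x. (cmod x)\<^sup>2"] cong: if_cong)

lemma contraction_entry_bound:
  assumes R: "R \<in> carrier_mat p m" and c: "\<And>u. u \<in> carrier_mat m 1 \<Longrightarrow> nrm2 (R * u) \<le> nrm2 u"
    and ij: "i < p" "j < m"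
  shows "cmod (R $$ (i, j)) \<le> 1"
proof -
  note [simp] = carrier_matD[OF R]
  have e: "(R * unit_col m j) $$ (i, 0) = R $$ (i, j)"
    using ij by (simp add: index_mult_sum unit_col_def if_distrib cong: if_cong)
  have "(cmod ((R * unit_col m j) $$ (i, 0)))\<^sup>2 \<le> nrm2 (R * unit_col m j)"
    unfolding nrm2_def using ij by (intro member_le_sum) auto
  also have "\<dots> \<le> 1" using c[OF unit_col_carrier] nrm2_unit_col[OF ij(2)] by metis
  finally show ?thesis unfolding e by (simp add: abs_square_le_1)
qed

lemma eventually_not_in_spectrum:
  assumes A: "A \<in> carrier_mat n n"
  shows "eventually (\<lambda>\<xi>. complex_of_real \<xi> \<notin> spectrum A) (at l)"
proof -
  have "finite {\<xi>. complex_of_real \<xi> \<in> spectrum A}"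
    using finite_vimageI[OF finite_spectrum[OF A] inj_of_real] by (simp add: vimage_def)
  then have "\<not> l islimpt {\<xi>. complex_of_real \<xi> \<in> spectrum A}" by (rule islimpt_finite)
  then show ?thesis by (simp add: islimpt_iff_eventually)
qed

text \<open>\<open>V\<close> collects the vectors \<open>b\<close> for which
  \<open>C (\<xi> - A)^-1 b\<close> stays bounded as \<xi> tends to \<open>l\<close>. It contains
  the range of \<open>B\<close> by the bound on \<open>R\<close>, and it is
  \<open>A\<close>-invariant as \<open>(\<xi> - A)^-1 A = \<xi> (\<xi> - A)^-1 - 1\<close>.
  Controllability makes it the whole space. For an eigenvector \<open>w\<close> at \<open>l\<close>
  the expression is \<open>C w / (\<xi> - l)\<close>, so \<open>C w = 0\<close>, against
  observability.\<close>

lemma contractive_no_real_eigenvalue: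
  assumes r: "realization m1 m2 n A B C R" and AB: "pbh n A B" and CA: "pbh n (adj A) (adj C)"
    and bd: "\<And>\<xi> i j. i < m2 \<Longrightarrow> j < m1 \<Longrightarrow> cmod (R (complex_of_real \<xi>) $$ (i, j)) \<le> 1"
  shows "complex_of_real l \<notin> spectrum A"
proof
  assume l: "complex_of_real l \<in> spectrum A"
  have A: "A \<in> carrier_mat n n" and B: "B \<in> carrier_mat n m1" and C: "C \<in> carrier_mat m2 n"
    using r by (auto simp: realization_def)
  note [simp] = carrier_matD[OF A] carrier_matD[OF B] carrier_matD[OF C]
  let ?M = "\<lambda>\<xi>. complex_of_real \<xi> \<cdot>\<^sub>m 1\<^sub>m n - A"
  define N where "N = (\<lambda>\<xi>. mat_inv (?M \<xi>))"
  have M: "?M \<xi> \<in> carrier_mat n n" for \<xi> by (simp add: carrier_iff)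
  have N: "N \<xi> * ?M \<xi> = 1\<^sub>m n" "dim_row (N \<xi>) = n" "dim_col (N \<xi>) = n"
    if "complex_of_real \<xi> \<notin> spectrum A" for \<xi>
    using mat_inv_props[OF M, of \<xi>] spectrum_det[OF A] that by (auto simp: N_def)
  note ev = eventually_not_in_spectrum[OF A, of l]
  define V where "V = {b \<in> carrier_mat n 1. \<exists>K. eventually (\<lambda>\<xi>. \<forall>i<m2. cmod ((C * (N \<xi> * b)) $$ (i, 0)) \<le> K) (at l)}"
  have Vc: "b \<in> carrier_mat n 1" if "b \<in> V" for b using that by (auto simp: V_def)
  have VI: "b \<in> V" if "b \<in> carrier_mat n 1"
    "eventually (\<lambda>\<xi>. \<forall>i<m2. cmod ((C * (N \<xi> * b)) $$ (i, 0)) \<le> K) (at l)" for b K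
    using that by (auto simp: V_def)
  have V: "subspace_mat n V"
  proof (rule subspace_matI)
    show "V \<subseteq> carrier_mat n 1" by (auto simp: V_def)
    show "0\<^sub>m n 1 \<in> V"
    proof (rule VI[of _ 0])
      show "eventually (\<lambda>\<xi>. \<forall>i<m2. cmod ((C * (N \<xi> * 0\<^sub>m n 1)) $$ (i, 0)) \<le> 0) (at l)"
        using ev by eventually_elim (simp add: N mult_zero_dim)
    qed simp
    fix x c assume x: "x \<in> V"
    note [simp] = carrier_matD[OF Vc[OF x]]
    obtain K where K: "eventually (\<lambda>\<xi>. \<forall>i<m2. cmod ((C * (N \<xi> * x)) $$ (i, 0)) \<le> K) (at l)"
      using x by (auto simp: V_def)
    show "c \<cdot>\<^sub>m x \<in> V"
    proof (rule VI[of _ "cmod c * K"])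
      show "eventually (\<lambda>\<xi>. \<forall>i<m2. cmod ((C * (N \<xi> * (c \<cdot>\<^sub>m x))) $$ (i, 0)) \<le> cmod c * K) (at l)"
        using ev K by eventually_elim (auto simp: N mult_smult_dim norm_mult intro!: mult_left_mono)
    qed (simp add: carrier_iff)
    fix y assume y: "y \<in> V"
    note [simp] = carrier_matD[OF Vc[OF y]]
    obtain K' where K': "eventually (\<lambda>\<xi>. \<forall>i<m2. cmod ((C * (N \<xi> * y)) $$ (i, 0)) \<le> K') (at l)"
      using y by (auto simp: V_def)
    show "x + y \<in> V"
    proof (rule VI[of _ "K + K'"])
      show "eventually (\<lambda>\<xi>. \<forall>i<m2. cmod ((C * (N \<xi> * (x + y))) $$ (i, 0)) \<le> K + K') (at l)"
        using ev K K'
        by eventually_elim (auto simp: N mult_add_dim intro!: order_trans[OF norm_triangle_ineq] add_mono)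
    qed (simp add: carrier_iff)
  qed
  have BV: "B * u \<in> V" if u: "u \<in> carrier_mat m1 1" for u
  proof (rule VI[of _ "\<Sum>k<m1. cmod (u $$ (k, 0))"])
    note [simp] = carrier_matD[OF u]
    show "B * u \<in> carrier_mat n 1" by (simp add: carrier_iff)
    show "eventually (\<lambda>\<xi>. \<forall>i<m2. cmod ((C * (N \<xi> * (B * u))) $$ (i, 0)) \<le> (\<Sum>k<m1. cmod (u $$ (k, 0)))) (at l)"
      using ev
    proof eventually_elim
      case (elim \<xi>)
      have Re: "R (complex_of_real \<xi>) = C * N \<xi> * B" using r elim by (simp add: realization_def N_def)
      show ?case
      proof (intro allI impI)
        fix i assume i: "i < m2"
        have "C * (N \<xi> * (B * u)) = R (complex_of_real \<xi>) * u"
          unfolding Re using N[OF elim] by (simp add: mult_assoc_dim)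
        moreover have "dim_row (R (complex_of_real \<xi>)) = m2" "dim_col (R (complex_of_real \<xi>)) = m1"
          unfolding Re by simp_all
        ultimately have "(C * (N \<xi> * (B * u))) $$ (i, 0) = (\<Sum>k<m1. R (complex_of_real \<xi>) $$ (i, k) * u $$ (k, 0))"
          using i by (simp add: index_mult_sum)
        also have "cmod \<dots> \<le> (\<Sum>k<m1. cmod (R (complex_of_real \<xi>) $$ (i, k) * u $$ (k, 0)))" by (rule norm_sum)
        also have "\<dots> \<le> (\<Sum>k<m1. cmod (u $$ (k, 0)))"
          by (intro sum_mono) (auto simp: norm_mult intro!: mult_left_le_one_le bd i)
        finally show "cmod ((C * (N \<xi> * (B * u))) $$ (i, 0)) \<le> (\<Sum>k<m1. cmod (u $$ (k, 0)))" .
      qed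
    qed
  qed
  have AV: "A * x \<in> V" if x: "x \<in> V" for x
  proof -
    note [simp] = carrier_matD[OF Vc[OF x]]
    obtain K where K: "eventually (\<lambda>\<xi>. \<forall>i<m2. cmod ((C * (N \<xi> * x)) $$ (i, 0)) \<le> K) (at l)"
      using x by (auto simp: V_def)
    have lb: "eventually (\<lambda>\<xi>. \<bar>\<xi>\<bar> \<le> \<bar>l\<bar> + 1) (at l)"
      unfolding eventually_at by (rule exI[of _ 1]) (auto simp: dist_real_def)
    show ?thesis
    proof (rule VI[of _ "(\<bar>l\<bar> + 1) * \<bar>K\<bar> + (\<Sum>i<m2. cmod ((C * x) $$ (i, 0)))"])
      show "A * x \<in> carrier_mat n 1" by (simp add: carrier_iff)
      show "eventually (\<lambda>\<xi>. \<forall>i<m2. cmod ((C * (N \<xi> * (A * x))) $$ (i, 0)) \<le>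
          (\<bar>l\<bar> + 1) * \<bar>K\<bar> + (\<Sum>i<m2. cmod ((C * x) $$ (i, 0)))) (at l)"
        using ev K lb
      proof eventually_elim
        case (elim \<xi>)
        note [simp] = N(2,3)[OF elim(1)]
        have "(N \<xi> * ?M \<xi>) * x = x" unfolding N(1)[OF elim(1)] by (simp add: one_mult_dim)
        then have "complex_of_real \<xi> \<cdot>\<^sub>m (N \<xi> * x) - N \<xi> * (A * x) = x" by (simp add: mat_simps)
        then have h: "C * (complex_of_real \<xi> \<cdot>\<^sub>m (N \<xi> * x) - N \<xi> * (A * x)) = C * x" by (rule arg_cong)
        have e: "(C * (N \<xi> * (A * x))) $$ (i, 0) = complex_of_real \<xi> * (C * (N \<xi> * x)) $$ (i, 0) - (C * x) $$ (i, 0)"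
          if "i < m2" for i
          unfolding h[symmetric] using that by (simp add: mult_minus_dim mult_smult_dim)
        show ?case
        proof (intro allI impI)
          fix i assume i: "i < m2"
          have "cmod ((C * (N \<xi> * (A * x))) $$ (i, 0)) \<le> \<bar>\<xi>\<bar> * cmod ((C * (N \<xi> * x)) $$ (i, 0)) + cmod ((C * x) $$ (i, 0))"
            unfolding e[OF i] using norm_triangle_ineq4[of "complex_of_real \<xi> * (C * (N \<xi> * x)) $$ (i, 0)"]
            by (simp add: norm_mult)
          also have "\<dots> \<le> (\<bar>l\<bar> + 1) * \<bar>K\<bar> + (\<Sum>i<m2. cmod ((C * x) $$ (i, 0)))"
          proof (rule add_mono)
            have "cmod ((C * (N \<xi> * x)) $$ (i, 0)) \<le> K" using elim(2) i by blast
            then show "\<bar>\<xi>\<bar> * cmod ((C * (N \<xi> * x)) $$ (i, 0)) \<le> (\<bar>l\<bar> + 1) * \<bar>K\<bar>"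
              using elim(3) by (intro mult_mono) auto
            show "cmod ((C * x) $$ (i, 0)) \<le> (\<Sum>i<m2. cmod ((C * x) $$ (i, 0)))"
              using i by (intro member_le_sum) auto
          qed
          finally show "cmod ((C * (N \<xi> * (A * x))) $$ (i, 0)) \<le> (\<bar>l\<bar> + 1) * \<bar>K\<bar> + (\<Sum>i<m2. cmod ((C * x) $$ (i, 0)))" .
        qed
      qed
    qed
  qed
  obtain w where w: "w \<in> carrier_mat n 1" and w0: "w \<noteq> 0\<^sub>m n 1" and Aw: "A * w = complex_of_real l \<cdot>\<^sub>m w"
    using l unfolding spectrum_iff[OF A] by auto
  note [simp] = carrier_matD[OF w]
  have "w \<in> V" by (rule reachable[OF A B AB V BV AV w])
  then obtain K where K: "eventually (\<lambda>\<xi>. \<forall>i<m2. cmod ((C * (N \<xi> * w)) $$ (i, 0)) \<le> K) (at l)"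
    by (auto simp: V_def)
  have "C * w = 0\<^sub>m m2 1"
  proof (rule eq_matI)
    fix i j assume "i < dim_row (0\<^sub>m m2 1 :: complex mat)" "j < dim_col (0\<^sub>m m2 1 :: complex mat)"
    then have ij: "i < m2" "j = 0" by auto
    have "eventually (\<lambda>\<xi>. cmod ((C * w) $$ (i, 0)) \<le> K * \<bar>\<xi> - l\<bar>) (at l)"
      using ev K
    proof eventually_elim
      case (elim \<xi>)
      note [simp] = N(2,3)[OF elim(1)]
      have "(N \<xi> * ?M \<xi>) * w = w" unfolding N(1)[OF elim(1)] by (simp add: one_mult_dim)
      then have "complex_of_real \<xi> \<cdot>\<^sub>m (N \<xi> * w) - N \<xi> * (A * w) = w" by (simp add: mat_simps)
      then have "w = complex_of_real \<xi> \<cdot>\<^sub>m (N \<xi> * w) - complex_of_real l \<cdot>\<^sub>m (N \<xi> * w)"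
        by (simp add: Aw mult_smult_dim)
      then have "C * w = C * (complex_of_real \<xi> \<cdot>\<^sub>m (N \<xi> * w) - complex_of_real l \<cdot>\<^sub>m (N \<xi> * w))" by (rule arg_cong)
      then have "(C * w) $$ (i, 0) = (complex_of_real (\<xi> - l)) * (C * (N \<xi> * w)) $$ (i, 0)"
        using ij by (simp add: mult_minus_dim mult_smult_dim algebra_simps)
      then have "cmod ((C * w) $$ (i, 0)) = \<bar>\<xi> - l\<bar> * cmod ((C * (N \<xi> * w)) $$ (i, 0))"
        by (metis norm_mult norm_of_real)
      also have "\<dots> \<le> \<bar>\<xi> - l\<bar> * K" using elim(2) ij by (intro mult_left_mono) auto
      finally show ?case by (simp add: mult.commute)
    qed
    moreover have "((\<lambda>\<xi>. K * \<bar>\<xi> - l\<bar>) \<longlongrightarrow> K * \<bar>l - l\<bar>) (at l)" by (intro tendsto_intros)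
    ultimately have "cmod ((C * w) $$ (i, 0)) \<le> K * \<bar>l - l\<bar>"
      by (intro tendsto_le[OF _ _ tendsto_const]) auto
    then show "(C * w) $$ (i, j) = 0\<^sub>m m2 1 $$ (i, j)" using ij by simp
  qed auto
  then have "w = 0\<^sub>m n 1" by (rule obsD[OF CA w Aw C])
  then show False using w0 by simp
qed

lemma riccati_solution_iff:
  assumes A: "A \<in> carrier_mat n n" and B: "B \<in> carrier_mat n m" and C: "C \<in> carrier_mat p n"
  shows "riccati_solution n A B C X \<longleftrightarrow>
    ric n A B (adj C * C) X \<and> (\<forall>\<mu>\<in>spectrum (closed_loop A B X). Im \<mu> \<le> 0)"
proof (cases "X \<in> carrier_mat n n")
  case True
  note [simp] = carrier_matD[OF A] carrier_matD[OF B] carrier_matD[OF C] carrier_matD[OF True]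
  have e: "X * B * adj B * X = X * (B * (adj B * X))" "B * adj B * X = B * (adj B * X)"
    by (simp_all add: mult_assoc_dim)
  show ?thesis
    unfolding riccati_solution_def ric_def hermitian_mat_def spectrum_in_closed_lower_half_plane_def
      closed_loop_def e by auto
qed (auto simp: riccati_solution_def ric_def)

text \<open>Multiplying the Riccati equation by \<open>S = X^-1\<close> on both sides gives the
  identity of the admissible set. Feedback through \<open>B\<close> preserves controllability by
  \<open>B\<close>, and the substitution \<open>w = X y\<close> turns controllability by \<gamma>
  into observability of \<open>(C, A)\<close>.\<close>

lemma riccati_admissible:
  assumes A: "A \<in> carrier_mat n n" and B: "B \<in> carrier_mat n m1" and C: "C \<in> carrier_mat m2 n"
    and AB: "pbh n A B" and CA: "pbh n (adj A) (adj C)" and r: "ric n A B (adj C * C) X"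
    and sp: "\<And>\<mu>. \<mu> \<in> spectrum (closed_loop A B X) \<Longrightarrow> Im \<mu> \<le> 0"
  shows "admissible m1 m2 n (closed_loop A B X) (mat_inv X) B ((- \<i>) \<cdot>\<^sub>m (mat_inv X * adj C))"
    and "Determinant.det (mat_inv X) \<noteq> 0" and "invertible_mat X"
proof -
  have X: "X \<in> carrier_mat n n" and hX: "adj X = X"
    and eq: "\<i> \<cdot>\<^sub>m (X * A - adj A * X) = adj C * C + X * (B * (adj B * X))"
    using r by (auto simp: ric_def)
  note I = mat_inv_props[OF X riccati_solution_nonsingular[OF A B C CA r]]
  define S where "S = mat_inv X"
  have Sc: "S \<in> carrier_mat n n" and XS: "X * S = 1\<^sub>m n" and SX: "S * X = 1\<^sub>m n" using I by (auto simp: S_def)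
  note [simp] = carrier_matD[OF A] carrier_matD[OF B] carrier_matD[OF C] carrier_matD[OF X] carrier_matD[OF Sc]
  define \<alpha> where "\<alpha> = closed_loop A B X"
  define \<gamma> where "\<gamma> = (- \<i>) \<cdot>\<^sub>m (S * adj C)"
  have d [simp]: "dim_row \<alpha> = n" "dim_col \<alpha> = n" "dim_row \<gamma> = n" "dim_col \<gamma> = m2"
    by (auto simp: \<alpha>_def closed_loop_def \<gamma>_def)
  show "Determinant.det (mat_inv X) \<noteq> 0" using det_nonzero_of_inverse(2)[OF X Sc XS] by (simp add: S_def)
  show "invertible_mat X" unfolding invertible_mat_def inverts_mat_def
    using XS SX by (auto intro!: exI[of _ S])
  have SX': "S * (X * Z) = Z" and XS': "X * (S * Z) = Z" if "dim_row Z = n" for Z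
    using that by (simp_all add: mult_assoc_dim[symmetric] SX XS one_mult_dim)
  have hS: "adj S = S"
  proof -
    have 1: "adj S * X = 1\<^sub>m n" using arg_cong[OF XS, of adj] by (simp add: mat_simps hX)
    have "adj S = adj S * (X * S)" by (simp add: XS mult_one_dim)
    also have "\<dots> = (adj S * X) * S" by (simp add: mult_assoc_dim)
    also have "\<dots> = S" unfolding 1 by (simp add: one_mult_dim)
    finally show ?thesis .
  qed
  have ident: "\<alpha> * S - S * adj \<alpha> = \<i> \<cdot>\<^sub>m (B * adj B - \<gamma> * adj \<gamma>)"
  proof (rule eq_matI)
    fix i j assume "i < dim_row (\<i> \<cdot>\<^sub>m (B * adj B - \<gamma> * adj \<gamma>))" "j < dim_col (\<i> \<cdot>\<^sub>m (B * adj B - \<gamma> * adj \<gamma>))"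
    then have ij: "i < n" "j < n" by auto
    have "S * (\<i> \<cdot>\<^sub>m (X * A - adj A * X)) * S = S * (adj C * C + X * (B * (adj B * X))) * S" unfolding eq ..
    then have "\<i> \<cdot>\<^sub>m (A * S) - \<i> \<cdot>\<^sub>m (S * adj A) = S * (adj C * (C * S)) + B * adj B"
      by (simp add: mat_simps SX' XS)
    from arg_cong[OF this, of "\<lambda>M. M $$ (i, j)"]
    have e: "\<i> * (A * S) $$ (i, j) - \<i> * (S * adj A) $$ (i, j) = (S * (adj C * (C * S))) $$ (i, j) + (B * adj B) $$ (i, j)"
      using ij by simp
    have "\<i> * (\<i> * (A * S) $$ (i, j) - \<i> * (S * adj A) $$ (i, j)) =
        \<i> * ((S * (adj C * (C * S))) $$ (i, j) + (B * adj B) $$ (i, j))" unfolding e ..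
    then have e': "(S * adj A) $$ (i, j) = (A * S) $$ (i, j) + \<i> * ((S * (adj C * (C * S))) $$ (i, j) + (B * adj B) $$ (i, j))"
      by (simp add: algebra_simps)
    show "(\<alpha> * S - S * adj \<alpha>) $$ (i, j) = (\<i> \<cdot>\<^sub>m (B * adj B - \<gamma> * adj \<gamma>)) $$ (i, j)"
      unfolding \<alpha>_def closed_loop_def \<gamma>_def using ij
      by (simp add: mat_simps hX hS SX' XS) (simp add: e' algebra_simps)
  qed auto
  have pB: "pbh n \<alpha> B" unfolding pbh_def
  proof (intro ballI allI impI, elim conjE)
    fix w \<mu> assume w: "w \<in> carrier_mat n 1" and aw: "adj \<alpha> * w = \<mu> \<cdot>\<^sub>m w" and Bw: "adj B * w = 0\<^sub>m (dim_col B) 1"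
    note [simp] = carrier_matD[OF w]
    have "adj \<alpha> * w = adj A * w - \<i> \<cdot>\<^sub>m (X * (B * (adj B * w)))"
      by (simp add: \<alpha>_def closed_loop_def mat_simps hX) (rule eq_matI, auto)
    also have "\<dots> = adj A * w" unfolding Bw by (auto simp: mat_simps intro!: eq_matI)
    finally have "adj A * w = \<mu> \<cdot>\<^sub>m w" using aw by simp
    then show "w = 0\<^sub>m n 1" using Bw by (intro pbhD[OF AB w _ B]) auto
  qed
  have p\<gamma>: "pbh n \<alpha> \<gamma>" unfolding pbh_def
  proof (intro ballI allI impI, elim conjE)
    fix w \<mu> assume w: "w \<in> carrier_mat n 1" and aw: "adj \<alpha> * w = \<mu> \<cdot>\<^sub>m w" and gw: "adj \<gamma> * w = 0\<^sub>m (dim_col \<gamma>) 1"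
    note [simp] = carrier_matD[OF w]
    define y where "y = S * w"
    have y [simp]: "dim_row y = n" "dim_col y = 1" and yc: "y \<in> carrier_mat n 1" by (auto simp: y_def carrier_iff)
    have Xy: "X * y = w" by (simp add: y_def XS')
    have "\<i> \<cdot>\<^sub>m (C * y) = 0\<^sub>m m2 1" using gw by (simp add: \<gamma>_def y_def mat_simps hS)
    then have "(- \<i>) \<cdot>\<^sub>m (\<i> \<cdot>\<^sub>m (C * y)) = 0\<^sub>m m2 1" by (simp add: mat_simps)
    then have Cy: "C * y = 0\<^sub>m m2 1" by (simp add: smult_smult smult_one_mat)
    have "(\<alpha> * S - S * adj \<alpha>) * w = \<alpha> * y - \<mu> \<cdot>\<^sub>m y"
      by (simp add: mat_simps aw y_def)
    moreover have "(\<i> \<cdot>\<^sub>m (B * adj B - \<gamma> * adj \<gamma>)) * w = \<i> \<cdot>\<^sub>m (B * (adj B * w))"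
      by (simp add: mat_simps gw) (rule eq_matI, auto)
    ultimately have 1: "\<alpha> * y - \<mu> \<cdot>\<^sub>m y = \<i> \<cdot>\<^sub>m (B * (adj B * w))" using ident by simp
    have 2: "\<alpha> * y = A * y + \<i> \<cdot>\<^sub>m (B * (adj B * w))" by (simp add: \<alpha>_def closed_loop_def mat_simps Xy)
    have "A * y = \<mu> \<cdot>\<^sub>m y"
    proof (rule eq_matI)
      fix i j assume "i < dim_row (\<mu> \<cdot>\<^sub>m y)" "j < dim_col (\<mu> \<cdot>\<^sub>m y)"
      then show "(A * y) $$ (i, j) = (\<mu> \<cdot>\<^sub>m y) $$ (i, j)"
        using arg_cong[OF 1, of "\<lambda>M. M $$ (i, j)"] unfolding 2 by simp
    qed auto
    then have "y = 0\<^sub>m n 1" by (rule obsD[OF CA yc _ C Cy])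
    then show "w = 0\<^sub>m n 1" using Xy by (simp add: mult_zero_dim)
  qed
  have ac: "\<alpha> \<in> carrier_mat n n" and gc: "\<gamma> \<in> carrier_mat n m2" by (auto simp: carrier_iff)
  have "admissible m1 m2 n \<alpha> S B \<gamma>"
    unfolding admissible_def hermitian_mat_def spectrum_in_closed_lower_half_plane_def
    using ac Sc B gc hS ident sp pbh_imp_controllable[OF ac B pB] pbh_imp_controllable[OF ac gc p\<gamma>]
    by (simp add: \<alpha>_def)
  then show "admissible m1 m2 n (closed_loop A B X) (mat_inv X) B ((- \<i>) \<cdot>\<^sub>m (mat_inv X * adj C))"
    by (simp add: \<alpha>_def \<gamma>_def S_def)
qed

lemma contractive_riccati:
  assumes R: "rational_mat_fun m2 m1 R" and c: "contractive_on_reals m2 m1 R"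
    and r: "realization m1 m2 n A B C R" and AB: "pbh n A B" and CA: "pbh n (adj A) (adj C)"
  shows "\<exists>X. riccati_solution n A B C X"
proof -
  have A: "A \<in> carrier_mat n n" and B: "B \<in> carrier_mat n m1" and C: "C \<in> carrier_mat m2 n"
    using r by (auto simp: realization_def)
  have Rc: "R z \<in> carrier_mat m2 m1" for z using R by (simp add: rational_mat_fun_def)
  have con: "nrm2 (R (complex_of_real \<xi>) * u) \<le> nrm2 u" if "u \<in> carrier_mat m1 1" for \<xi> u
    using c that pos_semidef_defect_iff[OF Rc] by (auto simp: contractive_on_reals_def)
  have nr: "complex_of_real l \<notin> spectrum A" for l
    by (rule contractive_no_real_eigenvalue[OF r AB CA]) (rule contraction_entry_bound[OF Rc con])
  have "\<exists>X. ric n A B (adj C * C) X \<and> (\<forall>\<mu>\<in>spectrum (closed_loop A B X). Im \<mu> \<le> 0)"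
  proof (rule riccati_exists[OF A B C AB nr])
    fix l x and u :: "complex mat"
    assume x: "x \<in> carrier_mat n 1" and u: "u \<in> carrier_mat m1 1"
      and e: "complex_of_real l \<cdot>\<^sub>m x - A * x = B * u"
    note [simp] = carrier_matD[OF A] carrier_matD[OF B] carrier_matD[OF C] carrier_matD[OF x] carrier_matD[OF u]
    obtain Y where Y: "resolvent_sol n m1 A B (complex_of_real l) Y" "R (complex_of_real l) = C * Y"
      using realization_sol[OF r nr] by blast
    have Yc: "Y \<in> carrier_mat n m1" and Ye: "complex_of_real l \<cdot>\<^sub>m Y - A * Y = B" using Y(1) by (auto simp: resolvent_sol_def)
    note [simp] = carrier_matD[OF Yc]
    have Bu: "B * u \<in> carrier_mat n 1" by (simp add: carrier_iff)
    have 1: "resolvent_sol n 1 A (B * u) (complex_of_real l) x" using x e by (simp add: resolvent_sol_def)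
    have "complex_of_real l \<cdot>\<^sub>m (Y * u) - A * (Y * u) = (complex_of_real l \<cdot>\<^sub>m Y - A * Y) * u"
      by (simp add: mat_simps)
    then have 2: "resolvent_sol n 1 A (B * u) (complex_of_real l) (Y * u)"
      unfolding Ye by (simp add: resolvent_sol_def carrier_iff)
    have "x = Y * u" using 1 2 unfolding resolvent_sol_iff[OF A Bu nr] by simp
    then have "C * x = R (complex_of_real l) * u" unfolding Y(2) by (simp add: mult_assoc_dim)
    then show "nrm2 (C * x) \<le> nrm2 u" using con[OF u] by simp
  qed
  then show ?thesis using riccati_solution_iff[OF A B C] by blast
qed

lemma riccati_solution_unique:
  assumes A: "A \<in> carrier_mat n n" and B: "B \<in> carrier_mat n m" and C: "C \<in> carrier_mat p n"
    and AB: "pbh n A B" and 1: "riccati_solution n A B C X" and 2: "riccati_solution n A B C X'"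
  shows "X = X'"
proof (rule riccati_unique[OF A B _ AB, of "adj C * C"])
  show "adj C * C \<in> carrier_mat n n" using carrier_matD[OF C] by (simp add: carrier_iff)
qed (use 1 2 riccati_solution_iff[OF A B C] in auto)

section \<open>Matrix functions of a complex variable\<close>

definition has_mat_derivative ::
  "nat \<Rightarrow> nat \<Rightarrow> (complex \<Rightarrow> complex mat) \<Rightarrow> complex mat \<Rightarrow> complex \<Rightarrow> bool" where
  "has_mat_derivative n m F D z \<longleftrightarrow> (\<forall>z. F z \<in> carrier_mat n m) \<and> D \<in> carrier_mat n m \<and>
     (\<forall>i<n. \<forall>j<m. ((\<lambda>z. F z $$ (i, j)) has_field_derivative D $$ (i, j)) (at z))"

lemma has_mat_derivativeD:
  assumes "has_mat_derivative n m F D z"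
  shows "F y \<in> carrier_mat n m" "D \<in> carrier_mat n m"
    "i < n \<Longrightarrow> j < m \<Longrightarrow> ((\<lambda>z. F z $$ (i, j)) has_field_derivative D $$ (i, j)) (at z)"
  using assms by (auto simp: has_mat_derivative_def)

lemma has_mat_derivative_const:
  "L \<in> carrier_mat n m \<Longrightarrow> has_mat_derivative n m (\<lambda>z. L) (0\<^sub>m n m) z"
  by (auto simp: has_mat_derivative_def)

lemma has_mat_derivative_mult:
  assumes F: "has_mat_derivative n k F D z" and G: "has_mat_derivative k m G E z"
  shows "has_mat_derivative n m (\<lambda>z. F z * G z) (D * G z + F z * E) z"
  unfolding has_mat_derivative_def
proof (intro conjI allI impI)
  note [simp] = carrier_matD[OF has_mat_derivativeD(1)[OF F]] carrier_matD[OF has_mat_derivativeD(2)[OF F]]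
    carrier_matD[OF has_mat_derivativeD(1)[OF G]] carrier_matD[OF has_mat_derivativeD(2)[OF G]]
  show "F z * G z \<in> carrier_mat n m" for z by (simp add: carrier_iff)
  show "D * G z + F z * E \<in> carrier_mat n m" by (simp add: carrier_iff)
  fix i j assume ij: "i < n" "j < m"
  have "((\<lambda>z. \<Sum>l<k. F z $$ (i, l) * G z $$ (l, j)) has_field_derivative
      (\<Sum>l<k. D $$ (i, l) * G z $$ (l, j) + E $$ (l, j) * F z $$ (i, l))) (at z)"
    by (intro DERIV_sum DERIV_mult has_mat_derivativeD(3)[OF F] has_mat_derivativeD(3)[OF G]) (use ij in auto)
  then show "((\<lambda>z. (F z * G z) $$ (i, j)) has_field_derivative (D * G z + F z * E) $$ (i, j)) (at z)"
    using ij by (simp add: index_mult_sum sum.distrib mult.commute)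
qed

lemma has_mat_derivative_add:
  assumes F: "has_mat_derivative n m F D z" and G: "has_mat_derivative n m G E z"
  shows "has_mat_derivative n m (\<lambda>z. F z + G z) (D + E) z"
  unfolding has_mat_derivative_def
  using has_mat_derivativeD[OF F] has_mat_derivativeD[OF G]
  by (auto simp: carrier_iff intro!: derivative_eq_intros)

lemma has_mat_derivative_minus:
  assumes F: "has_mat_derivative n m F D z" and G: "has_mat_derivative n m G E z"
  shows "has_mat_derivative n m (\<lambda>z. F z - G z) (D - E) z"
  unfolding has_mat_derivative_def
  using has_mat_derivativeD[OF F] has_mat_derivativeD[OF G]
  by (auto simp: carrier_iff intro!: derivative_eq_intros)

lemma has_mat_derivative_smult:
  assumes F: "has_mat_derivative n m F D z" and c: "(c has_field_derivative d) (at z)"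
  shows "has_mat_derivative n m (\<lambda>z. c z \<cdot>\<^sub>m F z) (d \<cdot>\<^sub>m F z + c z \<cdot>\<^sub>m D) z"
  unfolding has_mat_derivative_def
  using has_mat_derivativeD[OF F]
  by (auto simp: carrier_iff intro!: derivative_eq_intros c)

lemma has_mat_derivative_cmult:
  assumes F: "has_mat_derivative n m F D z"
  shows "has_mat_derivative n m (\<lambda>z. c \<cdot>\<^sub>m F z) (c \<cdot>\<^sub>m D) z"
  unfolding has_mat_derivative_def
  using has_mat_derivativeD[OF F]
  by (auto simp: carrier_iff intro!: derivative_eq_intros)

lemma has_mat_derivative_affine:
  assumes F: "has_mat_derivative n m F D (a * z + b)"
  shows "has_mat_derivative n m (\<lambda>z. F (a * z + b)) (a \<cdot>\<^sub>m D) z"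
  unfolding has_mat_derivative_def
proof (intro conjI allI impI)
  note D = has_mat_derivativeD[OF F]
  show "F (a * z + b) \<in> carrier_mat n m" for z by (rule D(1))
  show "a \<cdot>\<^sub>m D \<in> carrier_mat n m" using D(2) by simp
  fix i j assume ij: "i < n" "j < m"
  have "((\<lambda>z. a * z + b) has_field_derivative a) (at z)" by (auto intro!: derivative_eq_intros)
  from DERIV_chain2[OF D(3)[OF ij] this]
  show "((\<lambda>z. F (a * z + b) $$ (i, j)) has_field_derivative (a \<cdot>\<^sub>m D) $$ (i, j)) (at z)"
    using ij carrier_matD[OF D(2)] by (simp add: mult.commute)
qed

lemma has_mat_derivative_eq:
  "has_mat_derivative n m F D z \<Longrightarrow> D = E \<Longrightarrow> has_mat_derivative n m F E z"
  by simp

lemma has_mat_derivative_unique: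
  assumes F: "has_mat_derivative n m F D z" and G: "has_mat_derivative n m F E z"
  shows "D = E"
  by (rule eq_matI)
     (use DERIV_unique[OF has_mat_derivativeD(3)[OF F] has_mat_derivativeD(3)[OF G]]
        carrier_matD[OF has_mat_derivativeD(2)[OF F]] carrier_matD[OF has_mat_derivativeD(2)[OF G]] in auto)

lemma has_mat_derivative_zero_constant:
  assumes "\<And>z. has_mat_derivative n m F (0\<^sub>m n m) z"
  shows "F z = F 0"
proof (rule eq_matI)
  note D = has_mat_derivativeD[OF assms]
  note [simp] = carrier_matD[OF D(1)]
  fix i j assume "i < dim_row (F 0)" "j < dim_col (F 0)"
  then have ij: "i < n" "j < m" by auto
  have "((\<lambda>z. F z $$ (i, j)) has_field_derivative 0) (at x within UNIV)" for x
    using D(3)[OF ij, of x] ij by simp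
  then obtain c where "\<And>x. F x $$ (i, j) = c"
    using has_field_derivative_zero_constant[of UNIV "\<lambda>z. F z $$ (i, j)"] by auto
  then show "F z $$ (i, j) = F 0 $$ (i, j)" by simp
qed (use carrier_matD[OF has_mat_derivativeD(1)[OF assms]] in auto)

lemma has_mat_derivative_eq_functions:
  assumes F: "\<And>z. has_mat_derivative n m F (D z) z" and G: "\<And>z. has_mat_derivative n m G (D z) z"
    and 0: "F 0 = G 0"
  shows "F z = G z"
proof -
  note d = has_mat_derivativeD(1,2)[OF F] has_mat_derivativeD(1)[OF G]
  note [simp] = carrier_matD[OF d(1)] carrier_matD[OF d(2)] carrier_matD[OF d(3)]
  have "has_mat_derivative n m (\<lambda>z. F z - G z) (0\<^sub>m n m) z" for z
    by (rule has_mat_derivative_eq[OF has_mat_derivative_minus[OF F G]]) (auto intro!: eq_matI)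
  from has_mat_derivative_zero_constant[OF this, of z] have "F z - G z = 0\<^sub>m n m" unfolding 0 by (auto intro!: eq_matI)
  then show ?thesis using minus_zero_iff d by blast
qed

subsection \<open>The matrix exponential\<close>

lemma dim_mat_exp [simp]: "dim_row (mat_exp A) = dim_row A" "dim_col (mat_exp A) = dim_row A"
  by (auto simp: mat_exp_def)

lemma mat_exp_carrier [simp]: "A \<in> carrier_mat n n \<Longrightarrow> mat_exp A \<in> carrier_mat n n"
  by (auto simp: mat_exp_def carrier_iff)

lemma pow_mat_entry_bound:
  assumes A: "A \<in> carrier_mat n n"
  obtains c where "\<And>k i j. i < n \<Longrightarrow> j < n \<Longrightarrow> cmod ((A ^\<^sub>m k) $$ (i, j)) \<le> c ^ k"
proof -
  note [simp] = carrier_matD[OF A]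
  define c where "c = (\<Sum>i<n. \<Sum>j<n. cmod (A $$ (i, j)))"
  have c0: "0 \<le> c" by (simp add: c_def sum_nonneg)
  have "cmod ((A ^\<^sub>m k) $$ (i, j)) \<le> c ^ k" if "i < n" "j < n" for k i j
    using that
  proof (induction k arbitrary: i j)
    case (Suc k)
    have "cmod ((A ^\<^sub>m Suc k) $$ (i, j)) = cmod (\<Sum>l<n. (A ^\<^sub>m k) $$ (i, l) * A $$ (l, j))"
      using Suc.prems by (simp add: index_mult_sum)
    also have "\<dots> \<le> (\<Sum>l<n. cmod ((A ^\<^sub>m k) $$ (i, l) * A $$ (l, j)))" by (rule norm_sum)
    also have "\<dots> \<le> (\<Sum>l<n. c ^ k * cmod (A $$ (l, j)))"
      unfolding norm_mult by (intro sum_mono mult_right_mono Suc.IH Suc.prems) auto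
    also have "\<dots> = c ^ k * (\<Sum>l<n. cmod (A $$ (l, j)))" by (simp add: sum_distrib_left)
    also have "(\<Sum>l<n. cmod (A $$ (l, j))) \<le> c"
      unfolding c_def by (intro sum_mono member_le_sum) (use Suc.prems in auto)
    then have "c ^ k * (\<Sum>l<n. cmod (A $$ (l, j))) \<le> c ^ k * c" using c0 by (intro mult_left_mono) auto
    finally show ?case by (simp add: mult.commute)
  qed auto
  then show thesis using that by blast
qed

lemma mat_exp_smult_entry:
  assumes A: "A \<in> carrier_mat n n" and ij: "i < n" "j < n"
  shows "mat_exp (z \<cdot>\<^sub>m A) $$ (i, j) = (\<Sum>k. ((A ^\<^sub>m k) $$ (i, j) / fact k) * z ^ k)"
  using carrier_matD[OF A] ij by (simp add: mat_exp_def smult_pow_mat mult.commute)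

lemma summable_mat_exp:
  fixes A :: "complex mat"
  assumes A: "A \<in> carrier_mat n n" and ij: "i < n" "j < n"
  shows "summable (\<lambda>k. ((A ^\<^sub>m k) $$ (i, j) / fact k) * z ^ k)"
proof -
  obtain c where c: "\<And>k i j. i < n \<Longrightarrow> j < n \<Longrightarrow> cmod ((A ^\<^sub>m k) $$ (i, j)) \<le> c ^ k"
    using pow_mat_entry_bound[OF A] by blast
  show ?thesis
  proof (rule summable_comparison_test')
    show "summable (\<lambda>k. inverse (fact k) * (c * cmod z) ^ k)" by (rule summable_exp)
    show "norm (((A ^\<^sub>m k) $$ (i, j) / fact k) * z ^ k) \<le> inverse (fact k) * (c * cmod z) ^ k" for k
      using mult_right_mono[OF c[OF ij, of k], of "cmod z ^ k / fact k"]
      by (simp add: norm_mult norm_divide norm_power power_mult_distrib field_simps)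
  qed
qed

text \<open>Both factor orders are read off the same differentiated power series; comparing them
  shows that \<open>A\<close> commutes with its exponential.\<close>

lemma mat_exp_derivative:
  assumes A: "A \<in> carrier_mat n n"
  shows "has_mat_derivative n n (\<lambda>z. mat_exp (z \<cdot>\<^sub>m A)) (A * mat_exp (z \<cdot>\<^sub>m A)) z"
    and "has_mat_derivative n n (\<lambda>z. mat_exp (z \<cdot>\<^sub>m A)) (mat_exp (z \<cdot>\<^sub>m A) * A) z"
proof -
  note [simp] = carrier_matD[OF A]
  have d: "((\<lambda>z. mat_exp (z \<cdot>\<^sub>m A) $$ (i, j)) has_field_derivative
      (\<Sum>k. ((A ^\<^sub>m Suc k) $$ (i, j) / fact k) * z ^ k)) (at z)" if ij: "i < n" "j < n" for i j
  proof -
    let ?c = "\<lambda>k. (A ^\<^sub>m k) $$ (i, j) / fact k"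
    have "((\<lambda>z. \<Sum>k. ?c k * z ^ k) has_field_derivative (\<Sum>k. diffs ?c k * z ^ k)) (at z)"
      by (rule termdiffs_strong_converges_everywhere) (rule summable_mat_exp[OF A ij])
    moreover have "diffs ?c k = (A ^\<^sub>m Suc k) $$ (i, j) / fact k" for k
      by (simp add: diffs_def field_simps del: of_nat_Suc)
    ultimately show ?thesis unfolding mat_exp_smult_entry[OF A ij] by simp
  qed
  have l: "(A * mat_exp (z \<cdot>\<^sub>m A)) $$ (i, j) = (\<Sum>k. ((A ^\<^sub>m Suc k) $$ (i, j) / fact k) * z ^ k)" if ij: "i < n" "j < n" for i j
  proof -
    have "(A * mat_exp (z \<cdot>\<^sub>m A)) $$ (i, j) = (\<Sum>l<n. A $$ (i, l) * (\<Sum>k. ((A ^\<^sub>m k) $$ (l, j) / fact k) * z ^ k))"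
      using ij by (simp add: index_mult_sum mat_exp_smult_entry[OF A])
    also have "\<dots> = (\<Sum>l<n. \<Sum>k. A $$ (i, l) * (((A ^\<^sub>m k) $$ (l, j) / fact k) * z ^ k))"
      using ij by (intro sum.cong refl suminf_mult[symmetric] summable_mat_exp[OF A]) auto
    also have "\<dots> = (\<Sum>k. \<Sum>l<n. A $$ (i, l) * (((A ^\<^sub>m k) $$ (l, j) / fact k) * z ^ k))"
      using ij by (intro suminf_sum[symmetric] summable_mult summable_mat_exp[OF A]) auto
    also have "\<dots> = (\<Sum>k. ((A ^\<^sub>m Suc k) $$ (i, j) / fact k) * z ^ k)"
    proof (rule suminf_cong)
      fix k
      have "(A ^\<^sub>m Suc k) $$ (i, j) = (\<Sum>l<n. A $$ (i, l) * (A ^\<^sub>m k) $$ (l, j))"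
        using ij by (subst pow_mat_Suc_left) (auto simp: index_mult_sum)
      then show "(\<Sum>l<n. A $$ (i, l) * (((A ^\<^sub>m k) $$ (l, j) / fact k) * z ^ k)) = ((A ^\<^sub>m Suc k) $$ (i, j) / fact k) * z ^ k"
        by (simp add: sum_distrib_left sum_distrib_right sum_divide_distrib mult.assoc)
    qed
    finally show ?thesis .
  qed
  have r: "(mat_exp (z \<cdot>\<^sub>m A) * A) $$ (i, j) = (\<Sum>k. ((A ^\<^sub>m Suc k) $$ (i, j) / fact k) * z ^ k)" if ij: "i < n" "j < n" for i j
  proof -
    have "(mat_exp (z \<cdot>\<^sub>m A) * A) $$ (i, j) = (\<Sum>l<n. A $$ (l, j) * (\<Sum>k. ((A ^\<^sub>m k) $$ (i, l) / fact k) * z ^ k))"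
      using ij by (simp add: index_mult_sum mat_exp_smult_entry[OF A] mult.commute)
    also have "\<dots> = (\<Sum>l<n. \<Sum>k. A $$ (l, j) * (((A ^\<^sub>m k) $$ (i, l) / fact k) * z ^ k))"
      using ij by (intro sum.cong refl suminf_mult[symmetric] summable_mat_exp[OF A]) auto
    also have "\<dots> = (\<Sum>k. \<Sum>l<n. A $$ (l, j) * (((A ^\<^sub>m k) $$ (i, l) / fact k) * z ^ k))"
      using ij by (intro suminf_sum[symmetric] summable_mult summable_mat_exp[OF A]) auto
    also have "\<dots> = (\<Sum>k. ((A ^\<^sub>m Suc k) $$ (i, j) / fact k) * z ^ k)"
    proof (rule suminf_cong)
      fix k
      have "(A ^\<^sub>m Suc k) $$ (i, j) = (\<Sum>l<n. A $$ (l, j) * (A ^\<^sub>m k) $$ (i, l))"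
        using ij by (simp add: index_mult_sum mult.commute)
      then show "(\<Sum>l<n. A $$ (l, j) * (((A ^\<^sub>m k) $$ (i, l) / fact k) * z ^ k)) = ((A ^\<^sub>m Suc k) $$ (i, j) / fact k) * z ^ k"
        by (simp add: sum_distrib_left sum_distrib_right sum_divide_distrib mult.assoc)
    qed
    finally show ?thesis .
  qed
  show "has_mat_derivative n n (\<lambda>z. mat_exp (z \<cdot>\<^sub>m A)) (A * mat_exp (z \<cdot>\<^sub>m A)) z"
    unfolding has_mat_derivative_def using d l by (auto simp: carrier_iff)
  show "has_mat_derivative n n (\<lambda>z. mat_exp (z \<cdot>\<^sub>m A)) (mat_exp (z \<cdot>\<^sub>m A) * A) z"
    unfolding has_mat_derivative_def using d r by (auto simp: carrier_iff)
qed

lemma mat_exp_commute: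
  assumes A: "A \<in> carrier_mat n n"
  shows "A * mat_exp (z \<cdot>\<^sub>m A) = mat_exp (z \<cdot>\<^sub>m A) * A"
  by (rule has_mat_derivative_unique[OF mat_exp_derivative[OF A]])

lemma mat_exp_zero:
  assumes A: "A \<in> carrier_mat n n"
  shows "mat_exp (0 \<cdot>\<^sub>m A) = 1\<^sub>m n"
proof (rule eq_matI)
  note [simp] = carrier_matD[OF A]
  fix i j assume "i < dim_row (1\<^sub>m n :: complex mat)" "j < dim_col (1\<^sub>m n :: complex mat)"
  then have ij: "i < n" "j < n" by auto
  show "mat_exp (0 \<cdot>\<^sub>m A) $$ (i, j) = 1\<^sub>m n $$ (i, j)"
    unfolding mat_exp_smult_entry[OF A ij] powser_zero using ij by simp
qed (use carrier_matD[OF A] in auto)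

lemma mat_exp_inverse:
  assumes A: "A \<in> carrier_mat n n"
  shows "mat_exp (z \<cdot>\<^sub>m A) * mat_exp ((- z) \<cdot>\<^sub>m A) = 1\<^sub>m n"
proof -
  note [simp] = carrier_matD[OF A]
  have m: "has_mat_derivative n n (\<lambda>z. mat_exp ((- z) \<cdot>\<^sub>m A)) ((-1) \<cdot>\<^sub>m (A * mat_exp ((- z) \<cdot>\<^sub>m A))) z" for z
    using has_mat_derivative_affine[where a = "-1" and b = 0, OF mat_exp_derivative(1)[OF A]] by simp
  have "has_mat_derivative n n (\<lambda>z. mat_exp (z \<cdot>\<^sub>m A) * mat_exp ((- z) \<cdot>\<^sub>m A)) (0\<^sub>m n n) z" for z
    by (rule has_mat_derivative_eq[OF has_mat_derivative_mult[OF mat_exp_derivative(2)[OF A] m]])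
       (simp add: mat_simps, rule eq_matI, auto)
  from has_mat_derivative_zero_constant[OF this, of z] show ?thesis
    using mat_exp_zero[OF A] by (simp add: one_mult_dim)
qed

text \<open>The product of \<open>mat_exp\<close> at \<open>- z\<close> with \<open>F z\<close> is
  constant. The functional equation and the intertwining and eigenvector rules below all identify a
  function as the solution of a linear equation through this lemma.\<close>

lemma mat_ode_unique:
  assumes A: "A \<in> carrier_mat n n" and F: "\<And>z. has_mat_derivative n m F (A * F z) z"
  shows "F z = mat_exp (z \<cdot>\<^sub>m A) * F 0"
proof -
  note [simp] = carrier_matD[OF A] carrier_matD[OF has_mat_derivativeD(1)[OF F]]
  have m: "has_mat_derivative n n (\<lambda>z. mat_exp ((- z) \<cdot>\<^sub>m A)) ((-1) \<cdot>\<^sub>m (mat_exp ((- z) \<cdot>\<^sub>m A) * A)) z" for z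
    using has_mat_derivative_affine[where a = "-1" and b = 0, OF mat_exp_derivative(2)[OF A]] by simp
  have "has_mat_derivative n m (\<lambda>z. mat_exp ((- z) \<cdot>\<^sub>m A) * F z) (0\<^sub>m n m) z" for z
    by (rule has_mat_derivative_eq[OF has_mat_derivative_mult[OF m F]])
       (simp add: mat_simps, rule eq_matI, auto)
  from has_mat_derivative_zero_constant[OF this, of z]
  have "mat_exp ((- z) \<cdot>\<^sub>m A) * F z = F 0" using mat_exp_zero[OF A] by (simp add: one_mult_dim)
  then have "mat_exp (z \<cdot>\<^sub>m A) * F 0 = (mat_exp (z \<cdot>\<^sub>m A) * mat_exp ((- z) \<cdot>\<^sub>m A)) * F z"
    by (simp add: mult_assoc_dim)
  then show ?thesis unfolding mat_exp_inverse[OF A] by (simp add: one_mult_dim)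
qed

lemma mat_exp_add:
  assumes A: "A \<in> carrier_mat n n"
  shows "mat_exp (a \<cdot>\<^sub>m A) * mat_exp (b \<cdot>\<^sub>m A) = mat_exp ((a + b) \<cdot>\<^sub>m A)"
proof -
  have "has_mat_derivative n n (\<lambda>z. mat_exp ((z + b) \<cdot>\<^sub>m A)) (A * mat_exp ((z + b) \<cdot>\<^sub>m A)) z" for z
    using has_mat_derivative_affine[where a = 1 and b = b, OF mat_exp_derivative(1)[OF A]] by (simp add: smult_one_mat)
  from mat_ode_unique[OF A this, of a] show ?thesis by simp
qed

lemma mat_exp_intertwine:
  assumes A: "A \<in> carrier_mat n n" and B: "B \<in> carrier_mat k k" and T: "T \<in> carrier_mat k n"
    and TA: "T * A = B * T"
  shows "T * mat_exp (z \<cdot>\<^sub>m A) = mat_exp (z \<cdot>\<^sub>m B) * T"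
proof -
  note [simp] = carrier_matD[OF A] carrier_matD[OF B] carrier_matD[OF T]
  have "has_mat_derivative k n (\<lambda>z. T * mat_exp (z \<cdot>\<^sub>m A)) (B * (T * mat_exp (z \<cdot>\<^sub>m A))) z" for z
  proof (rule has_mat_derivative_eq[OF has_mat_derivative_mult[OF has_mat_derivative_const[OF T] mat_exp_derivative(1)[OF A]]])
    have "T * (A * mat_exp (z \<cdot>\<^sub>m A)) = B * (T * mat_exp (z \<cdot>\<^sub>m A))"
      using TA by (simp add: mult_assoc_dim[symmetric])
    then show "0\<^sub>m k n * mat_exp (z \<cdot>\<^sub>m A) + T * (A * mat_exp (z \<cdot>\<^sub>m A)) = B * (T * mat_exp (z \<cdot>\<^sub>m A))"
      by (simp add: zero_mult_dim) (rule eq_matI, auto)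
  qed
  from mat_ode_unique[OF B this, of z] show ?thesis using mat_exp_zero[OF A] by (simp add: mult_one_dim)
qed

lemma mat_exp_eigenvector:
  assumes A: "A \<in> carrier_mat n n" and v: "v \<in> carrier_mat n 1" and Av: "A * v = \<mu> \<cdot>\<^sub>m v"
  shows "mat_exp (z \<cdot>\<^sub>m A) * v = exp (z * \<mu>) \<cdot>\<^sub>m v"
proof -
  note [simp] = carrier_matD[OF A] carrier_matD[OF v]
  have "has_mat_derivative n 1 (\<lambda>z. exp (z * \<mu>) \<cdot>\<^sub>m v) (A * (exp (z * \<mu>) \<cdot>\<^sub>m v)) z" for z
  proof (rule has_mat_derivative_eq[OF has_mat_derivative_smult[OF has_mat_derivative_const[OF v], where d = "exp (z * \<mu>) * \<mu>"]])
    show "((\<lambda>z. exp (z * \<mu>)) has_field_derivative exp (z * \<mu>) * \<mu>) (at z)"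
      by (auto intro!: derivative_eq_intros)
    show "(exp (z * \<mu>) * \<mu>) \<cdot>\<^sub>m v + exp (z * \<mu>) \<cdot>\<^sub>m 0\<^sub>m n 1 = A * (exp (z * \<mu>) \<cdot>\<^sub>m v)"
      by (simp add: mult_smult_dim Av) (rule eq_matI, auto)
  qed
  from mat_ode_unique[OF A this, of z] show ?thesis by (simp add: smult_one_mat)
qed

lemma mat_exp_adj:
  assumes A: "A \<in> carrier_mat n n"
  shows "adj (mat_exp (z \<cdot>\<^sub>m A)) = mat_exp (cnj z \<cdot>\<^sub>m adj A)"
proof (rule eq_matI)
  note [simp] = carrier_matD[OF A]
  have aA: "adj A \<in> carrier_mat n n" using A by simp
  fix i j assume "i < dim_row (mat_exp (cnj z \<cdot>\<^sub>m adj A))" "j < dim_col (mat_exp (cnj z \<cdot>\<^sub>m adj A))"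
  then have ij: "i < n" "j < n" by auto
  have "(\<lambda>k. cnj (((A ^\<^sub>m k) $$ (j, i) / fact k) * z ^ k)) sums cnj (mat_exp (z \<cdot>\<^sub>m A) $$ (j, i))"
    unfolding mat_exp_smult_entry[OF A ij(2,1)] sums_cnj
    by (rule summable_sums[OF summable_mat_exp[OF A ij(2,1)]])
  moreover have "cnj (((A ^\<^sub>m k) $$ (j, i) / fact k) * z ^ k) = ((adj A ^\<^sub>m k) $$ (i, j) / fact k) * cnj z ^ k" for k
    using ij by (simp add: adj_pow[symmetric])
  ultimately have "(\<lambda>k. ((adj A ^\<^sub>m k) $$ (i, j) / fact k) * cnj z ^ k) sums cnj (mat_exp (z \<cdot>\<^sub>m A) $$ (j, i))"
    by (simp only:)
  then have "cnj (mat_exp (z \<cdot>\<^sub>m A) $$ (j, i)) = (\<Sum>k. ((adj A ^\<^sub>m k) $$ (i, j) / fact k) * cnj z ^ k)"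
    by (rule sums_unique)
  then show "adj (mat_exp (z \<cdot>\<^sub>m A)) $$ (i, j) = mat_exp (cnj z \<cdot>\<^sub>m adj A) $$ (i, j)"
    unfolding mat_exp_smult_entry[OF aA ij] using ij by simp
qed (use carrier_matD[OF A] in auto)

section \<open>Pseudo-exponential potentials\<close>

subsection \<open>Increasing families of quadratic forms\<close>

text \<open>Bolzano-Weierstrass, extracting one further subsequence for each coordinate.\<close>

lemma convergent_coordinates:
  fixes f :: "nat \<Rightarrow> nat \<Rightarrow> complex"
  assumes "\<And>k i. i < n \<Longrightarrow> cmod (f k i) \<le> 1"
  obtains r l where "strict_mono r" "\<And>i. i < n \<Longrightarrow> (\<lambda>k. f (r k) i) \<longlonglongrightarrow> l i"
  using assms
proof (induction n arbitrary: thesis)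
  case 0
  then show ?case using strict_mono_id by blast
next
  case (Suc n)
  obtain r l where r: "strict_mono r" "\<And>i. i < n \<Longrightarrow> (\<lambda>k. f (r k) i) \<longlonglongrightarrow> l i"
    using Suc.IH Suc.prems(2) by (metis less_Suc_eq)
  have "bounded (range (\<lambda>k. f (r k) n))"
    unfolding bounded_iff using Suc.prems(2)[of n] by blast
  then obtain a s where s: "strict_mono s" "((\<lambda>k. f (r k) n) \<circ> s) \<longlonglongrightarrow> a"
    using bounded_imp_convergent_subsequence by blast
  show ?case
  proof (rule Suc.prems(1)[of "r \<circ> s" "l(n := a)"])
    show "strict_mono (r \<circ> s)" using r(1) s(1) by (rule strict_mono_o)
    fix i assume "i < Suc n"
    then show "(\<lambda>k. f ((r \<circ> s) k) i) \<longlonglongrightarrow> (l(n := a)) i"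
      using s(2) LIMSEQ_subseq_LIMSEQ[OF r(2)[of i] s(1)] by (cases "i = n") (auto simp: o_def)
  qed
qed

lemma qf_smult:
  assumes "A \<in> carrier_mat n n" "w \<in> carrier_mat n 1"
  shows "qf A (c \<cdot>\<^sub>m w) = of_real ((cmod c)\<^sup>2) * qf A w"
proof -
  note [simp] = carrier_matD[OF assms(1)] carrier_matD[OF assms(2)]
  have "qf A (c \<cdot>\<^sub>m w) = cnj c * c * qf A w" by (simp add: qf_def mat_simps)
  then show ?thesis unfolding complex_norm_square by (simp add: mult.commute)
qed

lemma nrm2_smult: "w \<in> carrier_mat n 1 \<Longrightarrow> nrm2 (c \<cdot>\<^sub>m w) = (cmod c)\<^sup>2 * nrm2 w"
  by (simp add: nrm2_def carrier_iff norm_mult power_mult_distrib sum_distrib_left)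

text \<open>A Dini argument on the unit sphere: if every form took a value below \<open>M\<close> at
  some unit vector, then by monotonicity every form would be at most \<open>M\<close> at a limit
  \<open>v\<close> of such vectors, against unboundedness at \<open>v\<close>.\<close>

lemma increasing_forms_uniform:
  fixes P :: "nat \<Rightarrow> complex mat"
  assumes P: "\<And>k. P k \<in> carrier_mat n n"
    and mono: "\<And>k l w. k \<le> l \<Longrightarrow> w \<in> carrier_mat n 1 \<Longrightarrow> Re (qf (P k) w) \<le> Re (qf (P l) w)"
    and unb: "\<And>w M. w \<in> carrier_mat n 1 \<Longrightarrow> w \<noteq> 0\<^sub>m n 1 \<Longrightarrow> \<exists>k. M < Re (qf (P k) w)"
  shows "\<exists>k. \<forall>w\<in>carrier_mat n 1. M * nrm2 w \<le> Re (qf (P k) w)"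
proof (rule ccontr)
  assume neg: "\<not> ?thesis"
  have "\<exists>u. u \<in> carrier_mat n 1 \<and> nrm2 u = 1 \<and> Re (qf (P k) u) < M" for k
  proof -
    obtain w where w: "w \<in> carrier_mat n 1" and lt: "Re (qf (P k) w) < M * nrm2 w"
    proof -
      have "\<not> (\<forall>w\<in>carrier_mat n 1. M * nrm2 w \<le> Re (qf (P k) w))" using neg by blast
      then show thesis using that by (auto simp: not_le)
    qed
    have "w \<noteq> 0\<^sub>m n 1"
    proof
      assume w0: "w = 0\<^sub>m n 1"
      have "qf (P k) w = 0" unfolding qf_def w0 using carrier_matD[OF P] by (simp add: mult_zero_dim)
      moreover have "nrm2 w = 0" unfolding w0 by (simp add: nrm2_def)
      ultimately show False using lt by simp
    qed
    then have pos: "0 < nrm2 w" using nrm2_pos[OF w] by simp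
    define c where "c = complex_of_real (1 / sqrt (nrm2 w))"
    have c: "(cmod c)\<^sup>2 = 1 / nrm2 w" using pos by (simp add: c_def norm_divide power_divide)
    have "nrm2 (c \<cdot>\<^sub>m w) = 1" unfolding nrm2_smult[OF w] c using pos by simp
    moreover have "Re (qf (P k) (c \<cdot>\<^sub>m w)) < M"
      unfolding qf_smult[OF P w] c using pos lt by (simp add: field_simps)
    ultimately show ?thesis using w by (intro exI[of _ "c \<cdot>\<^sub>m w"]) simp
  qed
  then obtain u where u: "\<And>k. u k \<in> carrier_mat n 1" and u1: "\<And>k. nrm2 (u k) = 1"
    and uM: "\<And>k. Re (qf (P k) (u k)) < M" by metis
  note ud = carrier_matD[OF u]
  have "cmod (u k $$ (i, 0)) \<le> 1" if "i < n" for k i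
  proof -
    have "(cmod (u k $$ (i, 0)))\<^sup>2 \<le> nrm2 (u k)"
      unfolding nrm2_def by (rule member_le_sum) (use that ud in auto)
    then show ?thesis using u1 by (simp add: abs_square_le_1)
  qed
  then obtain r l where r: "strict_mono r" and l: "\<And>i. i < n \<Longrightarrow> (\<lambda>k. u (r k) $$ (i, 0)) \<longlonglongrightarrow> l i"
    using convergent_coordinates[of n "\<lambda>k i. u k $$ (i, 0)"] by blast
  define v where "v = Matrix.mat n 1 (\<lambda>(i, j). l i)"
  have v: "v \<in> carrier_mat n 1" by (simp add: v_def)
  have vi: "v $$ (i, 0) = l i" if "i < n" for i using that by (simp add: v_def)
  have "(\<lambda>k. \<Sum>i<n. (cmod (u (r k) $$ (i, 0)))\<^sup>2) \<longlonglongrightarrow> (\<Sum>i<n. (cmod (l i))\<^sup>2)"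
    by (intro tendsto_intros l) auto
  then have "(\<lambda>k. nrm2 (u (r k))) \<longlonglongrightarrow> nrm2 v"
    using ud carrier_matD[OF v] by (simp add: nrm2_def vi)
  then have "nrm2 v = 1" using u1 by (simp add: LIMSEQ_const_iff)
  then have v0: "v \<noteq> 0\<^sub>m n 1" using nrm2_zero_iff[OF v] by auto
  obtain k where k: "M < Re (qf (P k) v)" using unb[OF v v0] by blast
  have "(\<lambda>j. \<Sum>a<n. \<Sum>b<n. cnj (u (r j) $$ (a, 0)) * P k $$ (a, b) * u (r j) $$ (b, 0)) \<longlonglongrightarrow>
      (\<Sum>a<n. \<Sum>b<n. cnj (l a) * P k $$ (a, b) * l b)"
    by (intro tendsto_intros l) auto
  then have "(\<lambda>j. qf (P k) (u (r j))) \<longlonglongrightarrow> qf (P k) v"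
    unfolding qf_alt[OF P u] qf_alt[OF P v] by (simp add: vi)
  then have lim: "(\<lambda>j. Re (qf (P k) (u (r j)))) \<longlonglongrightarrow> Re (qf (P k) v)" by (rule tendsto_Re)
  have "Re (qf (P k) (u (r j))) \<le> M" if "k \<le> j" for j
  proof -
    have "k \<le> r j" using that seq_suble[OF r, of j] by linarith
    then show ?thesis using mono[OF _ u, of k "r j"] uM[of "r j"] by (meson less_imp_le order_trans)
  qed
  then have "Re (qf (P k) v) \<le> M" by (intro LIMSEQ_le_const2[OF lim]) blast
  then show False using k by simp
qed

text \<open>With \<open>y\<close> the column \<open>j\<close> of the inverse, the lower bound reads
  \<open>M |y|^2 \<le> Re (y $$ (j, 0)) \<le> |y|\<close>, which limits \<open>|y|\<close> and hence
  every entry to \<open>1 / M\<close>.\<close>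

lemma positive_form_inverse_bound:
  assumes P: "P \<in> carrier_mat n n" and M: "0 < M"
    and low: "\<And>w. w \<in> carrier_mat n 1 \<Longrightarrow> M * nrm2 w \<le> Re (qf P w)"
  shows "Determinant.det P \<noteq> 0"
    and "\<lbrakk>i < n; j < n; mat_inv P = N\<rbrakk> \<Longrightarrow> cmod (N $$ (i, j)) \<le> 1 / M"
proof -
  note [simp] = carrier_matD[OF P]
  show d: "Determinant.det P \<noteq> 0" unfolding det_nonzero_iff[OF P]
  proof (intro ballI impI)
    fix w assume w: "w \<in> carrier_mat n (1::nat)" and 0: "P * w = 0\<^sub>m n 1"
    have "qf P w = 0" unfolding qf_def 0 using carrier_matD[OF w] by (simp add: mult_zero_dim)
    then have "M * nrm2 w \<le> 0" using low[OF w] by simp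
    then have "nrm2 w = 0" using M nrm2_nonneg[of w] by (simp add: mult_le_0_iff)
    then show "w = 0\<^sub>m n 1" using nrm2_zero_iff[OF w] by simp
  qed
  note I = mat_inv_props[OF P d] note [simp] = carrier_matD[OF I(1)]
  assume ij: "i < n" "j < n" and N: "mat_inv P = N"
  define y where "y = N * unit_col n j"
  have yc: "y \<in> carrier_mat n 1" and yd [simp]: "dim_row y = n" "dim_col y = 1" using N by (auto simp: y_def carrier_iff)
  have yi: "y $$ (a, 0) = N $$ (a, j)" if "a < n" for a
    using that ij N by (auto simp: y_def index_mult_sum unit_col_def if_distrib cong: if_cong)
  have Py: "P * y = unit_col n j"
    unfolding y_def N[symmetric] using I by (simp add: mult_assoc_dim[symmetric] one_mult_dim)
  have "qf P y = cnj (y $$ (j, 0))"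
    unfolding qf_def Py using ij by (simp add: index_mult_sum unit_col_def if_distrib cong: if_cong)
  then have "M * nrm2 y \<le> Re (y $$ (j, 0))" using low[OF yc] by simp
  also have "\<dots> \<le> cmod (y $$ (j, 0))" by (rule complex_Re_le_cmod)
  finally have 1: "M * nrm2 y \<le> cmod (y $$ (j, 0))" .
  have le: "(cmod (y $$ (a, 0)))\<^sup>2 \<le> nrm2 y" if "a < n" for a
    unfolding nrm2_def by (rule member_le_sum) (use that in auto)
  define t where "t = cmod (y $$ (j, 0))"
  have "M * t\<^sup>2 \<le> t" using le[OF ij(2)] 1 M unfolding t_def by (meson mult_left_mono less_imp_le order_trans)
  then have "M * t \<le> 1"
    by (cases "t = 0") (auto simp: power2_eq_square t_def mult_le_cancel_right2 mult.assoc[symmetric])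
  then have t: "t \<le> 1 / M" using M by (simp add: field_simps)
  have "nrm2 y \<le> t / M" using 1 M by (simp add: t_def field_simps)
  then have "(cmod (y $$ (i, 0)))\<^sup>2 \<le> t / M" using le[OF ij(1)] by linarith
  also have "\<dots> \<le> (1 / M) / M" using t M by (intro divide_right_mono) auto
  also have "\<dots> = (1 / M)\<^sup>2" by (simp add: power2_eq_square)
  finally have "cmod (y $$ (i, 0)) \<le> 1 / M" by (rule power2_le_imp_le) (use M in simp)
  then show "cmod (N $$ (i, j)) \<le> 1 / M" using yi[OF ij(1)] by simp
qed

section \<open>Holomorphic continuation of the data of a potential\<close>

lemma midpoint_islimpt:
  assumes "a < (b :: real)"
  shows "complex_of_real ((a + b) / 2) islimpt of_real ` {a<..<b}"
  unfolding islimpt_approachable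
proof (intro allI impI)
  fix e :: real assume e: "0 < e"
  define x where "x = (a + b) / 2 + min (e / 2) ((b - a) / 4)"
  have x: "a < x" "x < b" "x \<noteq> (a + b) / 2" "\<bar>x - (a + b) / 2\<bar> < e"
    using e assms by (auto simp: x_def min_def field_simps)
  have "dist (complex_of_real x) (of_real ((a + b) / 2)) < e" using x(4) unfolding dist_of_real by (simp add: dist_real_def)
  moreover have "complex_of_real x \<noteq> of_real ((a + b) / 2)" using x(3) unfolding of_real_eq_iff .
  ultimately show "\<exists>x'\<in>of_real ` {a<..<b}. x' \<noteq> complex_of_real ((a + b) / 2) \<and> dist x' (of_real ((a + b) / 2)) < e"
    using x(1,2) by (intro bexI[of _ "of_real x"] conjI) auto
qed

text \<open>Schwarz reflection: conjugating both argument and value keeps a function holomorphic,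
  whereas the adjoint alone does not.\<close>

lemma has_mat_derivative_adj_cnj:
  assumes F: "has_mat_derivative n m F D (cnj z)"
  shows "has_mat_derivative m n (\<lambda>z. adj (F (cnj z))) (adj D) z"
  unfolding has_mat_derivative_def
proof (intro conjI allI impI)
  note D = has_mat_derivativeD[OF F]
  note [simp] = carrier_matD[OF D(1)] carrier_matD[OF D(2)]
  show "adj (F (cnj z)) \<in> carrier_mat m n" for z by (simp add: carrier_iff)
  show "adj D \<in> carrier_mat m n" by (simp add: carrier_iff)
  fix i j assume ij: "i < m" "j < n"
  show "((\<lambda>z. adj (F (cnj z)) $$ (i, j)) has_field_derivative adj D $$ (i, j)) (at z)"
    using has_field_derivative_cnj_cnj[OF D(3)[OF ij(2,1)]] ij by (simp add: o_def)
qed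

lemma has_mat_derivative_holomorphic:
  assumes F: "\<And>z. has_mat_derivative n m F (D z) z" and ij: "i < n" "j < m"
  shows "(\<lambda>z. F z $$ (i, j)) holomorphic_on UNIV"
  using has_mat_derivativeD(3)[OF F ij] holomorphic_on_open[of UNIV "\<lambda>z. F z $$ (i, j)"] by auto

locale pe_data =
  fixes n m1 m2 :: nat and \<alpha> S0 \<gamma>1 \<gamma> :: "complex mat"
  assumes \<alpha>: "\<alpha> \<in> carrier_mat n n" and S0: "S0 \<in> carrier_mat n n"
    and \<gamma>1: "\<gamma>1 \<in> carrier_mat n m1" and \<gamma>: "\<gamma> \<in> carrier_mat n m2"
    and herm: "adj S0 = S0"
    and ident: "\<alpha> * S0 - S0 * adj \<alpha> = \<i> \<cdot>\<^sub>m (\<gamma>1 * adj \<gamma>1 - \<gamma> * adj \<gamma>)"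
    and spec: "\<And>\<mu>. \<mu> \<in> spectrum \<alpha> \<Longrightarrow> Im \<mu> \<le> 0"
    and ctrb: "pbh n \<alpha> \<gamma>"
    and detS0: "Determinant.det S0 \<noteq> 0"
begin

lemma dims [simp]:
  "dim_row \<alpha> = n" "dim_col \<alpha> = n" "dim_row S0 = n" "dim_col S0 = n"
  "dim_row \<gamma>1 = n" "dim_col \<gamma>1 = m1" "dim_row \<gamma> = n" "dim_col \<gamma> = m2"
  using carrier_matD[OF \<alpha>] carrier_matD[OF S0] carrier_matD[OF \<gamma>1] carrier_matD[OF \<gamma>] by auto

lemma adj_alpha: "adj \<alpha> \<in> carrier_mat n n"
  using \<alpha> by simp

text \<open>The analysis uses \<open>P(x) = exp(ix\<alpha>) S(x) exp(-ix\<alpha>\<^sup>*)\<close> instead of \<open>S\<close>: it satisfies \<open>P' = 2 h h\<^sup>*\<close> with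
  \<open>h(x) = exp(2ix\<alpha>) \<gamma>\<close>, and \<open>v = -2i \<gamma>\<^sub>1\<^sup>* P\<^sup>-\<^sup>1 h\<close>. The functions \<open>Es\<close> and \<open>hs\<close> continue the adjoints of
  \<open>E\<close> and \<open>h\<close> holomorphically from the real axis.\<close>

definition E where "E z = mat_exp ((2 * \<i> * z) \<cdot>\<^sub>m \<alpha>)"
definition Es where "Es z = mat_exp ((- (2 * \<i> * z)) \<cdot>\<^sub>m adj \<alpha>)"
definition h where "h z = E z * \<gamma>"
definition hs where "hs z = adj \<gamma> * Es z"

lemma E_dims [simp]: "dim_row (E z) = n" "dim_col (E z) = n" "dim_row (Es z) = n" "dim_col (Es z) = n"
  "dim_row (h z) = n" "dim_col (h z) = m2" "dim_row (hs z) = m2" "dim_col (hs z) = n"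
  by (auto simp: E_def Es_def h_def hs_def)

lemma E_add: "E (s + z) = E s * E z" "Es (s + z) = Es z * Es s"
  using mat_exp_add[OF \<alpha>, of "2 * \<i> * s" "2 * \<i> * z"] mat_exp_add[OF adj_alpha, of "- (2 * \<i> * z)" "- (2 * \<i> * s)"]
  by (simp_all add: E_def Es_def algebra_simps)

lemma adj_E: "adj (E (cnj z)) = Es z"
  using mat_exp_adj[OF \<alpha>, of "2 * \<i> * cnj z"] by (simp add: E_def Es_def)

lemma adj_h: "adj (h (cnj z)) = hs z" and adj_hs: "adj (hs (cnj z)) = h z"
proof -
  show 1: "adj (h (cnj z)) = hs z" for z by (simp add: h_def hs_def adj_mult adj_E)
  show "adj (hs (cnj z)) = h z" using 1[of "cnj z"] by (simp add: adj_adj flip: 1)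
qed

lemma E_deriv: "has_mat_derivative n n E ((2 * \<i>) \<cdot>\<^sub>m (\<alpha> * E z)) z"
  using has_mat_derivative_affine[where a = "2 * \<i>" and b = 0, OF mat_exp_derivative(1)[OF \<alpha>]]
  by (simp add: E_def[abs_def])

lemma Es_deriv: "has_mat_derivative n n Es ((- (2 * \<i>)) \<cdot>\<^sub>m (Es z * adj \<alpha>)) z"
  using has_mat_derivative_affine[where a = "- (2 * \<i>)" and b = 0, OF mat_exp_derivative(2)[OF adj_alpha]]
  by (simp add: Es_def[abs_def])

lemma h_deriv: "has_mat_derivative n m2 h ((2 * \<i>) \<cdot>\<^sub>m (\<alpha> * h z)) z"
  unfolding h_def[abs_def]
  by (rule has_mat_derivative_eq[OF has_mat_derivative_mult[OF E_deriv has_mat_derivative_const[OF \<gamma>]]])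
     (simp add: mat_simps, rule eq_matI, auto)

lemma hs_deriv: "has_mat_derivative m2 n hs ((- (2 * \<i>)) \<cdot>\<^sub>m (hs z * adj \<alpha>)) z"
  unfolding hs_def[abs_def]
  by (rule has_mat_derivative_eq[OF has_mat_derivative_mult[OF has_mat_derivative_const Es_deriv]])
     (auto simp: mat_simps carrier_iff intro!: eq_matI)

text \<open>Solutions have to be meromorphic in a complex variable, so integration along the real
  axis is replaced by a primitive of the entire function \<open>2 h hs\<close>, normalized to
  \<open>S0\<close> at 0.\<close>

lemma primitive_exists:
  "\<exists>P. (\<forall>z. has_mat_derivative n n P (2 \<cdot>\<^sub>m (h z * hs z)) z) \<and> P 0 = S0"
proof -
  let ?f = "\<lambda>i j z. (2 \<cdot>\<^sub>m (h z * hs z)) $$ (i, j)"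
  have "\<exists>g. \<forall>z. (g has_field_derivative ?f i j z) (at z)" if ij: "i < n" "j < n" for i j
  proof -
    have "?f i j holomorphic_on UNIV"
      by (rule has_mat_derivative_holomorphic[OF has_mat_derivative_cmult[OF has_mat_derivative_mult[OF h_deriv hs_deriv]] ij])
    then obtain g where "\<And>x. (g has_field_derivative ?f i j x) (at x within UNIV)"
      using holomorphic_convex_primitive'[of UNIV "?f i j"] by auto
    then show ?thesis by auto
  qed
  then obtain g where g: "\<And>i j z. i < n \<Longrightarrow> j < n \<Longrightarrow> (g i j has_field_derivative ?f i j z) (at z)"
    by metis
  define P where "P = (\<lambda>z. Matrix.mat n n (\<lambda>(i, j). S0 $$ (i, j) + (g i j z - g i j 0)))"
  have "has_mat_derivative n n P (2 \<cdot>\<^sub>m (h z * hs z)) z" for z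
    unfolding has_mat_derivative_def
  proof (intro conjI allI impI)
    fix i j assume ij: "i < n" "j < n"
    have "((\<lambda>z. S0 $$ (i, j) + (g i j z - g i j 0)) has_field_derivative 0 + (?f i j z - 0)) (at z)"
      by (intro derivative_intros g ij)
    then show "((\<lambda>z. P z $$ (i, j)) has_field_derivative (2 \<cdot>\<^sub>m (h z * hs z)) $$ (i, j)) (at z)"
      using ij by (simp add: P_def)
  qed (auto simp: P_def carrier_iff)
  moreover have "P 0 = S0" by (rule eq_matI) (auto simp: P_def)
  ultimately show ?thesis by blast
qed

definition P where
  "P = (SOME P. (\<forall>z. has_mat_derivative n n P (2 \<cdot>\<^sub>m (h z * hs z)) z) \<and> P 0 = S0)"

lemma P_deriv: "has_mat_derivative n n P (2 \<cdot>\<^sub>m (h z * hs z)) z" and P_0: "P 0 = S0"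
  using someI_ex[OF primitive_exists] unfolding P_def by blast+

lemma P_carrier: "P z \<in> carrier_mat n n"
  by (rule has_mat_derivativeD(1)[OF P_deriv])

lemma P_dims [simp]: "dim_row (P z) = n" "dim_col (P z) = n"
  using carrier_matD[OF P_carrier] by auto

lemma P_unique:
  assumes "\<And>z. has_mat_derivative n n F (2 \<cdot>\<^sub>m (h z * hs z)) z" "F 0 = S0"
  shows "F z = P z"
  using has_mat_derivative_eq_functions[OF assms(1) P_deriv] assms(2) P_0 by simp

lemma h_0: "h 0 = \<gamma>" and hs_0: "hs 0 = adj \<gamma>"
  using mat_exp_zero[OF \<alpha>] mat_exp_zero[OF adj_alpha]
  by (simp_all add: h_def hs_def E_def Es_def one_mult_dim mult_one_dim)

lemma i_squared: "\<i> * (\<i> * c) = - (c::complex)"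
  by (simp add: mult.assoc[symmetric])

text \<open>Both sides have the same derivative, and at 0 the claim is the identity of the
  admissible set.\<close>

lemma P_ident: "\<alpha> * P z - P z * adj \<alpha> = \<i> \<cdot>\<^sub>m (\<gamma>1 * adj \<gamma>1 - h z * hs z)"
proof -
  let ?D = "\<lambda>z. 2 \<cdot>\<^sub>m (\<alpha> * (h z * hs z)) - 2 \<cdot>\<^sub>m (h z * (hs z * adj \<alpha>))"
  have 1: "has_mat_derivative n n (\<lambda>z. \<alpha> * P z - P z * adj \<alpha>) (?D z) z" for z
    by (rule has_mat_derivative_eq[OF has_mat_derivative_minus[OF
          has_mat_derivative_mult[OF has_mat_derivative_const[OF \<alpha>] P_deriv]
          has_mat_derivative_mult[OF P_deriv has_mat_derivative_const[OF adj_alpha]]]])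
       (simp add: mat_simps, rule eq_matI, auto)
  have gg: "\<gamma>1 * adj \<gamma>1 \<in> carrier_mat n n" by (simp add: carrier_iff)
  have 2: "has_mat_derivative n n (\<lambda>z. \<i> \<cdot>\<^sub>m (\<gamma>1 * adj \<gamma>1 - h z * hs z)) (?D z) z" for z
    by (rule has_mat_derivative_eq[OF has_mat_derivative_cmult[OF has_mat_derivative_minus[OF
          has_mat_derivative_const[OF gg] has_mat_derivative_mult[OF h_deriv hs_deriv]]]])
       (simp add: mat_simps, rule eq_matI, auto simp: algebra_simps i_squared)
  show ?thesis
    by (rule has_mat_derivative_eq_functions[OF 1 2]) (simp add: P_0 h_0 hs_0 ident)
qed

lemma P_herm: "adj (P (cnj z)) = P z"
proof (rule P_unique)
  fix z
  show "has_mat_derivative n n (\<lambda>z. adj (P (cnj z))) (2 \<cdot>\<^sub>m (h z * hs z)) z"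
    by (rule has_mat_derivative_eq[OF has_mat_derivative_adj_cnj[OF P_deriv]])
       (simp add: mat_simps adj_h adj_hs)
qed (simp add: P_0 herm)

lemma P_real_herm: "adj (P (of_real x)) = P (of_real x)"
  using P_herm[of "of_real x"] by simp

text \<open>By the multiplicativity of \<open>E\<close> and \<open>Es\<close> both sides have the
  same derivative in \<open>z\<close>. With \<open>z = 1\<close> the growth of \<open>P\<close>
  along the integers becomes a telescoping sum.\<close>

lemma P_shift: "P (s + z) = P s + E s * (P z - S0) * Es s"
proof -
  let ?D = "\<lambda>z. 2 \<cdot>\<^sub>m (h (s + z) * hs (s + z))"
  have 1: "has_mat_derivative n n (\<lambda>z. P (s + z)) (?D z) z" for z
    using has_mat_derivative_affine[where a = 1 and b = s and z = z, OF P_deriv]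
    by (simp add: smult_one_mat add.commute)
  have Ec: "E s \<in> carrier_mat n n" "Es s \<in> carrier_mat n n" by (simp_all add: carrier_iff)
  have 2: "has_mat_derivative n n (\<lambda>z. P s + E s * (P z - S0) * Es s) (?D z) z" for z
    by (rule has_mat_derivative_eq[OF has_mat_derivative_add[OF has_mat_derivative_const[OF P_carrier]
          has_mat_derivative_mult[OF has_mat_derivative_mult[OF has_mat_derivative_const[OF Ec(1)]
            has_mat_derivative_minus[OF P_deriv has_mat_derivative_const[OF S0]]] has_mat_derivative_const[OF Ec(2)]]]])
       (simp add: h_def hs_def E_add mat_simps, rule eq_matI, auto)
  have "P 0 - S0 = 0\<^sub>m n n" unfolding P_0 by (rule eq_matI) auto
  then have 3: "P (s + 0) = P s + E s * (P 0 - S0) * Es s"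
    by (simp add: mult_zero_dim zero_mult_dim) (rule eq_matI, auto)
  show ?thesis by (rule has_mat_derivative_eq_functions[OF 1 2 3])
qed

subsection \<open>Growth of P\<close>

lemma form_deriv:
  assumes w: "w \<in> carrier_mat n 1"
  shows "((\<lambda>x. Re (qf (P (of_real x)) w)) has_real_derivative 2 * nrm2 (hs (of_real x) * w)) (at x)"
proof -
  note [simp] = carrier_matD[OF w]
  have "has_mat_derivative 1 1 (\<lambda>z. adj w * (P z * w)) (adj w * ((2 \<cdot>\<^sub>m (h z * hs z)) * w)) z" for z
    by (rule has_mat_derivative_eq[OF has_mat_derivative_mult[OF has_mat_derivative_const
          has_mat_derivative_mult[OF P_deriv has_mat_derivative_const[OF w]]]])
       (auto simp: mat_simps carrier_iff intro!: eq_matI)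
  from has_mat_derivativeD(3)[OF this, of 0 0 "of_real x"]
  have "((\<lambda>z. qf (P z) w) has_field_derivative (adj w * ((2 \<cdot>\<^sub>m (h (of_real x) * hs (of_real x))) * w)) $$ (0, 0)) (at (of_real x))"
    by (simp add: qf_def)
  moreover have "(adj w * ((2 \<cdot>\<^sub>m (h (of_real x) * hs (of_real x))) * w)) $$ (0, 0) = of_real (2 * nrm2 (hs (of_real x) * w))"
  proof -
    have "adj w * ((2 \<cdot>\<^sub>m (h (of_real x) * hs (of_real x))) * w) = 2 \<cdot>\<^sub>m (adj (hs (of_real x) * w) * (hs (of_real x) * w))"
      using adj_hs[of "of_real x"] by (simp add: mat_simps)
    then show ?thesis by (simp add: adj_self_nrm2)
  qed
  ultimately have "((\<lambda>z. qf (P z) w) has_field_derivative of_real (2 * nrm2 (hs (of_real x) * w))) (at (of_real x))" by simp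
  then have "((\<lambda>x. qf (P (of_real x)) w) has_vector_derivative of_real (2 * nrm2 (hs (of_real x) * w))) (at x)"
    by (rule has_vector_derivative_real_field)
  from has_field_derivative_Re[OF this] show ?thesis by simp
qed

lemma form_mono:
  assumes w: "w \<in> carrier_mat n 1" and xy: "x \<le> y"
  shows "Re (qf (P (of_real x)) w) \<le> Re (qf (P (of_real y)) w)"
  by (rule DERIV_nonneg_imp_nondecreasing[OF xy]) (use form_deriv[OF w] in force)

text \<open>By the identity theorem \<open>hs z * v\<close> vanishes for all \<open>z\<close>. The
  space of such vectors is invariant under \<open>adj \<alpha>\<close>, by differentiation, and
  evaluation at 0 places it in the kernel of \<open>adj \<gamma>\<close>; controllability leaves
  only 0.\<close>

lemma hs_vanish:
  assumes v: "v \<in> carrier_mat n 1" and 0: "\<And>x. 0 < x \<Longrightarrow> x < 1 \<Longrightarrow> hs (of_real x) * v = 0\<^sub>m m2 1"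
  shows "v = 0\<^sub>m n 1"
proof (rule ccontr)
  assume v0: "v \<noteq> 0\<^sub>m n 1"
  define K where "K = {x \<in> carrier_mat n 1. \<forall>z. hs z * x = 0\<^sub>m m2 1}"
  have K: "subspace_mat n K"
    by (rule subspace_matI) (auto simp: K_def mat_simps carrier_iff intro!: eq_matI)
  have d: "has_mat_derivative m2 1 (\<lambda>z. hs z * x) ((- (2 * \<i>)) \<cdot>\<^sub>m (hs z * (adj \<alpha> * x))) z"
    if x: "x \<in> carrier_mat n 1" for x z
  proof -
    note [simp] = carrier_matD[OF x]
    show ?thesis
      by (rule has_mat_derivative_eq[OF has_mat_derivative_mult[OF hs_deriv has_mat_derivative_const[OF x]]])
         (auto simp: mat_simps intro!: eq_matI)
  qed
  have inv: "adj \<alpha> * x \<in> K" if x: "x \<in> K" for x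
  proof -
    have xc: "x \<in> carrier_mat n 1" and 0: "(\<lambda>z. hs z * x) = (\<lambda>z. 0\<^sub>m m2 1)" using x by (auto simp: K_def)
    note [simp] = carrier_matD[OF xc]
    have "hs z * (adj \<alpha> * x) = 0\<^sub>m m2 1" for z
    proof -
      have "(- (2 * \<i>)) \<cdot>\<^sub>m (hs z * (adj \<alpha> * x)) = 0\<^sub>m m2 1"
        using d[OF xc, of z] unfolding 0 by (rule has_mat_derivative_unique[OF _ has_mat_derivative_const]) simp
      then have "(\<i> / 2) \<cdot>\<^sub>m ((- (2 * \<i>)) \<cdot>\<^sub>m (hs z * (adj \<alpha> * x))) = 0\<^sub>m m2 1" by simp
      then show ?thesis by (simp add: smult_smult smult_one_mat)
    qed
    then show ?thesis by (simp add: K_def carrier_iff)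
  qed
  have hv: "hs z * v = 0\<^sub>m m2 1" for z
  proof (rule eq_matI)
    fix i j assume "i < dim_row (0\<^sub>m m2 1 :: complex mat)" "j < dim_col (0\<^sub>m m2 1 :: complex mat)"
    then have ij: "i < m2" "j < 1" by auto
    have hol: "(\<lambda>z. (hs z * v) $$ (i, j)) holomorphic_on UNIV"
      by (rule has_mat_derivative_holomorphic[OF d[OF v] ij])
    have "(hs z * v) $$ (i, j) = 0"
    proof (rule analytic_continuation[OF hol, of "of_real ` {0<..<1}" "1/2"])
      show "(1/2::complex) islimpt of_real ` {0<..<1}" using midpoint_islimpt[of 0 1] by (simp del: greaterThanLessThan_iff)
    qed (use 0 ij in auto)
    then show "(hs z * v) $$ (i, j) = 0\<^sub>m m2 1 $$ (i, j)" using ij by simp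
  qed (use carrier_matD[OF v] in auto)
  have vK: "v \<in> K" unfolding K_def by (intro CollectI conjI allI v hv)
  obtain w \<mu> where w: "w \<in> K" "w \<noteq> 0\<^sub>m n 1" "adj \<alpha> * w = \<mu> \<cdot>\<^sub>m w"
    by (rule invariant_subspace_eigenvector[OF adj_alpha K inv vK v0])
  have wc: "w \<in> carrier_mat n 1" and "hs 0 * w = 0\<^sub>m m2 1" using w(1) by (auto simp: K_def)
  then have gw: "adj \<gamma> * w = 0\<^sub>m m2 1" by (simp add: hs_0)
  have "w = 0\<^sub>m n 1" by (rule pbhD[OF ctrb wc w(3) \<gamma> gw])
  then show False using w(2) by simp
qed

text \<open>The increment of \<open>P\<close> over a unit interval, a controllability Gramian of
  \<alpha> and \<gamma> in continuous time.\<close>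

definition G where "G = P 1 - S0"

lemma G_carrier: "G \<in> carrier_mat n n"
  by (simp add: G_def carrier_iff)

lemma qf_G: "w \<in> carrier_mat n 1 \<Longrightarrow> qf G w = qf (P 1) w - qf (P 0) w"
  by (simp add: G_def P_0 qf_def carrier_iff mat_simps)

lemma G_nonneg: "w \<in> carrier_mat n 1 \<Longrightarrow> 0 \<le> Re (qf G w)"
  using form_mono[of w 0 1] by (simp add: qf_G)

lemma G_pos:
  assumes w: "w \<in> carrier_mat n 1" and w0: "w \<noteq> 0\<^sub>m n 1"
  shows "0 < Re (qf G w)"
proof (rule ccontr)
  assume "\<not> 0 < Re (qf G w)"
  then have le: "Re (qf (P (of_real 1)) w) \<le> Re (qf (P (of_real 0)) w)" by (simp add: qf_G[OF w])
  have "hs (of_real x) * w = 0\<^sub>m m2 1" if x: "0 < x" "x < 1" for x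
  proof -
    let ?f = "\<lambda>x. Re (qf (P (of_real x)) w)"
    have const: "?f y = ?f 0" if "0 \<le> y" "y \<le> 1" for y
      using form_mono[OF w, of 0 y] form_mono[OF w, of y 1] that le by simp
    have "(?f has_real_derivative 0) (at x)"
      by (rule has_field_derivative_transform_within_open[OF DERIV_const[of "?f 0"] open_greaterThanLessThan])
         (use x const[symmetric] in auto)
    then have 0: "nrm2 (hs (of_real x) * w) = 0" using DERIV_unique[OF form_deriv[OF w]] by fastforce
    have "hs (of_real x) * w \<in> carrier_mat m2 1" using carrier_matD[OF w] by (simp add: carrier_iff)
    from nrm2_zero_iff[OF this] 0 show ?thesis by simp
  qed
  from hs_vanish[OF w this] w0 show False by simp
qed

text \<open>If the form stayed bounded, its increments \<open>qf G (Es k w)\<close> would tend to 0,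
  and since \<open>G\<close> is positive definite so would \<open>Es k w\<close>. The vectors that
  decay in this way form a space invariant under \<open>adj \<alpha>\<close>, which then contains an
  eigenvector; its eigenvalue has nonnegative imaginary part, and \<open>Es\<close> does not shrink
  it.\<close>

lemma form_unbounded:
  assumes w: "w \<in> carrier_mat n 1" and w0: "w \<noteq> 0\<^sub>m n 1"
  shows "\<exists>k::nat. M < Re (qf (P (of_nat k)) w)"
proof (rule ccontr)
  assume "\<not> ?thesis"
  then have bd: "Re (qf (P (of_nat k)) w) \<le> M" for k by (meson not_le)
  \<comment> \<open>Compactness is used through \<open>increasing_forms_uniform\<close> for the
    family \<open>k G\<close>: some multiple of \<open>G\<close> dominates the identity.\<close>
  obtain k0 where k0: "\<And>x. x \<in> carrier_mat n 1 \<Longrightarrow> 1 * nrm2 x \<le> Re (qf (of_nat k0 \<cdot>\<^sub>m G) x)"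
  proof -
    have q: "qf (of_nat k \<cdot>\<^sub>m G) x = of_nat k * qf G x" if "x \<in> carrier_mat n 1" for k x
      using carrier_matD[OF that] carrier_matD[OF G_carrier] by (simp add: qf_def mat_simps)
    have "\<exists>k. \<forall>x\<in>carrier_mat n 1. 1 * nrm2 x \<le> Re (qf (of_nat k \<cdot>\<^sub>m G) x)"
    proof (rule increasing_forms_uniform)
      show "of_nat k \<cdot>\<^sub>m G \<in> carrier_mat n n" for k using G_carrier by simp
      show "Re (qf (of_nat k \<cdot>\<^sub>m G) x) \<le> Re (qf (of_nat l \<cdot>\<^sub>m G) x)" if "k \<le> l" "x \<in> carrier_mat n 1" for k l x
        unfolding q[OF that(2)] using that(1) G_nonneg[OF that(2)] by (simp add: mult_right_mono)
      show "\<exists>k. N < Re (qf (of_nat k \<cdot>\<^sub>m G) x)" if "x \<in> carrier_mat n 1" "x \<noteq> 0\<^sub>m n 1" for x N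
        unfolding q[OF that(1)] using reals_Archimedean3[OF G_pos[OF that]] by simp
    qed
    then show thesis using that by blast
  qed
  define u where "u = (\<lambda>(x::complex mat) (k::nat). Es (of_nat k) * x)"
  have uc: "u x k \<in> carrier_mat n 1" if "x \<in> carrier_mat n 1" for x k
    using carrier_matD[OF that] by (simp add: u_def carrier_iff)
  have step: "qf (P (of_nat (Suc k))) w = qf (P (of_nat k)) w + qf G (u w k)" for k
  proof -
    note [simp] = carrier_matD[OF w] carrier_matD[OF G_carrier]
    have aE: "adj (Es (of_nat k)) = E (of_nat k)" using adj_E[of "of_nat k"] by (metis adj_adj complex_cnj_of_nat)
    have "P (of_nat (Suc k)) = P (of_nat k) + E (of_nat k) * G * Es (of_nat k)"
      using P_shift[of "of_nat k" 1] by (simp add: G_def add.commute)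
    then show ?thesis by (simp add: qf_def u_def mat_simps aE)
  qed
  have conv: "convergent (\<lambda>k. Re (qf (P (of_nat k)) w))"
  proof -
    have "incseq (\<lambda>k. Re (qf (P (of_nat k)) w))"
      using form_mono[OF w] by (auto simp: incseq_def) (metis of_nat_le_iff of_real_of_nat_eq)
    then obtain L where "(\<lambda>k. Re (qf (P (of_nat k)) w)) \<longlonglongrightarrow> L"
      using incseq_convergent[of _ M] bd by metis
    then show ?thesis by (auto simp: convergent_def)
  qed
  then obtain L where L: "(\<lambda>k. Re (qf (P (of_nat k)) w)) \<longlonglongrightarrow> L" by (auto simp: convergent_def)
  have "(\<lambda>k. Re (qf (P (of_nat (Suc k))) w) - Re (qf (P (of_nat k)) w)) \<longlonglongrightarrow> L - L"
    by (intro tendsto_diff L LIMSEQ_Suc[OF L])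
  then have G0: "(\<lambda>k. Re (qf G (u w k))) \<longlonglongrightarrow> 0" unfolding step by simp
  have n0: "(\<lambda>k. nrm2 (u w k)) \<longlonglongrightarrow> 0"
  proof (rule Lim_null_comparison)
    show "(\<lambda>k. of_nat k0 * Re (qf G (u w k))) \<longlonglongrightarrow> 0" by (intro tendsto_mult_right_zero G0)
    have "qf (of_nat k0 \<cdot>\<^sub>m G) (u w k) = of_nat k0 * qf G (u w k)" for k
      using carrier_matD[OF uc[OF w]] carrier_matD[OF G_carrier] by (simp add: qf_def mat_simps)
    then show "eventually (\<lambda>k. norm (nrm2 (u w k)) \<le> of_nat k0 * Re (qf G (u w k))) sequentially"
      using k0[OF uc[OF w]] by simp
  qed
  \<comment> \<open>The vectors that decay under \<open>Es\<close> at integer times; the space is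
    invariant since \<open>Es\<close> commutes with \<open>adj \<alpha>\<close>.\<close>
  define K where "K = {x \<in> carrier_mat n 1. \<forall>i<n. (\<lambda>k. u x k $$ (i, 0)) \<longlonglongrightarrow> 0}"
  have K: "subspace_mat n K"
  proof (rule subspace_matI)
    fix x y c assume x: "x \<in> K"
    have xc: "x \<in> carrier_mat n 1" using x by (simp add: K_def)
    note [simp] = carrier_matD[OF xc]
    have "u (c \<cdot>\<^sub>m x) k $$ (i, 0) = c * u x k $$ (i, 0)" if "i < n" for k i using that by (simp add: u_def mult_smult_dim)
    then show "c \<cdot>\<^sub>m x \<in> K" using x by (auto simp: K_def intro!: tendsto_mult_right_zero)
    assume y: "y \<in> K"
    have yc: "y \<in> carrier_mat n 1" using y by (simp add: K_def)
    note [simp] = carrier_matD[OF yc]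
    have "u (x + y) k $$ (i, 0) = u x k $$ (i, 0) + u y k $$ (i, 0)" if "i < n" for k i
      using that by (simp add: u_def mult_add_dim)
    then show "x + y \<in> K" using x y by (auto simp: K_def intro!: tendsto_add_zero)
  qed (auto simp: K_def u_def mult_zero_dim)
  have inv: "adj \<alpha> * x \<in> K" if x: "x \<in> K" for x
  proof -
    have xc: "x \<in> carrier_mat n 1" using x by (simp add: K_def)
    note [simp] = carrier_matD[OF xc]
    have "u (adj \<alpha> * x) k = adj \<alpha> * u x k" for k
      using mat_exp_commute[OF adj_alpha, of "- (2 * \<i> * of_nat k)"]
      by (simp add: u_def Es_def mult_assoc_dim[symmetric])
    then have e: "u (adj \<alpha> * x) k $$ (i, 0) = (\<Sum>l<n. adj \<alpha> $$ (i, l) * u x k $$ (l, 0))" if "i < n" for k i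
      using that carrier_matD[OF uc[OF xc]] by (simp add: index_mult_sum del: index_adj)
    have "(\<lambda>k. \<Sum>l<n. adj \<alpha> $$ (i, l) * u x k $$ (l, 0)) \<longlonglongrightarrow> 0" for i
      using x by (auto simp: K_def intro!: tendsto_null_sum tendsto_mult_right_zero)
    then show ?thesis using e xc by (simp add: K_def carrier_iff del: index_adj)
  qed
  have lim: "(\<lambda>k. u w k $$ (i, 0)) \<longlonglongrightarrow> 0" if i: "i < n" for i
  proof -
    have a: "(\<lambda>k. sqrt (nrm2 (u w k))) \<longlonglongrightarrow> 0" using tendsto_real_sqrt[OF n0] by simp
    have b: "norm (u w k $$ (i, 0)) \<le> sqrt (nrm2 (u w k))" for k
      unfolding nrm2_def using i carrier_matD[OF uc[OF w]] by (intro real_le_rsqrt member_le_sum) auto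
    show ?thesis by (rule Lim_null_comparison[OF always_eventually[OF allI[OF b]] a])
  qed
  have wK: "w \<in> K" using w lim by (simp add: K_def)
  obtain v \<mu> where v: "v \<in> K" "v \<noteq> 0\<^sub>m n 1" "adj \<alpha> * v = \<mu> \<cdot>\<^sub>m v"
    by (rule invariant_subspace_eigenvector[OF adj_alpha K inv wK w0])
  have vc: "v \<in> carrier_mat n 1" using v(1) by (simp add: K_def)
  note [simp] = carrier_matD[OF vc]
  have "\<mu> \<in> spectrum (adj \<alpha>)" unfolding spectrum_iff[OF adj_alpha] using vc v(2,3) by (intro bexI[of _ v] conjI)
  then have mu: "0 \<le> Im \<mu>" using spec[of "cnj \<mu>"] spectrum_adj[OF \<alpha>] by simp
  obtain i where i: "i < n" "v $$ (i, 0) \<noteq> 0" using v(2) by (auto simp: mat_eq_iff)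
  have "u v k $$ (i, 0) = exp (- (2 * \<i> * of_nat k) * \<mu>) * v $$ (i, 0)" for k
    unfolding u_def Es_def mat_exp_eigenvector[OF adj_alpha vc v(3)] using i by simp
  then have "cmod (u v k $$ (i, 0)) = exp (2 * of_nat k * Im \<mu>) * cmod (v $$ (i, 0))" for k
    by (simp add: norm_mult)
  then have ge: "cmod (v $$ (i, 0)) \<le> cmod (u v k $$ (i, 0))" for k
    using mu by (simp add: mult_le_cancel_right1)
  have "(\<lambda>k. u v k $$ (i, 0)) \<longlonglongrightarrow> 0" using v(1) i by (simp add: K_def)
  then have "(\<lambda>k. cmod (u v k $$ (i, 0))) \<longlonglongrightarrow> 0" by (rule tendsto_norm_zero)
  then have "cmod (v $$ (i, 0)) \<le> 0" using ge by (intro LIMSEQ_le_const) auto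
  then show False using i by simp
qed

lemma P_large:
  assumes M: "0 < M"
  obtains X where "\<And>x w. X \<le> x \<Longrightarrow> w \<in> carrier_mat n 1 \<Longrightarrow> M * nrm2 w \<le> Re (qf (P (of_real x)) w)"
proof -
  have "\<exists>k. \<forall>w\<in>carrier_mat n 1. M * nrm2 w \<le> Re (qf (P (of_nat k)) w)"
  proof (rule increasing_forms_uniform[OF P_carrier _ form_unbounded])
    show "Re (qf (P (of_nat k)) w) \<le> Re (qf (P (of_nat l)) w)" if "k \<le> l" "w \<in> carrier_mat n 1" for k l w
      using form_mono[OF that(2), of "real k" "real l"] that(1) by simp
  qed
  then obtain k where k: "\<forall>w\<in>carrier_mat n 1. M * nrm2 w \<le> Re (qf (P (of_nat k)) w)" ..
  show thesis
  proof (rule that[of "real k"])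
    fix x and w :: "complex mat" assume x: "real k \<le> x" and w: "w \<in> carrier_mat n 1"
    show "M * nrm2 w \<le> Re (qf (P (of_real x)) w)" using bspec[OF k w] form_mono[OF w x] by simp
  qed
qed

lemma P_eventually_nonsingular: "eventually (\<lambda>x. Determinant.det (P (of_real x)) \<noteq> 0) at_top"
proof (rule P_large[of 1])
  fix X :: real assume X: "\<And>x (w::complex mat). X \<le> x \<Longrightarrow> w \<in> carrier_mat n 1 \<Longrightarrow> 1 * nrm2 w \<le> Re (qf (P (of_real x)) w)"
  have "Determinant.det (P (of_real x)) \<noteq> 0" if x: "X \<le> x" for x
    by (rule positive_form_inverse_bound(1)[OF P_carrier, of 1]) (use X[OF x] in auto)
  then show ?thesis unfolding eventually_at_top_linorder by (intro exI[of _ X] allI impI)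
qed simp

lemma P_inverse_tendsto:
  assumes ij: "i < n" "j < n"
  shows "((\<lambda>x. mat_inv (P (of_real x)) $$ (i, j)) \<longlongrightarrow> 0) at_top"
proof (rule tendstoI)
  fix e :: real assume e: "0 < e"
  show "eventually (\<lambda>x. dist (mat_inv (P (of_real x)) $$ (i, j)) 0 < e) at_top"
  proof (rule P_large[of "2 / e"])
    fix X :: real assume X: "\<And>x w. X \<le> x \<Longrightarrow> w \<in> carrier_mat n 1 \<Longrightarrow> (2 / e) * nrm2 w \<le> Re (qf (P (of_real x)) w)"
    have "dist (mat_inv (P (of_real x)) $$ (i, j)) 0 < e" if x: "X \<le> x" for x
    proof -
      have "cmod (mat_inv (P (of_real x)) $$ (i, j)) \<le> 1 / (2 / e)"
        by (rule positive_form_inverse_bound(2)[OF P_carrier _ X[OF x] ij refl]) (use e in auto)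
      then show ?thesis using e by simp
    qed
    then show ?thesis unfolding eventually_at_top_linorder by (intro exI[of _ X] allI impI)
  qed (use e in simp)
qed

end

section \<open>Dirac systems in block form and the indefinite form given by j\<close>

lemma stacked_entry:
  assumes u: "u \<in> carrier_mat (m1 + m2) k" and il: "i < m1 + m2" "l < k"
  shows "u $$ (i, l) = (if i < m1 then upper_block m1 u $$ (i, l) else lower_block m1 m2 u $$ (i - m1, l))"
  using carrier_matD[OF u] il by (auto simp: upper_block_def lower_block_def)

lemma block_dims [simp]:
  "dim_row (upper_block m1 u) = m1" "dim_col (upper_block m1 u) = dim_col u"
  "dim_row (lower_block m1 m2 u) = m2" "dim_col (lower_block m1 m2 u) = dim_col u"
  by (simp_all add: upper_block_def lower_block_def)

lemma j_mat_dims [simp]: "dim_row (j_mat m1 m2) = m1 + m2" "dim_col (j_mat m1 m2) = m1 + m2"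
  by (simp_all add: j_mat_def)

lemma V_mat_dims [simp]:
  "w \<in> carrier_mat m1 m2 \<Longrightarrow> dim_row (V_mat m1 m2 w) = m1 + m2" "w \<in> carrier_mat m1 m2 \<Longrightarrow> dim_col (V_mat m1 m2 w) = m1 + m2"
  by (auto simp: V_mat_def)

lemma j_mat_mult:
  assumes u: "u \<in> carrier_mat (m1 + m2) k" and il: "i < m1 + m2" "l < k"
  shows "(j_mat m1 m2 * u) $$ (i, l) = (if i < m1 then u $$ (i, l) else - u $$ (i, l))"
proof -
  note [simp] = carrier_matD[OF u]
  have e: "j_mat m1 m2 $$ (i, k) = (if k = i then if i < m1 then 1 else - 1 else 0)" if "k < m1 + m2" for k
    using il that by (auto simp: j_mat_def)
  have "(j_mat m1 m2 * u) $$ (i, l) = (\<Sum>k<m1 + m2. if k = i then (if i < m1 then u $$ (i, l) else - u $$ (i, l)) else 0)"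
    using il by (auto simp: index_mult_sum e if_distrib[of "\<lambda>x. x * _"] cong: if_cong)
  then show ?thesis using il by simp
qed

lemma dirac_rhs_blocks:
  fixes c :: complex
  assumes w: "w \<in> carrier_mat m1 m2" and u: "u \<in> carrier_mat (m1 + m2) k"
  defines "Nu \<equiv> (\<i> \<cdot>\<^sub>m (c \<cdot>\<^sub>m j_mat m1 m2 + j_mat m1 m2 * V_mat m1 m2 w)) * u"
  shows "Nu \<in> carrier_mat (m1 + m2) k"
    "upper_block m1 Nu = (\<i> * c) \<cdot>\<^sub>m upper_block m1 u + \<i> \<cdot>\<^sub>m (w * lower_block m1 m2 u)"
    "lower_block m1 m2 Nu = (- (\<i> * c)) \<cdot>\<^sub>m lower_block m1 m2 u - \<i> \<cdot>\<^sub>m (adj w * upper_block m1 u)"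
proof -
  note [simp] = carrier_matD[OF w] carrier_matD[OF u]
  have jc: "j_mat m1 m2 \<in> carrier_mat (m1 + m2) (m1 + m2)" by (simp add: carrier_iff)
  have Vc: "V_mat m1 m2 w \<in> carrier_mat (m1 + m2) (m1 + m2)" using w by (simp add: carrier_iff)
  note [simp] = carrier_matD[OF Vc]
  have Vu: "V_mat m1 m2 w * u \<in> carrier_mat (m1 + m2) k" by (simp add: carrier_iff)
  show Nc: "Nu \<in> carrier_mat (m1 + m2) k" by (simp add: Nu_def carrier_iff)
  have N: "Nu = (\<i> * c) \<cdot>\<^sub>m (j_mat m1 m2 * u) + \<i> \<cdot>\<^sub>m (j_mat m1 m2 * (V_mat m1 m2 w * u))"
    unfolding Nu_def by (simp add: mat_simps) 
  have V1: "(V_mat m1 m2 w * u) $$ (i, l) = (w * lower_block m1 m2 u) $$ (i, l)" if il: "i < m1" "l < k" for i l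
    using il w by (auto simp: index_mult_sum sum_lessThan_add V_mat_def lower_block_def)
  have V2: "(V_mat m1 m2 w * u) $$ (m1 + i, l) = (adj w * upper_block m1 u) $$ (i, l)" if il: "i < m2" "l < k" for i l
    using il w by (auto simp: index_mult_sum sum_lessThan_add V_mat_def upper_block_def)
  have e: "Nu $$ (i, l) = (if i < m1 then (\<i> * c) * u $$ (i, l) + \<i> * (V_mat m1 m2 w * u) $$ (i, l)
     else - ((\<i> * c) * u $$ (i, l)) - \<i> * (V_mat m1 m2 w * u) $$ (i, l))" if "i < m1 + m2" "l < k" for i l
    unfolding N using that by (simp add: j_mat_mult[OF u] j_mat_mult[OF Vu])
  show "upper_block m1 Nu = (\<i> * c) \<cdot>\<^sub>m upper_block m1 u + \<i> \<cdot>\<^sub>m (w * lower_block m1 m2 u)"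
  proof (rule eq_matI)
    fix i l assume "i < dim_row ((\<i> * c) \<cdot>\<^sub>m upper_block m1 u + \<i> \<cdot>\<^sub>m (w * lower_block m1 m2 u))"
      "l < dim_col ((\<i> * c) \<cdot>\<^sub>m upper_block m1 u + \<i> \<cdot>\<^sub>m (w * lower_block m1 m2 u))"
    then have il: "i < m1" "l < k" by auto
    have "upper_block m1 Nu $$ (i, l) = Nu $$ (i, l)" using il carrier_matD[OF Nc] by (simp add: upper_block_def)
    also have "\<dots> = (\<i> * c) * u $$ (i, l) + \<i> * (w * lower_block m1 m2 u) $$ (i, l)" using e[of i l] V1[OF il] il by simp
    finally show "upper_block m1 Nu $$ (i, l) = ((\<i> * c) \<cdot>\<^sub>m upper_block m1 u + \<i> \<cdot>\<^sub>m (w * lower_block m1 m2 u)) $$ (i, l)"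
      using il by (simp add: upper_block_def)
  qed (use carrier_matD[OF Nc] in auto)
  show "lower_block m1 m2 Nu = (- (\<i> * c)) \<cdot>\<^sub>m lower_block m1 m2 u - \<i> \<cdot>\<^sub>m (adj w * upper_block m1 u)"
  proof (rule eq_matI)
    fix i l assume "i < dim_row ((- (\<i> * c)) \<cdot>\<^sub>m lower_block m1 m2 u - \<i> \<cdot>\<^sub>m (adj w * upper_block m1 u))"
      "l < dim_col ((- (\<i> * c)) \<cdot>\<^sub>m lower_block m1 m2 u - \<i> \<cdot>\<^sub>m (adj w * upper_block m1 u))"
    then have il: "i < m2" "l < k" by auto
    have "lower_block m1 m2 Nu $$ (i, l) = Nu $$ (m1 + i, l)" using il carrier_matD[OF Nc] by (simp add: lower_block_def)
    also have "\<dots> = - ((\<i> * c) * u $$ (m1 + i, l)) - \<i> * (adj w * upper_block m1 u) $$ (i, l)"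
      using e[of "m1 + i" l] V2[OF il] il by simp
    finally show "lower_block m1 m2 Nu $$ (i, l) = ((- (\<i> * c)) \<cdot>\<^sub>m lower_block m1 m2 u - \<i> \<cdot>\<^sub>m (adj w * upper_block m1 u)) $$ (i, l)"
      using il by (simp add: lower_block_def)
  qed (use carrier_matD[OF Nc] in auto)
qed

lemma j_form_blocks:
  assumes u: "u \<in> carrier_mat (m1 + m2) k" and u': "u' \<in> carrier_mat (m1 + m2) k'"
  shows "adj u * (j_mat m1 m2 * u') =
    adj (upper_block m1 u) * upper_block m1 u' - adj (lower_block m1 m2 u) * lower_block m1 m2 u'"
proof (rule eq_matI)
  note [simp] = carrier_matD[OF u] carrier_matD[OF u']
  fix l l' assume "l < dim_row (adj (upper_block m1 u) * upper_block m1 u' - adj (lower_block m1 m2 u) * lower_block m1 m2 u')"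
    "l' < dim_col (adj (upper_block m1 u) * upper_block m1 u' - adj (lower_block m1 m2 u) * lower_block m1 m2 u')"
  then have l: "l < k" "l' < k'" by auto
  have "(adj u * (j_mat m1 m2 * u')) $$ (l, l') = (\<Sum>i<m1 + m2. cnj (u $$ (i, l)) * (j_mat m1 m2 * u') $$ (i, l'))"
    using l by (simp add: index_mult_sum)
  also have "\<dots> = (\<Sum>i<m1 + m2. cnj (u $$ (i, l)) * (if i < m1 then u' $$ (i, l') else - u' $$ (i, l')))"
    by (intro sum.cong refl) (use l j_mat_mult[OF u'] in simp)
  also have "\<dots> = (\<Sum>i<m1. cnj (u $$ (i, l)) * u' $$ (i, l')) - (\<Sum>i<m2. cnj (u $$ (m1 + i, l)) * u' $$ (m1 + i, l'))"
    by (simp add: sum_lessThan_add sum_negf)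
  finally show "(adj u * (j_mat m1 m2 * u')) $$ (l, l') =
      (adj (upper_block m1 u) * upper_block m1 u' - adj (lower_block m1 m2 u) * lower_block m1 m2 u') $$ (l, l')"
    using l by (simp add: index_mult_sum upper_block_def lower_block_def)
qed (use carrier_matD[OF u] carrier_matD[OF u'] in auto)

text \<open>The coefficient \<open>N\<close> satisfies \<open>adj N * j + j * N = 0\<close>, because
  \<open>j * N\<close> is \<open>\<i>\<close> times the Hermitian matrix \<open>c + V\<close>; this
  is where \<open>c\<close> has to be real.\<close>

lemma dirac_form_derivative_zero:
  fixes c :: complex
  assumes w: "w \<in> carrier_mat m1 m2" and u: "u \<in> carrier_mat (m1 + m2) k" and u': "u' \<in> carrier_mat (m1 + m2) k'"
    and c: "cnj c = c"
  defines "N \<equiv> \<i> \<cdot>\<^sub>m (c \<cdot>\<^sub>m j_mat m1 m2 + j_mat m1 m2 * V_mat m1 m2 w)"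
  shows "adj (N * u) * (j_mat m1 m2 * u') + adj u * (j_mat m1 m2 * (N * u')) = 0\<^sub>m k k'"
proof -
  note [simp] = carrier_matD[OF w] carrier_matD[OF u] carrier_matD[OF u']
  note b = dirac_rhs_blocks[OF w u, where c = c, folded N_def] dirac_rhs_blocks[OF w u', where c = c, folded N_def]
  show ?thesis
    unfolding j_form_blocks[OF b(1) u'] j_form_blocks[OF u b(4)] b
    by (simp add: mat_simps c, rule eq_matI, auto simp: algebra_simps)
qed

subsection \<open>Continuation along the real axis\<close>

text \<open>The derivative vanishes on a real interval with a limit point inside the punctured disc,
  hence on the whole punctured disc by the identity theorem. The punctured disc is connected, so the
  constant to the right of \<open>a\<close> is also the one to its left, whatever the type of the
  singularity.\<close>

lemma isolated_singularity_real_constant: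
  assumes iso: "isolated_singularity_at f (of_real a)" and b: "a < b"
    and d: "\<And>x. a < x \<Longrightarrow> x < b \<Longrightarrow> (f has_field_derivative 0) (at (of_real x))"
  obtains r c where "0 < r" "\<And>z. z \<in> ball (of_real a) r - {of_real a} \<Longrightarrow> f z = c"
proof -
  obtain r where r: "0 < r" and an: "f analytic_on ball (of_real a) r - {of_real a}"
    using iso unfolding isolated_singularity_at_def by blast
  let ?S = "ball (of_real a) r - {complex_of_real a}"
  have op: "open ?S" by (intro open_delete open_ball)
  have con: "connected ?S" by (rule connected_punctured_ball) simp
  have hol: "f holomorphic_on ?S" by (rule analytic_imp_holomorphic[OF an])
  define t where "t = min b (a + r)"
  have t: "a < t" "t \<le> b" "t \<le> a + r" using b r by (auto simp: t_def)
  have in_S: "complex_of_real x \<in> ?S" if "a < x" "x < t" for x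
  proof -
    have "dist (complex_of_real a) (of_real x) = \<bar>a - x\<bar>" unfolding dist_of_real by (simp add: dist_real_def)
    then show ?thesis using that t by simp
  qed
  have 0: "deriv f z = 0" if "z \<in> ?S" for z
  proof (rule analytic_continuation[OF holomorphic_deriv[OF hol op] op con _ _ midpoint_islimpt[OF t(1)] _ that])
    show "of_real ` {a<..<t} \<subseteq> ?S" using in_S by auto
    show "complex_of_real ((a + t) / 2) \<in> ?S" by (rule in_S) (use t in auto)
    show "deriv f z = 0" if z: "z \<in> of_real ` {a<..<t}" for z
    proof -
      obtain x where x: "a < x" "x < t" "z = of_real x" using z by auto
      show ?thesis using DERIV_imp_deriv[OF d[of x]] x t by simp
    qed
  qed
  have "(f has_field_derivative 0) (at z)" if "z \<in> ?S" for z
    using holomorphic_derivI[OF hol op that] 0[OF that] by simp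
  then have "f constant_on ?S" by (rule has_field_derivative_0_imp_constant_on[OF _ con op])
  then obtain c where "\<And>z. z \<in> ?S \<Longrightarrow> f z = c" unfolding constant_on_def by blast
  then show thesis using that r by blast
qed

lemma isolated_singularity_cnj_cnj:
  assumes "isolated_singularity_at f (cnj z)"
  shows "isolated_singularity_at (\<lambda>w. cnj (f (cnj w))) z"
proof -
  obtain r where r: "0 < r" and an: "f analytic_on ball (cnj z) r - {cnj z}"
    using assms unfolding isolated_singularity_at_def by blast
  have op: "open (ball z r - {z})" by (intro open_delete open_ball)
  have dist: "dist (cnj a) (cnj b) = dist a b" for a b
    unfolding dist_norm by (metis complex_cnj_diff complex_mod_cnj)
  have "cnj ` (ball z r - {z}) \<subseteq> ball (cnj z) r - {cnj z}" by (auto simp: dist)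
  then have "cnj \<circ> f \<circ> cnj holomorphic_on ball z r - {z}"
    by (intro holomorphic_on_compose_cnj_cnj op holomorphic_on_subset[OF analytic_imp_holomorphic[OF an]])
  then have "(\<lambda>w. cnj (f (cnj w))) analytic_on ball z r - {z}"
    unfolding analytic_on_open[OF op] by (simp add: o_def)
  then show ?thesis unfolding isolated_singularity_at_def using r by blast
qed

lemma isolated_singularity_sum:
  assumes "finite I" "\<And>i. i \<in> I \<Longrightarrow> isolated_singularity_at (f i) z"
  shows "isolated_singularity_at (\<lambda>w. \<Sum>i\<in>I. f i w) z"
  using assms by (induction I rule: finite_induct) (auto intro: isolated_singularity_at_const isolated_singularity_at_add)

text \<open>Around each point \<open>f\<close> equals a constant \<open>c a\<close> on a punctured
  disc. Constants of neighbouring points agree because the discs overlap, and connectedness of the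
  half-line makes them all equal. Continuity at \<open>x\<close> and \<open>y\<close> identifies the
  values there with these constants.\<close>

lemma real_axis_constant:
  assumes iso: "\<And>a. 0 \<le> a \<Longrightarrow> isolated_singularity_at f (of_real a)"
    and d: "\<And>a. 0 \<le> a \<Longrightarrow> \<exists>b>a. \<forall>x. a < x \<longrightarrow> x < b \<longrightarrow> (f has_field_derivative 0) (at (of_real x))"
    and x: "0 \<le> x" "isCont f (of_real x)" and y: "0 \<le> y" "isCont f (of_real y)"
  shows "f (of_real x) = f (of_real y)"
proof -
  have "\<forall>a\<in>{0..}. \<exists>p. 0 < snd p \<and> (\<forall>z\<in>ball (of_real a) (snd p) - {of_real a}. f z = fst p)"
  proof
    fix a :: real assume "a \<in> {0..}" then have a: "0 \<le> a" by simp
    obtain b where b: "a < b" "\<forall>x. a < x \<longrightarrow> x < b \<longrightarrow> (f has_field_derivative 0) (at (of_real x))" using d[OF a] by blast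
    obtain r c where "0 < r" "\<And>z. z \<in> ball (of_real a) r - {of_real a} \<Longrightarrow> f z = c"
      by (rule isolated_singularity_real_constant[OF iso[OF a] b(1)]) (use b(2) in auto)
    then show "\<exists>p. 0 < snd p \<and> (\<forall>z\<in>ball (of_real a) (snd p) - {of_real a}. f z = fst p)" by (intro exI[of _ "(c, r)"]) simp
  qed
  from bchoice[OF this] obtain p where p: "\<forall>a\<in>{0..}. 0 < snd (p a) \<and> (\<forall>z\<in>ball (of_real a) (snd (p a)) - {of_real a}. f z = fst (p a))" ..
  define c r where "c = (\<lambda>a. fst (p a))" and "r = (\<lambda>a. snd (p a))"
  have r: "0 < r a" if "0 \<le> a" for a using p that by (simp add: r_def)
  have c: "f z = c a" if "0 \<le> a" "z \<in> ball (of_real a) (r a) - {of_real a}" for a z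
    using p that unfolding r_def c_def by blast
  have cont: "f (of_real a) = c a" if a: "0 \<le> a" "isCont f (of_real a)" for a
  proof -
    have "eventually (\<lambda>z. z \<in> ball (of_real a) (r a) - {of_real a}) (at (complex_of_real a))"
      unfolding eventually_at_filter using eventually_nhds_in_open[OF open_ball, of "complex_of_real a" "of_real a" "r a"] r[OF a(1)]
      by (auto elim: eventually_mono)
    then have "eventually (\<lambda>z. f z = c a) (at (complex_of_real a))" by eventually_elim (use c[OF a(1)] in auto)
    then have 1: "(f \<longlongrightarrow> c a) (at (complex_of_real a))" by (rule tendsto_eventually)
    have 2: "(f \<longlongrightarrow> f (of_real a)) (at (complex_of_real a))" using a(2) by (simp add: isCont_def)
    show ?thesis by (rule tendsto_unique[OF at_neq_bot 2 1])
  qed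
  have "c x = c y"
  proof (rule connected_local_const[where A = "{0..}" and f = c])
    show "\<forall>a\<in>{0..}. eventually (\<lambda>b. c a = c b) (at a within {0..})"
    proof
      fix a :: real assume "a \<in> {0..}"
      then have a: "0 \<le> a" by simp
      show "eventually (\<lambda>b. c a = c b) (at a within {0..})"
        unfolding eventually_at
      proof (intro exI[of _ "r a"] conjI ballI impI)
        fix b assume "b \<in> {0..}" and ba: "b \<noteq> a \<and> dist b a < r a"
        then have b: "0 \<le> b" by simp
        \<comment> \<open>The point \<open>t = b + s / 2\<close> lies in both punctured discs: the
          bounds on \<open>s\<close> keep it within each radius and away from both centres.\<close>
        define s where "s = min (r b) (min \<bar>b - a\<bar> (r a - \<bar>b - a\<bar>))"
        have s: "0 < s" "s \<le> r b" "s \<le> \<bar>b - a\<bar>" "s \<le> r a - \<bar>b - a\<bar>" using ba r[OF b] by (auto simp: s_def dist_real_def)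
        define t where "t = b + s / 2"
        have "t \<noteq> a" "\<bar>a - t\<bar> < r a" "t \<noteq> b" "\<bar>b - t\<bar> < r b" unfolding t_def using s by linarith+
        then have t: "complex_of_real t \<in> ball (of_real a) (r a) - {of_real a}" "complex_of_real t \<in> ball (of_real b) (r b) - {of_real b}"
          using dist_of_real[of a t, where 'a = complex] dist_of_real[of b t, where 'a = complex] by (auto simp: dist_real_def)
        show "c a = c b" using c[OF a t(1)] c[OF b t(2)] by simp
      qed (rule r[OF a])
    qed
  qed (use x y in \<open>auto simp: connected_iff_interval\<close>)
  then show ?thesis using cont[OF x] cont[OF y] by simp
qed

context pe_data begin

subsection \<open>The matrix function S\<close>

text \<open>The holomorphic continuation of \<open>S\<close>, obtained by solving the relation
  between \<open>P\<close> and \<open>S\<close> for \<open>S\<close>.\<close>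

definition F where "F z = mat_exp ((- (\<i> * z)) \<cdot>\<^sub>m \<alpha>) * P z * mat_exp ((\<i> * z) \<cdot>\<^sub>m adj \<alpha>)"

lemma F_deriv: "has_mat_derivative n n F
    (mat_exp ((- (\<i> * z)) \<cdot>\<^sub>m \<alpha>) * \<gamma>1 * (adj \<gamma>1 * mat_exp ((\<i> * z) \<cdot>\<^sub>m adj \<alpha>)) +
     mat_exp ((\<i> * z) \<cdot>\<^sub>m \<alpha>) * \<gamma> * (adj \<gamma> * mat_exp ((- (\<i> * z)) \<cdot>\<^sub>m adj \<alpha>))) z"
proof -
  define a where "a = (\<lambda>z. mat_exp ((- (\<i> * z)) \<cdot>\<^sub>m \<alpha>))"
  define b where "b = (\<lambda>z. mat_exp ((\<i> * z) \<cdot>\<^sub>m adj \<alpha>))"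
  define c where "c = (\<lambda>z. mat_exp ((\<i> * z) \<cdot>\<^sub>m \<alpha>))"
  define d where "d = (\<lambda>z. mat_exp ((- (\<i> * z)) \<cdot>\<^sub>m adj \<alpha>))"
  have [simp]: "dim_row (a z) = n" "dim_col (a z) = n" "dim_row (b z) = n" "dim_col (b z) = n"
    "dim_row (c z) = n" "dim_col (c z) = n" "dim_row (d z) = n" "dim_col (d z) = n" for z
    by (simp_all add: a_def b_def c_def d_def)
  have ad: "has_mat_derivative n n a ((- \<i>) \<cdot>\<^sub>m (a z * \<alpha>)) z" for z
    using has_mat_derivative_affine[where a = "- \<i>" and b = 0, OF mat_exp_derivative(2)[OF \<alpha>]]
    by (simp add: a_def)
  have bd: "has_mat_derivative n n b (\<i> \<cdot>\<^sub>m (adj \<alpha> * b z)) z" for z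
    using has_mat_derivative_affine[where a = "\<i>" and b = 0, OF mat_exp_derivative(1)[OF adj_alpha]]
    by (simp add: b_def)
  have ah: "a z * h z = c z * \<gamma>"
    using mat_exp_add[OF \<alpha>, of "- (\<i> * z)" "2 * \<i> * z"]
    by (simp add: a_def c_def h_def E_def mult_assoc_dim[symmetric])
  have hb: "hs z * b z = adj \<gamma> * d z"
    using mat_exp_add[OF adj_alpha, of "- (2 * \<i> * z)" "\<i> * z"]
    by (simp add: b_def d_def hs_def Es_def mult_assoc_dim)
  have F: "F = (\<lambda>z. a z * P z * b z)" by (simp add: F_def[abs_def] a_def b_def)
  have id2: "(- \<i>) \<cdot>\<^sub>m (\<alpha> * P z - P z * adj \<alpha>) = \<gamma>1 * adj \<gamma>1 - h z * hs z"
    unfolding P_ident by (simp add: smult_smult smult_one_mat)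
  have "(((- \<i>) \<cdot>\<^sub>m (a z * \<alpha>)) * P z + a z * (2 \<cdot>\<^sub>m (h z * hs z))) * b z + (a z * P z) * (\<i> \<cdot>\<^sub>m (adj \<alpha> * b z))
    = a z * (((- \<i>) \<cdot>\<^sub>m (\<alpha> * P z - P z * adj \<alpha>)) * b z) + 2 \<cdot>\<^sub>m (a z * (h z * (hs z * b z)))"
    by (simp add: mat_simps, rule eq_matI, auto simp: algebra_simps)
  also have "\<dots> = a z * \<gamma>1 * (adj \<gamma>1 * b z) + (a z * h z) * (hs z * b z)"
    unfolding id2 by (simp add: mat_simps, rule eq_matI, auto simp: algebra_simps)
  also have "\<dots> = a z * \<gamma>1 * (adj \<gamma>1 * b z) + c z * \<gamma> * (adj \<gamma> * d z)" unfolding ah hb ..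
  finally show ?thesis
    unfolding F a_def[symmetric, THEN fun_cong] b_def[symmetric, THEN fun_cong] c_def[symmetric, THEN fun_cong] d_def[symmetric, THEN fun_cong]
    by (intro has_mat_derivative_eq[OF has_mat_derivative_mult[OF has_mat_derivative_mult[OF ad P_deriv] bd]])
qed

lemma Lambda_gram:
  "Lambda_fun \<alpha> \<gamma>1 \<gamma> t * adj (Lambda_fun \<alpha> \<gamma>1 \<gamma> t) =
    mat_exp ((- (\<i> * of_real t)) \<cdot>\<^sub>m \<alpha>) * \<gamma>1 * (adj \<gamma>1 * mat_exp ((\<i> * of_real t) \<cdot>\<^sub>m adj \<alpha>)) +
    mat_exp ((\<i> * of_real t) \<cdot>\<^sub>m \<alpha>) * \<gamma> * (adj \<gamma> * mat_exp ((- (\<i> * of_real t)) \<cdot>\<^sub>m adj \<alpha>))"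
proof -
  define X where "X = mat_exp ((- (\<i> * of_real t)) \<cdot>\<^sub>m \<alpha>) * \<gamma>1"
  define Y where "Y = mat_exp ((\<i> * of_real t) \<cdot>\<^sub>m \<alpha>) * \<gamma>"
  have [simp]: "dim_row X = n" "dim_col X = m1" "dim_row Y = n" "dim_col Y = m2" by (simp_all add: X_def Y_def)
  have aX: "adj X = adj \<gamma>1 * mat_exp ((\<i> * of_real t) \<cdot>\<^sub>m adj \<alpha>)"
    unfolding X_def using mat_exp_adj[OF \<alpha>, of "- (\<i> * of_real t)"] by (simp add: adj_mult)
  have aY: "adj Y = adj \<gamma> * mat_exp ((- (\<i> * of_real t)) \<cdot>\<^sub>m adj \<alpha>)"
    unfolding Y_def using mat_exp_adj[OF \<alpha>, of "\<i> * of_real t"] by (simp add: adj_mult)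
  have L: "Lambda_fun \<alpha> \<gamma>1 \<gamma> t = four_block_mat X Y (0\<^sub>m 0 m1) (0\<^sub>m 0 m2)"
    by (simp add: Lambda_fun_def X_def Y_def)
  have "Lambda_fun \<alpha> \<gamma>1 \<gamma> t * adj (Lambda_fun \<alpha> \<gamma>1 \<gamma> t) = X * adj X + Y * adj Y"
    unfolding L by (rule eq_matI) (auto simp: index_mult_sum sum_lessThan_add)
  then show ?thesis unfolding aX aY by (simp only: X_def Y_def)
qed

lemma F_0: "F 0 = S0"
  using mat_exp_zero[OF \<alpha>] mat_exp_zero[OF adj_alpha] by (simp add: F_def P_0 one_mult_dim mult_one_dim)

lemma F_dims [simp]: "dim_row (F z) = n" "dim_col (F z) = n"
  by (simp_all add: F_def)

text \<open>The fundamental theorem of calculus: on the real axis the derivative of \<open>F\<close>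
  is \<open>\<Lambda> \<Lambda>^*\<close> by \<open>Lambda_gram\<close>.\<close>

lemma S_fun_eq:
  assumes x: "0 \<le> x"
  shows "S_fun \<alpha> S0 \<gamma>1 \<gamma> x = F (of_real x)"
proof (rule eq_matI)
  fix i j assume "i < dim_row (F (of_real x))" "j < dim_col (F (of_real x))"
  then have ij: "i < n" "j < n" by auto
  define G where "G = (\<lambda>t. Lambda_fun \<alpha> \<gamma>1 \<gamma> t * adj (Lambda_fun \<alpha> \<gamma>1 \<gamma> t))"
  have FG: "has_mat_derivative n n F (G t) (of_real t)" for t
    unfolding G_def Lambda_gram by (rule F_deriv)
  have v: "((\<lambda>t. F (of_real t) $$ (i, j)) has_vector_derivative G t $$ (i, j)) (at t)" for t
    by (rule has_vector_derivative_real_field[OF has_mat_derivativeD(3)[OF FG ij]])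
  have "((\<lambda>t. G t $$ (i, j)) has_integral F (of_real x) $$ (i, j) - F (of_real 0) $$ (i, j)) {0..x}"
    by (rule fundamental_theorem_of_calculus[OF x has_vector_derivative_at_within[OF v]])
  then have "integral {0..x} (\<lambda>t. G t $$ (i, j)) = F (of_real x) $$ (i, j) - S0 $$ (i, j)" by (simp only: integral_unique F_0 of_real_0)
  then show "S_fun \<alpha> S0 \<gamma>1 \<gamma> x $$ (i, j) = F (of_real x) $$ (i, j)" 
    using ij unfolding S_fun_def G_def by simp
qed (auto simp: S_fun_def)

definition pot where "pot x = (- 2 * \<i>) \<cdot>\<^sub>m (adj \<gamma>1 * (mat_inv (P (of_real x)) * h (of_real x)))"

text \<open>The exponentials relating \<open>S(x)\<close> to \<open>P(x)\<close> are invertible, so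
  both are singular at the same points. In the formula for the potential they cancel on the left of
  \<open>P^-1\<close> and combine to \<open>h\<close> on its right.\<close>

lemma pe_potential_eq:
  "pe_potential \<alpha> S0 \<gamma>1 \<gamma> x = (if 0 \<le> x \<and> Determinant.det (P (of_real x)) \<noteq> 0 then Some (pot x) else None)"
proof (cases "0 \<le> x")
  case False
  then show ?thesis by (simp add: pe_potential_def)
next
  case True
  define z where "z = complex_of_real x"
  define a where "a = mat_exp ((- (\<i> * z)) \<cdot>\<^sub>m \<alpha>)"
  define b where "b = mat_exp ((\<i> * z) \<cdot>\<^sub>m adj \<alpha>)"
  define c where "c = mat_exp ((\<i> * z) \<cdot>\<^sub>m \<alpha>)"
  define d where "d = mat_exp ((- (\<i> * z)) \<cdot>\<^sub>m adj \<alpha>)"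
  have [simp]: "dim_row a = n" "dim_col a = n" "dim_row b = n" "dim_col b = n" "dim_row c = n" "dim_col c = n" "dim_row d = n" "dim_col d = n"
    by (simp_all add: a_def b_def c_def d_def)
  have cs: "a \<in> carrier_mat n n" "b \<in> carrier_mat n n" "c \<in> carrier_mat n n" "d \<in> carrier_mat n n"
    by (simp_all add: carrier_iff)
  have ac: "a * c = 1\<^sub>m n" using mat_exp_inverse[OF \<alpha>, of "- (\<i> * z)"] by (simp add: a_def c_def)
  have bd: "b * d = 1\<^sub>m n" using mat_exp_inverse[OF adj_alpha, of "\<i> * z"] by (simp add: b_def d_def)
  have Fz: "F z = a * P z * b" by (simp add: F_def a_def b_def)
  have det: "Determinant.det (F z) = Determinant.det a * Determinant.det (P z) * Determinant.det b"
  proof -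
    have "a * P z \<in> carrier_mat n n" by (simp add: carrier_iff)
    then show ?thesis unfolding Fz using det_mult[OF _ cs(2)] det_mult[OF cs(1) P_carrier] by simp
  qed
  have det_iff: "Determinant.det (F z) \<noteq> 0 \<longleftrightarrow> Determinant.det (P z) \<noteq> 0"
    unfolding det using det_nonzero_of_inverse[OF cs(1,3) ac] det_nonzero_of_inverse[OF cs(2,4) bd] by simp
  have S: "S_fun \<alpha> S0 \<gamma>1 \<gamma> x = F z" using S_fun_eq[OF True] by (simp add: z_def)
  show ?thesis
  proof (cases "Determinant.det (P z) = 0")
    case True
    then show ?thesis using det_iff by (simp add: pe_potential_def S z_def[symmetric])
  next
    case False
    note I = mat_inv_props[OF P_carrier False] note [simp] = carrier_matD[OF I(1)]
    have db: "d * b = 1\<^sub>m n" using mat_exp_inverse[OF adj_alpha, of "- (\<i> * z)"] by (simp add: b_def d_def)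
    have inv: "mat_inv (F z) = d * mat_inv (P z) * c"
    proof (rule mat_inv_unique)
      have "F z * (d * mat_inv (P z) * c) = a * (P z * ((b * d) * (mat_inv (P z) * c)))"
        unfolding Fz by (simp add: mat_simps)
      also have "\<dots> = a * ((P z * mat_inv (P z)) * c)" unfolding bd by (simp add: mat_simps)
      also have "\<dots> = 1\<^sub>m n" unfolding I(2) using ac by (simp add: one_mult_dim)
      finally show "F z * (d * mat_inv (P z) * c) = 1\<^sub>m n" .
    qed (auto simp: carrier_iff)
    have ccg: "c * (c * \<gamma>) = h z"
      unfolding c_def h_def E_def using mat_exp_add[OF \<alpha>, of "\<i> * z" "\<i> * z"]
      by (simp add: mult_assoc_dim[symmetric] mult.assoc)
    have "adj \<gamma>1 * b * mat_inv (F z) * c * \<gamma> = adj \<gamma>1 * ((b * d) * (mat_inv (P z) * (c * (c * \<gamma>))))"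
      unfolding inv by (simp add: mat_simps)
    also have "\<dots> = adj \<gamma>1 * (mat_inv (P z) * h z)" unfolding bd ccg by (simp add: mat_simps)
    finally show ?thesis
      using False True det_iff by (simp add: pe_potential_def S pot_def z_def[symmetric] b_def[symmetric] c_def[symmetric])
  qed
qed

subsection \<open>The inverse of P\<close>

lemma P_holomorphic: "i < n \<Longrightarrow> j < n \<Longrightarrow> (\<lambda>z. P z $$ (i, j)) holomorphic_on UNIV"
  by (rule has_mat_derivative_holomorphic[OF P_deriv])

lemma det_P_holomorphic: "(\<lambda>z. Determinant.det (P z)) holomorphic_on UNIV"
  by (rule det_closed[where \<P> = "\<lambda>f. f holomorphic_on UNIV", OF _ _ _ P_carrier P_holomorphic])
     (auto intro: holomorphic_intros)

lemma adj_mat_P_holomorphic: "i < n \<Longrightarrow> j < n \<Longrightarrow> (\<lambda>z. adj_mat (P z) $$ (i, j)) holomorphic_on UNIV"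
  by (rule adj_mat_closed[where \<P> = "\<lambda>f. f holomorphic_on UNIV", OF _ _ _ P_carrier P_holomorphic])
     (auto intro: holomorphic_intros)

text \<open>The adjugate formula shows the entries as quotients of entire functions. At the zeros of
  the determinant the value is the zero matrix, because \<open>1 / 0 = 0\<close>; the identities for
  \<open>M\<close> are therefore stated at regular points.\<close>

definition M where "M z = (1 / Determinant.det (P z)) \<cdot>\<^sub>m adj_mat (P z)"

lemma M_dims [simp]: "dim_row (M z) = n" "dim_col (M z) = n"
  using carrier_matD[OF adj_mat(1)[OF P_carrier]] by (simp_all add: M_def)

lemma M_eq: "Determinant.det (P z) \<noteq> 0 \<Longrightarrow> M z = mat_inv (P z)"
  using mat_inv_adj_mat[OF P_carrier] by (simp add: M_def)

lemma P_M: "Determinant.det (P z) \<noteq> 0 \<Longrightarrow> P z * M z = 1\<^sub>m n"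
  and M_P: "Determinant.det (P z) \<noteq> 0 \<Longrightarrow> M z * P z = 1\<^sub>m n"
  using mat_inv_props[OF P_carrier] by (simp_all add: M_eq)

lemma M_entry: "i < n \<Longrightarrow> j < n \<Longrightarrow> M z $$ (i, j) = adj_mat (P z) $$ (i, j) / Determinant.det (P z)"
  using carrier_matD[OF adj_mat(1)[OF P_carrier, of z]] by (simp add: M_def)

lemma M_meromorphic:
  assumes ij: "i < n" "j < n"
  shows "(\<lambda>z. M z $$ (i, j)) meromorphic_on A"
proof -
  have hol: "f meromorphic_on A" if "f holomorphic_on UNIV" for f
    using that by (intro analytic_on_imp_meromorphic_on) (metis analytic_on_open analytic_on_subset open_UNIV subset_UNIV)
  then show ?thesis unfolding M_entry[OF ij]
    by (intro meromorphic_on_divide hol adj_mat_P_holomorphic det_P_holomorphic ij)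
qed

text \<open>Differentiability comes from the quotient formula, the value of the derivative from
  differentiating \<open>P M = 1\<close> on the open set of regular points.\<close>

lemma M_deriv:
  assumes d: "Determinant.det (P z0) \<noteq> 0"
  shows "has_mat_derivative n n M ((- 2) \<cdot>\<^sub>m (M z0 * (h z0 * (hs z0 * M z0)))) z0"
proof -
  have "\<exists>D. ((\<lambda>z. M z $$ (i, j)) has_field_derivative D) (at z0)" if ij: "i < n" "j < n" for i j
  proof -
    obtain D1 where "((\<lambda>z. adj_mat (P z) $$ (i, j)) has_field_derivative D1) (at z0)"
      using adj_mat_P_holomorphic[OF ij] unfolding holomorphic_on_open[OF open_UNIV] by blast
    moreover obtain D2 where "((\<lambda>z. Determinant.det (P z)) has_field_derivative D2) (at z0)"
      using det_P_holomorphic unfolding holomorphic_on_open[OF open_UNIV] by blast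
    ultimately show ?thesis unfolding M_entry[OF ij] using DERIV_divide d by blast
  qed
  then have "\<forall>p\<in>{..<n} \<times> {..<n}. \<exists>D. ((\<lambda>z. M z $$ p) has_field_derivative D) (at z0)" by auto
  from bchoice[OF this] obtain D0 where D0: "\<forall>p\<in>{..<n} \<times> {..<n}. ((\<lambda>z. M z $$ p) has_field_derivative D0 p) (at z0)" ..
  define D where "D = Matrix.mat n n D0"
  have [simp]: "dim_row D = n" "dim_col D = n" by (simp_all add: D_def)
  have MD: "has_mat_derivative n n M D z0"
    unfolding has_mat_derivative_def using D0 by (auto simp: D_def carrier_iff)
  note PM = has_mat_derivative_mult[OF P_deriv[of z0] MD]
  have op: "open {z. Determinant.det (P z) \<noteq> 0}"
    by (intro open_Collect_neq holomorphic_on_imp_continuous_on det_P_holomorphic continuous_on_const)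
  have one: "1\<^sub>m n \<in> carrier_mat n n" by simp
  have z: "2 \<cdot>\<^sub>m (h z0 * hs z0) * M z0 + P z0 * D = 0\<^sub>m n n"
  proof (rule eq_matI)
    fix i j assume "i < dim_row (0\<^sub>m n n :: complex mat)" "j < dim_col (0\<^sub>m n n :: complex mat)"
    then have ij: "i < n" "j < n" by auto
    have "((\<lambda>z. (P z * M z) $$ (i, j)) has_field_derivative 0) (at z0)"
    proof (rule has_field_derivative_transform_within_open[OF DERIV_const op])
      show "z0 \<in> {z. Determinant.det (P z) \<noteq> 0}" using d by simp
      show "(1\<^sub>m n :: complex mat) $$ (i, j) = (P z * M z) $$ (i, j)" if "z \<in> {z. Determinant.det (P z) \<noteq> 0}" for z
        using P_M that by simp
    qed
    from DERIV_unique[OF has_mat_derivativeD(3)[OF PM ij] this]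
    show "(2 \<cdot>\<^sub>m (h z0 * hs z0) * M z0 + P z0 * D) $$ (i, j) = 0\<^sub>m n n $$ (i, j)" using ij by simp
  qed auto
  have "D = (M z0 * P z0) * D" unfolding M_P[OF d] by (simp add: one_mult_dim)
  also have "\<dots> = M z0 * (2 \<cdot>\<^sub>m (h z0 * hs z0) * M z0 + P z0 * D) - 2 \<cdot>\<^sub>m (M z0 * (h z0 * (hs z0 * M z0)))"
    by (simp add: mat_simps, rule eq_matI, auto)
  also have "\<dots> = (- 2) \<cdot>\<^sub>m (M z0 * (h z0 * (hs z0 * M z0)))"
    unfolding z by (simp add: mult_zero_dim, rule eq_matI, auto)
  finally show ?thesis using MD by simp
qed

lemma M_ident:
  assumes d: "Determinant.det (P z) \<noteq> 0"
  shows "M z * \<alpha> - adj \<alpha> * M z = \<i> \<cdot>\<^sub>m (M z * (\<gamma>1 * (adj \<gamma>1 * M z)) - M z * (h z * (hs z * M z)))"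
proof -
  have "M z * (\<alpha> * P z - P z * adj \<alpha>) * M z = M z * (\<alpha> * (P z * M z)) - (M z * P z) * (adj \<alpha> * M z)"
    by (simp add: mat_simps)
  also have "\<dots> = M z * \<alpha> - adj \<alpha> * M z" unfolding P_M[OF d] M_P[OF d] by (simp add: mat_simps)
  finally have "M z * \<alpha> - adj \<alpha> * M z = M z * (\<i> \<cdot>\<^sub>m (\<gamma>1 * adj \<gamma>1 - h z * hs z)) * M z" unfolding P_ident by simp
  then have e: "M z * \<alpha> - adj \<alpha> * M z = \<i> \<cdot>\<^sub>m (M z * (\<gamma>1 * (adj \<gamma>1 * M z)) - M z * (h z * (hs z * M z)))"
    by (simp add: mat_simps)
  show ?thesis by (rule e)
qed

end

section \<open>The explicit normalized solution\<close>

lemma lower_identity_1: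
  assumes "H \<in> carrier_mat p n" "A \<in> carrier_mat n n" "Q \<in> carrier_mat n q" "W \<in> carrier_mat n q"
  shows "\<i> \<cdot>\<^sub>m (((- (2 * \<i>)) \<cdot>\<^sub>m (H * A)) * Q + H * ((- 2) \<cdot>\<^sub>m W)) = 2 \<cdot>\<^sub>m (H * (A * Q)) - (2 * \<i>) \<cdot>\<^sub>m (H * W)"
proof -
  note [simp] = assms[THEN carrier_matD(1)] assms[THEN carrier_matD(2)]
  have 1: "((- (2 * \<i>)) \<cdot>\<^sub>m (H * A)) * Q = (- (2 * \<i>)) \<cdot>\<^sub>m (H * (A * Q))" by (simp only: smult_mult_dim mult_assoc_dim assms[THEN carrier_matD(1)] assms[THEN carrier_matD(2)] index_mult_mat(2,3))
  have 2: "H * ((- 2) \<cdot>\<^sub>m W) = (- 2) \<cdot>\<^sub>m (H * W)" by (simp add: mult_smult_dim)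
  show ?thesis unfolding 1 2
  proof (rule eq_matI)
    fix i j assume "i < dim_row (2 \<cdot>\<^sub>m (H * (A * Q)) - (2 * \<i>) \<cdot>\<^sub>m (H * W))" "j < dim_col (2 \<cdot>\<^sub>m (H * (A * Q)) - (2 * \<i>) \<cdot>\<^sub>m (H * W))"
    then have ij: "i < p" "j < q" by auto
    have e: "\<i> * ((- (2 * \<i>)) * a + (- 2) * b) = 2 * a - (2 * \<i>) * b" for a b :: complex
      by (simp add: complex_eq_iff)
    show "(\<i> \<cdot>\<^sub>m ((- (2 * \<i>)) \<cdot>\<^sub>m (H * (A * Q)) + (- 2) \<cdot>\<^sub>m (H * W))) $$ (i, j) = (2 \<cdot>\<^sub>m (H * (A * Q)) - (2 * \<i>) \<cdot>\<^sub>m (H * W)) $$ (i, j)"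
      using ij e by simp
  qed auto
qed
text \<open>As in the preceding identity, the factors are kept opaque: what \<open>UL_deriv\<close>
  needs is scalar arithmetic in each entry.\<close>

lemma lower_identity_2:
  assumes "p \<in> carrier_mat a b" "q \<in> carrier_mat a b" "r \<in> carrier_mat a b" "s \<in> carrier_mat a b"
  shows "2 \<cdot>\<^sub>m (c \<cdot>\<^sub>m p + q - \<i> \<cdot>\<^sub>m r + \<i> \<cdot>\<^sub>m s) - (2 * \<i>) \<cdot>\<^sub>m s = (- (2 * \<i> * c)) \<cdot>\<^sub>m (\<i> \<cdot>\<^sub>m p) - \<i> \<cdot>\<^sub>m ((2 * \<i>) \<cdot>\<^sub>m (q - \<i> \<cdot>\<^sub>m r))"
proof (rule eq_matI)
  note [simp] = assms[THEN carrier_matD(1)] assms[THEN carrier_matD(2)]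
  fix i j assume "i < dim_row ((- (2 * \<i> * c)) \<cdot>\<^sub>m (\<i> \<cdot>\<^sub>m p) - \<i> \<cdot>\<^sub>m ((2 * \<i>) \<cdot>\<^sub>m (q - \<i> \<cdot>\<^sub>m r)))"
    "j < dim_col ((- (2 * \<i> * c)) \<cdot>\<^sub>m (\<i> \<cdot>\<^sub>m p) - \<i> \<cdot>\<^sub>m ((2 * \<i>) \<cdot>\<^sub>m (q - \<i> \<cdot>\<^sub>m r)))"
  then have ij: "i < a" "j < b" by auto
  have e: "2 * (c * p + q - \<i> * r + \<i> * s) - (2 * \<i>) * s = (- (2 * \<i> * c)) * (\<i> * p) - \<i> * ((2 * \<i>) * (q - \<i> * r))" for p q r s :: complex
    by (simp add: complex_eq_iff algebra_simps)
  show "(2 \<cdot>\<^sub>m (c \<cdot>\<^sub>m p + q - \<i> \<cdot>\<^sub>m r + \<i> \<cdot>\<^sub>m s) - (2 * \<i>) \<cdot>\<^sub>m s) $$ (i, j) =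
      ((- (2 * \<i> * c)) \<cdot>\<^sub>m (\<i> \<cdot>\<^sub>m p) - \<i> \<cdot>\<^sub>m ((2 * \<i>) \<cdot>\<^sub>m (q - \<i> \<cdot>\<^sub>m r))) $$ (i, j)"
    using ij e[of "p $$ (i, j)" "q $$ (i, j)" "r $$ (i, j)" "s $$ (i, j)"] by simp
qed (use assms[THEN carrier_matD(1)] assms[THEN carrier_matD(2)] in auto)

lemma append_rows_entry:
  assumes "i < m1 + m2" "l < m1"
  shows "(1\<^sub>m m1 @\<^sub>r 0\<^sub>m m2 m1 :: complex mat) $$ (i, l) = (if i = l then 1 else 0)"
  using assms by (auto simp: append_rows_def)

context pe_data begin

lemma M_real_herm:
  assumes d: "Determinant.det (P (of_real x)) \<noteq> 0"
  shows "adj (M (of_real x)) = M (of_real x)"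
proof -
  have c: "adj (M (of_real x)) \<in> carrier_mat n n" by (simp add: carrier_iff)
  have "P (of_real x) * adj (M (of_real x)) = adj (M (of_real x) * P (of_real x))"
    by (simp add: adj_mult P_real_herm)
  also have "\<dots> = 1\<^sub>m n" unfolding M_P[OF d] by (simp add: adj_one)
  finally have e: "P (of_real x) * adj (M (of_real x)) = 1\<^sub>m n" .
  show ?thesis by (rule trans[OF sym[OF mat_inv_unique[OF P_carrier c e]] sym[OF M_eq[OF d]]])
qed

lemma adj_h_real: "adj (h (of_real x)) = hs (of_real x)" and adj_hs_real: "adj (hs (of_real x)) = h (of_real x)"
  using adj_h[of "of_real x"] adj_hs[of "of_real x"] by simp_all

lemma pot_carrier: "pot x \<in> carrier_mat m1 m2"
  using carrier_matD[OF P_carrier] by (simp add: pot_def carrier_iff)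

lemma regular_at_0: "Determinant.det (P 0) \<noteq> 0"
  using detS0 by (simp add: P_0)

end

text \<open>For real \<xi> outside the spectrum of \<alpha>, that is, up to finitely many points,
  \<open>K = - (\<xi> - \<alpha>)^-1 \<gamma>1\<close> satisfies the equation.\<close>

locale pe_resolvent = pe_data +
  fixes \<xi> :: real and K :: "complex mat"
  assumes K: "K \<in> carrier_mat n m1" and resolvent: "\<alpha> * K - of_real \<xi> \<cdot>\<^sub>m K = \<gamma>1"
begin

lemma K_dims [simp]: "dim_row K = n" "dim_col K = m1"
  using carrier_matD[OF K] by auto

lemma alpha_K: "\<alpha> * K = of_real \<xi> \<cdot>\<^sub>m K + \<gamma>1"
  unfolding resolvent[symmetric] by (rule eq_matI) auto

text \<open>The normalized solution is \<open>exp(ix\<xi>)\<close> times the column \<open>(U, L)\<close>.\<close>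

definition U where "U z = 1\<^sub>m m1 - \<i> \<cdot>\<^sub>m (adj \<gamma>1 * (M z * K))"
definition L where "L z = \<i> \<cdot>\<^sub>m (hs z * (M z * K))"

lemma UL_dims [simp]: "dim_row (U z) = m1" "dim_col (U z) = m1" "dim_row (L z) = m2" "dim_col (L z) = m1"
  by (simp_all add: U_def L_def)

lemma M_ident_K:
  assumes d: "Determinant.det (P z) \<noteq> 0"
  shows "adj \<alpha> * (M z * K) = of_real \<xi> \<cdot>\<^sub>m (M z * K) + M z * \<gamma>1
    - \<i> \<cdot>\<^sub>m (M z * (\<gamma>1 * (adj \<gamma>1 * (M z * K)))) + \<i> \<cdot>\<^sub>m (M z * (h z * (hs z * (M z * K))))"
proof -
  have "adj \<alpha> * (M z * K) = M z * (\<alpha> * K) - (M z * \<alpha> - adj \<alpha> * M z) * K"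
    by (simp add: mat_simps, rule eq_matI, auto)
  also have "\<dots> = of_real \<xi> \<cdot>\<^sub>m (M z * K) + M z * \<gamma>1
    - \<i> \<cdot>\<^sub>m (M z * (\<gamma>1 * (adj \<gamma>1 * (M z * K)))) + \<i> \<cdot>\<^sub>m (M z * (h z * (hs z * (M z * K))))"
    unfolding M_ident[OF d] alpha_K by (simp add: mat_simps, rule eq_matI, auto simp: algebra_simps)
  finally show ?thesis .
qed

text \<open>The upper equation is the derivative of \<open>M\<close>. In the lower one the
  derivative of \<open>hs\<close> brings in \<open>adj \<alpha>\<close>, which
  \<open>M_ident_K\<close> moves through \<open>M\<close>; this produces the term with
  \<xi>.\<close>

lemma UL_deriv:
  assumes d: "Determinant.det (P (of_real x)) \<noteq> 0"
  defines "z \<equiv> complex_of_real x"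
  shows "has_mat_derivative m1 m1 U (\<i> \<cdot>\<^sub>m (pot x * L z)) z"
    and "has_mat_derivative m2 m1 L ((- (2 * \<i> * of_real \<xi>)) \<cdot>\<^sub>m L z - \<i> \<cdot>\<^sub>m (adj (pot x) * U z)) z"
proof -
  have dz: "Determinant.det (P z) \<noteq> 0" using d by (simp add: z_def)
  have pot: "pot x = (- 2 * \<i>) \<cdot>\<^sub>m (adj \<gamma>1 * (M z * h z))" unfolding pot_def z_def M_eq[OF d] ..
  have [simp]: "adj (M z) = M z" "adj (h z) = hs z" "adj (hs z) = h z"
    unfolding z_def by (fact M_real_herm[OF d] adj_h_real adj_hs_real)+
  have K': "has_mat_derivative n m1 (\<lambda>z. M z * K) ((- 2) \<cdot>\<^sub>m (M z * (h z * (hs z * (M z * K))))) z"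
    by (rule has_mat_derivative_eq[OF has_mat_derivative_mult[OF M_deriv[OF dz] has_mat_derivative_const[OF K]]])
       (simp add: mat_simps, rule eq_matI, auto)
  have g: "adj \<gamma>1 \<in> carrier_mat m1 n" by (simp add: carrier_iff)
  have one: "1\<^sub>m m1 \<in> carrier_mat m1 m1" by simp
  have e1: "0\<^sub>m m1 m1 - \<i> \<cdot>\<^sub>m (0\<^sub>m m1 n * (M z * K) + adj \<gamma>1 * ((- 2) \<cdot>\<^sub>m (M z * (h z * (hs z * (M z * K)))))) = \<i> \<cdot>\<^sub>m (pot x * L z)"
    by (simp add: pot L_def mat_simps, rule eq_matI, simp_all add: algebra_simps i_squared)
  show "has_mat_derivative m1 m1 U (\<i> \<cdot>\<^sub>m (pot x * L z)) z"
    unfolding U_def[abs_def]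
    by (rule has_mat_derivative_eq[OF has_mat_derivative_minus[OF has_mat_derivative_const[OF one]
          has_mat_derivative_cmult[OF has_mat_derivative_mult[OF has_mat_derivative_const[OF g] K']]] e1])
  let ?MK = "M z * K"
  have "\<i> \<cdot>\<^sub>m (((- (2 * \<i>)) \<cdot>\<^sub>m (hs z * adj \<alpha>)) * ?MK + hs z * ((- 2) \<cdot>\<^sub>m (M z * (h z * (hs z * ?MK))))) =
      2 \<cdot>\<^sub>m (hs z * (adj \<alpha> * ?MK)) - (2 * \<i>) \<cdot>\<^sub>m (hs z * (M z * (h z * (hs z * ?MK))))"
    by (rule lower_identity_1[of _ m2 n _ _ m1]) (simp_all add: carrier_iff)
  also have "\<dots> = (- (2 * \<i> * of_real \<xi>)) \<cdot>\<^sub>m L z - \<i> \<cdot>\<^sub>m (adj (pot x) * U z)"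
  proof -
    let ?p = "hs z * ?MK" and ?q = "hs z * (M z * \<gamma>1)" and ?r = "hs z * (M z * (\<gamma>1 * (adj \<gamma>1 * ?MK)))"
      and ?s = "hs z * (M z * (h z * (hs z * ?MK)))"
    have 1: "hs z * (adj \<alpha> * ?MK) = of_real \<xi> \<cdot>\<^sub>m ?p + ?q - \<i> \<cdot>\<^sub>m ?r + \<i> \<cdot>\<^sub>m ?s"
      unfolding M_ident_K[OF dz] by (simp add: mat_simps)
    have 2: "adj (pot x) * U z = (2 * \<i>) \<cdot>\<^sub>m (?q - \<i> \<cdot>\<^sub>m ?r)"
      unfolding pot U_def by (simp add: mat_simps mult_ac)
    show ?thesis unfolding 1 2 L_def
      by (rule lower_identity_2[of _ m2 m1]) (simp_all add: carrier_iff)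
  qed
  finally have e2: "\<i> \<cdot>\<^sub>m (((- (2 * \<i>)) \<cdot>\<^sub>m (hs z * adj \<alpha>)) * ?MK + hs z * ((- 2) \<cdot>\<^sub>m (M z * (h z * (hs z * ?MK))))) =
      (- (2 * \<i> * of_real \<xi>)) \<cdot>\<^sub>m L z - \<i> \<cdot>\<^sub>m (adj (pot x) * U z)" .
  have LL: "L = (\<lambda>z. \<i> \<cdot>\<^sub>m (hs z * (M z * K)))" by (rule ext) (rule L_def)
  show "has_mat_derivative m2 m1 L ((- (2 * \<i> * of_real \<xi>)) \<cdot>\<^sub>m L z - \<i> \<cdot>\<^sub>m (adj (pot x) * U z)) z"
    by (rule has_mat_derivative_eq[OF has_mat_derivative_cmult[OF has_mat_derivative_mult[OF hs_deriv K']] e2, folded LL])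
qed

text \<open>Follows by sandwiching \<open>M_ident\<close> between \<open>adj K\<close> and
  \<open>K\<close>: the contributions of the real number \<xi> cancel, and the rest accounts for all
  nonconstant terms in the expansion of the j-form.\<close>

lemma UL_ident:
  assumes d: "Determinant.det (P (of_real x)) \<noteq> 0"
  defines "z \<equiv> complex_of_real x"
  shows "adj (U z) * U z - adj (L z) * L z = 1\<^sub>m m1"
proof -
  have dz: "Determinant.det (P z) \<noteq> 0" using d by (simp add: z_def)
  have [simp]: "adj (M z) = M z" "adj (h z) = hs z" "adj (hs z) = h z"
    unfolding z_def by (fact M_real_herm[OF d] adj_h_real adj_hs_real)+
  have 1: "adj K * (M z * (\<alpha> * K)) - adj (\<alpha> * K) * (M z * K) = adj K * ((M z * \<alpha> - adj \<alpha> * M z) * K)"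
    by (simp add: mat_simps)
  have e: "adj K * (M z * \<gamma>1) - adj \<gamma>1 * (M z * K) = \<i> \<cdot>\<^sub>m (adj K * (M z * (\<gamma>1 * (adj \<gamma>1 * (M z * K))))
      - adj K * (M z * (h z * (hs z * (M z * K)))))"
    (is "?l = ?r")
  proof -
    have "?l = adj K * (M z * (\<alpha> * K)) - adj (\<alpha> * K) * (M z * K)"
      unfolding alpha_K by (simp add: mat_simps, rule eq_matI, auto)
    also have "\<dots> = ?r" unfolding 1 M_ident[OF dz] by (simp add: mat_simps)
    finally show ?thesis .
  qed
  have "adj (U z) * U z - adj (L z) * L z = 1\<^sub>m m1 + \<i> \<cdot>\<^sub>m (adj K * (M z * \<gamma>1) - adj \<gamma>1 * (M z * K))
    + (adj K * (M z * (\<gamma>1 * (adj \<gamma>1 * (M z * K)))) - adj K * (M z * (h z * (hs z * (M z * K)))))"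
    unfolding U_def L_def by (simp add: mat_simps, rule eq_matI, auto simp: algebra_simps i_squared)
  also have "\<dots> = 1\<^sub>m m1" unfolding e by (simp add: mat_simps, rule eq_matI, auto simp: algebra_simps i_squared)
  finally show ?thesis .
qed

definition sol where
  "sol z = Matrix.mat (m1 + m2) m1 (\<lambda>(i, l). exp (\<i> * of_real \<xi> * z) * (if i < m1 then U z $$ (i, l) else L z $$ (i - m1, l)))"

lemma sol_carrier: "sol z \<in> carrier_mat (m1 + m2) m1"
  by (simp add: sol_def)

lemma sol_blocks:
  "upper_block m1 (sol z) = exp (\<i> * of_real \<xi> * z) \<cdot>\<^sub>m U z" "lower_block m1 m2 (sol z) = exp (\<i> * of_real \<xi> * z) \<cdot>\<^sub>m L z"
  by (rule eq_matI, auto simp: sol_def upper_block_def lower_block_def)+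

lemma sol_deriv:
  assumes d: "Determinant.det (P (of_real x)) \<noteq> 0" and il: "i < m1 + m2" "l < m1"
  shows "((\<lambda>z. sol z $$ (i, l)) has_field_derivative
    ((\<i> \<cdot>\<^sub>m (of_real \<xi> \<cdot>\<^sub>m j_mat m1 m2 + j_mat m1 m2 * V_mat m1 m2 (pot x))) * sol (of_real x)) $$ (i, l)) (at (of_real x))"
proof -
  define z where "z = complex_of_real x"
  define Nu where "Nu = (\<i> \<cdot>\<^sub>m (of_real \<xi> \<cdot>\<^sub>m j_mat m1 m2 + j_mat m1 m2 * V_mat m1 m2 (pot x))) * sol z"
  note N = dirac_rhs_blocks[OF pot_carrier[of x] sol_carrier[of z], where c = "of_real \<xi>", folded Nu_def]
  note [simp] = carrier_matD[OF pot_carrier]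
  have e: "((\<lambda>z. exp (\<i> * of_real \<xi> * z)) has_field_derivative exp (\<i> * of_real \<xi> * z) * (\<i> * of_real \<xi>)) (at z)"
    by (auto intro!: derivative_eq_intros)
  note ds = UL_deriv[OF d, folded z_def]
  note eu = has_mat_derivative_smult[OF ds(1) e] and el = has_mat_derivative_smult[OF ds(2) e]
  show ?thesis unfolding z_def[symmetric] Nu_def[symmetric]
  proof (cases "i < m1")
    case True
    let ?E = "((exp (\<i> * of_real \<xi> * z) * (\<i> * of_real \<xi>)) \<cdot>\<^sub>m U z + exp (\<i> * of_real \<xi> * z) \<cdot>\<^sub>m (\<i> \<cdot>\<^sub>m (pot x * L z))) $$ (i, l)"
    have "Nu $$ (i, l) = upper_block m1 Nu $$ (i, l)" using stacked_entry[OF N(1) il] True by simp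
    also have "\<dots> = ?E"
      unfolding N(2) sol_blocks using True il by (simp add: mult_smult_dim algebra_simps)
    finally have "Nu $$ (i, l) = ?E" .
    moreover have "(\<lambda>z. sol z $$ (i, l)) = (\<lambda>z. (exp (\<i> * of_real \<xi> * z) \<cdot>\<^sub>m U z) $$ (i, l))"
      using True il by (simp add: sol_def)
    ultimately show "((\<lambda>z. sol z $$ (i, l)) has_field_derivative Nu $$ (i, l)) (at z)"
      using has_mat_derivativeD(3)[OF eu True il(2)] by simp
  next
    case False
    then have i: "i - m1 < m2" using il by auto
    let ?E = "((exp (\<i> * of_real \<xi> * z) * (\<i> * of_real \<xi>)) \<cdot>\<^sub>m L z + exp (\<i> * of_real \<xi> * z) \<cdot>\<^sub>m
        ((- (2 * \<i> * of_real \<xi>)) \<cdot>\<^sub>m L z - \<i> \<cdot>\<^sub>m (adj (pot x) * U z))) $$ (i - m1, l)"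
    have "Nu $$ (i, l) = lower_block m1 m2 Nu $$ (i - m1, l)" using stacked_entry[OF N(1) il] False by simp
    also have "\<dots> = ?E"
      unfolding N(3) sol_blocks using i il by (simp add: mult_smult_dim algebra_simps)
    finally have "Nu $$ (i, l) = ?E" .
    moreover have "(\<lambda>z. sol z $$ (i, l)) = (\<lambda>z. (exp (\<i> * of_real \<xi> * z) \<cdot>\<^sub>m L z) $$ (i - m1, l))"
      using False i il by (simp add: sol_def)
    ultimately show "((\<lambda>z. sol z $$ (i, l)) has_field_derivative Nu $$ (i, l)) (at z)"
      using has_mat_derivativeD(3)[OF el i il(2)] by simp
  qed
qed

lemma sol_meromorphic:
  assumes il: "i < m1 + m2" "l < m1"
  shows "(\<lambda>z. sol z $$ (i, l)) meromorphic_on A"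
proof -
  have hol: "f meromorphic_on A" if "f holomorphic_on UNIV" for f
    using that by (intro analytic_on_imp_meromorphic_on) (metis analytic_on_open analytic_on_subset open_UNIV subset_UNIV)
  have MK: "(\<lambda>z. (M z * K) $$ (a, l)) meromorphic_on A" if "a < n" for a
    using that il by (simp add: index_mult_sum) (intro conjI impI meromorphic_intros M_meromorphic, auto)
  have U: "(\<lambda>z. U z $$ (i, l)) meromorphic_on A" if "i < m1"
    using that il by (simp add: U_def index_mult_sum[of _ "adj \<gamma>1"]) (intro conjI impI meromorphic_intros MK, auto)
  have hs: "(\<lambda>z. hs z $$ (a, b)) meromorphic_on A" if "a < m2" "b < n" for a b
    by (rule hol, rule has_mat_derivative_holomorphic[OF hs_deriv that])
  have L: "(\<lambda>z. L z $$ (i - m1, l)) meromorphic_on A" if "\<not> i < m1"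
    using that il by (simp add: L_def index_mult_sum[of _ "hs _"]) (intro conjI impI meromorphic_intros MK hs, auto)
  have e: "(\<lambda>z. exp (\<i> * of_real \<xi> * z)) meromorphic_on A" by (rule hol) (intro holomorphic_intros)
  show ?thesis
  proof (cases "i < m1")
    case True
    show ?thesis using meromorphic_on_mult[OF e U[OF True]] True il by (simp add: sol_def)
  next
    case False
    show ?thesis using meromorphic_on_mult[OF e L[OF False]] False il by (simp add: sol_def)
  qed
qed

lemma sol_dirac: "dirac_solution m1 m2 (pe_potential \<alpha> S0 \<gamma>1 \<gamma>) \<xi> m1 sol"
  unfolding dirac_solution_def
proof (intro conjI allI impI)
  fix x w i l assume x: "0 \<le> x" and w: "pe_potential \<alpha> S0 \<gamma>1 \<gamma> x = Some w" and il: "i < m1 + m2" "l < m1"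
  have d: "Determinant.det (P (of_real x)) \<noteq> 0" and w': "w = pot x" using w unfolding pe_potential_eq by (auto split: if_splits)
  show "((\<lambda>z. sol z $$ (i, l)) has_field_derivative
    ((\<i> \<cdot>\<^sub>m (of_real \<xi> \<cdot>\<^sub>m j_mat m1 m2 + j_mat m1 m2 * V_mat m1 m2 w)) * sol (of_real x)) $$ (i, l)) (at (of_real x))"
    unfolding w' by (rule sol_deriv[OF d il])
qed (use sol_carrier sol_meromorphic in auto)

text \<open>\<open>U\<close> tends to 1 because the inverse of \<open>P\<close> tends to 0. The
  factor \<open>hs\<close> in \<open>L\<close> may grow exponentially, so \<open>L\<close> is not
  estimated directly: by \<open>UL_ident\<close> its columns satisfy
  \<open>|L|^2 = |U|^2 - 1\<close>.\<close>

lemma UL_limits: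
  assumes l: "l < m1"
  shows "i < m1 \<Longrightarrow> ((\<lambda>x. U (of_real x) $$ (i, l)) \<longlongrightarrow> (if i = l then 1 else 0)) at_top"
    and "i < m2 \<Longrightarrow> ((\<lambda>x. L (of_real x) $$ (i, l)) \<longlongrightarrow> 0) at_top"
proof -
  have M0: "((\<lambda>x. M (of_real x) $$ (a, b)) \<longlongrightarrow> 0) at_top" if ab: "a < n" "b < n" for a b
  proof (rule Lim_transform_eventually[OF P_inverse_tendsto[OF ab]])
    show "eventually (\<lambda>x. mat_inv (P (of_real x)) $$ (a, b) = M (of_real x) $$ (a, b)) at_top"
      using P_eventually_nonsingular by eventually_elim (simp add: M_eq)
  qed
  have MK: "((\<lambda>x. (M (of_real x) * K) $$ (a, b)) \<longlongrightarrow> 0) at_top" if "a < n" "b < m1" for a b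
    using that by (simp add: index_mult_sum) (intro tendsto_null_sum tendsto_mult_left_zero M0, auto)
  have g: "((\<lambda>x. (adj \<gamma>1 * (M (of_real x) * K)) $$ (a, b)) \<longlongrightarrow> 0) at_top" if "a < m1" "b < m1" for a b
    using that by (simp add: index_mult_sum[of _ "adj \<gamma>1"]) (intro tendsto_null_sum tendsto_mult_right_zero MK, auto)
  have U: "((\<lambda>x. U (of_real x) $$ (a, b)) \<longlongrightarrow> (if a = b then 1 else 0)) at_top" if ab: "a < m1" "b < m1" for a b
  proof -
    have "((\<lambda>x. (if a = b then 1 else 0) - \<i> * (adj \<gamma>1 * (M (of_real x) * K)) $$ (a, b)) \<longlongrightarrow> (if a = b then 1 else 0) - 0) at_top"
      by (intro tendsto_diff tendsto_const tendsto_mult_right_zero g ab)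
    then show ?thesis using ab by (simp add: U_def)
  qed
  show "i < m1 \<Longrightarrow> ((\<lambda>x. U (of_real x) $$ (i, l)) \<longlongrightarrow> (if i = l then 1 else 0)) at_top" using U l by blast
  assume i: "i < m2"
  have e: "(\<Sum>a<m2. (cmod (L (of_real x) $$ (a, l)))\<^sup>2) = (\<Sum>a<m1. (cmod (U (of_real x) $$ (a, l)))\<^sup>2) - 1"
    if d: "Determinant.det (P (of_real x)) \<noteq> 0" for x
  proof -
    have "(adj (U (of_real x)) * U (of_real x) - adj (L (of_real x)) * L (of_real x)) $$ (l, l) = 1"
      unfolding UL_ident[OF d] using l by simp
    moreover have "(adj (U (of_real x)) * U (of_real x) - adj (L (of_real x)) * L (of_real x)) $$ (l, l)
      = of_real (\<Sum>a<m1. (cmod (U (of_real x) $$ (a, l)))\<^sup>2) - of_real (\<Sum>a<m2. (cmod (L (of_real x) $$ (a, l)))\<^sup>2)"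
      using l by (simp add: adj_self_diag)
    ultimately have "of_real ((\<Sum>a<m1. (cmod (U (of_real x) $$ (a, l)))\<^sup>2) - (\<Sum>a<m2. (cmod (L (of_real x) $$ (a, l)))\<^sup>2)) = (1 :: complex)"
      by simp
    then show ?thesis by (simp only: of_real_eq_1_iff)
  qed
  have "((\<lambda>x. (\<Sum>a<m1. (cmod (U (of_real x) $$ (a, l)))\<^sup>2) - 1) \<longlongrightarrow> (\<Sum>a<m1. (cmod (if a = l then 1 else 0))\<^sup>2) - 1) at_top"
    by (intro tendsto_intros U l) auto
  moreover have "(\<Sum>a<m1. (cmod (if a = l then 1 else 0))\<^sup>2) = (\<Sum>a<m1. if a = l then 1 else 0)" by (intro sum.cong) auto
  ultimately have "((\<lambda>x. (\<Sum>a<m1. (cmod (U (of_real x) $$ (a, l)))\<^sup>2) - 1) \<longlongrightarrow> 0) at_top" using l by simp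
  then have "((\<lambda>x. sqrt ((\<Sum>a<m1. (cmod (U (of_real x) $$ (a, l)))\<^sup>2) - 1)) \<longlongrightarrow> 0) at_top" using tendsto_real_sqrt by fastforce
  moreover have "eventually (\<lambda>x. norm (L (of_real x) $$ (i, l)) \<le> sqrt ((\<Sum>a<m1. (cmod (U (of_real x) $$ (a, l)))\<^sup>2) - 1)) at_top"
    using P_eventually_nonsingular
  proof eventually_elim
    case (elim x)
    show ?case unfolding e[OF elim, symmetric] using i by (intro real_le_rsqrt member_le_sum) auto
  qed
  ultimately show "((\<lambda>x. L (of_real x) $$ (i, l)) \<longlongrightarrow> 0) at_top" by (rule Lim_null_comparison[rotated])
qed

lemma sol_normalized: "normalized_solution m1 m2 (pe_potential \<alpha> S0 \<gamma>1 \<gamma>) \<xi> sol"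
  unfolding normalized_solution_def
proof (intro conjI allI impI sol_dirac)
  fix i l assume il: "i < m1 + m2" "l < m1"
  define g where "g = (\<lambda>x. (if i < m1 then U (of_real x) $$ (i, l) else L (of_real x) $$ (i - m1, l)) - (if i = l then 1 else 0))"
  have "(g \<longlongrightarrow> (if i < m1 then if i = l then 1 else 0 else 0) - (if i = l then 1 else 0)) at_top"
    unfolding g_def using UL_limits[OF il(2)] il by (intro tendsto_diff tendsto_const) auto
  then have g: "(g \<longlongrightarrow> 0) at_top" using il by (auto split: if_splits)
  have "(sol (of_real x) - exp (\<i> * of_real (x * \<xi>)) \<cdot>\<^sub>m (1\<^sub>m m1 @\<^sub>r 0\<^sub>m m2 m1)) $$ (i, l) = exp (\<i> * of_real (x * \<xi>)) * g x" for x
  proof -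
    have [simp]: "dim_row (1\<^sub>m m1 @\<^sub>r 0\<^sub>m m2 m1 :: complex mat) = m1 + m2" "dim_col (1\<^sub>m m1 @\<^sub>r 0\<^sub>m m2 m1 :: complex mat) = m1"
      by (simp_all add: append_rows_def)
    have "exp (\<i> * of_real \<xi> * of_real x) = exp (\<i> * of_real (x * \<xi>))" by (simp add: mult_ac)
    then show ?thesis using il append_rows_entry[OF il] by (simp add: sol_def g_def algebra_simps)
  qed
  moreover have "((\<lambda>x. exp (\<i> * of_real (x * \<xi>)) * g x) \<longlongrightarrow> 0) at_top"
    by (rule tendsto_norm_zero_cancel) (use tendsto_norm_zero[OF g] in \<open>simp add: norm_mult\<close>)
  ultimately show "((\<lambda>x. (sol (of_real x) - exp (\<i> * of_real (x * \<xi>)) \<cdot>\<^sub>m (1\<^sub>m m1 @\<^sub>r 0\<^sub>m m2 m1)) $$ (i, l)) \<longlongrightarrow> 0) at_top"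
    by simp
qed

end

section \<open>Values of normalized solutions at 0\<close>

lemma adj_self_sum_zero:
  assumes d: "dim_col Z2 = dim_col Z1" and z: "adj Z1 * Z1 + adj Z2 * Z2 = 0\<^sub>m (dim_col Z1) (dim_col Z1)"
  shows "Z1 = 0\<^sub>m (dim_row Z1) (dim_col Z1)" "Z2 = 0\<^sub>m (dim_row Z2) (dim_col Z2)"
proof -
  have e: "(adj Z1 * Z1) $$ (l, l) = 0 \<and> (adj Z2 * Z2) $$ (l, l) = 0" if l: "l < dim_col Z1" for l
  proof -
    have "(adj Z1 * Z1 + adj Z2 * Z2) $$ (l, l) = 0" unfolding z using l by simp
    then have "of_real ((\<Sum>i<dim_row Z1. (cmod (Z1 $$ (i, l)))\<^sup>2) + (\<Sum>i<dim_row Z2. (cmod (Z2 $$ (i, l)))\<^sup>2)) = (0 :: complex)"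
      using l d by (simp add: adj_self_diag)
    then have "(\<Sum>i<dim_row Z1. (cmod (Z1 $$ (i, l)))\<^sup>2) + (\<Sum>i<dim_row Z2. (cmod (Z2 $$ (i, l)))\<^sup>2) = 0"
      by (simp only: of_real_eq_0_iff)
    moreover have "0 \<le> (\<Sum>i<dim_row Z1. (cmod (Z1 $$ (i, l)))\<^sup>2)" "0 \<le> (\<Sum>i<dim_row Z2. (cmod (Z2 $$ (i, l)))\<^sup>2)"
      by (simp_all add: sum_nonneg)
    ultimately have "(\<Sum>i<dim_row Z1. (cmod (Z1 $$ (i, l)))\<^sup>2) = 0" "(\<Sum>i<dim_row Z2. (cmod (Z2 $$ (i, l)))\<^sup>2) = 0" by linarith+
    then show ?thesis using l d by (simp only: adj_self_diag of_real_0 simp_thms)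
  qed
  show "Z1 = 0\<^sub>m (dim_row Z1) (dim_col Z1)" by (rule adj_self_zero) (use e in blast)
  show "Z2 = 0\<^sub>m (dim_row Z2) (dim_col Z2)" by (rule adj_self_zero) (use e d in simp)
qed

text \<open>The columns of \<open>(U, L)\<close> span a maximal j-positive subspace, so anything
  j-orthogonal to them is j-negative unless it is 0. Concretely, with \<open>R = L U^-1\<close> one
  has \<open>D1 = adj R * D2\<close>, and for a null pair a sum of two squares vanishes.\<close>

lemma j_isometry_complement:
  assumes U: "U \<in> carrier_mat m1 m1" and L: "L \<in> carrier_mat m2 m1" and det: "Determinant.det U \<noteq> 0"
    and iso: "adj U * U - adj L * L = 1\<^sub>m m1"
    and D1: "D1 \<in> carrier_mat m1 k" and D2: "D2 \<in> carrier_mat m2 k"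
    and orth: "adj U * D1 = adj L * D2" and null: "adj D1 * D1 = adj D2 * D2"
  shows "D1 = 0\<^sub>m m1 k" "D2 = 0\<^sub>m m2 k"
proof -
  define W where "W = mat_inv U"
  define R where "R = L * W"
  note I = mat_inv_props[OF U det, folded W_def]
  note [simp] = carrier_matD[OF U] carrier_matD[OF L] carrier_matD[OF D1] carrier_matD[OF D2] carrier_matD[OF I(1)]
  have [simp]: "dim_row R = m2" "dim_col R = m1" by (simp_all add: R_def)
  have WU: "adj W * adj U = 1\<^sub>m m1"
  proof -
    have "adj W * adj U = adj (U * W)" by (simp add: adj_mult)
    then show ?thesis unfolding I(2) by (simp add: adj_one)
  qed
  have D1R: "adj R * D2 = D1"
  proof -
    have "adj R * D2 = adj W * (adj L * D2)" by (simp add: R_def mat_simps)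
    also have "\<dots> = (adj W * adj U) * D1" unfolding orth[symmetric] by (simp add: mat_simps)
    finally show ?thesis unfolding WU by (simp add: one_mult_dim)
  qed
  have RW: "adj R * R + adj W * W = 1\<^sub>m m1"
  proof -
    have "adj W * W = adj W * ((adj U * U - adj L * L) * W)" unfolding iso by (simp add: one_mult_dim)
    also have "\<dots> = (adj W * adj U) * (U * W) - adj R * R" by (simp add: R_def mat_simps)
    finally have "adj W * W = 1\<^sub>m m1 - adj R * R" unfolding WU I(2) by (simp add: one_mult_dim)
    then show ?thesis by (simp only:) (rule eq_matI, auto)
  qed
  \<comment> \<open>\<open>|R D1 - D2|^2 + |W D1|^2\<close> equals \<open>|D2|^2 - |D1|^2\<close>,
    because \<open>adj R * R + adj W * W = 1\<close> and \<open>D1 = adj R * D2\<close>.\<close>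
  define Z1 where "Z1 = R * D1 - D2"
  define Z2 where "Z2 = W * D1"
  have [simp]: "dim_row Z1 = m2" "dim_col Z1 = k" "dim_row Z2 = m1" "dim_col Z2 = k" by (simp_all add: Z1_def Z2_def)
  have aD: "adj D2 * R = adj D1" unfolding D1R[symmetric] by (simp add: adj_mult adj_adj)
  have "adj Z1 * Z1 + adj Z2 * Z2 = adj D1 * ((adj R * R + adj W * W) * D1) - adj D1 * (adj R * D2) - (adj D2 * R) * D1 + adj D2 * D2"
    unfolding Z1_def Z2_def by (simp add: mat_simps, rule eq_matI, auto)
  also have "\<dots> = 0\<^sub>m k k" unfolding RW D1R aD null by (simp add: one_mult_dim null, rule eq_matI, auto)
  finally have "adj Z1 * Z1 + adj Z2 * Z2 = 0\<^sub>m (dim_col Z1) (dim_col Z1)" by simp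
  from adj_self_sum_zero[OF _ this] have Z1: "Z1 = 0\<^sub>m m2 k" and Z2: "Z2 = 0\<^sub>m m1 k" by simp_all
  have "D1 = U * (W * D1)" using I(2) by (simp add: mult_assoc_dim[symmetric] one_mult_dim)
  then show D10: "D1 = 0\<^sub>m m1 k" using Z2 unfolding Z2_def by (simp add: mult_zero_dim)
  have "D2 = R * D1 - Z1" unfolding Z1_def by (rule eq_matI) auto
  then show "D2 = 0\<^sub>m m2 k" unfolding Z1 D10 by (simp add: mult_zero_dim)
qed

context pe_data begin

text \<open>The determinant of \<open>P\<close> is entire and nonzero at 0, where \<open>P\<close>
  is \<open>S0\<close>, so its zeros are isolated.\<close>

lemma det_P_real_isolated: "\<exists>b>a. \<forall>x. a < x \<longrightarrow> x < b \<longrightarrow> Determinant.det (P (of_real x)) \<noteq> 0"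
proof -
  obtain r where r: "0 < r" "\<And>z. z \<in> ball (complex_of_real a) r - {of_real a} \<Longrightarrow> Determinant.det (P z) \<noteq> 0"
  proof (cases "Determinant.det (P (of_real a)) = 0")
    case True
    show thesis
      by (rule isolated_zeros[OF det_P_holomorphic open_UNIV connected_UNIV UNIV_I True UNIV_I regular_at_0])
         (use that in blast)
  next
    case False
    have "open {z. Determinant.det (P z) \<noteq> 0}"
      by (intro open_Collect_neq holomorphic_on_imp_continuous_on det_P_holomorphic continuous_on_const)
    then obtain r where "0 < r" "ball (of_real a) r \<subseteq> {z. Determinant.det (P z) \<noteq> 0}"
      using False by (elim openE[of _ "of_real a"]) auto
    then show thesis using that by blast
  qed
  have "Determinant.det (P (of_real x)) \<noteq> 0" if x: "a < x" "x < a + r" for x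
  proof (rule r(2))
    have "dist (complex_of_real a) (of_real x) = \<bar>a - x\<bar>" unfolding dist_of_real by (simp add: dist_real_def)
    then show "complex_of_real x \<in> ball (of_real a) r - {of_real a}" using x by simp
  qed
  then show ?thesis using r(1) by (intro exI[of _ "a + r"]) simp
qed

lemma dirac_solution_deriv:
  assumes u: "dirac_solution m1 m2 (pe_potential \<alpha> S0 \<gamma>1 \<gamma>) \<xi> k u" and x: "0 \<le> x"
    and d: "Determinant.det (P (of_real x)) \<noteq> 0"
  shows "has_mat_derivative (m1 + m2) k u
    ((\<i> \<cdot>\<^sub>m (of_real \<xi> \<cdot>\<^sub>m j_mat m1 m2 + j_mat m1 m2 * V_mat m1 m2 (pot x))) * u (of_real x)) (of_real x)"
proof -
  have uc: "u z \<in> carrier_mat (m1 + m2) k" for z using u by (simp add: dirac_solution_def)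
  have "pe_potential \<alpha> S0 \<gamma>1 \<gamma> x = Some (pot x)" using x d by (simp add: pe_potential_eq)
  then show ?thesis
    unfolding has_mat_derivative_def using u x dirac_rhs_blocks(1)[OF pot_carrier[of x] uc, of "of_real \<xi>" "of_real x"]
    by (simp add: dirac_solution_def)
qed

lemma normalized_limit:
  assumes Y: "normalized_solution m1 m2 v \<xi> Y" and il: "i < m1 + m2" "l < m1"
  shows "((\<lambda>x. cnj (exp (\<i> * of_real (x * \<xi>))) * Y (of_real x) $$ (i, l)) \<longlongrightarrow> (if i = l then 1 else 0)) at_top"
proof -
  let ?e = "\<lambda>x. exp (\<i> * complex_of_real (x * \<xi>))"
  have [simp]: "dim_row (1\<^sub>m m1 @\<^sub>r 0\<^sub>m m2 m1 :: complex mat) = m1 + m2" "dim_col (1\<^sub>m m1 @\<^sub>r 0\<^sub>m m2 m1 :: complex mat) = m1"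
    by (simp_all add: append_rows_def)
  have ne: "cmod (?e x) = 1" for x by simp
  have ee1: "?e x * cnj (?e x) = 1" for x unfolding complex_norm_square[symmetric] ne by simp
  have ee: "cnj (?e x) * (?e x * c) = c" for x c
  proof -
    have "cnj (?e x) * (?e x * c) = (?e x * cnj (?e x)) * c" by (simp only: mult_ac)
    then show ?thesis unfolding ee1 by simp
  qed
  have "((\<lambda>x. (Y (of_real x) - ?e x \<cdot>\<^sub>m (1\<^sub>m m1 @\<^sub>r 0\<^sub>m m2 m1)) $$ (i, l)) \<longlongrightarrow> 0) at_top"
    using Y il unfolding normalized_solution_def by blast
  then have "((\<lambda>x. cmod (Y (of_real x) $$ (i, l) - ?e x * (if i = l then 1 else 0))) \<longlongrightarrow> 0) at_top"
    using il append_rows_entry[OF il] by (intro tendsto_norm_zero) simp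
  then have "((\<lambda>x. cmod (cnj (?e x) * (Y (of_real x) $$ (i, l) - ?e x * (if i = l then 1 else 0)))) \<longlongrightarrow> 0) at_top"
    unfolding norm_mult complex_mod_cnj ne by simp
  then have "((\<lambda>x. cnj (?e x) * (Y (of_real x) $$ (i, l) - ?e x * (if i = l then 1 else 0))) \<longlongrightarrow> 0) at_top"
    by (rule tendsto_norm_zero_cancel)
  then have "((\<lambda>x. cnj (?e x) * Y (of_real x) $$ (i, l) - (if i = l then 1 else 0)) \<longlongrightarrow> 0) at_top"
    unfolding right_diff_distrib ee .
  then show ?thesis by (rule LIM_zero_cancel)
qed

text \<open>The form \<open>Y\<^sup>* j Y'\<close> continues to a function with isolated singularities at the real points, so
  it is constant across the singular points of the potential as well.\<close>

lemma normalized_j_form: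
  assumes Y: "normalized_solution m1 m2 (pe_potential \<alpha> S0 \<gamma>1 \<gamma>) \<xi> Y"
    and Y': "normalized_solution m1 m2 (pe_potential \<alpha> S0 \<gamma>1 \<gamma>) \<xi> Y'"
  shows "adj (Y 0) * (j_mat m1 m2 * Y' 0) = 1\<^sub>m m1"
proof (rule eq_matI)
  have s: "dirac_solution m1 m2 (pe_potential \<alpha> S0 \<gamma>1 \<gamma>) \<xi> m1 Y" "dirac_solution m1 m2 (pe_potential \<alpha> S0 \<gamma>1 \<gamma>) \<xi> m1 Y'"
    using Y Y' unfolding normalized_solution_def by blast+
  have c: "Y z \<in> carrier_mat (m1 + m2) m1" "Y' z \<in> carrier_mat (m1 + m2) m1" for z using s by (simp_all add: dirac_solution_def)
  note [simp] = carrier_matD[OF c(1)] carrier_matD[OF c(2)]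
  have jc: "j_mat m1 m2 \<in> carrier_mat (m1 + m2) (m1 + m2)" by (simp add: carrier_iff)
  fix l l' assume "l < dim_row (1\<^sub>m m1 :: complex mat)" "l' < dim_col (1\<^sub>m m1 :: complex mat)"
  then have l: "l < m1" "l' < m1" by auto
  \<comment> \<open>On the real axis \<open>f\<close> is an entry of the j-form; the conjugated
    argument turns the adjoint factor into a function with isolated singularities as well.\<close>
  define f where "f = (\<lambda>z. (adj (Y (cnj z)) * (j_mat m1 m2 * Y' z)) $$ (l, l'))"
  have f_sum: "f z = (\<Sum>i<m1 + m2. cnj (Y (cnj z) $$ (i, l)) * ((if i < m1 then 1 else - 1) * Y' z $$ (i, l')))" for z
  proof -
    have "f z = (\<Sum>i<m1 + m2. cnj (Y (cnj z) $$ (i, l)) * (j_mat m1 m2 * Y' z) $$ (i, l'))"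
      unfolding f_def using l by (simp add: index_mult_sum[of _ "adj _"])
    also have "\<dots> = (\<Sum>i<m1 + m2. cnj (Y (cnj z) $$ (i, l)) * ((if i < m1 then 1 else - 1) * Y' z $$ (i, l')))"
      by (intro sum.cong refl) (use l j_mat_mult[OF c(2)] in simp)
    finally show ?thesis .
  qed
  have iso: "isolated_singularity_at f (of_real a)" if a: "0 \<le> a" for a
  proof -
    have a': "complex_of_real a \<in> of_real ` {0..}" using a by simp
    have i1: "isolated_singularity_at (\<lambda>z. Y z $$ (i, l)) (of_real a)" "isolated_singularity_at (\<lambda>z. Y' z $$ (i, l')) (of_real a)"
      if "i < m1 + m2" for i
    proof -
      have "(\<lambda>z. Y z $$ (i, l)) meromorphic_on of_real ` {0..}" "(\<lambda>z. Y' z $$ (i, l')) meromorphic_on of_real ` {0..}"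
        using s that l by (simp_all add: dirac_solution_def)
      then show "isolated_singularity_at (\<lambda>z. Y z $$ (i, l)) (of_real a)" "isolated_singularity_at (\<lambda>z. Y' z $$ (i, l')) (of_real a)"
        using a' by (auto intro!: meromorphic_on_isolated_singularity elim!: meromorphic_on_subset)
    qed
    show ?thesis unfolding f_sum[abs_def]
    proof (rule isolated_singularity_sum)
      fix i assume "i \<in> {..<m1 + m2}"
      then have i: "i < m1 + m2" by simp
      show "isolated_singularity_at (\<lambda>z. cnj (Y (cnj z) $$ (i, l)) * ((if i < m1 then 1 else - 1) * Y' z $$ (i, l'))) (of_real a)"
      proof (intro isolated_singularity_at_times isolated_singularity_at_const i1(2)[OF i])
        show "isolated_singularity_at (\<lambda>z. cnj (Y (cnj z) $$ (i, l))) (of_real a)"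
          by (rule isolated_singularity_cnj_cnj[where f = "\<lambda>z. Y z $$ (i, l)"]) (use i1(1)[OF i] in simp)
      qed
    qed simp
  qed
  have der: "(f has_field_derivative 0) (at (of_real x))" if x: "0 \<le> x" and d: "Determinant.det (P (of_real x)) \<noteq> 0" for x
  proof -
    have cx: "cnj (complex_of_real x) = of_real x" by simp
    note d1 = dirac_solution_deriv[OF s(1) x d] and d2 = dirac_solution_deriv[OF s(2) x d]
    have d1': "has_mat_derivative m1 (m1 + m2) (\<lambda>z. adj (Y (cnj z)))
      (adj ((\<i> \<cdot>\<^sub>m (of_real \<xi> \<cdot>\<^sub>m j_mat m1 m2 + j_mat m1 m2 * V_mat m1 m2 (pot x))) * Y (of_real x))) (of_real x)"
      by (rule has_mat_derivative_adj_cnj) (simp only: cx d1)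
    have "has_mat_derivative m1 m1 (\<lambda>z. adj (Y (cnj z)) * (j_mat m1 m2 * Y' z)) (0\<^sub>m m1 m1) (of_real x)"
    proof (rule has_mat_derivative_eq[OF has_mat_derivative_mult[OF d1' has_mat_derivative_mult[OF has_mat_derivative_const[OF jc] d2]]])
      let ?N = "\<i> \<cdot>\<^sub>m (of_real \<xi> \<cdot>\<^sub>m j_mat m1 m2 + j_mat m1 m2 * V_mat m1 m2 (pot x))"
      have "0\<^sub>m (m1 + m2) (m1 + m2) * Y' (of_real x) + j_mat m1 m2 * (?N * Y' (of_real x)) = j_mat m1 m2 * (?N * Y' (of_real x))"
        by (simp add: zero_mult_dim) (rule eq_matI, auto simp: V_mat_def)
      then show "adj (?N * Y (of_real x)) * (j_mat m1 m2 * Y' (of_real x)) +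
        adj (Y (cnj (of_real x))) * (0\<^sub>m (m1 + m2) (m1 + m2) * Y' (of_real x) + j_mat m1 m2 * (?N * Y' (of_real x))) = 0\<^sub>m m1 m1"
        using dirac_form_derivative_zero[OF pot_carrier[of x] c, of "of_real \<xi>" "of_real x" "of_real x"] by simp
    qed
    from has_mat_derivativeD(3)[OF this l] show ?thesis using l by (simp add: f_def)
  qed
  have const: "f (of_real x) = f (of_real 0)" if x: "0 \<le> x" and d: "Determinant.det (P (of_real x)) \<noteq> 0" for x
  proof (rule real_axis_constant[OF iso _ x _ order_refl])
    show "isCont f (of_real x)" by (rule DERIV_isCont[OF der[OF x d]])
    show "isCont f (of_real 0)" by (rule DERIV_isCont[OF der]) (use regular_at_0 in auto)
    show "\<exists>b>a. \<forall>x. a < x \<longrightarrow> x < b \<longrightarrow> (f has_field_derivative 0) (at (of_real x))" if a: "0 \<le> a" for a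
    proof -
      obtain b where b: "a < b" "\<forall>x. a < x \<longrightarrow> x < b \<longrightarrow> Determinant.det (P (of_real x)) \<noteq> 0" using det_P_real_isolated by blast
      show ?thesis
      proof (rule exI[of _ b], intro conjI allI impI b(1))
        fix x assume "a < x" "x < b"
        then show "(f has_field_derivative 0) (at (of_real x))" using a b(2) by (intro der) auto
      qed
    qed
  qed
  have "eventually (\<lambda>x. f (of_real x) = f (of_real 0)) at_top"
    using P_eventually_nonsingular eventually_ge_at_top[of 0] by eventually_elim (use const in blast)
  then have lim0: "((\<lambda>x. f (of_real x)) \<longlongrightarrow> f (of_real 0)) at_top" by (rule tendsto_eventually)
  let ?e = "\<lambda>x. exp (\<i> * complex_of_real (x * \<xi>))"
  \<comment> \<open>The unimodular factor of one solution cancels against the conjugate factor of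
    the other, so the form tends to its value on the normalized columns.\<close>
  have f_lim: "f (of_real x) = (\<Sum>i<m1 + m2. cnj (cnj (?e x) * Y (of_real x) $$ (i, l)) * ((if i < m1 then 1 else - 1) * (cnj (?e x) * Y' (of_real x) $$ (i, l'))))" for x
  proof -
    have ne: "cmod (?e x) = 1" by simp
    have e1: "?e x * cnj (?e x) = 1" unfolding complex_norm_square[symmetric] ne by simp
    have "cnj (cnj (?e x) * a) * (s * (cnj (?e x) * b)) = cnj a * (s * b)" for a b s :: complex
    proof -
      have "cnj (cnj (?e x) * a) * (s * (cnj (?e x) * b)) = (?e x * cnj (?e x)) * (cnj a * (s * b))"
        by (simp only: complex_cnj_mult complex_cnj_cnj mult_ac)
      then show ?thesis unfolding e1 by simp
    qed
    then show ?thesis unfolding f_sum by (simp only: complex_cnj_complex_of_real)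
  qed
  have "((\<lambda>x. f (of_real x)) \<longlongrightarrow> (\<Sum>i<m1 + m2. cnj (if i = l then 1 else 0) * ((if i < m1 then 1 else - 1) * (if i = l' then 1 else 0)))) at_top"
    unfolding f_lim by (intro tendsto_intros normalized_limit[OF Y] normalized_limit[OF Y'] l) auto
  then have "f (of_real 0) = (\<Sum>i<m1 + m2. cnj (if i = l then 1 else 0) * ((if i < m1 then 1 else - 1) * (if i = l' then 1 else 0)))"
    by (rule tendsto_unique[OF trivial_limit_at_top_linorder lim0])
  also have "\<dots> = (\<Sum>i<m1 + m2. if i = l then (if l = l' then 1 else 0) else 0)" using l by (intro sum.cong) auto
  also have "\<dots> = (if l = l' then 1 else 0)" using l by simp
  finally show "(adj (Y 0) * (j_mat m1 m2 * Y' 0)) $$ (l, l') = 1\<^sub>m m1 $$ (l, l')" using l by (simp add: f_def)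
next
  have c: "Y 0 \<in> carrier_mat (m1 + m2) m1" "Y' 0 \<in> carrier_mat (m1 + m2) m1"
    using Y Y' by (simp_all add: dirac_solution_def normalized_solution_def)
  show "dim_row (adj (Y 0) * (j_mat m1 m2 * Y' 0)) = dim_row (1\<^sub>m m1 :: complex mat)"
    "dim_col (adj (Y 0) * (j_mat m1 m2 * Y' 0)) = dim_col (1\<^sub>m m1 :: complex mat)"
    using carrier_matD[OF c(1)] carrier_matD[OF c(2)] by auto
qed

end

context pe_resolvent begin

lemma UL_norm:
  assumes d: "Determinant.det (P (of_real x)) \<noteq> 0" and w: "w \<in> carrier_mat m1 1"
  shows "nrm2 (U (of_real x) * w) = nrm2 w + nrm2 (L (of_real x) * w)"
proof -
  note [simp] = carrier_matD[OF w]
  let ?U = "U (complex_of_real x)" and ?L = "L (complex_of_real x)"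
  have "adj (?U * w) * (?U * w) - adj (?L * w) * (?L * w) = adj w * ((adj ?U * ?U - adj ?L * ?L) * w)"
    by (simp add: mat_simps)
  also have "\<dots> = adj w * w" unfolding UL_ident[OF d] by (simp add: one_mult_dim)
  finally have "(adj (?U * w) * (?U * w)) $$ (0, 0) - (adj (?L * w) * (?L * w)) $$ (0, 0) = (adj w * w) $$ (0, 0)"
    by (auto dest: arg_cong[where f = "\<lambda>M. M $$ (0, 0)"])
  then have "of_real (nrm2 (?U * w) - nrm2 (?L * w)) = (of_real (nrm2 w) :: complex)"
    by (simp add: adj_self_nrm2)
  then have "nrm2 (?U * w) - nrm2 (?L * w) = nrm2 w" by (simp only: of_real_eq_iff)
  then show ?thesis by simp
qed

text \<open>By \<open>UL_norm\<close> the matrix \<open>U 0\<close> does not decrease norms, so it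
  is injective.\<close>

lemma U0_det: "Determinant.det (U 0) \<noteq> 0"
proof -
  have Uc: "U 0 \<in> carrier_mat m1 m1" by (simp add: carrier_iff)
  show ?thesis unfolding det_nonzero_iff[OF Uc]
  proof (intro ballI impI)
    fix w assume w: "w \<in> carrier_mat m1 (1::nat)" and 0: "U 0 * w = 0\<^sub>m m1 1"
    have "nrm2 (U 0 * w) = nrm2 w + nrm2 (L 0 * w)" using UL_norm[of 0 w] w regular_at_0 by simp
    moreover have "nrm2 (U 0 * w) = 0" using 0 nrm2_zero_iff[of "0\<^sub>m m1 1" m1] by simp
    ultimately have "nrm2 w = 0" using nrm2_nonneg[of w] nrm2_nonneg[of "L 0 * w"] by linarith
    then show "w = 0\<^sub>m m1 1" using nrm2_zero_iff[OF w] by simp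
  qed
qed

lemma sol_0_blocks: "upper_block m1 (sol 0) = U 0" "lower_block m1 m2 (sol 0) = L 0"
  by (simp_all add: sol_blocks smult_one_mat)

text \<open>All four values of the j-form between \<open>Y\<close> and the explicit solution at 0
  equal the identity. The difference is therefore j-null and j-orthogonal to the explicit solution,
  and \<open>j_isometry_complement\<close> makes it 0.\<close>

lemma normalized_at_0:
  assumes Y: "normalized_solution m1 m2 (pe_potential \<alpha> S0 \<gamma>1 \<gamma>) \<xi> Y"
  shows "upper_block m1 (Y 0) = U 0" "lower_block m1 m2 (Y 0) = L 0"
proof -
  have c: "Y 0 \<in> carrier_mat (m1 + m2) m1" using Y by (simp add: normalized_solution_def dirac_solution_def)
  note [simp] = carrier_matD[OF c]
  define a where "a = upper_block m1 (Y 0)"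
  define b where "b = lower_block m1 m2 (Y 0)"
  have [simp]: "dim_row a = m1" "dim_col a = m1" "dim_row b = m2" "dim_col b = m1" by (simp_all add: a_def b_def)
  have 1: "adj (U 0) * U 0 - adj (L 0) * L 0 = 1\<^sub>m m1" using UL_ident[of 0] regular_at_0 by simp
  have 2: "adj (U 0) * a - adj (L 0) * b = 1\<^sub>m m1"
    using normalized_j_form[OF sol_normalized Y] unfolding j_form_blocks[OF sol_carrier c] sol_0_blocks a_def b_def .
  have 3: "adj a * U 0 - adj b * L 0 = 1\<^sub>m m1"
    using normalized_j_form[OF Y sol_normalized] unfolding j_form_blocks[OF c sol_carrier] sol_0_blocks a_def b_def .
  have 4: "adj a * a - adj b * b = 1\<^sub>m m1"
    using normalized_j_form[OF Y Y] unfolding j_form_blocks[OF c c] a_def b_def .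
  define D1 where "D1 = a - U 0"
  define D2 where "D2 = b - L 0"
  have D1: "D1 \<in> carrier_mat m1 m1" and D2: "D2 \<in> carrier_mat m2 m1" by (simp_all add: D1_def D2_def carrier_iff)
  have o: "adj (U 0) * D1 - adj (L 0) * D2 = (adj (U 0) * a - adj (L 0) * b) - (adj (U 0) * U 0 - adj (L 0) * L 0)"
    unfolding D1_def D2_def by (simp add: mat_simps, rule eq_matI, auto)
  have "adj (U 0) * D1 - adj (L 0) * D2 = 0\<^sub>m m1 m1" unfolding o 1 2 by (rule eq_matI) auto
  then have orth: "adj (U 0) * D1 = adj (L 0) * D2"
    using minus_zero_iff[of "adj (U 0) * D1" m1 m1 "adj (L 0) * D2"] carrier_matD[OF D1] carrier_matD[OF D2] by (simp add: carrier_iff)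
  have n: "adj D1 * D1 - adj D2 * D2 = ((adj a * a - adj b * b) - (adj a * U 0 - adj b * L 0))
      - ((adj (U 0) * a - adj (L 0) * b) - (adj (U 0) * U 0 - adj (L 0) * L 0))"
    unfolding D1_def D2_def by (simp add: mat_simps, rule eq_matI, auto)
  have "adj D1 * D1 - adj D2 * D2 = 0\<^sub>m m1 m1" unfolding n 1 2 3 4 by (rule eq_matI) auto
  then have null: "adj D1 * D1 = adj D2 * D2"
    using minus_zero_iff[of "adj D1 * D1" m1 m1 "adj D2 * D2"] carrier_matD[OF D1] carrier_matD[OF D2] by (simp add: carrier_iff)
  have "U 0 \<in> carrier_mat m1 m1" "L 0 \<in> carrier_mat m2 m1" by (simp_all add: carrier_iff)
  note z = j_isometry_complement[OF this U0_det 1 D1 D2 orth null]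
  have "a = U 0 + D1" "b = L 0 + D2" unfolding D1_def D2_def by (rule eq_matI, auto)+
  then show "upper_block m1 (Y 0) = U 0" "lower_block m1 m2 (Y 0) = L 0"
    unfolding z a_def[symmetric] b_def[symmetric] by (auto simp: mat_eq_iff)
qed

end

section \<open>The realization read off from a potential\<close>

context pe_data begin

definition X where "X = mat_inv S0"

lemma X_inv: "S0 * X = 1\<^sub>m n" "X * S0 = 1\<^sub>m n" and X_carrier: "X \<in> carrier_mat n n"
  using mat_inv_props[OF S0 detS0] by (simp_all add: X_def)

lemma X_dims [simp]: "dim_row X = n" "dim_col X = n"
  using carrier_matD[OF X_carrier] by auto

lemma M_0: "M 0 = X"
  using M_eq[OF regular_at_0] by (simp add: P_0 X_def)

lemma X_herm: "adj X = X"
  using M_real_herm[of 0] regular_at_0 by (simp add: M_0)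

text \<open>\<open>A0\<close> and \<open>C0\<close> come from solving the recovery formulas for
  \<open>A\<close> and \<open>C\<close>: \<alpha> is the closed loop of \<open>A0\<close>, and
  \<gamma> equals \<open>- \<i> S0 adj C0\<close>.\<close>

definition A0 where "A0 = \<alpha> - \<i> \<cdot>\<^sub>m (\<gamma>1 * (adj \<gamma>1 * X))"
definition C0 where "C0 = (- \<i>) \<cdot>\<^sub>m (adj \<gamma> * X)"

lemma A0_dims [simp]: "dim_row A0 = n" "dim_col A0 = n" "dim_row C0 = m2" "dim_col C0 = n"
  by (simp_all add: A0_def C0_def)

lemma A0_carrier: "A0 \<in> carrier_mat n n" and C0_carrier: "C0 \<in> carrier_mat m2 n"
  by (simp_all add: carrier_iff)

lemma closed_loop_A0: "closed_loop A0 \<gamma>1 X = \<alpha>"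
  by (rule eq_matI) (auto simp: closed_loop_def A0_def)

lemma X_ident: "X * \<alpha> - adj \<alpha> * X = \<i> \<cdot>\<^sub>m (X * (\<gamma>1 * (adj \<gamma>1 * X)) - X * (\<gamma> * (adj \<gamma> * X)))"
  using M_ident[OF regular_at_0] by (simp add: M_0 h_0 hs_0)

lemma ric_A0: "ric n A0 \<gamma>1 (adj C0 * C0) X"
proof -
  let ?G = "X * (\<gamma>1 * (adj \<gamma>1 * X))" and ?H = "X * (\<gamma> * (adj \<gamma> * X))"
  have "\<i> \<cdot>\<^sub>m (X * A0 - adj A0 * X) = \<i> \<cdot>\<^sub>m (X * \<alpha> - adj \<alpha> * X) + 2 \<cdot>\<^sub>m ?G"
    by (simp add: A0_def mat_simps X_herm, rule eq_matI, auto simp: algebra_simps i_squared)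
  also have "\<dots> = ?H + ?G" unfolding X_ident by (rule eq_matI, auto simp: algebra_simps i_squared)
  also have "\<dots> = adj C0 * C0 + X * (\<gamma>1 * (adj \<gamma>1 * X))" by (simp add: C0_def mat_simps X_herm)
  finally show ?thesis unfolding ric_def using X_carrier X_herm by simp
qed

lemma pbh_A0:
  assumes c: "pbh n \<alpha> \<gamma>1"
  shows "pbh n A0 \<gamma>1"
  unfolding pbh_def
proof (intro ballI allI impI, elim conjE)
  fix w \<mu> assume w: "w \<in> carrier_mat n 1" and a: "adj A0 * w = \<mu> \<cdot>\<^sub>m w" and g: "adj \<gamma>1 * w = 0\<^sub>m (dim_col \<gamma>1) 1"
  note [simp] = carrier_matD[OF w]
  have "adj A0 * w = adj \<alpha> * w + \<i> \<cdot>\<^sub>m (X * (\<gamma>1 * (adj \<gamma>1 * w)))" by (simp add: A0_def mat_simps X_herm, rule eq_matI, auto)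
  also have "\<dots> = adj \<alpha> * w" unfolding g by (simp add: mult_zero_dim, rule eq_matI, auto)
  finally have e: "adj \<alpha> * w = \<mu> \<cdot>\<^sub>m w" using a by simp
  have "adj \<gamma>1 * w = 0\<^sub>m m1 1" using g by simp
  then show "w = 0\<^sub>m n 1" by (rule pbhD[OF c w e \<gamma>1])
qed

text \<open>An eigenvector \<open>w\<close> of \<open>A0\<close> in the kernel of \<open>C0\<close>
  gives an eigenvector \<open>X * w\<close> of \<open>adj \<alpha>\<close> in the kernel of
  \<open>adj \<gamma>\<close>, which controllability excludes.\<close>

lemma obs_A0: "pbh n (adj A0) (adj C0)"
  unfolding pbh_def
proof (intro ballI allI impI, elim conjE)
  fix w \<mu> assume w: "w \<in> carrier_mat n 1" and a: "adj (adj A0) * w = \<mu> \<cdot>\<^sub>m w" and g: "adj (adj C0) * w = 0\<^sub>m (dim_col (adj C0)) 1"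
  note [simp] = carrier_matD[OF w]
  have gw: "adj \<gamma> * (X * w) = 0\<^sub>m m2 1"
  proof -
    have "adj \<gamma> * (X * w) = \<i> \<cdot>\<^sub>m (C0 * w)" by (simp add: C0_def mat_simps)
    also have "C0 * w = 0\<^sub>m m2 1" using g by (simp add: adj_adj)
    finally show ?thesis by simp
  qed
  have aX: "adj \<alpha> * X = X * \<alpha> - \<i> \<cdot>\<^sub>m (X * (\<gamma>1 * (adj \<gamma>1 * X)) - X * (\<gamma> * (adj \<gamma> * X)))"
    unfolding X_ident[symmetric] by (rule eq_matI) auto
  have "adj \<alpha> * (X * w) = (adj \<alpha> * X) * w" by (simp add: mult_assoc_dim)
  also have "\<dots> = X * (A0 * w) + \<i> \<cdot>\<^sub>m (X * (\<gamma> * (adj \<gamma> * (X * w))))"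
    unfolding aX by (simp add: A0_def mat_simps, rule eq_matI, auto)
  also have "\<dots> = X * (A0 * w)" unfolding gw by (simp add: mult_zero_dim, rule eq_matI, auto)
  also have "A0 * w = \<mu> \<cdot>\<^sub>m w" using a by (simp add: adj_adj)
  finally have e: "adj \<alpha> * (X * w) = \<mu> \<cdot>\<^sub>m (X * w)" by (simp add: mult_smult_dim)
  have "X * w \<in> carrier_mat n 1" by (simp add: carrier_iff)
  from pbhD[OF ctrb this e \<gamma> gw] have z: "X * w = 0\<^sub>m n 1" .
  have "w = S0 * (X * w)" by (simp add: mult_assoc_dim[symmetric] X_inv one_mult_dim)
  then show "w = 0\<^sub>m n 1" unfolding z by (simp add: mult_zero_dim)
qed

lemma mat_inv_X: "mat_inv X = S0"
  by (rule mat_inv_unique[OF X_carrier S0 X_inv(2)])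

lemma gamma_eq: "(- \<i>) \<cdot>\<^sub>m (mat_inv X * adj C0) = \<gamma>"
proof -
  have "(- \<i>) \<cdot>\<^sub>m (S0 * adj C0) = (S0 * X) * \<gamma>" by (simp add: C0_def mat_simps X_herm)
  then show ?thesis unfolding mat_inv_X X_inv by (simp add: one_mult_dim)
qed

text \<open>By \<open>normalized_at_0\<close> the quotient is \<open>L 0\<close> times the inverse
  \<open>W\<close> of \<open>U 0\<close>. Multiplication by \<open>W\<close> turns the resolvent of
  \<alpha> into that of \<open>A0\<close>, so the quotient is \<open>C0 * Q\<close> with
  \<open>Q = - K W\<close>. The norm bound holds since \<open>|L w| \<le> |U w|\<close> at
  0.\<close>

lemma reflection_point:
  assumes xi: "complex_of_real \<xi> \<notin> spectrum \<alpha>"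
  shows "\<exists>Q. resolvent_sol n m1 A0 \<gamma>1 (of_real \<xi>) Q \<and>
    (\<exists>Y. normalized_solution m1 m2 (pe_potential \<alpha> S0 \<gamma>1 \<gamma>) \<xi> Y) \<and>
    (\<forall>Y. normalized_solution m1 m2 (pe_potential \<alpha> S0 \<gamma>1 \<gamma>) \<xi> Y \<longrightarrow> Determinant.det (upper_block m1 (Y 0)) \<noteq> 0 \<and>
      lower_block m1 m2 (Y 0) * mat_inv (upper_block m1 (Y 0)) = C0 * Q) \<and>
    (\<forall>u\<in>carrier_mat m1 1. nrm2 ((C0 * Q) * u) \<le> nrm2 u)"
proof -
  define K where "K = - (mat_inv (of_real \<xi> \<cdot>\<^sub>m 1\<^sub>m n - \<alpha>) * \<gamma>1)"
  have r: "resolvent_sol n m1 \<alpha> \<gamma>1 (of_real \<xi>) (- K)"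
    unfolding resolvent_sol_iff[OF \<alpha> \<gamma>1 xi] K_def by (rule eq_matI) auto
  then have Kd [simp]: "dim_row K = n" "dim_col K = m1" by (auto simp: resolvent_sol_def)
  have Kc: "K \<in> carrier_mat n m1" by (simp add: carrier_iff)
  have "\<alpha> * K - of_real \<xi> \<cdot>\<^sub>m K = of_real \<xi> \<cdot>\<^sub>m (- K) - \<alpha> * (- K)"
    by (simp add: mult_uminus_dim, rule eq_matI, auto)
  then have Kr: "\<alpha> * K - of_real \<xi> \<cdot>\<^sub>m K = \<gamma>1" using r by (simp add: resolvent_sol_def)
  interpret pe_resolvent n m1 m2 \<alpha> S0 \<gamma>1 \<gamma> \<xi> K
    by unfold_locales (rule Kc Kr)+
  have Uc: "U 0 \<in> carrier_mat m1 m1" by (simp add: carrier_iff)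
  define W where "W = mat_inv (U 0)"
  note I = mat_inv_props[OF Uc U0_det, folded W_def] note [simp] = carrier_matD[OF I(1)]
  have U0: "U 0 = 1\<^sub>m m1 - \<i> \<cdot>\<^sub>m (adj \<gamma>1 * (X * K))" and L0: "L 0 = \<i> \<cdot>\<^sub>m (adj \<gamma> * (X * K))"
    by (simp_all add: U_def L_def M_0 hs_0)
  define Q where "Q = - (K * W)"
  have Qd [simp]: "dim_row Q = n" "dim_col Q = m1" by (simp_all add: Q_def)
  have "of_real \<xi> \<cdot>\<^sub>m Q - A0 * Q = (\<alpha> * K - of_real \<xi> \<cdot>\<^sub>m K - \<i> \<cdot>\<^sub>m (\<gamma>1 * (adj \<gamma>1 * (X * K)))) * W"
    unfolding Q_def A0_def by (simp add: mat_simps, rule eq_matI, auto)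
  also have "\<dots> = \<gamma>1 * (U 0 * W)" unfolding Kr U0 by (simp add: mat_simps)
  also have "\<dots> = \<gamma>1" unfolding I(2) by (simp add: mult_one_dim)
  finally have rQ: "resolvent_sol n m1 A0 \<gamma>1 (of_real \<xi>) Q" by (simp add: resolvent_sol_def carrier_iff)
  have LW: "L 0 * W = C0 * Q" unfolding L0 Q_def C0_def by (simp add: mat_simps, rule eq_matI, auto)
  have con: "nrm2 ((C0 * Q) * u) \<le> nrm2 u" if u: "u \<in> carrier_mat m1 1" for u
  proof -
    note [simp] = carrier_matD[OF u]
    have Wu: "W * u \<in> carrier_mat m1 1" by (simp add: carrier_iff)
    have "U 0 * (W * u) = u" using I(2) by (simp add: mult_assoc_dim[symmetric] one_mult_dim)
    moreover have "(C0 * Q) * u = L 0 * (W * u)" unfolding LW[symmetric] by (simp add: mult_assoc_dim)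
    ultimately show ?thesis using UL_norm[of 0, OF _ Wu] regular_at_0 by simp
  qed
  have Y: "Determinant.det (upper_block m1 (Y 0)) \<noteq> 0 \<and> lower_block m1 m2 (Y 0) * mat_inv (upper_block m1 (Y 0)) = C0 * Q"
    if "normalized_solution m1 m2 (pe_potential \<alpha> S0 \<gamma>1 \<gamma>) \<xi> Y" for Y
    unfolding normalized_at_0[OF that] W_def[symmetric] using U0_det LW by simp
  show ?thesis
  proof (intro exI[of _ Q] conjI rQ allI impI ballI con)
    show "\<exists>Y. normalized_solution m1 m2 (pe_potential \<alpha> S0 \<gamma>1 \<gamma>) \<xi> Y" using sol_normalized by blast
  qed (use Y in simp_all)
qed

lemma finite_real_spectrum: "finite {\<xi>. complex_of_real \<xi> \<in> spectrum \<alpha>}" "finite {\<xi>. complex_of_real \<xi> \<in> spectrum A0}"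
  using finite_vimageI[OF finite_spectrum[OF \<alpha>] inj_of_real] finite_vimageI[OF finite_spectrum[OF A0_carrier] inj_of_real]
  by (simp_all add: vimage_def)

lemma reflection_realization:
  assumes R: "rational_mat_fun m2 m1 R" and l: "left_reflection_coefficient m1 m2 (pe_potential \<alpha> S0 \<gamma>1 \<gamma>) R"
  shows "realization m1 m2 n A0 \<gamma>1 C0 R"
    and "\<exists>F. finite F \<and> (\<forall>\<xi>. \<xi> \<notin> F \<longrightarrow> (\<forall>u\<in>carrier_mat m1 1. nrm2 (R (of_real \<xi>) * u) \<le> nrm2 u))"
proof -
  obtain F where F: "finite F" "\<forall>\<xi>. \<xi> \<notin> F \<longrightarrow> (\<exists>Y. normalized_solution m1 m2 (pe_potential \<alpha> S0 \<gamma>1 \<gamma>) \<xi> Y) \<and>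
       (\<forall>Y. normalized_solution m1 m2 (pe_potential \<alpha> S0 \<gamma>1 \<gamma>) \<xi> Y \<longrightarrow>
          Determinant.det (upper_block m1 (Y 0)) \<noteq> 0 \<and>
          R (of_real \<xi>) = lower_block m1 m2 (Y 0) * mat_inv (upper_block m1 (Y 0)))"
    using l unfolding left_reflection_coefficient_def by (elim exE conjE)
  define F' where "F' = F \<union> {\<xi>. complex_of_real \<xi> \<in> spectrum \<alpha>}"
  have fin: "finite F'" using F(1) finite_real_spectrum by (simp add: F'_def)
  have pt: "\<exists>Q. resolvent_sol n m1 A0 \<gamma>1 (of_real \<xi>) Q \<and> R (of_real \<xi>) = C0 * Q \<and>
      (\<forall>u\<in>carrier_mat m1 1. nrm2 (R (of_real \<xi>) * u) \<le> nrm2 u)" if x: "\<xi> \<notin> F'" for \<xi>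
  proof -
    have "complex_of_real \<xi> \<notin> spectrum \<alpha>" and xF: "\<xi> \<notin> F" using x by (auto simp: F'_def)
    from reflection_point[OF this(1)] obtain Q where Q0: "resolvent_sol n m1 A0 \<gamma>1 (of_real \<xi>) Q \<and>
      (\<exists>Y. normalized_solution m1 m2 (pe_potential \<alpha> S0 \<gamma>1 \<gamma>) \<xi> Y) \<and>
      (\<forall>Y. normalized_solution m1 m2 (pe_potential \<alpha> S0 \<gamma>1 \<gamma>) \<xi> Y \<longrightarrow> Determinant.det (upper_block m1 (Y 0)) \<noteq> 0 \<and>
        lower_block m1 m2 (Y 0) * mat_inv (upper_block m1 (Y 0)) = C0 * Q) \<and>
      (\<forall>u\<in>carrier_mat m1 1. nrm2 ((C0 * Q) * u) \<le> nrm2 u)" ..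
    note Q = conjunct1[OF Q0] conjunct1[OF conjunct2[OF Q0]] conjunct1[OF conjunct2[OF conjunct2[OF Q0]]]
      conjunct2[OF conjunct2[OF conjunct2[OF Q0]]]
    obtain Y where Y: "normalized_solution m1 m2 (pe_potential \<alpha> S0 \<gamma>1 \<gamma>) \<xi> Y" using Q(2) ..
    have "lower_block m1 m2 (Y 0) * mat_inv (upper_block m1 (Y 0)) = C0 * Q" using Q(3) Y by (elim allE impE conjE)
    moreover have "R (of_real \<xi>) = lower_block m1 m2 (Y 0) * mat_inv (upper_block m1 (Y 0))"
      using conjunct2[OF mp[OF HOL.spec[OF F(2)] xF], rule_format, OF Y] by (elim conjE)
    ultimately have RQ: "R (of_real \<xi>) = C0 * Q" by (rule trans[rotated])
    have Q4: "\<forall>u\<in>carrier_mat m1 1. nrm2 (R (of_real \<xi>) * u) \<le> nrm2 u" unfolding RQ by (rule Q(4))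
    show ?thesis by (rule exI[of _ Q], rule conjI, rule Q(1), rule conjI, rule RQ, rule Q4)
  qed
  show "realization m1 m2 n A0 \<gamma>1 C0 R"
  proof (rule realization_rational[OF R A0_carrier \<gamma>1 C0_carrier, of "of_real ` (- F')"])
    have "infinite (- F')" using fin infinite_UNIV_char_0[where 'a = real] finite_Un[of F' "- F'"] by (simp only: Compl_partition simp_thms not_False_eq_True)
    moreover have "inj_on complex_of_real (- F')" by (simp add: inj_on_def)
    ultimately show "infinite (complex_of_real ` (- F'))" by (simp only: finite_image_iff not_False_eq_True)
    fix z assume "z \<in> complex_of_real ` (- F')"
    then obtain \<xi> where z: "\<xi> \<notin> F'" "z = of_real \<xi>" by auto
    from pt[OF z(1)] obtain Q where "resolvent_sol n m1 A0 \<gamma>1 (of_real \<xi>) Q" "R (of_real \<xi>) = C0 * Q" by (elim exE conjE)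
    then show "\<exists>Y. resolvent_sol n m1 A0 \<gamma>1 z Y \<and> R z = C0 * Y" unfolding z(2) by (intro exI[where x = Q] conjI)
  qed
  show "\<exists>F. finite F \<and> (\<forall>\<xi>. \<xi> \<notin> F \<longrightarrow> (\<forall>u\<in>carrier_mat m1 1. nrm2 (R (of_real \<xi>) * u) \<le> nrm2 u))"
  proof (intro exI[of _ F'] conjI fin allI impI)
    fix \<xi> assume "\<xi> \<notin> F'"
    from pt[OF this] show "\<forall>u\<in>carrier_mat m1 1. nrm2 (R (of_real \<xi>) * u) \<le> nrm2 u" by (elim exE conjE)
  qed
qed

lemma realization_reflection:
  assumes r: "realization m1 m2 n A0 \<gamma>1 C0 R"
  shows "left_reflection_coefficient m1 m2 (pe_potential \<alpha> S0 \<gamma>1 \<gamma>) R"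
  unfolding left_reflection_coefficient_def
proof (intro exI[of _ "{\<xi>. complex_of_real \<xi> \<in> spectrum \<alpha>} \<union> {\<xi>. complex_of_real \<xi> \<in> spectrum A0}"] conjI allI impI)
  show "finite ({\<xi>. complex_of_real \<xi> \<in> spectrum \<alpha>} \<union> {\<xi>. complex_of_real \<xi> \<in> spectrum A0})"
    using finite_real_spectrum by simp
next
  fix \<xi> assume x: "\<xi> \<notin> {\<xi>. complex_of_real \<xi> \<in> spectrum \<alpha>} \<union> {\<xi>. complex_of_real \<xi> \<in> spectrum A0}"
  then have x1: "complex_of_real \<xi> \<notin> spectrum \<alpha>" and x2: "complex_of_real \<xi> \<notin> spectrum A0" by auto
  from reflection_point[OF x1] obtain Q where Q0: "resolvent_sol n m1 A0 \<gamma>1 (of_real \<xi>) Q \<and>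
      (\<exists>Y. normalized_solution m1 m2 (pe_potential \<alpha> S0 \<gamma>1 \<gamma>) \<xi> Y) \<and>
      (\<forall>Y. normalized_solution m1 m2 (pe_potential \<alpha> S0 \<gamma>1 \<gamma>) \<xi> Y \<longrightarrow> Determinant.det (upper_block m1 (Y 0)) \<noteq> 0 \<and>
        lower_block m1 m2 (Y 0) * mat_inv (upper_block m1 (Y 0)) = C0 * Q) \<and>
      (\<forall>u\<in>carrier_mat m1 1. nrm2 ((C0 * Q) * u) \<le> nrm2 u)" ..
    note Q = conjunct1[OF Q0] conjunct1[OF conjunct2[OF Q0]] conjunct1[OF conjunct2[OF conjunct2[OF Q0]]]
      conjunct2[OF conjunct2[OF conjunct2[OF Q0]]]
  show "\<exists>Y. normalized_solution m1 m2 (pe_potential \<alpha> S0 \<gamma>1 \<gamma>) \<xi> Y" by (rule Q(2))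
  from realization_sol[OF r x2] obtain Q' where Q': "resolvent_sol n m1 A0 \<gamma>1 (of_real \<xi>) Q'" "R (of_real \<xi>) = C0 * Q'"
    by (elim exE conjE)
  have "Q' = Q" using Q(1) Q'(1) unfolding resolvent_sol_iff[OF A0_carrier \<gamma>1 x2] by simp
  then have RQ: "R (of_real \<xi>) = C0 * Q" using Q'(2) by simp
  fix Y assume Y: "normalized_solution m1 m2 (pe_potential \<alpha> S0 \<gamma>1 \<gamma>) \<xi> Y"
  have e: "Determinant.det (upper_block m1 (Y 0)) \<noteq> 0 \<and> lower_block m1 m2 (Y 0) * mat_inv (upper_block m1 (Y 0)) = C0 * Q"
    using Q(3) Y by (elim allE impE)
  show "Determinant.det (upper_block m1 (Y 0)) \<noteq> 0" by (rule conjunct1[OF e])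
  show "R (of_real \<xi>) = lower_block m1 m2 (Y 0) * mat_inv (upper_block m1 (Y 0))"
    unfolding RQ by (rule sym[OF conjunct2[OF e]])
qed

end

lemma admissible_pe_data:
  assumes a: "admissible m1 m2 n \<alpha> S0 \<gamma>1 \<gamma>" and d: "Determinant.det S0 \<noteq> 0"
  shows "pe_data n m1 m2 \<alpha> S0 \<gamma>1 \<gamma>" and "pbh n \<alpha> \<gamma>1"
proof -
  have c: "\<alpha> \<in> carrier_mat n n" "S0 \<in> carrier_mat n n" "\<gamma>1 \<in> carrier_mat n m1" "\<gamma> \<in> carrier_mat n m2"
    using a by (auto simp: admissible_def)
  show "pbh n \<alpha> \<gamma>1" using a controllable_iff_pbh[OF c(1,3)] by (simp add: admissible_def)
  have "pbh n \<alpha> \<gamma>" using a controllable_iff_pbh[OF c(1,4)] by (simp add: admissible_def)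
  then show "pe_data n m1 m2 \<alpha> S0 \<gamma>1 \<gamma>"
    using a d c by unfold_locales
      (auto simp: admissible_def hermitian_mat_def spectrum_in_closed_lower_half_plane_def)
qed

section \<open>Independence of the realization\<close>

text \<open>\<open>h\<close> and \<open>P\<close> are transformed into \<open>T h\<close> and
  \<open>T P adj T\<close>, the latter because \<open>P\<close> is determined by its derivative and
  initial value; the factors \<open>T\<close> cancel in
  \<open>adj \<gamma>1 * P^-1 * h\<close>.\<close>

lemma pe_potential_similar:
  assumes p: "pe_data n m1 m2 \<alpha> S0 \<gamma>1 \<gamma>" and q: "pe_data n m1 m2 \<alpha>' S0' \<gamma>1' \<gamma>'"
    and T: "T \<in> carrier_mat n n" and dT: "Determinant.det T \<noteq> 0" and Ta: "T * \<alpha> = \<alpha>' * T"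
    and S: "S0' = T * S0 * adj T" and g1: "\<gamma>1' = T * \<gamma>1" and g: "\<gamma>' = T * \<gamma>"
  shows "pe_potential \<alpha>' S0' \<gamma>1' \<gamma>' = pe_potential \<alpha> S0 \<gamma>1 \<gamma>"
proof
  fix x
  interpret p: pe_data n m1 m2 \<alpha> S0 \<gamma>1 \<gamma> by (rule p)
  interpret q: pe_data n m1 m2 \<alpha>' S0' \<gamma>1' \<gamma>' by (rule q)
  note I = mat_inv_props[OF T dT]
  note [simp] = carrier_matD[OF T] carrier_matD[OF I(1)]
  have h: "q.h z = T * p.h z" for z
  proof -
    have "q.h z = q.E z * \<gamma>'" by (rule q.h_def)
    also have "\<dots> = (q.E z * T) * \<gamma>" unfolding g by (simp add: mult_assoc_dim)
    also have "q.E z * T = T * p.E z" unfolding q.E_def p.E_def by (rule mat_exp_intertwine[OF p.\<alpha> q.\<alpha> T Ta, symmetric])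
    finally show ?thesis unfolding p.h_def by (simp add: mult_assoc_dim)
  qed
  have hs: "q.hs z = p.hs z * adj T" for z
    unfolding q.adj_h[symmetric] h by (simp add: adj_mult p.adj_h)
  have aT: "adj T \<in> carrier_mat n n" using T by simp
  have P: "T * p.P z * adj T = q.P z" for z
  proof (rule q.P_unique)
    show "has_mat_derivative n n (\<lambda>z. T * p.P z * adj T) (2 \<cdot>\<^sub>m (q.h z * q.hs z)) z" for z
      by (rule has_mat_derivative_eq[OF has_mat_derivative_mult[OF has_mat_derivative_mult[OF
            has_mat_derivative_const[OF T] p.P_deriv] has_mat_derivative_const[OF aT]]])
         (simp add: h hs mat_simps, rule eq_matI, auto)
    show "T * p.P 0 * adj T = S0'" unfolding p.P_0 S ..
  qed
  have TI: "mat_inv T * (T * Z) = Z" if "dim_row Z = n" for Z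
    using that I(3) by (simp add: mult_assoc_dim[symmetric] one_mult_dim)
  have aTI: "adj T * adj (mat_inv T) = 1\<^sub>m n" using arg_cong[OF I(3), of adj] by (simp add: adj_mult adj_one)
  have det: "Determinant.det (q.P z) \<noteq> 0 \<longleftrightarrow> Determinant.det (p.P z) \<noteq> 0" for z
  proof -
    have "T * p.P z \<in> carrier_mat n n" by (simp add: carrier_iff)
    then have "Determinant.det (q.P z) = Determinant.det T * Determinant.det (p.P z) * Determinant.det (adj T)"
      unfolding P[symmetric] using det_mult[OF _ aT] det_mult[OF T p.P_carrier] by simp
    moreover have "Determinant.det (adj T) \<noteq> 0"
      by (rule det_nonzero_of_inverse(1)[OF aT _ aTI]) (use I in simp)
    ultimately show ?thesis using dT by simp
  qed
  have pot: "q.pot x = p.pot x" if d: "Determinant.det (p.P (of_real x)) \<noteq> 0"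
  proof -
    note J = mat_inv_props[OF p.P_carrier d] note [simp] = carrier_matD[OF J(1)]
    let ?J = "mat_inv (p.P (of_real x))"
    have inv: "mat_inv (q.P (of_real x)) = adj (mat_inv T) * (?J * mat_inv T)"
    proof (rule mat_inv_unique[OF q.P_carrier])
      have "q.P (of_real x) * (adj (mat_inv T) * (?J * mat_inv T)) = T * (p.P (of_real x) * ((adj T * adj (mat_inv T)) * (?J * mat_inv T)))"
        unfolding P[symmetric] by (simp add: mat_simps)
      also have "\<dots> = T * ((p.P (of_real x) * ?J) * mat_inv T)" unfolding aTI by (simp add: mat_simps)
      also have "\<dots> = 1\<^sub>m n" unfolding J(2) by (simp add: one_mult_dim I(2))
      finally show "q.P (of_real x) * (adj (mat_inv T) * (?J * mat_inv T)) = 1\<^sub>m n" .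
    qed (simp add: carrier_iff)
    have "adj \<gamma>1' * (mat_inv (q.P (of_real x)) * q.h (of_real x)) =
      adj \<gamma>1 * ((adj T * adj (mat_inv T)) * (?J * (mat_inv T * (T * p.h (of_real x)))))"
      unfolding inv h g1 by (simp add: mat_simps)
    also have "\<dots> = adj \<gamma>1 * (?J * p.h (of_real x))" unfolding aTI by (simp add: TI one_mult_dim)
    finally show ?thesis by (simp add: q.pot_def p.pot_def)
  qed
  show "pe_potential \<alpha>' S0' \<gamma>1' \<gamma>' x = pe_potential \<alpha> S0 \<gamma>1 \<gamma> x"
    unfolding q.pe_potential_eq p.pe_potential_eq det using pot by simp
qed

text \<open>A Riccati solution is a form on the state space, so it is pulled back by congruence. The
  closed loops become similar, which transports the spectral condition.\<close>

lemma riccati_similarity: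
  assumes A: "A \<in> carrier_mat n n" and B: "B \<in> carrier_mat n m" and C: "C \<in> carrier_mat p n"
    and A': "A' \<in> carrier_mat n n" and B': "B' \<in> carrier_mat n m" and C': "C' \<in> carrier_mat p n"
    and T: "T \<in> carrier_mat n n" and dT: "Determinant.det T \<noteq> 0"
    and TA: "T * A = A' * T" and TB: "T * B = B'" and CT: "C' * T = C"
    and r: "riccati_solution n A' B' C' X'"
  defines "X \<equiv> adj T * (X' * T)"
  shows "riccati_solution n A B C X" and "T * closed_loop A B X = closed_loop A' B' X' * T"
proof -
  have r': "ric n A' B' (adj C' * C') X'" and sp: "\<forall>\<mu>\<in>spectrum (closed_loop A' B' X'). Im \<mu> \<le> 0"
    using r riccati_solution_iff[OF A' B' C'] by auto
  have X': "X' \<in> carrier_mat n n" and h: "adj X' = X'"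
    and eq: "\<i> \<cdot>\<^sub>m (X' * A' - adj A' * X') = adj C' * C' + X' * (B' * (adj B' * X'))" using r' by (auto simp: ric_def)
  note [simp] = carrier_matD[OF A] carrier_matD[OF B] carrier_matD[OF C] carrier_matD[OF A'] carrier_matD[OF B']
    carrier_matD[OF C'] carrier_matD[OF T] carrier_matD[OF X']
  have Xd [simp]: "dim_row X = n" "dim_col X = n" by (simp_all add: X_def)
  have aTB: "adj B' = adj B * adj T" unfolding TB[symmetric] by (simp add: adj_mult)
  have XA: "X * A = adj T * ((X' * A') * T)" unfolding X_def by (simp add: mult_assoc_dim TA)
  have AX: "adj A * X = adj T * ((adj A' * X') * T)"
  proof -
    have "adj A * adj T = adj T * adj A'" using arg_cong[OF TA, of adj] by (simp add: adj_mult)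
    then have "(adj A * adj T) * (X' * T) = (adj T * adj A') * (X' * T)" by simp
    then show ?thesis unfolding X_def by (simp add: mult_assoc_dim)
  qed
  have CC: "adj C * C = adj T * ((adj C' * C') * T)" unfolding CT[symmetric] by (simp add: adj_mult mult_assoc_dim)
  have XB: "X * (B * (adj B * X)) = adj T * ((X' * (B' * (adj B' * X'))) * T)"
  proof -
    have "X * (B * (adj B * X)) = adj T * (X' * ((T * B) * ((adj B * adj T) * (X' * T))))"
      unfolding X_def by (simp add: mult_assoc_dim)
    then show ?thesis unfolding TB aTB[symmetric] by (simp add: mult_assoc_dim)
  qed
  have "\<i> \<cdot>\<^sub>m (X * A - adj A * X) = adj T * ((\<i> \<cdot>\<^sub>m (X' * A' - adj A' * X')) * T)"
    unfolding XA AX by (simp add: mat_simps)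
  also have "\<dots> = adj C * C + X * (B * (adj B * X))" unfolding eq CC XB by (simp add: mat_simps)
  finally have ricX: "ric n A B (adj C * C) X"
    unfolding ric_def by (simp add: carrier_iff) (simp add: X_def adj_mult adj_adj h mult_assoc_dim)
  show cl: "T * closed_loop A B X = closed_loop A' B' X' * T"
  proof -
    have "T * (B * (adj B * X)) = (T * B) * ((adj B * adj T) * (X' * T))" unfolding X_def by (simp add: mult_assoc_dim)
    then have "T * (B * (adj B * X)) = (B' * (adj B' * X')) * T" unfolding TB aTB[symmetric] by (simp add: mult_assoc_dim)
    then show ?thesis unfolding closed_loop_def by (simp add: mult_add_dim add_mult_dim mult_smult_dim smult_mult_dim TA)
  qed
  have clc: "closed_loop A B X \<in> carrier_mat n n" "closed_loop A' B' X' \<in> carrier_mat n n"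
    by (simp_all add: closed_loop_def carrier_iff)
  note [simp] = carrier_matD[OF clc(1)] carrier_matD[OF clc(2)]
  have "Im \<mu> \<le> 0" if mu: "\<mu> \<in> spectrum (closed_loop A B X)" for \<mu>
  proof -
    obtain w where w: "w \<in> carrier_mat n 1" "w \<noteq> 0\<^sub>m n 1" "closed_loop A B X * w = \<mu> \<cdot>\<^sub>m w"
      using mu unfolding spectrum_iff[OF clc(1)] by auto
    note [simp] = carrier_matD[OF w(1)]
    have Tw: "T * w \<in> carrier_mat n 1" by (simp add: carrier_iff)
    have Tw0: "T * w \<noteq> 0\<^sub>m n 1" using dT w(1,2) unfolding det_nonzero_iff[OF T] by auto
    have "closed_loop A' B' X' * (T * w) = (T * closed_loop A B X) * w" unfolding cl by (simp add: mult_assoc_dim)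
    also have "\<dots> = \<mu> \<cdot>\<^sub>m (T * w)" by (simp add: mult_assoc_dim w(3) mult_smult_dim)
    finally have "\<mu> \<in> spectrum (closed_loop A' B' X')" unfolding spectrum_iff[OF clc(2)] using Tw Tw0 by (intro bexI[of _ "T * w"] conjI)
    then show ?thesis using sp by blast
  qed
  then show "riccati_solution n A B C X" using ricX riccati_solution_iff[OF A B C] by simp
qed

section \<open>From realizations to potentials and back\<close>

definition riccati_potential where
  "riccati_potential A B C X = pe_potential (closed_loop A B X) (mat_inv X) B ((- \<i>) \<cdot>\<^sub>m (mat_inv X * adj C))"

lemma riccati_pe_data:
  assumes A: "A \<in> carrier_mat n n" and B: "B \<in> carrier_mat n m1" and C: "C \<in> carrier_mat m2 n"
    and AB: "pbh n A B" and CA: "pbh n (adj A) (adj C)" and r: "riccati_solution n A B C X"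
  shows "admissible m1 m2 n (closed_loop A B X) (mat_inv X) B ((- \<i>) \<cdot>\<^sub>m (mat_inv X * adj C))"
    and "Determinant.det (mat_inv X) \<noteq> 0" and "invertible_mat X" and "Determinant.det X \<noteq> 0"
    and "pe_data n m1 m2 (closed_loop A B X) (mat_inv X) B ((- \<i>) \<cdot>\<^sub>m (mat_inv X * adj C))"
    and "X \<in> carrier_mat n n" and "adj X = X"
proof -
  have r': "ric n A B (adj C * C) X" and sp: "\<And>\<mu>. \<mu> \<in> spectrum (closed_loop A B X) \<Longrightarrow> Im \<mu> \<le> 0"
    using r riccati_solution_iff[OF A B C] by auto
  show 1: "admissible m1 m2 n (closed_loop A B X) (mat_inv X) B ((- \<i>) \<cdot>\<^sub>m (mat_inv X * adj C))"
    by (rule riccati_admissible(1)[OF A B C AB CA r' sp])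
  show 2: "Determinant.det (mat_inv X) \<noteq> 0"
    by (rule riccati_admissible(2)[OF A B C AB CA r' sp])
  show "invertible_mat X" by (rule riccati_admissible(3)[OF A B C AB CA r' sp])
  show "Determinant.det X \<noteq> 0" by (rule riccati_solution_nonsingular[OF A B C CA r'])
  show "pe_data n m1 m2 (closed_loop A B X) (mat_inv X) B ((- \<i>) \<cdot>\<^sub>m (mat_inv X * adj C))"
    by (rule admissible_pe_data(1)[OF 1 2])
  show "X \<in> carrier_mat n n" "adj X = X" using r' by (simp_all add: ric_def)
qed

text \<open>The state space isomorphism pulls one Riccati solution back to a solution for the other
  realization, and uniqueness identifies the two. The comparison is made for controllable and
  observable realizations, which covers both the minimal ones and those read off from
  potentials.\<close>

lemma riccati_potential_unique:
  assumes r: "realization m1 m2 n A B C R" and AB: "pbh n A B" and CA: "pbh n (adj A) (adj C)" and X: "riccati_solution n A B C X"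
    and r': "realization m1 m2 n' A' B' C' R" and AB': "pbh n' A' B'" and CA': "pbh n' (adj A') (adj C')"
    and X': "riccati_solution n' A' B' C' X'"
  shows "riccati_potential A' B' C' X' = riccati_potential A B C X"
proof -
  have A: "A \<in> carrier_mat n n" and B: "B \<in> carrier_mat n m1" and C: "C \<in> carrier_mat m2 n"
    and A1: "A' \<in> carrier_mat n' n'" and B1: "B' \<in> carrier_mat n' m1" and C1: "C' \<in> carrier_mat m2 n'"
    using r r' by (auto simp: realization_def)
  note iso = realization_isomorphism[OF A B C A1 B1 C1 AB CA AB' CA' markov_parameters_eq[OF r r']]
  have n: "n' = n" by (rule iso(1))
  have A': "A' \<in> carrier_mat n n" and B': "B' \<in> carrier_mat n m1" and C': "C' \<in> carrier_mat m2 n"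
    using A1 B1 C1 unfolding n .
  obtain T where T: "T \<in> carrier_mat n n" and dT: "Determinant.det T \<noteq> 0" and TA: "T * A = A' * T"
    and TB: "T * B = B'" and CT: "C' * T = C" using iso(2) by auto
  note sim = riccati_similarity[OF A B C A' B' C' T dT TA TB CT X'[unfolded n]]
  have XX: "X = adj T * (X' * T)" by (rule riccati_solution_unique[OF A B C AB X sim(1)])
  note d = riccati_pe_data[OF A B C AB CA X] and d' = riccati_pe_data[OF A' B' C' AB'[unfolded n] CA'[unfolded n] X'[unfolded n]]
  note I = mat_inv_props[OF T dT] and J = mat_inv_props[OF d(6,4)]
  note [simp] = carrier_matD[OF T] carrier_matD[OF A] carrier_matD[OF B] carrier_matD[OF C] carrier_matD[OF C']
    carrier_matD[OF d(6)] carrier_matD[OF d'(6)] carrier_matD[OF I(1)] carrier_matD[OF J(1)]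
  have IT: "adj (mat_inv T) * adj T = 1\<^sub>m n" using arg_cong[OF I(2), of adj] by (simp add: adj_mult adj_one)
  have TI: "adj T * adj (mat_inv T) = 1\<^sub>m n" using arg_cong[OF I(3), of adj] by (simp add: adj_mult adj_one)
  have S: "mat_inv X' = T * mat_inv X * adj T"
  proof (rule mat_inv_unique[OF d'(6)])
    have e: "adj T * (X' * (T * (mat_inv X * adj T))) = adj T"
    proof -
      have "adj T * (X' * (T * (mat_inv X * adj T))) = (adj T * (X' * T)) * (mat_inv X * adj T)"
        by (simp add: mult_assoc_dim)
      also have "\<dots> = X * (mat_inv X * adj T)" unfolding XX[symmetric] ..
      also have "\<dots> = (X * mat_inv X) * adj T" by (simp add: mult_assoc_dim)
      finally show ?thesis unfolding J(2) by (simp add: one_mult_dim)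
    qed
    have "X' * (T * mat_inv X * adj T) = (adj (mat_inv T) * adj T) * (X' * (T * (mat_inv X * adj T)))"
      unfolding IT by (simp add: one_mult_dim mult_assoc_dim)
    also have "\<dots> = adj (mat_inv T) * (adj T * (X' * (T * (mat_inv X * adj T))))" by (simp add: mult_assoc_dim)
    finally show "X' * (T * mat_inv X * adj T) = 1\<^sub>m n" unfolding e IT .
  qed (simp add: carrier_iff)
  have g: "(- \<i>) \<cdot>\<^sub>m (mat_inv X' * adj C') = T * ((- \<i>) \<cdot>\<^sub>m (mat_inv X * adj C))"
    unfolding S CT[symmetric] by (simp add: mat_simps)
  show ?thesis unfolding riccati_potential_def
    by (rule pe_potential_similar[OF d(5) d'(5) T dT _ S TB[symmetric] g]) (use sim(2) XX in simp)
qed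

lemma riccati_potential_reflection:
  assumes r: "realization m1 m2 n A B C R" and AB: "pbh n A B" and CA: "pbh n (adj A) (adj C)" and X: "riccati_solution n A B C X"
  shows "riccati_potential A B C X \<in> PE_nonsing m1 m2" and "left_reflection_coefficient m1 m2 (riccati_potential A B C X) R"
proof -
  have A: "A \<in> carrier_mat n n" and B: "B \<in> carrier_mat n m1" and C: "C \<in> carrier_mat m2 n"
    using r by (auto simp: realization_def)
  note d = riccati_pe_data[OF A B C AB CA X]
  show "riccati_potential A B C X \<in> PE_nonsing m1 m2"
    unfolding PE_nonsing_def riccati_potential_def using d(1,2) by blast
  interpret p: pe_data n m1 m2 "closed_loop A B X" "mat_inv X" B "(- \<i>) \<cdot>\<^sub>m (mat_inv X * adj C)" by (rule d(5))
  note J = mat_inv_props[OF d(6,4)]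
  note [simp] = carrier_matD[OF A] carrier_matD[OF B] carrier_matD[OF C] carrier_matD[OF d(6)] carrier_matD[OF J(1)]
  have X1: "p.X = X" unfolding p.X_def by (rule mat_inv_unique[OF J(1) d(6) J(3)])
  have "p.A0 = closed_loop A B X - \<i> \<cdot>\<^sub>m (B * (adj B * p.X))" by (rule p.A0_def)
  also have "\<dots> = A" unfolding X1 closed_loop_def by (rule eq_matI) auto
  finally have A1: "p.A0 = A" .
  have aS: "adj (mat_inv X) = mat_inv X" by (rule p.herm)
  have "p.C0 = C * (mat_inv X * X)" unfolding p.C0_def X1 by (simp add: mat_simps aS)
  then have C1: "p.C0 = C" unfolding J(3) by (simp add: mult_one_dim)
  show "left_reflection_coefficient m1 m2 (riccati_potential A B C X) R"
    unfolding riccati_potential_def by (rule p.realization_reflection) (simp only: A1 C1 r)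
qed

text \<open>Every potential of the class is the Riccati potential of the realization read off from
  it; this reduces uniqueness of the potential to \<open>riccati_potential_unique\<close>.\<close>

lemma PE_reflection_riccati:
  assumes R: "rational_mat_fun m2 m1 R" and v: "v \<in> PE_nonsing m1 m2" and l: "left_reflection_coefficient m1 m2 v R"
  shows "\<exists>n A B C X. realization m1 m2 n A B C R \<and> pbh n A B \<and> pbh n (adj A) (adj C) \<and>
      riccati_solution n A B C X \<and> v = riccati_potential A B C X"
    and "\<exists>F. finite F \<and> (\<forall>\<xi>. \<xi> \<notin> F \<longrightarrow> (\<forall>u\<in>carrier_mat m1 1. nrm2 (R (of_real \<xi>) * u) \<le> nrm2 u))"
proof -
  obtain n \<alpha> S0 \<gamma>1 \<gamma> where a: "admissible m1 m2 n \<alpha> S0 \<gamma>1 \<gamma>" and d: "Determinant.det S0 \<noteq> 0"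
    and v': "v = pe_potential \<alpha> S0 \<gamma>1 \<gamma>" using v unfolding PE_nonsing_def by blast
  interpret p: pe_data n m1 m2 \<alpha> S0 \<gamma>1 \<gamma> by (rule admissible_pe_data(1)[OF a d])
  note rr = p.reflection_realization[OF R l[unfolded v']]
  have sol: "riccati_solution n p.A0 \<gamma>1 p.C0 p.X"
    unfolding riccati_solution_iff[OF p.A0_carrier p.\<gamma>1 p.C0_carrier] using p.ric_A0 p.spec by (simp add: p.closed_loop_A0)
  have "v = riccati_potential p.A0 \<gamma>1 p.C0 p.X"
    unfolding riccati_potential_def p.closed_loop_A0 p.gamma_eq unfolding p.mat_inv_X by (rule v')
  then show "\<exists>n A B C X. realization m1 m2 n A B C R \<and> pbh n A B \<and> pbh n (adj A) (adj C) \<and>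
      riccati_solution n A B C X \<and> v = riccati_potential A B C X"
    using rr(1) p.pbh_A0[OF admissible_pe_data(2)[OF a d]] p.obs_A0 sol by (intro exI conjI)
  show "\<exists>F. finite F \<and> (\<forall>\<xi>. \<xi> \<notin> F \<longrightarrow> (\<forall>u\<in>carrier_mat m1 1. nrm2 (R (of_real \<xi>) * u) \<le> nrm2 u))" by (rule rr(2))
qed

text \<open>Near a real point the bound gives \<open>|p| \<le> |q|\<close> for each entry, and by
  continuity also at the point; a real zero of \<open>q\<close> would be a common zero, against
  coprimality. So \<open>R\<close> is continuous on the real axis and the bound extends to the
  exceptional points.\<close>

lemma contractive_of_cofinite:
  assumes R: "rational_mat_fun m2 m1 R" and F: "finite F"
    and con: "\<And>\<xi> u. \<xi> \<notin> F \<Longrightarrow> u \<in> carrier_mat m1 1 \<Longrightarrow> nrm2 (R (of_real \<xi>) * u) \<le> nrm2 u"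
  shows "contractive_on_reals m2 m1 R"
proof -
  have Rc: "R z \<in> carrier_mat m2 m1" for z using R by (simp add: rational_mat_fun_def)
  have evF: "eventually (\<lambda>\<xi>. \<xi> \<notin> F) (at x)" for x :: real
    using islimpt_finite[OF F, of x] by (simp add: islimpt_iff_eventually)
  have of_real_lim: "filterlim complex_of_real (at (complex_of_real x)) (at x)" for x
    unfolding filterlim_at by (auto intro!: tendsto_eq_intros simp: eventually_at_filter)
  have cont: "isCont (\<lambda>z. R z $$ (i, l)) (of_real x)" if il: "i < m2" "l < m1" for i l x
  proof -
    obtain p q where q0: "q \<noteq> 0" and cop: "coprime p q" and e: "\<And>z. poly q z \<noteq> 0 \<Longrightarrow> R z $$ (i, l) = poly p z / poly q z"
      using R il unfolding rational_mat_fun_def by blast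
    have "finite {\<xi>. poly q (complex_of_real \<xi>) = 0}"
      using finite_vimageI[OF poly_roots_finite[OF q0] inj_of_real] by (simp add: vimage_def)
    from islimpt_finite[OF this, of x] have evq: "eventually (\<lambda>\<xi>. poly q (complex_of_real \<xi>) \<noteq> 0) (at x)"
      by (simp add: islimpt_iff_eventually)
    have ev: "eventually (\<lambda>\<xi>. cmod (poly p (complex_of_real \<xi>)) \<le> cmod (poly q (complex_of_real \<xi>))) (at x)"
      using evF evq
    proof eventually_elim
      case (elim \<xi>)
      have "cmod (R (of_real \<xi>) $$ (i, l)) \<le> 1" by (rule contraction_entry_bound[OF Rc con[OF elim(1)] il])
      then show ?case using e[OF elim(2)] elim(2) by (simp add: norm_divide field_simps)
    qed
    have lim: "((\<lambda>\<xi>. cmod (poly r (complex_of_real \<xi>))) \<longlongrightarrow> cmod (poly r (of_real x))) (at x)" for r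
      by (intro tendsto_intros)
    have "cmod (poly p (of_real x)) \<le> cmod (poly q (of_real x))" by (rule tendsto_le[OF _ lim lim ev]) simp
    then have "poly q (of_real x) = 0 \<Longrightarrow> poly p (of_real x) = 0" by simp
    then have nz: "poly q (complex_of_real x) \<noteq> 0" using coprime_poly_0[OF cop, of "of_real x"] by auto
    have "open {z. poly q z \<noteq> 0}" by (intro open_Collect_neq continuous_intros)
    then have "eventually (\<lambda>z. z \<in> {z. poly q z \<noteq> 0}) (nhds (complex_of_real x))" using nz by (intro eventually_nhds_in_open) auto
    then have "eventually (\<lambda>z. R z $$ (i, l) = poly p z / poly q z) (nhds (complex_of_real x))" by eventually_elim (use e in simp)
    moreover have "isCont (\<lambda>z. poly p z / poly q z) (of_real x)" using nz by (intro continuous_intros)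
    ultimately show ?thesis by (simp add: isCont_cong)
  qed
  show ?thesis unfolding contractive_on_reals_def
  proof (intro allI conjI impI)
    fix x i l assume "i < m2" "l < m1"
    from cont[OF this, of x] show "\<not> is_pole (\<lambda>z. R z $$ (i, l)) (complex_of_real x)"
      unfolding isCont_def is_pole_def using not_tendsto_and_filterlim_at_infinity[OF at_neq_bot] by blast
  next
    fix x
    show "pos_semidef (1\<^sub>m m1 - adj (R (complex_of_real x)) * R (complex_of_real x))"
      unfolding pos_semidef_defect_iff[OF Rc]
    proof
      fix u :: "complex mat" assume u: "u \<in> carrier_mat m1 1"
      have n: "nrm2 (R z * u) = (\<Sum>i<m2. (cmod (\<Sum>k<m1. R z $$ (i, k) * u $$ (k, 0)))\<^sup>2)" for z
        using carrier_matD[OF Rc[of z]] carrier_matD[OF u] by (simp add: nrm2_def index_mult_sum)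
      have "((\<lambda>\<xi>. R (complex_of_real \<xi>) $$ (i, k)) \<longlongrightarrow> R (of_real x) $$ (i, k)) (at x)" if "i < m2" "k < m1" for i k
        using filterlim_compose[OF _ of_real_lim] cont[OF that, of x] unfolding isCont_def by blast
      then have "((\<lambda>\<xi>. nrm2 (R (complex_of_real \<xi>) * u)) \<longlongrightarrow> nrm2 (R (of_real x) * u)) (at x)"
        unfolding n by (intro tendsto_intros) auto
      moreover have "eventually (\<lambda>\<xi>. nrm2 (R (complex_of_real \<xi>) * u) \<le> nrm2 u) (at x)"
        using evF by eventually_elim (rule con[OF _ u])
      ultimately show "nrm2 (R (complex_of_real x) * u) \<le> nrm2 u" by (intro tendsto_upperbound) auto
    qed
  qed
qed

theorem theorem4p1:
  fixes m1 m2 :: nat and R :: "complex \<Rightarrow> complex mat"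
  assumes "0 < m1" and "0 < m2"
    and "rational_mat_fun m2 m1 R" and "proper_mat_fun m2 m1 R"
  shows
    "((\<exists>v \<in> PE_nonsing m1 m2. left_reflection_coefficient m1 m2 v R)
        \<longleftrightarrow> vanishes_at_infinity m2 m1 R \<and> contractive_on_reals m2 m1 R) \<and>
     (vanishes_at_infinity m2 m1 R \<and> contractive_on_reals m2 m1 R \<longrightarrow>
        (\<exists>v. (v \<in> PE_nonsing m1 m2 \<and> left_reflection_coefficient m1 m2 v R) \<and>
           (\<forall>v'. v' \<in> PE_nonsing m1 m2 \<and> left_reflection_coefficient m1 m2 v' R \<longrightarrow> v' = v) \<and>
           (\<exists>n A B C. minimal_realization m1 m2 n A B C R) \<and>
           (\<forall>n A B C. minimal_realization m1 m2 n A B C R \<longrightarrow>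
              (\<exists>X. riccati_solution n A B C X \<and>
                 (\<forall>X'. riccati_solution n A B C X' \<longrightarrow> X' = X) \<and>
                 invertible_mat X \<and>
                 (let \<alpha> = A + \<i> \<cdot>\<^sub>m (B * mat_adjoint B * X);
                      S0 = mat_inv X;
                      \<gamma>1 = B;
                      \<gamma> = (- \<i>) \<cdot>\<^sub>m (S0 * mat_adjoint C)
                  in admissible m1 m2 n \<alpha> S0 \<gamma>1 \<gamma> \<and> Determinant.det S0 \<noteq> 0 \<and>
                     v = pe_potential \<alpha> S0 \<gamma>1 \<gamma>)))))"
    (is "(?ex \<longleftrightarrow> ?cond) \<and> (?cond \<longrightarrow> ?recover)")
proof -
  note R = assms(3)
  have 1: ?cond if ex: ?ex
  proof -
    obtain v where v: "v \<in> PE_nonsing m1 m2" "left_reflection_coefficient m1 m2 v R" using ex by blast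
    obtain n A B C where "realization m1 m2 n A B C R" using PE_reflection_riccati(1)[OF R v] by (elim exE conjE)
    then have 1: "vanishes_at_infinity m2 m1 R" by (rule realization_vanishes)
    obtain F where "finite F" "\<forall>\<xi>. \<xi> \<notin> F \<longrightarrow> (\<forall>u\<in>carrier_mat m1 1. nrm2 (R (of_real \<xi>) * u) \<le> nrm2 u)"
      using PE_reflection_riccati(2)[OF R v] by (elim exE conjE)
    then have "contractive_on_reals m2 m1 R" by (intro contractive_of_cofinite[OF R]) auto
    with 1 show ?thesis by simp
  qed
  have 2: ?recover if cond: ?cond
  proof -
    have van: "vanishes_at_infinity m2 m1 R" and con: "contractive_on_reals m2 m1 R" using cond by auto
    have sol: "\<exists>X. riccati_solution n A B C X" "realization m1 m2 n A B C R" "pbh n A B" "pbh n (adj A) (adj C)"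
      if mr: "minimal_realization m1 m2 n A B C R" for n A B C
    proof -
      show r: "realization m1 m2 n A B C R" using mr by (simp add: minimal_realization_def)
      show AB: "pbh n A B" and CA: "pbh n (adj A) (adj C)" by (rule minimal_realization_pbh[OF R mr])+
      show "\<exists>X. riccati_solution n A B C X" by (rule contractive_riccati[OF R con r AB CA])
    qed
    obtain n A B C where mr: "minimal_realization m1 m2 n A B C R" using minimal_realization_exists[OF R van] by (elim exE)
    obtain X where X: "riccati_solution n A B C X" using sol(1)[OF mr] ..
    define v where "v = riccati_potential A B C X"
    have v: "v \<in> PE_nonsing m1 m2 \<and> left_reflection_coefficient m1 m2 v R"
      unfolding v_def using riccati_potential_reflection[OF sol(2-4)[OF mr] X] by (rule conjI)
    have uniq: "v' = v" if v': "v' \<in> PE_nonsing m1 m2 \<and> left_reflection_coefficient m1 m2 v' R" for v'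
    proof -
      obtain n' A' B' C' X' where *: "realization m1 m2 n' A' B' C' R" "pbh n' A' B'" "pbh n' (adj A') (adj C')"
        "riccati_solution n' A' B' C' X'" "v' = riccati_potential A' B' C' X'"
        using PE_reflection_riccati(1)[OF R conjunct1[OF v'] conjunct2[OF v']] by (elim exE conjE)
      show ?thesis unfolding *(5) v_def by (rule riccati_potential_unique[OF sol(2-4)[OF mr] X *(1-4)])
    qed
    have clause: "\<exists>X. riccati_solution n A B C X \<and> (\<forall>X'. riccati_solution n A B C X' \<longrightarrow> X' = X) \<and> invertible_mat X \<and>
        (let \<alpha> = A + \<i> \<cdot>\<^sub>m (B * mat_adjoint B * X); S0 = mat_inv X; \<gamma>1 = B; \<gamma> = (- \<i>) \<cdot>\<^sub>m (S0 * mat_adjoint C)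
         in admissible m1 m2 n \<alpha> S0 \<gamma>1 \<gamma> \<and> Determinant.det S0 \<noteq> 0 \<and> v = pe_potential \<alpha> S0 \<gamma>1 \<gamma>)"
      if mr': "minimal_realization m1 m2 n A B C R" for n A B C
    proof -
      obtain Z where Z: "riccati_solution n A B C Z" using sol(1)[OF mr'] ..
      have A: "A \<in> carrier_mat n n" and B: "B \<in> carrier_mat n m1" and C: "C \<in> carrier_mat m2 n"
        using sol(2)[OF mr'] by (auto simp: realization_def)
      note d = riccati_pe_data[OF A B C sol(3,4)[OF mr'] Z]
      have cl: "A + \<i> \<cdot>\<^sub>m (B * adj B * Z) = closed_loop A B Z"
        using carrier_matD[OF B] carrier_matD[OF d(6)] by (simp add: closed_loop_def mult_assoc_dim)
      \<comment> \<open>The potential built from an arbitrary minimal realization has reflection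
        coefficient \<open>R\<close> as well, so the uniqueness just proved identifies it with
        \<open>v\<close>.\<close>
      have "riccati_potential A B C Z \<in> PE_nonsing m1 m2 \<and> left_reflection_coefficient m1 m2 (riccati_potential A B C Z) R"
        using riccati_potential_reflection[OF sol(2-4)[OF mr'] Z] by (rule conjI)
      then have vZ: "v = riccati_potential A B C Z" using uniq by simp
      show ?thesis
        unfolding Let_def
      proof (intro exI[of _ Z] conjI allI impI Z d(3))
        show "X' = Z" if "riccati_solution n A B C X'" for X'
          by (rule riccati_solution_unique[OF A B C sol(3)[OF mr'] that Z])
      qed (unfold cl, use d(1,2) vZ riccati_potential_def in simp_all)
    qed
    show ?thesis using v uniq clause mr by (intro exI[of _ v] conjI allI impI) (assumption | blast)+
  qed
  have 3: ?ex if ?cond using 2[OF that] by blast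
  show ?thesis using 1 2 3 by blast
qed

end
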